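(* Let $n\ge1$, $\alpha>-1$, $0<p\le1$, $q\ge1$, $\Phi_1\in\mathscr L_p$, $\Phi_2\in\mathscr U^q$, and $\rho_i(t)=\frac{1}{t\Phi_i^{-1}(1/t)}$ for $i=1,2$. Assume that $\Phi_2$ satisfies the Dini condition: there is $C>0$ with $\int_0^t\frac{\Phi_2(s)}{s^2}ds\le C\frac{\Phi_2(t)}{t}$ for all $t>0$. Let $\Phi$ be the growth function determined by $$\rho=\rho_\Phi:=\frac{\rho_1}{\rho_2},\qquad \rho_\Phi(t)=\frac{1}{t\Phi^{-1}(1/t)}.$$ Then the Hankel operator $h_b$ extends into a bounded operator from $\mathcal A_\alpha^{\Phi_1}(\mathbb B^n)$ into $\mathcal A_\alpha^{\Phi_2}(\mathbb B^n)$ if and only if its symbol $b$ belongs to $\Gamma_{\alpha,\rho}(\mathbb B^n)=(\mathcal A_\alpha^{\Phi}(\mathbb B^n))^*$.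
   Context: $\mathbb B^n$ is the unit ball of $\mathbb C^n$, $d\nu$ is Lebesgue measure on it, and $d\nu_\alpha(z)=c_\alpha(1-|z|^2)^\alpha d\nu(z)$ with $\nu_\alpha(\mathbb B^n)=1$. A growth function is a continuous non-decreasing function from $[0,\infty)$ onto itself. $\mathscr U^q$ ($q\ge1$): growth functions $\Phi$ of upper type $q$ ($\Phi(st)\le Ct^q\Phi(s)$ for all $s>0$, $t\ge1$, some $C>0$) with $\Phi(t)/t$ non-decreasing. $\mathscr L_p$ ($0<p\le1$): growth functions $\Phi$ of lower type $p$ ($\Phi(st)\le Ct^p\Phi(s)$ for all $s>0$, $0<t\le1$, some $C>0$) with $\Phi(t)/t$ non-increasing. Growth functions are equivalent if $c\Phi_1(ct)\le\Phi_2(t)\le c^{-1}\Phi_1(c^{-1}t)$ for some $c>0$; equivalent growth functions define the same spaces and are not distinguished. By convention members of $\mathscr U^q$ (resp. $\mathscr L_p$) are supposed convex (resp. concave) and $C^1$ with $\Phi'(t)\simeq\Phi(t)/t$. Note that $\Phi^{-1}(t)=t\Phi_1^{-1}(t)/\Phi_2^{-1}(t)\simeq\Phi_1^{-1}(t)\Psi_2^{-1}(t)$, where $\Psi_2(s)=\sup_{t\ge0}\{ts-\Phi_2(t)\}$ is the complementary function of $\Phi_2$. $\mathcal A_\alpha^\Phi(\mathbb B^n)$ is the space of holomorphic $f$ on $\mathbb B^n$ with $\int_{\mathbb B^n}\Phi(|f|)\,d\nu_\alpha<\infty$, with (quasi-)norm $\|f\|^{lux}_{\alpha,\Phi}=\inf\{\lambda>0:\int\Phi(|f|/\lambda)\,d\nu_\alpha\le1\}$.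 $\mathcal A^2_\alpha$ is the case $\Phi(t)=t^2$. $P_\alpha f(z)=\int_{\mathbb B^n}\frac{f(\xi)}{(1-\langle z,\xi\rangle)^{n+1+\alpha}}d\nu_\alpha(\xi)$ is the Bergman projection. For a symbol $b\in\mathcal A_\alpha^2(\mathbb B^n)$ the small Hankel operator is defined on bounded holomorphic $f$ by $h_b(f)=P_\alpha(b\overline f)$. "$h_b$ extends into a bounded operator from $\mathcal A_\alpha^{\Phi_1}$ into $\mathcal A_\alpha^{\Phi_2}$" means there is $C$ with $\|h_b(f)\|^{lux}_{\alpha,\Phi_2}\le C\|f\|^{lux}_{\alpha,\Phi_1}$ for all bounded holomorphic $f$. $Rf(z)=\sum_{j}z_j\frac{\partial f}{\partial z_j}(z)$. A positive function $\rho$ is of upper type $\gamma$ on $[0,1]$ if $\rho(st)\le Cs^\gamma\rho(t)$ for $s>1$, $st\le1$. For $\rho$ of upper type $\gamma$ (some $\gamma\ge0$), $\Gamma_{\alpha,\rho}(\mathbb B^n)$ is the space of holomorphic $f$ on $\mathbb B^n$ such that for some integer $k>\gamma(n+1+\alpha)$ and some $C>0$, $|R^kf(z)|\le C(1-|z|^2)^{-k}\rho\big((1-|z|^2)^{n+1+\alpha}\big)$ for all $z\in\mathbb B^n$; it does not depend on the choice of such $k$. The identification $\Gamma_{\alpha,\rho}=(\mathcal A_\alpha^\Phi)^*$ is under the pairing $\langle f,g\rangle_\alpha=\lim_{r\to1}\int_{\mathbb B^n}f(rz)\overline{g(z)}\,d\nu_\alpha(z)$. *)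

theory Defs
  imports "HOL-Analysis.Analysis"
begin

section \<open>Growth functions\<close>

text \<open>A growth function is modelled by a function on the reals of which only the restriction to
  the half-line \<open>{0..}\<close> matters.\<close>

definition growth_function :: "(real \<Rightarrow> real) \<Rightarrow> bool" where
  "growth_function \<Phi> \<longleftrightarrow>
     continuous_on {0..} \<Phi> \<and> mono_on {0..} \<Phi> \<and> \<Phi> ` {0..} = {0..}"

definition growth_upper_type :: "real \<Rightarrow> (real \<Rightarrow> real) \<Rightarrow> bool" where
  "growth_upper_type q \<Phi> \<longleftrightarrow> (\<exists>C>0. \<forall>s>0. \<forall>t\<ge>1. \<Phi> (s * t) \<le> C * t powr q * \<Phi> s)"

definition growth_lower_type :: "real \<Rightarrow> (real \<Rightarrow> real) \<Rightarrow> bool" where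
  "growth_lower_type p \<Phi> \<longleftrightarrow>
     (\<exists>C>0. \<forall>s>0. \<forall>t. 0 < t \<and> t \<le> 1 \<longrightarrow> \<Phi> (s * t) \<le> C * t powr p * \<Phi> s)"

text \<open>\<open>\<Phi>\<close> is of class \<open>C\<^sup>1\<close> with \<open>\<Phi>'(t) \<simeq> \<Phi>(t) / t\<close>. The derivative is only required on the open
  half-line, since for instance \<open>t powr p\<close> with \<open>p < 1\<close> is not differentiable at \<open>0\<close>.\<close>

definition regular_C1 :: "(real \<Rightarrow> real) \<Rightarrow> bool" where
  "regular_C1 \<Phi> \<longleftrightarrow>
     (\<exists>\<Phi>'. continuous_on {0<..} \<Phi>' \<and> (\<forall>t>0. (\<Phi> has_real_derivative \<Phi>' t) (at t)) \<and>
       (\<exists>c>0. \<forall>t>0. c * (\<Phi> t / t) \<le> \<Phi>' t \<and> \<Phi>' t \<le> (\<Phi> t / t) / c))"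

text \<open>The classes \<open>\<U>\<^sup>q\<close> and \<open>\<L>\<^sub>p\<close>, including the standing convention that their members are
  convex (resp. concave) and regular. In particular, members are strictly increasing on \<open>{0..}\<close>.\<close>

definition class_U :: "real \<Rightarrow> (real \<Rightarrow> real) set" where
  "class_U q = {\<Phi>. growth_function \<Phi> \<and> growth_upper_type q \<Phi> \<and>
     mono_on {0<..} (\<lambda>t. \<Phi> t / t) \<and> convex_on {0..} \<Phi> \<and> regular_C1 \<Phi>}"

definition class_L :: "real \<Rightarrow> (real \<Rightarrow> real) set" where
  "class_L p = {\<Phi>. growth_function \<Phi> \<and> growth_lower_type p \<Phi> \<and>
     antimono_on {0<..} (\<lambda>t. \<Phi> t / t) \<and> concave_on {0..} \<Phi> \<and> regular_C1 \<Phi>}"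

text \<open>The integral is taken in \<open>[0,\<infinity>]\<close>, so that the condition includes its convergence.\<close>

definition Dini_condition :: "(real \<Rightarrow> real) \<Rightarrow> bool" where
  "Dini_condition \<Phi> \<longleftrightarrow>
     (\<exists>C>0. \<forall>t>0. (\<integral>\<^sup>+s\<in>{0<..<t}. ennreal (\<Phi> s / s\<^sup>2) \<partial>lborel) \<le> ennreal (C * (\<Phi> t / t)))"

definition growth_inverse :: "(real \<Rightarrow> real) \<Rightarrow> real \<Rightarrow> real" where
  "growth_inverse \<Phi> = inv_into {0..} \<Phi>"

definition rho_of :: "(real \<Rightarrow> real) \<Rightarrow> real \<Rightarrow> real" where
  "rho_of \<Phi> t = 1 / (t * growth_inverse \<Phi> (1 / t))"


section \<open>Bergman--Orlicz spaces of the unit ball\<close>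

text \<open>The ball \<open>\<bool>\<^sup>n\<close> is \<open>ball 0 1\<close> in the type \<open>complex ^ 'n\<close>, so \<open>n = CARD('n)\<close>. Functions on the
  ball are total functions whose values outside the ball are irrelevant.\<close>

definition holomorphic_ball :: "(complex ^ 'n \<Rightarrow> complex) \<Rightarrow> bool" where
  "holomorphic_ball f \<longleftrightarrow>
     (\<forall>z\<in>ball 0 1. \<exists>D. (f has_derivative D) (at z) \<and> (\<forall>c v. D (c *s v) = c * D v))"

definition cinner :: "complex ^ 'n \<Rightarrow> complex ^ 'n \<Rightarrow> complex" where
  "cinner z w = (\<Sum>j\<in>UNIV. z $ j * cnj (w $ j))"

text \<open>The constant \<open>c\<^sub>\<alpha>\<close> is the reciprocal of the total mass of \<open>(1 - |z|\<^sup>2)\<^sup>\<alpha>\<close>, which is finite for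
  \<open>\<alpha> > -1\<close>.\<close>

definition nu_const :: "'n::finite itself \<Rightarrow> real \<Rightarrow> real" where
  "nu_const _ \<alpha> =
     1 / (LINT z|restrict_space lborel (ball (0 :: complex ^ 'n) 1). (1 - (norm z)\<^sup>2) powr \<alpha>)"

definition nu :: "real \<Rightarrow> (complex ^ 'n) measure" where
  "nu \<alpha> = density (restrict_space lborel (ball 0 1))
     (\<lambda>z. ennreal (nu_const TYPE('n) \<alpha> * (1 - (norm z)\<^sup>2) powr \<alpha>))"

definition bergman_orlicz :: "real \<Rightarrow> (real \<Rightarrow> real) \<Rightarrow> (complex ^ 'n \<Rightarrow> complex) set" where
  "bergman_orlicz \<alpha> \<Phi> =
     {f. holomorphic_ball f \<and> (\<integral>\<^sup>+z. ennreal (\<Phi> (norm (f z))) \<partial>nu \<alpha>) < \<infinity>}"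

text \<open>The Luxemburg (quasi-)norm is \<open>[0,\<infinity>]\<close>-valued: it is \<open>\<infinity>\<close> if no \<open>c\<close> is admissible.\<close>

definition lux_norm :: "real \<Rightarrow> (real \<Rightarrow> real) \<Rightarrow> (complex ^ 'n \<Rightarrow> complex) \<Rightarrow> ennreal" where
  "lux_norm \<alpha> \<Phi> f =
     (INF c\<in>{c. 0 < c \<and> (\<integral>\<^sup>+z. ennreal (\<Phi> (norm (f z) / c)) \<partial>nu \<alpha>) \<le> 1}. ennreal c)"


section \<open>Small Hankel operators\<close>

text \<open>On the ball \<open>1 - \<langle>z,\<xi>\<rangle>\<close> has positive real part, and the power is the principal branch.\<close>

definition bergman_proj ::
    "real \<Rightarrow> (complex ^ 'n \<Rightarrow> complex) \<Rightarrow> complex ^ 'n \<Rightarrow> complex" where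
  "bergman_proj \<alpha> f z =
     (LINT \<xi>|nu \<alpha>. f \<xi> / (1 - cinner z \<xi>) powr complex_of_real (real CARD('n) + 1 + \<alpha>))"

definition hankel ::
    "real \<Rightarrow> (complex ^ 'n \<Rightarrow> complex) \<Rightarrow> (complex ^ 'n \<Rightarrow> complex) \<Rightarrow> complex ^ 'n \<Rightarrow> complex" where
  "hankel \<alpha> b f = bergman_proj \<alpha> (\<lambda>z. b z * cnj (f z))"

definition hankel_extends_bounded ::
    "real \<Rightarrow> (complex ^ 'n \<Rightarrow> complex) \<Rightarrow> (real \<Rightarrow> real) \<Rightarrow> (real \<Rightarrow> real) \<Rightarrow> bool" where
  "hankel_extends_bounded \<alpha> b \<Phi>\<^sub>1 \<Phi>\<^sub>2 \<longleftrightarrow>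
     (\<exists>C>0. \<forall>f. holomorphic_ball f \<and> bounded (f ` ball 0 1) \<longrightarrow>
        lux_norm \<alpha> \<Phi>\<^sub>2 (hankel \<alpha> b f) \<le> ennreal C * lux_norm \<alpha> \<Phi>\<^sub>1 f)"


section \<open>The spaces \<open>\<Gamma>\<^bsub>\<alpha>,\<rho>\<^esub>\<close>\<close>

definition radial_deriv :: "(complex ^ 'n \<Rightarrow> complex) \<Rightarrow> complex ^ 'n \<Rightarrow> complex" where
  "radial_deriv f z = (\<Sum>j\<in>UNIV. z $ j * deriv (\<lambda>w. f (z + axis j w)) 0)"

definition rho_upper_type :: "real \<Rightarrow> (real \<Rightarrow> real) \<Rightarrow> bool" where
  "rho_upper_type \<gamma> \<rho> \<longleftrightarrow>
     (\<forall>t. 0 < t \<and> t \<le> 1 \<longrightarrow> \<rho> t > 0) \<and>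
     (\<exists>C>0. \<forall>s t. 1 < s \<and> 0 < t \<and> s * t \<le> 1 \<longrightarrow> \<rho> (s * t) \<le> C * s powr \<gamma> * \<rho> t)"

definition Gamma_space :: "real \<Rightarrow> (real \<Rightarrow> real) \<Rightarrow> (complex ^ 'n \<Rightarrow> complex) set" where
  "Gamma_space \<alpha> \<rho> =
     {f. holomorphic_ball f \<and>
        (\<exists>\<gamma>\<ge>0. rho_upper_type \<gamma> \<rho> \<and>
           (\<exists>k::nat. real k > \<gamma> * (real CARD('n) + 1 + \<alpha>) \<and>
              (\<exists>C>0. \<forall>z\<in>ball 0 1. norm ((radial_deriv ^^ k) f z)
                 \<le> C * (1 - (norm z)\<^sup>2) powr (- real k)
                     * \<rho> ((1 - (norm z)\<^sup>2) powr (real CARD('n) + 1 + \<alpha>)))))}"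


section \<open>Duality\<close>

text \<open>Boundedness forces a functional to agree on functions that coincide on the ball.\<close>

definition bounded_functional ::
    "real \<Rightarrow> (real \<Rightarrow> real) \<Rightarrow> ((complex ^ 'n \<Rightarrow> complex) \<Rightarrow> complex) \<Rightarrow> bool" where
  "bounded_functional \<alpha> \<Phi> \<Lambda> \<longleftrightarrow>
     (\<forall>f\<in>bergman_orlicz \<alpha> \<Phi>. \<forall>g\<in>bergman_orlicz \<alpha> \<Phi>. \<Lambda> (\<lambda>z. f z + g z) = \<Lambda> f + \<Lambda> g) \<and>
     (\<forall>f\<in>bergman_orlicz \<alpha> \<Phi>. \<forall>c. \<Lambda> (\<lambda>z. c * f z) = c * \<Lambda> f) \<and>
     (\<exists>C>0. \<forall>f\<in>bergman_orlicz \<alpha> \<Phi>. ennreal (norm (\<Lambda> f)) \<le> ennreal C * lux_norm \<alpha> \<Phi> f)"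

definition represents ::
    "real \<Rightarrow> (real \<Rightarrow> real) \<Rightarrow> (complex ^ 'n \<Rightarrow> complex) \<Rightarrow>
      ((complex ^ 'n \<Rightarrow> complex) \<Rightarrow> complex) \<Rightarrow> bool" where
  "represents \<alpha> \<Phi> g \<Lambda> \<longleftrightarrow>
     (\<forall>f\<in>bergman_orlicz \<alpha> \<Phi>.
        ((\<lambda>r. LINT z|nu \<alpha>. f (r *\<^sub>R z) * cnj (g z)) \<longlongrightarrow> \<Lambda> f) (at_left (1::real)))"

text \<open>\<open>G = (\<A>\<^sub>\<alpha>\<^sup>\<Phi>)\<^sup>*\<close> under the pairing
  \<open>\<langle>f,g\<rangle>\<^sub>\<alpha> = lim\<^bsub>r\<rightarrow>1\<^esub> \<integral> f(rz) cnj (g(z)) d\<nu>\<^sub>\<alpha>(z)\<close>: each \<open>g\<close> in \<open>G\<close> induces a bounded functional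
  on \<open>\<A>\<^sub>\<alpha>\<^sup>\<Phi>\<close>, and each bounded functional comes from exactly one \<open>g\<close> in \<open>G\<close>.\<close>

definition is_dual_space ::
    "real \<Rightarrow> (real \<Rightarrow> real) \<Rightarrow> (complex ^ 'n \<Rightarrow> complex) set \<Rightarrow> bool" where
  "is_dual_space \<alpha> \<Phi> G \<longleftrightarrow>
     (\<forall>g\<in>G. \<exists>\<Lambda>. bounded_functional \<alpha> \<Phi> \<Lambda> \<and> represents \<alpha> \<Phi> g \<Lambda>) \<and>
     (\<forall>\<Lambda>. bounded_functional \<alpha> \<Phi> \<Lambda> \<longrightarrow>
        (\<exists>g\<in>G. represents \<alpha> \<Phi> g \<Lambda> \<and>
           (\<forall>h\<in>G. represents \<alpha> \<Phi> h \<Lambda> \<longrightarrow> (\<forall>z\<in>ball 0 1. h z = g z))))"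

end

theory Submission
  imports Defs "HOL-Complex_Analysis.Complex_Analysis"
begin

text \<open>All estimates are driven by the kernels \<open>bk s z w = (1 - \<langle>z,w\<rangle>)\<^bsup>-s\<^esup>\<close>. With \<open>N = n + 1 + \<alpha>\<close>, a function
  with modular at most \<open>1\<close> is \<open>O(\<Phi>\<^sup>-\<^sup>1((1 - |z|\<^sup>2)\<^bsup>-N\<^esup>))\<close>, and suitable kernels attain this up to constants. Testing
  the Hankel operator (or a bounded functional) on kernels bounds the kernel transforms
  \<open>\<integral> b(w) bk (N + j) z w d\<nu>\<^sub>\<alpha>(w)\<close>, which are combinations of radial derivatives of \<open>b\<close>; hence \<open>b \<in> \<Gamma>\<^bsub>\<alpha>,\<rho>\<^esub>\<close>.
  Conversely, integration by parts replaces \<open>b d\<nu>\<^sub>\<alpha>\<close> by \<open>D d\<nu>\<^bsub>\<alpha>+k\<^esub>\<close> with \<open>|D| \<le> C (1 - |z|\<^sup>2)\<^bsup>-k\<^esup> \<rho>((1 - |z|\<^sup>2)\<^sup>N)\<close>,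
  and the pointwise bound turns \<open>|f| \<rho>\<close> into a function with \<open>\<Phi>\<^sub>2\<close>-modular at most that of \<open>f\<close>, on which the
  Bergman projection is bounded by a Schur test; the Dini condition provides the lower type \<open>1 + \<epsilon>\<close>
  this needs.\<close>

section \<open>Lebesgue measure\<close>

text \<open>Everything balances on one identity: with \<open>s = xd z powr - N\<close>, the weight
  \<open>\<rho> (xd z powr N)\<close> equals both \<open>\<Psi>\<^sub>2 s / \<Psi>\<^sub>1 s\<close>
  and \<open>s / \<Psi> s\<close>, where the \<Psi>'s invert the growth functions. The first form is
  point evaluation of the image divided by the reciprocal size of a test kernel, which governs the
  Hankel operator; the second does the same for functionals, so both problems end in one space. The
  obstacles lie on the concave side. \<Phi> is known only through its inverse, so its type has to be
  recovered from \<Psi>. The spaces need not be locally convex, so the pointwise bound is proved by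
  a self-improving argument, and agreement of functionals on kernels is carried to the whole space
  by approximation. That approximation uses dilations, which for \<alpha> < 0 are controlled only on
  average over the ratio. Integrals over the ball rest on exact scaling identities, and kernel
  integrals are reduced to the exponent 2N, which the reproducing formula evaluates in closed
  form.\<close>

lemma nn_integral_lborel_translate:
  fixes f :: "'a::euclidean_space \<Rightarrow> ennreal"
  assumes [measurable]: "f \<in> borel_measurable borel"
  shows "(\<integral>\<^sup>+x. f (x + c) \<partial>lborel) = (\<integral>\<^sup>+x. f x \<partial>lborel)"
proof -
  have "(\<integral>\<^sup>+x. f x \<partial>lborel) = (\<integral>\<^sup>+x. f x \<partial>distr lborel borel ((+) c))"
    by (simp add: lborel_distr_plus)
  also have "... = (\<integral>\<^sup>+x. f (x + c) \<partial>lborel)" by (subst nn_integral_distr) (auto simp: add.commute)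
  finally show ?thesis ..
qed

lemma nn_integral_lborel_scaleR:
  fixes f :: "'a::euclidean_space \<Rightarrow> ennreal"
  assumes [measurable]: "f \<in> borel_measurable borel" and "c > 0"
  shows "(\<integral>\<^sup>+x. f (c *\<^sub>R x) \<partial>lborel) = ennreal (1 / c ^ DIM('a)) * (\<integral>\<^sup>+x. f x \<partial>lborel)"
proof -
  have "(\<integral>\<^sup>+x. f x \<partial>lborel) =
      (\<integral>\<^sup>+x. f x \<partial>density (distr lborel borel (\<lambda>x. 0 + c *\<^sub>R x)) (\<lambda>_. ennreal (\<bar>c\<bar> ^ DIM('a))))"
    using lborel_affine[of c "0::'a"] assms by simp
  also have "... = ennreal (c ^ DIM('a)) * (\<integral>\<^sup>+x. f (c *\<^sub>R x) \<partial>lborel)"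
    using assms by (subst nn_integral_density) (auto simp: nn_integral_distr nn_integral_cmult)
  finally have "ennreal (1 / c ^ DIM('a)) * (\<integral>\<^sup>+x. f x \<partial>lborel)
     = (ennreal (1 / c ^ DIM('a)) * ennreal (c ^ DIM('a))) * (\<integral>\<^sup>+x. f (c *\<^sub>R x) \<partial>lborel)"
    by (simp add: mult.assoc)
  also have "ennreal (1 / c ^ DIM('a)) * ennreal (c ^ DIM('a)) = 1" using assms by (simp flip: ennreal_mult')
  finally show ?thesis by simp
qed

text \<open>The double integral \<open>?I\<close> is computed in two ways. Integrating first in x,
  the shift y = T x0 is absorbed by translation invariance and leaves the image measure of A.
  Substituting y - T x for y and exchanging the order leaves the Lebesgue measure of A, times the
  volume of {x. norm (y - T x) < 1}, a ball of radius 1 because T is a surjective isometry. The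
  common factor, the volume of the unit ball, cancels.\<close>

lemma distr_lborel_isometry:
  fixes T :: "'a::euclidean_space \<Rightarrow> 'a"
  assumes lin: "linear T" and iso: "\<And>x. norm (T x) = norm x"
  shows "distr lborel borel T = lborel"
proof (rule measure_eqI)
  let ?M = "distr lborel borel T"
  have cT: "continuous_on UNIV T" by (simp add: lin linear_continuous_on linear_conv_bounded_linear[symmetric])
  then have [measurable]: "T \<in> borel_measurable borel" by (rule borel_measurable_continuous_onI)
  have "inj T" using lin iso by (metis (no_types, lifting) linear_injective_0 norm_eq_zero)
  then have surj: "surj T" using lin by (simp add: linear_injective_imp_surjective)
  let ?B = "ball (0::'a) 1"
  have mB[measurable]: "Measurable.pred borel (\<lambda>x. x \<in> ball c r)" for c :: 'a and r by (simp add: pred_sets2)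
  fix A assume "A \<in> sets ?M"
  then have A[measurable]: "A \<in> sets borel" by simp
  have trans: "emeasure lborel {x. norm (y - T x) < 1} = emeasure lborel ?B" for y
  proof -
    obtain x0 where x0: "y = T x0" using surj by (metis surjD)
    have "norm (y - T x) = norm (x0 - x)" for x unfolding x0 using iso[of "x0 - x"] linear_diff[OF lin, of x0 x] by simp
    then have s: "{x. norm (y - T x) < 1} = ball x0 1" by (auto simp: dist_norm)
    have "emeasure lborel (ball x0 1) = (\<integral>\<^sup>+x. indicator (ball x0 1) x \<partial>lborel)" by simp
    also have "... = (\<integral>\<^sup>+x. indicator (ball x0 1) (x + x0) \<partial>lborel)"
      by (rule nn_integral_lborel_translate[symmetric]) measurable
    also have "... = (\<integral>\<^sup>+x. indicator ?B x \<partial>lborel)"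
      by (intro nn_integral_cong) (auto simp: indicator_def dist_norm)
    finally show ?thesis using s by simp
  qed
  let ?I = "\<integral>\<^sup>+y. \<integral>\<^sup>+x. indicator A (T x + y) * indicator ?B y \<partial>lborel \<partial>lborel"
  have 1: "?I = emeasure lborel ?B * emeasure ?M A"
  proof -
    have "(\<integral>\<^sup>+x. indicator A (T x + y) * indicator ?B y \<partial>lborel) = emeasure ?M A * indicator ?B y" for y
    proof -
      obtain x0 where x0: "y = T x0" using surj by (metis surjD)
      have "(\<integral>\<^sup>+x. indicator A (T x + y) \<partial>lborel) = (\<integral>\<^sup>+x. indicator A (T (x + x0)) \<partial>lborel)"
        by (simp add: x0 linear_add[OF lin])
      also have "... = (\<integral>\<^sup>+x. indicator A (T x) \<partial>lborel)" by (rule nn_integral_lborel_translate) auto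
      also have "... = emeasure ?M A" by (subst nn_integral_distr[symmetric, of T _ borel]) auto
      finally show ?thesis by (simp add: nn_integral_multc)
    qed
    then have "?I = (\<integral>\<^sup>+y. emeasure ?M A * indicator ?B y \<partial>lborel)" by simp
    also have "... = emeasure ?M A * emeasure lborel ?B" by (rule nn_integral_cmult_indicator) simp
    finally show ?thesis by (simp add: mult.commute)
  qed
  have 2: "?I = emeasure lborel ?B * emeasure lborel A"
  proof -
    have "?I = (\<integral>\<^sup>+x. \<integral>\<^sup>+y. indicator A (T x + y) * indicator ?B y \<partial>lborel \<partial>lborel)"
      by (rule lborel_pair.Fubini') measurable
    also have "... = (\<integral>\<^sup>+x. \<integral>\<^sup>+y. indicator A y * indicator ?B (y - T x) \<partial>lborel \<partial>lborel)"
    proof (rule nn_integral_cong)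
      fix x
      show "(\<integral>\<^sup>+y. indicator A (T x + y) * indicator ?B y \<partial>lborel)
         = (\<integral>\<^sup>+y. indicator A y * indicator ?B (y - T x) \<partial>lborel)"
        using nn_integral_lborel_translate[of "\<lambda>y. indicator A y * indicator ?B (y - T x)" "T x"] by (simp add: add.commute)
    qed
    also have "... = (\<integral>\<^sup>+y. \<integral>\<^sup>+x. indicator A y * indicator ?B (y - T x) \<partial>lborel \<partial>lborel)"
      by (rule lborel_pair.Fubini') measurable
    also have "... = (\<integral>\<^sup>+y. indicator A y * emeasure lborel ?B \<partial>lborel)"
    proof (rule nn_integral_cong)
      fix y
      have "(\<integral>\<^sup>+x. indicator ?B (y - T x) \<partial>lborel) = (\<integral>\<^sup>+x. indicator {x. norm (y - T x) < 1} x \<partial>lborel)"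
        by (intro nn_integral_cong) (simp add: indicator_def)
      also have "... = emeasure lborel {x. norm (y - T x) < 1}"
      proof (rule nn_integral_indicator)
        have "{x. norm (y - T x) < 1} \<in> sets borel" by measurable
        then show "{x. norm (y - T x) < 1} \<in> sets lborel" by simp
      qed
      also have "... = emeasure lborel ?B" by (rule trans)
      finally show "(\<integral>\<^sup>+x. indicator A y * indicator ?B (y - T x) \<partial>lborel) = indicator A y * emeasure lborel ?B"
        by (simp add: nn_integral_cmult)
    qed
    also have "... = (\<integral>\<^sup>+y. emeasure lborel ?B * indicator A y \<partial>lborel)" by (simp add: mult.commute)
    also have "... = emeasure lborel ?B * emeasure lborel A" by (rule nn_integral_cmult_indicator) simp
    finally show ?thesis .
  qed
  have "emeasure lborel ?B \<noteq> 0" "emeasure lborel ?B \<noteq> \<infinity>"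
    using emeasure_lborel_ball_finite[of "0::'a" 1] using content_ball_pos[of 1 "0::'a"] by (auto simp: measure_def)
  then show "emeasure ?M A = emeasure lborel A"
    using 1 2 ennreal_mult_cancel_left[of "emeasure lborel ?B" "emeasure ?M A" "emeasure lborel A"] by auto
qed simp


section \<open>Moments of the weights on the ball\<close>

definition xd :: "complex ^ 'n \<Rightarrow> real" where "xd z = 1 - (norm z)\<^sup>2"

text \<open>Since \<open>xd z\<close> is positive exactly on the ball,
  \<open>pos_powr \<alpha> (xd z)\<close> is the weight extended by zero. Integrals over the ball
  become integrals over the whole space, where scalings are available.\<close>

definition pos_powr :: "real \<Rightarrow> real \<Rightarrow> real" where
  "pos_powr a y = (if 0 < y then y powr a else 0)"

lemma pos_powr_nonneg [simp]: "0 \<le> pos_powr a y"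
  by (simp add: pos_powr_def)

lemma measurable_pos_powr [measurable]: "pos_powr a \<in> borel_measurable borel"
  unfolding pos_powr_def by measurable

lemma measurable_xd [measurable]: "xd \<in> borel_measurable borel"
  unfolding xd_def by measurable

lemma measurable_vec_nth' [measurable]: "(\<lambda>z::complex^'n. z $ i) \<in> borel_measurable borel"
  by (intro borel_measurable_continuous_onI continuous_intros)

lemma measurable_cnj [measurable]: "cnj \<in> borel_measurable borel"
  by (intro borel_measurable_continuous_onI continuous_intros)

lemma xd_pos_iff: "0 < xd z \<longleftrightarrow> z \<in> ball 0 1" for z :: "complex ^ 'n"
  unfolding xd_def by (simp add: abs_square_less_1)

lemma norm_vec_sq: "(norm (z :: complex ^ 'n))\<^sup>2 = (\<Sum>j\<in>UNIV. (norm (z $ j))\<^sup>2)"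
  by (simp add: norm_vec_def L2_set_def sum_nonneg)

text \<open>The substitution u = y - (t - 1) a gives the integral of u powr \<alpha> over (0,y),
  finite since \<alpha> > -1. A weight of exponent \<alpha> + 1 is thereby a superposition of
  shifted weights of exponent \<alpha>.\<close>

lemma nn_integral_pos_powr_affine:
  assumes "\<alpha> > -1" and a: "a > 0"
  shows "(\<integral>\<^sup>+t. indicator {1<..} t * ennreal (a * pos_powr \<alpha> (y - (t - 1) * a)) \<partial>lborel)
     = ennreal (pos_powr (\<alpha> + 1) y / (\<alpha> + 1))"
proof (cases "y > 0")
  case True
  have "((\<lambda>x. x powr \<alpha>) has_integral (y powr (\<alpha>+1) / (\<alpha>+1))) {0..y}"
    using has_integral_powr_from_0[of \<alpha> y] True assms by simp
  then have "(\<integral>\<^sup>+x. ennreal (indicator {0..y} x * x powr \<alpha>) \<partial>lborel) = ennreal (y powr (\<alpha>+1) / (\<alpha>+1))"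
    by (intro nn_integral_has_integral_lebesgue) auto
  also have "(\<integral>\<^sup>+x. ennreal (indicator {0..y} x * x powr \<alpha>) \<partial>lborel)
      = (\<integral>\<^sup>+u. ennreal (indicator {..<y} u * pos_powr \<alpha> u) \<partial>lborel)"
  proof (rule nn_integral_cong_AE)
    have "AE x in lborel. x \<noteq> 0 \<and> x \<noteq> y" using AE_lborel_singleton[of 0] AE_lborel_singleton[of y] by auto
    then show "AE x in lborel. ennreal (indicator {0..y} x * x powr \<alpha>) = ennreal (indicator {..<y} x * pos_powr \<alpha> x)"
      by eventually_elim (auto simp: indicator_def pos_powr_def)
  qed
  also have "... = ennreal \<bar>-a\<bar> * (\<integral>\<^sup>+t. ennreal (indicator {..<y} ((y+a) + (-a) * t) * pos_powr \<alpha> ((y+a) + (-a) * t)) \<partial>lborel)"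
    using a by (intro nn_integral_real_affine) auto
  also have "... = (\<integral>\<^sup>+t. ennreal a * ennreal (indicator {..<y} ((y+a) + (-a) * t) * pos_powr \<alpha> ((y+a) + (-a) * t)) \<partial>lborel)"
    using a by (subst nn_integral_cmult) auto
  also have "... = (\<integral>\<^sup>+t. indicator {1<..} t * ennreal (a * pos_powr \<alpha> (y - (t - 1) * a)) \<partial>lborel)"
  proof (rule nn_integral_cong)
    fix t :: real
    have "y + a + (-a) * t < y \<longleftrightarrow> a * 1 < a * t" by (simp add: algebra_simps)
    also have "... \<longleftrightarrow> 1 < t" using a by simp
    finally have "(y+a) + (-a) * t < y \<longleftrightarrow> 1 < t" .
    moreover have "(y+a) + (-a) * t = y - (t - 1) * a" by (simp add: algebra_simps)
    ultimately have "indicator {..<y} ((y+a) + (-a) * t) = (indicator {1<..} t :: real)"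
      "pos_powr \<alpha> ((y+a) + (-a) * t) = pos_powr \<alpha> (y - (t - 1) * a)"
      unfolding indicator_def lessThan_iff greaterThan_iff by (simp only:)+
    then show "ennreal a * ennreal (indicator {..<y} ((y+a) + (-a) * t) * pos_powr \<alpha> ((y+a) + (-a) * t))
      = indicator {1<..} t * ennreal (a * pos_powr \<alpha> (y - (t - 1) * a))"
      using a by (simp only:) (auto simp: indicator_def ennreal_mult')
  qed
  finally show ?thesis using True by (simp add: pos_powr_def)
next
  case False
  have "indicator {1<..} t * ennreal (a * pos_powr \<alpha> (y - (t - 1) * a)) = 0" for t
  proof (cases "t > 1")
    case True
    then have "(t - 1) * a > 0" using a by simp
    then have "\<not> y - (t - 1) * a > 0" using False by simp
    then show ?thesis by (simp add: pos_powr_def)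
  qed simp
  then have "(\<integral>\<^sup>+t. indicator {1<..} t * ennreal (a * pos_powr \<alpha> (y - (t - 1) * a)) \<partial>lborel) = 0"
    by (simp only: nn_integral_const) simp
  then show ?thesis using False by (simp add: pos_powr_def)
qed

lemma nn_integral_powr_tail:
  assumes "c > 0"
  shows "(\<integral>\<^sup>+t. indicator {1<..} t * ennreal (t powr - (c + 1)) \<partial>lborel) = ennreal (1 / c)"
proof -
  have "((\<lambda>x. x powr - (c+1)) has_integral (1 / c)) {1..}" using has_integral_powr_to_inf[of "- (c+1)" 1] assms by simp
  then have "(\<integral>\<^sup>+x. ennreal (indicator {1..} x * x powr - (c+1)) \<partial>lborel) = ennreal (1 / c)"
    by (intro nn_integral_has_integral_lebesgue) auto
  moreover have "(\<integral>\<^sup>+t. indicator {1<..} t * ennreal (t powr - (c + 1)) \<partial>lborel)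
     = (\<integral>\<^sup>+x. ennreal (indicator {1..} x * x powr - (c+1)) \<partial>lborel)"
  proof (rule nn_integral_cong_AE)
    show "AE t in lborel. indicator {1<..} t * ennreal (t powr - (c + 1)) = ennreal (indicator {1..} t * t powr - (c+1))"
      using AE_lborel_singleton[of 1] by eventually_elim (auto simp: indicator_def)
  qed
  ultimately show ?thesis by simp
qed

text \<open>Integration by parts in disguise: integrating the scaling identity \<open>sc\<close> over \<open>t > 1\<close>.\<close>

lemma scaling_by_parts:
  fixes H a :: "complex ^ 'n \<Rightarrow> real"
  assumes al: "\<alpha> > -1" and c: "c > 0"
    and [measurable]: "H \<in> borel_measurable borel" "a \<in> borel_measurable borel"
    and H: "\<And>z. 0 \<le> H z" and a: "\<And>z. 0 \<le> a z" "AE z in lborel. a z \<noteq> 0"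
    and sc: "\<And>t. t > 1 \<Longrightarrow> (\<integral>\<^sup>+z. ennreal (H z * (a z * pos_powr \<alpha> (xd z - (t - 1) * a z))) \<partial>lborel)
        = ennreal (t powr - (c + 1)) * (\<integral>\<^sup>+z. ennreal (H z * (a z * pos_powr \<alpha> (xd z))) \<partial>lborel)"
  shows "(\<integral>\<^sup>+z. ennreal (H z * pos_powr (\<alpha> + 1) (xd z)) \<partial>lborel)
     = ennreal ((\<alpha> + 1) / c) * (\<integral>\<^sup>+z. ennreal (H z * (a z * pos_powr \<alpha> (xd z))) \<partial>lborel)"
    (is "_ = _ * ?I")
proof -
  let ?h = "\<lambda>z t. H z * (a z * pos_powr \<alpha> (xd z - (t - 1) * a z))"
  have "(\<integral>\<^sup>+z. ennreal (H z * pos_powr (\<alpha> + 1) (xd z)) \<partial>lborel)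
     = (\<integral>\<^sup>+z. ennreal (\<alpha> + 1) * (\<integral>\<^sup>+t. indicator {1<..} t * ennreal (?h z t) \<partial>lborel) \<partial>lborel)"
  proof (rule nn_integral_cong_AE)
    show "AE z in lborel. ennreal (H z * pos_powr (\<alpha> + 1) (xd z)) =
       ennreal (\<alpha> + 1) * (\<integral>\<^sup>+t. indicator {1<..} t * ennreal (?h z t) \<partial>lborel)"
      using a(2)
    proof eventually_elim
      case (elim z)
      then have az: "a z > 0" using a(1)[of z] by simp
      have "(\<integral>\<^sup>+t. indicator {1<..} t * ennreal (?h z t) \<partial>lborel)
         = (\<integral>\<^sup>+t. ennreal (H z) * (indicator {1<..} t * ennreal (a z * pos_powr \<alpha> (xd z - (t - 1) * a z))) \<partial>lborel)"
        using H[of z] az by (intro nn_integral_cong) (simp add: ennreal_mult ac_simps)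
      also have "... = ennreal (H z) * ennreal (pos_powr (\<alpha> + 1) (xd z) / (\<alpha> + 1))"
        by (subst nn_integral_cmult) (auto simp: nn_integral_pos_powr_affine[OF al az])
      finally have "(\<integral>\<^sup>+t. indicator {1<..} t * ennreal (?h z t) \<partial>lborel)
        = ennreal (H z * (pos_powr (\<alpha> + 1) (xd z) / (\<alpha> + 1)))" using al H[of z] by (simp only:) (subst ennreal_mult, auto)
      moreover have "(\<alpha> + 1) * (H z * (pos_powr (\<alpha> + 1) (xd z) / (\<alpha> + 1))) = H z * pos_powr (\<alpha> + 1) (xd z)"
        using al by simp
      ultimately show ?case using al by (simp only: ennreal_mult'[symmetric])
    qed
  qed
  also have "... = ennreal (\<alpha> + 1) * (\<integral>\<^sup>+z. \<integral>\<^sup>+t. indicator {1<..} t * ennreal (?h z t) \<partial>lborel \<partial>lborel)"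
    by (subst nn_integral_cmult) auto
  also have "(\<integral>\<^sup>+z. \<integral>\<^sup>+t. indicator {1<..} t * ennreal (?h z t) \<partial>lborel \<partial>lborel)
     = (\<integral>\<^sup>+t. \<integral>\<^sup>+z. indicator {1<..} t * ennreal (?h z t) \<partial>lborel \<partial>lborel)"
    by (rule lborel_pair.Fubini') measurable
  also have "... = (\<integral>\<^sup>+t. indicator {1<..} t * ennreal (t powr - (c + 1)) * ?I \<partial>lborel)"
  proof (rule nn_integral_cong)
    fix t :: real
    have "(\<integral>\<^sup>+z. indicator {1<..} t * ennreal (?h z t) \<partial>lborel)
       = indicator {1<..} t * (\<integral>\<^sup>+z. ennreal (?h z t) \<partial>lborel)"
      by (subst nn_integral_cmult) auto
    also have "... = indicator {1<..} t * ennreal (t powr - (c + 1)) * ?I" using sc[of t] by (auto simp: indicator_def mult.assoc)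
    finally show "(\<integral>\<^sup>+z. indicator {1<..} t * ennreal (?h z t) \<partial>lborel)
      = indicator {1<..} t * ennreal (t powr - (c + 1)) * ?I" .
  qed
  also have "... = ennreal (1 / c) * ?I" using nn_integral_powr_tail[OF c] by (subst nn_integral_multc) auto
  also have "ennreal (\<alpha> + 1) * (ennreal (1 / c) * ?I) = ennreal ((\<alpha> + 1) / c) * ?I"
    using al c by (simp flip: ennreal_mult mult.assoc)
  finally show ?thesis .
qed

definition coord_scale :: "'n::finite \<Rightarrow> real \<Rightarrow> complex ^ 'n \<Rightarrow> complex ^ 'n" where
  "coord_scale i c z = (\<chi> j. if j = i then c *\<^sub>R z $ j else z $ j)"

lemma nn_integral_coord_scale:
  fixes f :: "complex ^ 'n \<Rightarrow> ennreal"
  assumes [measurable]: "f \<in> borel_measurable borel" and c: "c > 0"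
  shows "(\<integral>\<^sup>+x. f (coord_scale i c x) \<partial>lborel) = ennreal (1 / c\<^sup>2) * (\<integral>\<^sup>+x. f x \<partial>lborel)"
proof -
  \<comment> \<open>The two real basis directions of the complex coordinate i; hence the Jacobian
    c^2.\<close>
  define P where "P = {axis i 1, axis i \<i> :: complex ^ 'n}"
  define cf where "cf j = (if j \<in> P then c else 1)" for j :: "complex ^ 'n"
  have P: "P \<subseteq> Basis" by (auto simp: P_def Basis_vec_def Basis_complex_def)
  have "axis i 1 \<noteq> (axis i \<i> :: complex ^ 'n)" by (simp add: axis_eq_axis)
  then have cP: "card P = 2" by (simp add: P_def)
  have T: "0 + (\<Sum>j\<in>Basis. (cf j * (x \<bullet> j)) *\<^sub>R j) = coord_scale i c x" for x
  proof (rule euclidean_eqI)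
    fix b :: "complex ^ 'n" assume b: "b \<in> Basis"
    then obtain k u where bk: "b = axis k u" "u \<in> {1, \<i>}" by (auto simp: Basis_vec_def Basis_complex_def)
    have "b \<in> P \<longleftrightarrow> k = i" using bk by (auto simp: P_def axis_eq_axis)
    then have "coord_scale i c x \<bullet> b = cf b * (x \<bullet> b)" by (simp add: bk(1) inner_axis coord_scale_def cf_def)
    then show "(0 + (\<Sum>j\<in>Basis. (cf j * (x \<bullet> j)) *\<^sub>R j)) \<bullet> b = coord_scale i c x \<bullet> b" using b by simp
  qed
  have prod: "(\<Prod>j\<in>Basis. \<bar>cf j\<bar>) = c\<^sup>2"
  proof -
    have "(\<Prod>j\<in>Basis. \<bar>cf j\<bar>) = (\<Prod>j\<in>P. c)"
      using P c by (intro prod.mono_neutral_cong_right) (auto simp: cf_def)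
    then show ?thesis using cP by simp
  qed
  have [measurable]: "coord_scale i c \<in> borel_measurable borel"
  proof -
    have "(\<lambda>x. 0 + (\<Sum>j\<in>Basis. (cf j * (x \<bullet> j)) *\<^sub>R j)) \<in> borel_measurable borel" by measurable
    then show ?thesis unfolding T .
  qed
  have "(\<integral>\<^sup>+x. f x \<partial>lborel) =
      (\<integral>\<^sup>+x. f x \<partial>density (distr lborel borel (coord_scale i c)) (\<lambda>_. ennreal (c\<^sup>2)))"
    using lborel_affine_euclidean[of cf 0] c unfolding T prod by (simp add: cf_def)
  also have "... = ennreal (c\<^sup>2) * (\<integral>\<^sup>+x. f (coord_scale i c x) \<partial>lborel)"
    using c by (subst nn_integral_density) (auto simp: nn_integral_distr nn_integral_cmult)
  finally have "ennreal (1 / c\<^sup>2) * (\<integral>\<^sup>+x. f x \<partial>lborel)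
     = (ennreal (1 / c\<^sup>2) * ennreal (c\<^sup>2)) * (\<integral>\<^sup>+x. f (coord_scale i c x) \<partial>lborel)"
    by (simp add: mult.assoc)
  also have "ennreal (1 / c\<^sup>2) * ennreal (c\<^sup>2) = 1" using c by (simp flip: ennreal_mult')
  finally show ?thesis by simp
qed

definition moment :: "'n::finite \<Rightarrow> nat \<Rightarrow> real \<Rightarrow> ennreal" where
  "moment i k \<alpha> = (\<integral>\<^sup>+(z::complex^'n). ennreal (norm (z $ i) ^ (2 * k) * pos_powr \<alpha> (xd z)) \<partial>lborel)"

text \<open>\<open>scaling_by_parts\<close> is used with a = |z_i|^2 and the scaling of coordinate i
  by sqrt t, which lowers \<open>xd z\<close> by (t - 1) |z_i|^2. The integrand gains t^(k+1) and
  the Jacobian is 1/t, so c = k + 1.\<close>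

lemma moment_Suc_aux:
  fixes i :: "'n::finite"
  assumes al: "\<alpha> > -1"
  shows "moment i k (\<alpha> + 1) = ennreal ((\<alpha> + 1) / (real k + 1)) * moment i (Suc k) \<alpha>"
proof -
  have "moment i k (\<alpha> + 1) = ennreal ((\<alpha> + 1) / (real k + 1)) *
     (\<integral>\<^sup>+(z::complex^'n). ennreal (norm (z $ i) ^ (2 * k) * ((norm (z $ i))\<^sup>2 * pos_powr \<alpha> (xd z))) \<partial>lborel)"
    unfolding moment_def
  proof (rule scaling_by_parts[OF al])
    have "{z::complex^'n. z $ i = 0} \<subseteq> {z. z \<bullet> axis i 1 = 0}" by (auto simp: inner_axis)
    moreover have "negligible {z::complex^'n. z \<bullet> axis i 1 = 0}"
      by (intro negligible_standard_hyperplane) (auto simp: Basis_vec_def Basis_complex_def)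
    ultimately have "negligible {z::complex^'n. z $ i = 0}" by (rule negligible_subset[rotated])
    then have "{z::complex^'n. z $ i = 0} \<in> null_sets lebesgue" by (simp add: negligible_iff_null_sets)
    moreover have "{z::complex^'n. z $ i = 0} \<in> sets borel" by measurable
    ultimately have "{z::complex^'n. z $ i = 0} \<in> null_sets lborel" by (auto simp: null_sets_def)
    then have "AE z in lborel. z \<notin> {z::complex^'n. z $ i = 0}" by (rule AE_not_in)
    then show "AE z in lborel. (norm ((z::complex^'n) $ i))\<^sup>2 \<noteq> 0" by eventually_elim auto
  next
    fix t :: real assume t: "t > 1"
    let ?f = "\<lambda>z::complex^'n. ennreal (norm (z $ i) ^ (2 * k) * ((norm (z $ i))\<^sup>2 * pos_powr \<alpha> (xd z)))"
    have "(\<integral>\<^sup>+z. ?f (coord_scale i (sqrt t) z) \<partial>lborel) = ennreal (1 / (sqrt t)\<^sup>2) * (\<integral>\<^sup>+x. ?f x \<partial>lborel)"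
      using t by (intro nn_integral_coord_scale) auto
    moreover have "?f (coord_scale i (sqrt t) z)
       = ennreal (t ^ (k + 1)) * ennreal (norm (z $ i) ^ (2 * k) * ((norm (z $ i))\<^sup>2 * pos_powr \<alpha> (xd z - (t - 1) * (norm (z $ i))\<^sup>2)))" for z
    proof -
      have 1: "norm (coord_scale i (sqrt t) z $ i) ^ (2 * m) = t ^ m * norm (z $ i) ^ (2 * m)" for m
        using t by (simp add: coord_scale_def power_mult_distrib power_mult)
      have "(norm (coord_scale i (sqrt t) z))\<^sup>2 = (\<Sum>j\<in>UNIV. (norm (z $ j))\<^sup>2 + (if j = i then (t - 1) * (norm (z $ i))\<^sup>2 else 0))"
        unfolding norm_vec_sq using t by (intro sum.cong) (auto simp: coord_scale_def power_mult_distrib algebra_simps)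
      also have "... = (norm z)\<^sup>2 + (t - 1) * (norm (z $ i))\<^sup>2" by (simp add: sum.distrib norm_vec_sq)
      finally have 2: "xd (coord_scale i (sqrt t) z) = xd z - (t - 1) * (norm (z $ i))\<^sup>2" by (simp add: xd_def)
      show ?thesis using 1[of k] 1[of 1] 2 t by (simp flip: ennreal_mult' add: mult_ac)
    qed
    ultimately have *: "(\<integral>\<^sup>+z. ennreal (t ^ (k + 1)) * ennreal (norm (z $ i) ^ (2 * k) * ((norm (z $ i))\<^sup>2 * pos_powr \<alpha> (xd z - (t - 1) * (norm (z $ i))\<^sup>2))) \<partial>lborel)
        = ennreal (1 / t) * (\<integral>\<^sup>+x. ?f x \<partial>lborel)" using t by simp
    let ?J = "(\<integral>\<^sup>+(z::complex^'n). ennreal (norm (z $ i) ^ (2 * k) * ((norm (z $ i))\<^sup>2 * pos_powr \<alpha> (xd z - (t - 1) * (norm (z $ i))\<^sup>2))) \<partial>lborel)"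
    from * have "ennreal (t ^ (k + 1)) * ?J = ennreal (1 / t) * (\<integral>\<^sup>+x. ?f x \<partial>lborel)"
      by (subst (asm) nn_integral_cmult) auto
    then have "ennreal (1 / t ^ (k + 1)) * (ennreal (t ^ (k + 1)) * ?J) = ennreal (1 / t ^ (k + 1)) * (ennreal (1 / t) * (\<integral>\<^sup>+x. ?f x \<partial>lborel))"
      by simp
    moreover have "ennreal (1 / t ^ (k + 1)) * (ennreal (t ^ (k + 1)) * ?J) = ?J" using t by (simp flip: ennreal_mult' mult.assoc)
    moreover have "ennreal (1 / t ^ (k + 1)) * (ennreal (1 / t) * (\<integral>\<^sup>+x. ?f x \<partial>lborel)) = ennreal (t powr - (real k + 1 + 1)) * (\<integral>\<^sup>+x. ?f x \<partial>lborel)"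
    proof -
      have "t powr (real k + 1 + 1) = t ^ (k + 1) * t" using t powr_realpow[of t "k+2"] by (simp add: add.commute add.left_commute)
      then have "1 / t ^ (k + 1) * (1 / t) = t powr - (real k + 1 + 1)" using t by (simp only: powr_minus_divide) simp
      then show ?thesis using t by (simp flip: ennreal_mult' mult.assoc)
    qed
    ultimately show "?J = ennreal (t powr - (real k + 1 + 1)) * (\<integral>\<^sup>+x. ?f x \<partial>lborel)" by simp
  qed auto
  also have "(\<integral>\<^sup>+(z::complex^'n). ennreal (norm (z $ i) ^ (2 * k) * ((norm (z $ i))\<^sup>2 * pos_powr \<alpha> (xd z))) \<partial>lborel) = moment i (Suc k) \<alpha>"
    unfolding moment_def by (intro nn_integral_cong) (simp add: power2_eq_square mult_ac)
  finally show ?thesis .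
qed

text \<open>The same device with a = |z|^2 and the dilation by sqrt t of all n complex coordinates;
  the Jacobian t^(-n) makes c = k + n.\<close>

lemma moment_shift_aux:
  fixes i :: "'n::finite"
  assumes al: "\<alpha> > -1"
  shows "moment i k (\<alpha> + 1) = ennreal ((\<alpha> + 1) / (real k + real CARD('n))) *
     (\<integral>\<^sup>+(z::complex^'n). ennreal (norm (z $ i) ^ (2 * k) * ((norm z)\<^sup>2 * pos_powr \<alpha> (xd z))) \<partial>lborel)"
    unfolding moment_def
proof (rule scaling_by_parts[OF al])
  show "AE z in lborel. (norm (z::complex^'n))\<^sup>2 \<noteq> 0" using AE_lborel_singleton[of "0::complex^'n"] by eventually_elim auto
  fix t :: real assume t: "t > 1"
  let ?f = "\<lambda>z::complex^'n. ennreal (norm (z $ i) ^ (2 * k) * ((norm z)\<^sup>2 * pos_powr \<alpha> (xd z)))"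
  have "(\<integral>\<^sup>+z. ?f (sqrt t *\<^sub>R z) \<partial>lborel) = ennreal (1 / (sqrt t) ^ DIM(complex^'n)) * (\<integral>\<^sup>+x. ?f x \<partial>lborel)"
    using t by (intro nn_integral_lborel_scaleR) auto
  moreover have "(sqrt t) ^ DIM(complex^'n) = t ^ CARD('n)" using t by (simp add: mult.commute[of _ 2] power_mult)
  moreover have "?f (sqrt t *\<^sub>R z)
     = ennreal (t ^ (k + 1)) * ennreal (norm (z $ i) ^ (2 * k) * ((norm z)\<^sup>2 * pos_powr \<alpha> (xd z - (t - 1) * (norm z)\<^sup>2)))" for z
  proof -
    have 1: "norm ((sqrt t *\<^sub>R z) $ i) ^ (2 * m) = t ^ m * norm (z $ i) ^ (2 * m)" for m
      using t by (simp add: power_mult_distrib power_mult)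
    have 3: "(norm (sqrt t *\<^sub>R z))\<^sup>2 = t * (norm z)\<^sup>2" using t by (simp add: power_mult_distrib)
    have 2: "xd (sqrt t *\<^sub>R z) = xd z - (t - 1) * (norm z)\<^sup>2" unfolding xd_def 3 by (simp add: algebra_simps)
    show ?thesis using t unfolding 1[of k] 2 3 by (simp flip: ennreal_mult' add: mult_ac)
  qed
  ultimately have *: "(\<integral>\<^sup>+z. ennreal (t ^ (k + 1)) * ennreal (norm (z $ i) ^ (2 * k) * ((norm z)\<^sup>2 * pos_powr \<alpha> (xd z - (t - 1) * (norm z)\<^sup>2))) \<partial>lborel)
      = ennreal (1 / t ^ CARD('n)) * (\<integral>\<^sup>+x. ?f x \<partial>lborel)" using t by simp
  let ?J = "(\<integral>\<^sup>+(z::complex^'n). ennreal (norm (z $ i) ^ (2 * k) * ((norm z)\<^sup>2 * pos_powr \<alpha> (xd z - (t - 1) * (norm z)\<^sup>2))) \<partial>lborel)"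
  from * have "ennreal (t ^ (k + 1)) * ?J = ennreal (1 / t ^ CARD('n)) * (\<integral>\<^sup>+x. ?f x \<partial>lborel)"
    by (subst (asm) nn_integral_cmult) auto
  then have "ennreal (1 / t ^ (k + 1)) * (ennreal (t ^ (k + 1)) * ?J) = ennreal (1 / t ^ (k + 1)) * (ennreal (1 / t ^ CARD('n)) * (\<integral>\<^sup>+x. ?f x \<partial>lborel))"
    by simp
  moreover have "ennreal (1 / t ^ (k + 1)) * (ennreal (t ^ (k + 1)) * ?J) = ?J" using t by (simp flip: ennreal_mult' mult.assoc)
  moreover have "ennreal (1 / t ^ (k + 1)) * (ennreal (1 / t ^ CARD('n)) * (\<integral>\<^sup>+x. ?f x \<partial>lborel)) = ennreal (t powr - (real k + real CARD('n) + 1)) * (\<integral>\<^sup>+x. ?f x \<partial>lborel)"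
  proof -
    have "t powr (real k + real CARD('n) + 1) = t ^ (k + 1) * t ^ CARD('n)"
      using t powr_realpow[of t "k + 1 + CARD('n)"] by (simp add: power_add add_ac)
    then have "1 / t ^ (k + 1) * (1 / t ^ CARD('n)) = t powr - (real k + real CARD('n) + 1)" using t by (simp only: powr_minus_divide) simp
    then show ?thesis using t by (simp flip: ennreal_mult' mult.assoc)
  qed
  ultimately show "?J = ennreal (t powr - (real k + real CARD('n) + 1)) * (\<integral>\<^sup>+x. ?f x \<partial>lborel)" by simp
qed (auto intro: add_nonneg_pos)

lemma ennreal_mult_inverse_eq:
  assumes "x = ennreal c * y" "c > 0" shows "y = ennreal (1 / c) * x"
  using assms by (simp add: mult.assoc[symmetric] flip: ennreal_mult')

text \<open>Splitting 1 = |z|^2 + xd z turns the moment of exponent \<alpha> into the integral just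
  evaluated plus the moment of exponent \<alpha> + 1.\<close>

lemma moment_shift:
  fixes i :: "'n::finite"
  assumes al: "\<alpha> > -1"
  shows "moment i k \<alpha> = ennreal ((real k + (real CARD('n) + 1 + \<alpha>)) / (\<alpha> + 1)) * moment i k (\<alpha> + 1)"
proof -
  let ?I = "\<integral>\<^sup>+(z::complex^'n). ennreal (norm (z $ i) ^ (2 * k) * ((norm z)\<^sup>2 * pos_powr \<alpha> (xd z))) \<partial>lborel"
  have "moment i k \<alpha> = (\<integral>\<^sup>+(z::complex^'n). ennreal (norm (z $ i) ^ (2 * k) * ((norm z)\<^sup>2 * pos_powr \<alpha> (xd z)))
     + ennreal (norm (z $ i) ^ (2 * k) * pos_powr (\<alpha> + 1) (xd z)) \<partial>lborel)"
    unfolding moment_def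
  proof (rule nn_integral_cong)
    fix z :: "complex ^ 'n"
    have "pos_powr \<alpha> (xd z) = (norm z)\<^sup>2 * pos_powr \<alpha> (xd z) + pos_powr (\<alpha> + 1) (xd z)"
      by (simp add: pos_powr_def powr_add) (simp add: xd_def algebra_simps)
    then have "norm (z $ i) ^ (2 * k) * pos_powr \<alpha> (xd z) = norm (z $ i) ^ (2 * k) * ((norm z)\<^sup>2 * pos_powr \<alpha> (xd z))
     + norm (z $ i) ^ (2 * k) * pos_powr (\<alpha> + 1) (xd z)" by (metis distrib_left)
    then show "ennreal (norm (z $ i) ^ (2 * k) * pos_powr \<alpha> (xd z)) = ennreal (norm (z $ i) ^ (2 * k) * ((norm z)\<^sup>2 * pos_powr \<alpha> (xd z)))
     + ennreal (norm (z $ i) ^ (2 * k) * pos_powr (\<alpha> + 1) (xd z))" by (simp flip: ennreal_plus)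
  qed
  also have "... = ?I + moment i k (\<alpha> + 1)" unfolding moment_def by (subst nn_integral_add) auto
  also have "?I = ennreal (1 / ((\<alpha> + 1) / (real k + real CARD('n)))) * moment i k (\<alpha> + 1)"
    using al by (intro ennreal_mult_inverse_eq[OF moment_shift_aux] divide_pos_pos) (auto intro: add_nonneg_pos)
  also have "... + moment i k (\<alpha> + 1) = (ennreal ((real k + real CARD('n)) / (\<alpha> + 1)) + ennreal 1) * moment i k (\<alpha> + 1)"
    by (simp add: distrib_right)
  also have "ennreal ((real k + real CARD('n)) / (\<alpha> + 1)) + ennreal 1 = ennreal ((real k + (real CARD('n) + 1 + \<alpha>)) / (\<alpha> + 1))"
    using al by (subst ennreal_plus[symmetric]) (auto simp: add_divide_distrib[symmetric] field_simps)
  finally show ?thesis .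
qed

text \<open>Equating the two expressions for the moment of exponent \<alpha> + 1 eliminates it. The
  resulting ratio (k + 1) / (k + N) yields k! / (N)_k without polar coordinates.\<close>

lemma moment_Suc:
  fixes i :: "'n::finite"
  assumes al: "\<alpha> > -1"
  shows "moment i (Suc k) \<alpha> = ennreal ((real k + 1) / (real k + (real CARD('n) + 1 + \<alpha>))) * moment i k \<alpha>"
proof -
  have "moment i (Suc k) \<alpha> = ennreal (1 / ((\<alpha> + 1) / (real k + 1))) * moment i k (\<alpha> + 1)"
    using al by (intro ennreal_mult_inverse_eq[OF moment_Suc_aux]) auto
  also have "moment i k (\<alpha> + 1) = ennreal (1 / ((real k + (real CARD('n) + 1 + \<alpha>)) / (\<alpha> + 1))) * moment i k \<alpha>"
    using al by (intro ennreal_mult_inverse_eq[OF moment_shift]) (auto intro!: divide_pos_pos)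
  finally show ?thesis using al by (simp flip: mult.assoc ennreal_mult')
qed

text \<open>For exponent \<alpha> + 1 > 0 the weight is at most 1; the shift identity carries
  finiteness down to \<alpha>.\<close>

lemma moment_finite:
  fixes i :: "'n::finite"
  assumes al: "\<alpha> > -1"
  shows "moment i 0 \<alpha> < \<infinity>"
proof -
  have "moment i 0 (\<alpha> + 1) \<le> (\<integral>\<^sup>+z. indicator (ball (0::complex^'n) 1) z \<partial>lborel)" unfolding moment_def
  proof (rule nn_integral_mono)
    fix z :: "complex ^ 'n"
    have "pos_powr (\<alpha> + 1) (xd z) \<le> 1" using al powr_le1[of "\<alpha> + 1" "xd z"] by (auto simp: pos_powr_def xd_def)
    moreover have "pos_powr (\<alpha> + 1) (xd z) = 0" if "z \<notin> ball 0 1" using that xd_pos_iff[of z] by (simp add: pos_powr_def)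
    ultimately show "ennreal (norm (z $ i) ^ (2 * 0) * pos_powr (\<alpha> + 1) (xd z)) \<le> indicator (ball 0 1) z"
      by (cases "z \<in> ball 0 1") auto
  qed
  also have "... < \<infinity>" using emeasure_lborel_ball_finite[of "0::complex^'n" 1] by simp
  finally show ?thesis using moment_shift[OF al, of i 0] by (simp add: ennreal_mult_less_top)
qed

lemma moment_pos:
  fixes i :: "'n::finite"
  shows "moment i 0 \<alpha> > 0"
proof (rule ccontr)
  assume "\<not> ?thesis"
  then have "(\<integral>\<^sup>+(z::complex^'n). ennreal (pos_powr \<alpha> (xd z)) \<partial>lborel) = 0" by (simp add: moment_def)
  then have "AE z in lborel. ennreal (pos_powr \<alpha> (xd (z::complex^'n))) = 0" by (subst (asm) nn_integral_0_iff_AE) auto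
  then have "AE z in lborel. z \<notin> ball (0::complex^'n) 1"
    by eventually_elim (auto simp: pos_powr_def simp flip: xd_pos_iff simp del: mem_ball mem_ball_0 split: if_splits)
  then have "emeasure lborel (ball (0::complex^'n) 1) = 0" by (subst (asm) AE_iff_null_sets[symmetric]) auto
  then show False using content_ball_pos[of 1 "0::complex^'n"] by (simp add: measure_def)
qed

section \<open>The normalised measures and their invariance\<close>

lemma space_nu [simp]: "space (nu \<alpha> :: (complex ^ 'n) measure) = ball 0 1"
  by (simp add: nu_def space_restrict_space)

lemma sets_nu [simp]: "sets (nu \<alpha> :: (complex ^ 'n) measure) = sets (restrict_space borel (ball 0 1))"
  by (simp add: nu_def sets_restrict_space)

lemma nu_const_eq:
  fixes i :: "'n::finite"
  assumes al: "\<alpha> > -1"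
  shows "ennreal (nu_const TYPE('n) \<alpha>) * moment i 0 \<alpha> = 1" "nu_const TYPE('n) \<alpha> > 0"
proof -
  let ?L = "LINT z|restrict_space lborel (ball (0 :: complex ^ 'n) 1). (1 - (norm z)\<^sup>2) powr \<alpha>"
  have "?L = (LINT z|lborel. indicator (ball (0 :: complex ^ 'n) 1) z *\<^sub>R ((1 - (norm z)\<^sup>2) powr \<alpha>))"
    by (subst integral_restrict_space) auto
  also have "... = (LINT z|lborel. pos_powr \<alpha> (xd (z::complex^'n)))"
    using xd_pos_iff[where 'n='n] by (intro Bochner_Integration.integral_cong refl) (auto simp: indicator_def pos_powr_def xd_def)
  also have "... = enn2real (moment i 0 \<alpha>)" unfolding moment_def by (subst integral_eq_nn_integral) auto
  finally have L: "?L = enn2real (moment i 0 \<alpha>)" .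
  have pos: "enn2real (moment i 0 \<alpha>) > 0"
    using moment_pos[of i \<alpha>] moment_finite[OF al, of i] by (simp add: enn2real_positive_iff)
  show "nu_const TYPE('n) \<alpha> > 0" unfolding nu_const_def L using pos by simp
  have "moment i 0 \<alpha> = ennreal (enn2real (moment i 0 \<alpha>))" using moment_finite[OF al, of i] by simp
  then have "ennreal (nu_const TYPE('n) \<alpha>) * moment i 0 \<alpha> = ennreal (nu_const TYPE('n) \<alpha>) * ennreal (enn2real (moment i 0 \<alpha>))" by simp
  also have "... = 1" unfolding nu_const_def L using pos by (simp flip: ennreal_mult')
  finally show "ennreal (nu_const TYPE('n) \<alpha>) * moment i 0 \<alpha> = 1" .
qed

lemma measurable_nu_times_weight:
  fixes f :: "complex ^ 'n \<Rightarrow> ennreal"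
  assumes "f \<in> borel_measurable (nu \<alpha>)"
  shows "(\<lambda>z. f z * ennreal (pos_powr \<beta> (xd z))) \<in> borel_measurable borel"
proof -
  have "(\<lambda>z. f z * ennreal (pos_powr \<beta> (xd z))) = (\<lambda>z. (f z * indicator (ball 0 1) z) * ennreal (pos_powr \<beta> (xd z)))"
    using xd_pos_iff[where 'n='n] by (auto simp: fun_eq_iff indicator_def pos_powr_def)
  moreover have [measurable]: "(\<lambda>z. f z * indicator (ball 0 1) z) \<in> borel_measurable borel"
    using assms by (subst borel_measurable_restrict_space_iff_ennreal[symmetric]) (auto cong: measurable_cong_sets)
  ultimately show ?thesis by simp
qed

lemma nn_integral_nu:
  fixes f :: "complex ^ 'n \<Rightarrow> ennreal"
  assumes al: "\<alpha> > -1" and f: "f \<in> borel_measurable (nu \<alpha>)"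
  shows "(\<integral>\<^sup>+z. f z \<partial>nu \<alpha>) = ennreal (nu_const TYPE('n) \<alpha>) * (\<integral>\<^sup>+z. f z * ennreal (pos_powr \<alpha> (xd z)) \<partial>lborel)"
proof -
  have f': "f \<in> borel_measurable (restrict_space lborel (ball 0 1))"
    using f by (subst measurable_cong_sets[of _ "nu \<alpha>" borel borel]) (auto simp: sets_restrict_space)
  have "(\<integral>\<^sup>+z. f z \<partial>nu \<alpha>) = (\<integral>\<^sup>+z. ennreal (nu_const TYPE('n) \<alpha> * (1 - (norm z)\<^sup>2) powr \<alpha>) * f z \<partial>restrict_space lborel (ball 0 1))"
    unfolding nu_def using f' by (intro nn_integral_density) (auto intro!: measurable_restrict_space1)
  also have "... = (\<integral>\<^sup>+z. ennreal (nu_const TYPE('n) \<alpha> * (1 - (norm z)\<^sup>2) powr \<alpha>) * f z * indicator (ball 0 1) z \<partial>lborel)"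
    by (intro nn_integral_restrict_space) auto
  also have "... = (\<integral>\<^sup>+z. ennreal (nu_const TYPE('n) \<alpha>) * (f z * ennreal (pos_powr \<alpha> (xd z))) \<partial>lborel)"
    using nu_const_eq(2)[OF al, where 'n='n] xd_pos_iff[where 'n='n]
    by (intro nn_integral_cong) (auto simp: indicator_def pos_powr_def xd_def ennreal_mult' mult_ac)
  also have "... = ennreal (nu_const TYPE('n) \<alpha>) * (\<integral>\<^sup>+z. f z * ennreal (pos_powr \<alpha> (xd z)) \<partial>lborel)"
    using measurable_nu_times_weight[OF f] by (intro nn_integral_cmult) simp
  finally show ?thesis .
qed

lemma emeasure_nu_space:
  assumes al: "\<alpha> > -1"
  shows "emeasure (nu \<alpha> :: (complex ^ 'n) measure) (ball 0 1) = 1"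
proof -
  have "emeasure (nu \<alpha>) (space (nu \<alpha> :: (complex ^ 'n) measure)) = (\<integral>\<^sup>+z. 1 \<partial>(nu \<alpha> :: (complex ^ 'n) measure))" by simp
  also have "... = ennreal (nu_const TYPE('n) \<alpha>) * moment (undefined :: 'n) 0 \<alpha>"
    by (subst nn_integral_nu[OF al]) (auto simp: moment_def)
  also have "... = 1" by (rule nu_const_eq[OF al])
  finally show ?thesis by simp
qed

lemma finite_measure_nu:
  assumes "\<alpha> > -1"
  shows "finite_measure (nu \<alpha> :: (complex ^ 'n) measure)"
  by (rule finite_measureI) (simp add: emeasure_nu_space[OF assms])

lemma nu_shift:
  assumes al: "\<alpha> > -1" and \<beta>: "\<beta> > -1"
  shows "(nu \<beta> :: (complex ^ 'n) measure) =
    density (nu \<alpha>) (\<lambda>z. ennreal (nu_const TYPE('n) \<beta> / nu_const TYPE('n) \<alpha> * xd z powr (\<beta> - \<alpha>)))"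
  unfolding nu_def
proof (subst density_density_eq)
  show "density (restrict_space lborel (ball 0 1)) (\<lambda>z::complex^'n. ennreal (nu_const TYPE('n) \<beta> * (1 - (norm z)\<^sup>2) powr \<beta>)) =
    density (restrict_space lborel (ball 0 1))
     (\<lambda>z::complex^'n. ennreal (nu_const TYPE('n) \<alpha> * (1 - (norm z)\<^sup>2) powr \<alpha>) *
          ennreal (nu_const TYPE('n) \<beta> / nu_const TYPE('n) \<alpha> * xd z powr (\<beta> - \<alpha>)))"
  proof (rule density_cong)
    show "AE z::complex^'n in restrict_space lborel (ball 0 1). ennreal (nu_const TYPE('n) \<beta> * (1 - (norm z)\<^sup>2) powr \<beta>) =
        ennreal (nu_const TYPE('n) \<alpha> * (1 - (norm z)\<^sup>2) powr \<alpha>) *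
          ennreal (nu_const TYPE('n) \<beta> / nu_const TYPE('n) \<alpha> * xd z powr (\<beta> - \<alpha>))"
    proof (rule AE_I2)
      fix z :: "complex ^ 'n"
      assume "z \<in> space (restrict_space lborel (ball 0 1))"
      then have "xd z > 0" by (simp add: xd_pos_iff space_restrict_space)
      then have "xd z powr \<beta> = xd z powr \<alpha> * xd z powr (\<beta> - \<alpha>)" by (simp flip: powr_add)
      then show "ennreal (nu_const TYPE('n) \<beta> * (1 - (norm z)\<^sup>2) powr \<beta>) =
        ennreal (nu_const TYPE('n) \<alpha> * (1 - (norm z)\<^sup>2) powr \<alpha>) *
          ennreal (nu_const TYPE('n) \<beta> / nu_const TYPE('n) \<alpha> * xd z powr (\<beta> - \<alpha>))"
        using nu_const_eq(2)[OF al, where 'n='n] by (simp flip: ennreal_mult' add: xd_def[symmetric] field_simps)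
    qed
  qed (auto intro!: measurable_restrict_space1)
qed (auto intro!: measurable_restrict_space1)

lemma distr_nu_isometry:
  fixes T :: "complex ^ 'n \<Rightarrow> complex ^ 'n"
  assumes al: "\<alpha> > -1" and lin: "linear T" and iso: "\<And>x. norm (T x) = norm x"
  shows "T \<in> measurable (nu \<alpha>) (nu \<alpha>)" "distr (nu \<alpha>) (nu \<alpha>) T = nu \<alpha>"
proof -
  have cT: "continuous_on UNIV T" by (simp add: lin linear_continuous_on linear_conv_bounded_linear[symmetric])
  then have Tb[measurable]: "T \<in> borel_measurable borel" by (rule borel_measurable_continuous_onI)
  have "T \<in> measurable (restrict_space borel (ball 0 1)) (restrict_space borel (ball 0 1))"
    using iso by (intro measurable_restrict_space3 Tb) auto
  then show Tn[measurable]: "T \<in> measurable (nu \<alpha>) (nu \<alpha>)" by (simp cong: measurable_cong_sets)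
  show "distr (nu \<alpha>) (nu \<alpha>) T = nu \<alpha>"
  proof (rule measure_eqI)
    fix A assume "A \<in> sets (distr (nu \<alpha>) (nu \<alpha>) T)"
    then have A[measurable]: "A \<in> sets (nu \<alpha>)" by simp
    let ?g = "\<lambda>z. indicator A z * ennreal (pos_powr \<alpha> (xd z))"
    have g: "?g \<in> borel_measurable borel" using A by (intro measurable_nu_times_weight[of _ \<alpha>]) auto
    have "emeasure (distr (nu \<alpha>) (nu \<alpha>) T) A = (\<integral>\<^sup>+z. indicator A z \<partial>distr (nu \<alpha>) (nu \<alpha>) T)"
      using A by (intro nn_integral_indicator[symmetric]) auto
    also have "... = (\<integral>\<^sup>+z. indicator A (T z) \<partial>nu \<alpha>)" using A by (intro nn_integral_distr[OF Tn]) auto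
    also have "... = ennreal (nu_const TYPE('n) \<alpha>) * (\<integral>\<^sup>+z. indicator A (T z) * ennreal (pos_powr \<alpha> (xd z)) \<partial>lborel)"
      using A by (intro nn_integral_nu[OF al]) auto
    also have "(\<integral>\<^sup>+z. indicator A (T z) * ennreal (pos_powr \<alpha> (xd z)) \<partial>lborel) = (\<integral>\<^sup>+z. ?g (T z) \<partial>lborel)"
      using iso by (simp add: xd_def)
    also have "... = (\<integral>\<^sup>+z. ?g z \<partial>distr lborel borel T)" using g by (subst nn_integral_distr) auto
    also have "... = (\<integral>\<^sup>+z. ?g z \<partial>lborel)" by (simp add: distr_lborel_isometry[OF lin iso])
    also have "ennreal (nu_const TYPE('n) \<alpha>) * ... = (\<integral>\<^sup>+z. indicator A z \<partial>nu \<alpha>)"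
      using A by (intro nn_integral_nu[OF al, symmetric]) auto
    also have "... = emeasure (nu \<alpha>) A" using A by (rule nn_integral_indicator)
    finally show "emeasure (distr (nu \<alpha>) (nu \<alpha>) T) A = emeasure (nu \<alpha>) A" .
  qed simp
qed

lemma nn_integral_nu_coord_power:
  fixes i :: "'n::finite"
  assumes al: "\<alpha> > -1"
  shows "(\<integral>\<^sup>+(z::complex^'n). ennreal (norm (z $ i) ^ (2 * k)) \<partial>nu \<alpha>)
     = ennreal (fact k / pochhammer (real CARD('n) + 1 + \<alpha>) k)"
proof -
  have *: "(\<integral>\<^sup>+(z::complex^'n). ennreal (norm (z $ i) ^ (2 * k)) \<partial>nu \<alpha>) = ennreal (nu_const TYPE('n) \<alpha>) * moment i k \<alpha>" for k
    by (subst nn_integral_nu[OF al]) (auto simp: moment_def ennreal_mult intro!: measurable_restrict_space1 cong: measurable_cong_sets)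
  show ?thesis
  proof (induction k)
    case 0
    show ?case unfolding * by (simp add: nu_const_eq[OF al])
  next
    case (Suc k)
    have N: "real CARD('n) + 1 + \<alpha> > 0" using al by (simp add: add_pos_pos add_nonneg_pos)
    have "ennreal (nu_const TYPE('n) \<alpha>) * moment i (Suc k) \<alpha> =
      ennreal ((real k + 1) / (real k + (real CARD('n) + 1 + \<alpha>))) * (ennreal (nu_const TYPE('n) \<alpha>) * moment i k \<alpha>)"
      unfolding moment_Suc[OF al] by (simp add: mult_ac)
    also have "... = ennreal ((real k + 1) / (real k + (real CARD('n) + 1 + \<alpha>))) * ennreal (fact k / pochhammer (real CARD('n) + 1 + \<alpha>) k)"
      using Suc unfolding * by simp
    also have "... = ennreal (fact (Suc k) / pochhammer (real CARD('n) + 1 + \<alpha>) (Suc k))"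
    proof -
      have "pochhammer (real CARD('n) + 1 + \<alpha>) k > 0" using N by (rule pochhammer_pos)
      moreover have "(real k + 1) / (real k + (real CARD('n) + 1 + \<alpha>)) * (fact k / pochhammer (real CARD('n) + 1 + \<alpha>) k)
        = fact (Suc k) / pochhammer (real CARD('n) + 1 + \<alpha>) (Suc k)"
        by (simp add: pochhammer_Suc add_ac mult_ac)
      ultimately show ?thesis by (subst ennreal_mult''[symmetric]) auto
    qed
    finally show ?case unfolding * .
  qed
qed


section \<open>Holomorphic functions on the ball\<close>

lemma cinner_add_left: "cinner (x + y) z = cinner x z + cinner y z"
  by (simp add: cinner_def algebra_simps sum.distrib)

lemma cinner_add_right: "cinner x (y + z) = cinner x y + cinner x z"
  by (simp add: cinner_def algebra_simps sum.distrib)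

lemma cinner_diff_left: "cinner (x - y) z = cinner x z - cinner y z"
  by (simp add: cinner_def algebra_simps sum_subtractf)

lemma cinner_scale_left: "cinner (c *s x) y = c * cinner x y"
  by (simp add: cinner_def sum_distrib_left mult_ac)

lemma cinner_scale_right: "cinner x (c *s y) = cnj c * cinner x y"
  by (simp add: cinner_def sum_distrib_left mult_ac)

lemma scaleR_eq_smult: "r *\<^sub>R (x :: complex ^ 'n) = complex_of_real r *s x"
  unfolding vec_eq_iff vector_scaleR_component by (simp add: scaleR_conv_of_real)

lemma cinner_scaleR_left: "cinner (r *\<^sub>R x) y = of_real r * cinner x y"
  by (simp add: scaleR_eq_smult cinner_scale_left)

lemma cinner_scaleR_right: "cinner x (r *\<^sub>R y) = of_real r * cinner x y"
  by (simp add: scaleR_eq_smult cinner_scale_right)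

lemma cinner_commute: "cinner y x = cnj (cinner x y)"
  by (simp add: cinner_def mult_ac)

lemma cinner_self: "cinner z z = of_real ((norm z)\<^sup>2)"
  unfolding cinner_def norm_vec_sq by (simp add: complex_norm_square del: of_real_power)

lemma Re_cinner: "Re (cinner z w) = inner z w"
  by (simp add: cinner_def inner_vec_def inner_complex_def)

lemma norm_smult [simp]: "norm (c *s (z :: complex ^ 'n)) = norm c * norm z"
proof -
  have "(norm (c *s z))\<^sup>2 = (norm c * norm z)\<^sup>2" by (simp add: norm_vec_sq norm_mult power_mult_distrib sum_distrib_left)
  then show ?thesis by (simp add: power2_eq_iff_nonneg)
qed

lemma norm_cinner_le: "norm (cinner z w) \<le> norm z * norm w"
proof -
  \<comment> \<open>A phase that makes the product real and nonnegative, which reduces the claim to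
    the real Cauchy-Schwarz inequality.\<close>
  define u where "u = (if cinner z w = 0 then 1 else cnj (cinner z w) / norm (cinner z w))"
  have u: "norm u = 1" by (simp add: u_def norm_divide)
  have "cnj (cinner z w) * cinner z w = of_real (norm (cinner z w)) * of_real (norm (cinner z w))"
    using complex_norm_square[of "cinner z w"] by (simp add: power2_eq_square mult.commute)
  then have "u * cinner z w = of_real (norm (cinner z w))" by (auto simp: u_def)
  then have "norm (cinner z w) = Re (cinner (u *s z) w)" by (simp add: cinner_scale_left)
  also have "... = inner (u *s z) w" by (rule Re_cinner)
  also have "... \<le> norm (u *s z) * norm w" by (rule norm_cauchy_schwarz)
  finally show ?thesis using u by simp
qed

lemma continuous_on_cinner [continuous_intros]:
  assumes "continuous_on S f" "continuous_on S g"
  shows "continuous_on S (\<lambda>x. cinner (f x) (g x))"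
  unfolding cinner_def by (intro continuous_intros assms)

lemma continuous_on_smult [continuous_intros]:
  fixes f :: "'a::topological_space \<Rightarrow> complex" and g :: "'a \<Rightarrow> complex ^ 'n"
  assumes "continuous_on S f" "continuous_on S g"
  shows "continuous_on S (\<lambda>x. f x *s g x)"
proof -
  have "(\<lambda>x. f x *s g x) = (\<lambda>x. \<chi> i. f x * g x $ i)" by (simp add: vec_eq_iff fun_eq_iff)
  then show ?thesis by (simp only:) (intro continuous_intros assms)
qed

lemma bounded_linear_smult_left: "bounded_linear (\<lambda>c. c *s (v :: complex ^ 'n))"
proof (rule bounded_linear_intro[where K="norm v"])
  show "(x + y) *s v = x *s v + y *s v" for x y by (simp add: vec_eq_iff algebra_simps)
  show "(r *\<^sub>R x) *s v = r *\<^sub>R (x *s v)" for r and x :: complex by (simp add: vec_eq_iff)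
qed simp

lemma bounded_linear_smult_right: "bounded_linear (\<lambda>v. c *s (v :: complex ^ 'n))"
proof (rule bounded_linear_intro[where K="norm c"])
  show "c *s (x + y) = c *s x + c *s y" for x y :: "complex ^ 'n" by (simp add: vec_eq_iff algebra_simps)
  show "c *s (r *\<^sub>R x) = r *\<^sub>R (c *s x)" for r and x :: "complex ^ 'n" by (simp add: vec_eq_iff)
qed simp

lemma bounded_linear_cinner_left: "bounded_linear (\<lambda>z. cinner z (w :: complex ^ 'n))"
proof (rule bounded_linear_intro[where K="norm w"])
  show "cinner (x + y) w = cinner x w + cinner y w" for x y by (rule cinner_add_left)
  show "cinner (r *\<^sub>R x) w = r *\<^sub>R cinner x w" for r x unfolding cinner_scaleR_left by (simp add: scaleR_conv_of_real)
  show "norm (cinner x w) \<le> norm x * norm w" for x by (rule norm_cinner_le)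
qed

lemma hol_ball_slice:
  assumes "holomorphic_ball f" and z: "z + l *s v \<in> ball 0 1"
  obtains D where "(f has_derivative D) (at (z + l *s v))" "\<And>c v. D (c *s v) = c * D v"
    "((\<lambda>l. f (z + l *s v)) has_field_derivative D v) (at l)"
proof -
  obtain D where D: "(f has_derivative D) (at (z + l *s v))" "\<And>c v. D (c *s v) = c * D v"
    using assms unfolding holomorphic_ball_def by blast
  have "((\<lambda>l. z + l *s v) has_derivative (\<lambda>h. h *s v)) (at l)"
    using has_derivative_add[OF has_derivative_const bounded_linear_imp_has_derivative[OF bounded_linear_smult_left]] by simp
  then have "((\<lambda>l. f (z + l *s v)) has_derivative (\<lambda>h. D (h *s v))) (at l)" using D(1) by (rule has_derivative_compose)
  then have "((\<lambda>l. f (z + l *s v)) has_field_derivative D v) (at l)" by (simp add: D(2) has_field_derivative_def mult_commute_abs)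
  with D that show ?thesis by blast
qed

lemma hol_ball_imp_continuous_on:
  assumes "holomorphic_ball f" shows "continuous_on (ball 0 1) f"
  using assms unfolding holomorphic_ball_def by (meson continuous_at_imp_continuous_on has_derivative_continuous)

lemma hol_ball_slice_on:
  assumes "holomorphic_ball f" and "\<And>l. l \<in> S \<Longrightarrow> z + l *s v \<in> ball 0 1" and "open S"
  shows "(\<lambda>l. f (z + l *s v)) holomorphic_on S"
proof (rule holomorphic_onI)
  fix x assume "x \<in> S"
  with assms obtain D where "((\<lambda>l. f (z + l *s v)) has_field_derivative D) (at x)" using hol_ball_slice by metis
  then show "(\<lambda>l. f (z + l *s v)) field_differentiable at x within S"
    using field_differentiable_at_within field_differentiable_def by blast
qed

lemma measurable_continuous_nu:
  assumes "continuous_on (ball 0 1) (f :: complex ^ 'n \<Rightarrow> 'b::topological_space)"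
  shows "f \<in> borel_measurable (nu \<alpha>)"
  using borel_measurable_continuous_on_restrict[OF assms] by (simp cong: measurable_cong_sets)

lemma measurable_borel_nu:
  assumes "f \<in> borel_measurable borel"
  shows "f \<in> borel_measurable (nu \<alpha>)"
  using measurable_restrict_space1[OF assms, of "ball 0 1"] by (simp cong: measurable_cong_sets)

section \<open>Circle averages and Taylor coefficients\<close>

definition unit_phase :: "real \<Rightarrow> complex" where
  "unit_phase t = exp (2 * of_real pi * \<i> * of_real t)"

lemma norm_unit_phase [simp]: "norm (unit_phase t) = 1"
  by (simp add: unit_phase_def norm_exp_eq_Re)

lemma continuous_on_unit_phase [continuous_intros]:
  "continuous_on S f \<Longrightarrow> continuous_on S (\<lambda>x. unit_phase (f x))"
  unfolding unit_phase_def by (intro continuous_intros)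

definition unit_interval :: "real measure" where
  "unit_interval = restrict_space lborel {0..1}"

lemma finite_measure_unit_interval: "finite_measure unit_interval"
  by (rule finite_measureI) (simp add: unit_interval_def emeasure_restrict_space space_restrict_space)

lemma integral_unit_interval:
  fixes g :: "real \<Rightarrow> complex"
  assumes "continuous_on {0..1} g" and "(g has_integral I) {0..1}"
  shows "integral\<^sup>L unit_interval g = I"
proof -
  have "integral\<^sup>L unit_interval g = (LINT t:{0..1}|lborel. g t)"
    unfolding unit_interval_def set_lebesgue_integral_def by (rule integral_restrict_space) simp
  also have "... = integral {0..1} g" using borel_integrable_atLeastAtMost'[OF assms(1)] by (rule set_borel_integral_eq_integral)
  finally show ?thesis using assms(2) by (simp add: integral_unique)
qed

text \<open>Cauchy's formula for the k-th derivative, on a circle where the conjugate of the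
  parameter is its inverse. A radius R > 1 is at hand because the slices used below lie in an open
  ball.\<close>

lemma circle_coefficient:
  assumes holF: "F holomorphic_on ball 0 R" and R: "R > 1"
  shows "integral\<^sup>L unit_interval (\<lambda>t. F (unit_phase t) * cnj (unit_phase t) ^ k) = (deriv ^^ k) F 0 / fact k"
proof (rule integral_unit_interval)
  have sub: "cball 0 1 \<subseteq> ball (0::complex) R" using R by auto
  have cF: "continuous_on (cball 0 1) F" using holF sub holomorphic_on_imp_continuous_on continuous_on_subset by blast
  show "continuous_on {0..1} (\<lambda>t. F (unit_phase t) * cnj (unit_phase t) ^ k)"
    by (intro continuous_intros continuous_on_compose2[OF cF]) auto
  have "((\<lambda>u. F u / (u - 0) ^ Suc k) has_contour_integral (2 * pi * \<i> / fact k * (deriv ^^ k) F 0)) (circlepath 0 1)"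
    using cF holomorphic_on_subset[OF holF subset_trans[OF ball_subset_cball sub]]
    by (intro Cauchy_has_contour_integral_higher_derivative_circlepath) auto
  then have "((\<lambda>t. F (unit_phase t) / unit_phase t ^ Suc k * (2 * pi * \<i> * unit_phase t)) has_integral (2 * pi * \<i> / fact k * (deriv ^^ k) F 0)) {0..1}"
    unfolding has_contour_integral_def
  proof (rule has_integral_eq[rotated])
    fix x :: real assume x: "x \<in> {0..1}"
    have vd: "vector_derivative (circlepath 0 1) (at x within {0..1}) = 2 * pi * \<i> * unit_phase x"
      using x vector_derivative_circlepath01[of x 0 1] by (simp add: unit_phase_def)
    have cp: "circlepath 0 1 x = unit_phase x" by (simp add: circlepath unit_phase_def)
    show "F (circlepath 0 1 x) / (circlepath 0 1 x - 0) ^ Suc k * vector_derivative (circlepath 0 1) (at x within {0..1})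
      = F (unit_phase x) / unit_phase x ^ Suc k * (2 * pi * \<i> * unit_phase x)"
      unfolding vd cp by simp
  qed
  then have "((\<lambda>t. (1 / (2 * pi * \<i>)) * (F (unit_phase t) / unit_phase t ^ Suc k * (2 * pi * \<i> * unit_phase t))) has_integral (1 / (2 * pi * \<i>)) * (2 * pi * \<i> / fact k * (deriv ^^ k) F 0)) {0..1}"
    by (rule has_integral_mult_right)
  moreover have "(1 / (2 * pi * \<i>)) * (F (unit_phase t) / unit_phase t ^ Suc k * (2 * pi * \<i> * unit_phase t)) = F (unit_phase t) * cnj (unit_phase t) ^ k" for t
  proof -
    have nz: "unit_phase t \<noteq> 0" by (metis norm_unit_phase norm_zero zero_neq_one)
    have "unit_phase t * cnj (unit_phase t) = 1" using complex_norm_square[of "unit_phase t"] by simp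
    then have "cnj (unit_phase t) = 1 / unit_phase t" using nz by (simp add: field_simps)
    then show ?thesis unfolding \<open>cnj _ = _\<close> using nz by (simp add: power_divide)
  qed
  ultimately show "((\<lambda>t. F (unit_phase t) * cnj (unit_phase t) ^ k) has_integral (deriv ^^ k) F 0 / fact k) {0..1}" by simp
qed

text \<open>Each \<open>T t\<close> preserves the measure, so by Fubini the integrand may be
  replaced by its mean over t; \<open>avg\<close> supplies that mean in closed form, which for
  holomorphic integrands comes from Cauchy's formula.\<close>

lemma nu_average:
  fixes f :: "complex ^ 'n \<Rightarrow> complex" and T :: "real \<Rightarrow> complex ^ 'n \<Rightarrow> complex ^ 'n"
  assumes al: "\<alpha> > -1" and f: "integrable (nu \<alpha>) f"
    and lin: "\<And>t. linear (T t)" and iso: "\<And>t x. norm (T t x) = norm x"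
    and cont: "continuous_on UNIV (\<lambda>(t, z). T t z)"
    and avg: "\<And>z. z \<in> ball 0 1 \<Longrightarrow> integral\<^sup>L unit_interval (\<lambda>t. f (T t z)) = g z"
  shows "integrable (nu \<alpha>) g" "integral\<^sup>L (nu \<alpha>) g = integral\<^sup>L (nu \<alpha>) f"
proof -
  interpret nu: finite_measure "nu \<alpha> :: (complex ^ 'n) measure" by (rule finite_measure_nu[OF al])
  interpret ui: finite_measure unit_interval by (rule finite_measure_unit_interval)
  interpret P: pair_sigma_finite unit_interval "nu \<alpha> :: (complex ^ 'n) measure" ..
  let ?P = "unit_interval \<Otimes>\<^sub>M (nu \<alpha> :: (complex ^ 'n) measure)"
  have fm: "f \<in> borel_measurable (nu \<alpha>)" using f by simp
  have "(\<lambda>(t, z). T t z) \<in> borel_measurable (borel \<Otimes>\<^sub>M borel)"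
    using borel_measurable_continuous_onI[OF cont] by (simp add: borel_prod)
  moreover have "(\<lambda>p. (fst p, snd p)) \<in> measurable ?P (borel \<Otimes>\<^sub>M borel)"
    by (intro measurable_Pair measurable_compose[OF measurable_fst] measurable_compose[OF measurable_snd])
       (auto simp: unit_interval_def intro!: measurable_restrict_space1 measurable_borel_nu)
  ultimately have "(\<lambda>p. case (fst p, snd p) of (t, z) \<Rightarrow> T t z) \<in> measurable ?P borel"
    by (rule measurable_compose[rotated])
  then have "(\<lambda>(t, z). T t z) \<in> measurable ?P (restrict_space borel (ball 0 1))"
    using iso by (intro measurable_restrict_space2) (auto simp: space_pair_measure split_beta')
  then have Tm: "(\<lambda>(t, z). T t z) \<in> measurable ?P (nu \<alpha>)" by (simp cong: measurable_cong_sets)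
  have fT: "(\<lambda>(t, z). f (T t z)) \<in> borel_measurable ?P" using measurable_compose[OF Tm fm] by (simp add: split_beta')
  note Tn = distr_nu_isometry[OF al lin iso]
  have i1: "integrable (nu \<alpha>) (\<lambda>z. f (T t z))" for t using f integrable_distr[OF Tn(1)[of t], of f] by (simp add: Tn(2))
  have e1: "(\<integral>z. f (T t z) \<partial>nu \<alpha>) = (\<integral>z. f z \<partial>nu \<alpha>)" for t
    using integral_distr[OF Tn(1)[of t] fm] by (simp add: Tn(2))
  have e2: "(\<integral>z. norm (f (T t z)) \<partial>nu \<alpha>) = (\<integral>z. norm (f z) \<partial>nu \<alpha>)" for t
    using integral_distr[OF Tn(1)[of t], of "\<lambda>z. norm (f z)"] fm by (simp add: Tn(2))
  have int: "integrable ?P (\<lambda>(t, z). f (T t z))" using fT i1 e2 by (intro P.Fubini_integrable) auto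
  have ig: "integrable (nu \<alpha>) (\<lambda>z. \<integral>t. f (T t z) \<partial>unit_interval)" using P.integrable_snd[OF int] by simp
  have cg: "z \<in> space (nu \<alpha>) \<Longrightarrow> (\<integral>t. f (T t z) \<partial>unit_interval) = g z" for z using avg by simp
  show "integrable (nu \<alpha>) g" using ig by (rule Bochner_Integration.integrable_cong[THEN iffD1, rotated 2]) (simp_all add: cg)
  have "integral\<^sup>L (nu \<alpha>) g = (\<integral>z. \<integral>t. f (T t z) \<partial>unit_interval \<partial>nu \<alpha>)"
    using cg by (intro Bochner_Integration.integral_cong) auto
  also have "... = (\<integral>t. \<integral>z. f (T t z) \<partial>nu \<alpha> \<partial>unit_interval)" using P.Fubini_integral[OF int] .
  also have "... = (\<integral>z. f z \<partial>nu \<alpha>)"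
    unfolding e1 by (simp add: unit_interval_def measure_restrict_space space_restrict_space)
  finally show "integral\<^sup>L (nu \<alpha>) g = integral\<^sup>L (nu \<alpha>) f" .
qed

lemma integrable_mult_bounded:
  fixes f g :: "'a \<Rightarrow> complex"
  assumes f: "integrable M f" and g: "g \<in> borel_measurable M" and b: "\<And>z. z \<in> space M \<Longrightarrow> norm (g z) \<le> B"
  shows "integrable M (\<lambda>z. f z * g z)"
proof (rule Bochner_Integration.integrable_bound)
  show "integrable M (\<lambda>z. B * norm (f z))" using f by simp
  show "(\<lambda>z. f z * g z) \<in> borel_measurable M" using f g by measurable
  show "AE z in M. norm (f z * g z) \<le> norm (B * norm (f z))"
  proof (rule AE_I2)
    fix z assume "z \<in> space M"
    then have "norm (f z) * norm (g z) \<le> norm (f z) * B" using b by (intro mult_left_mono) auto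
    also have "... \<le> norm (B * norm (f z))" by (simp add: abs_mult mult.commute[of B] mult_left_mono)
    finally show "norm (f z * g z) \<le> norm (B * norm (f z))" by (simp add: norm_mult)
  qed
qed

lemma norm_cinner_ball_le:
  assumes "z \<in> ball 0 1" "norm w = 1" shows "norm (cinner z w) < 1"
  using norm_cinner_le[of z w] assms by simp

text \<open>Averaging over the unitary maps that fix \<open>w\<close> and rotate its orthogonal complement.\<close>

lemma integral_nu_project:
  fixes f :: "complex ^ 'n \<Rightarrow> complex"
  assumes al: "\<alpha> > -1" and f: "integrable (nu \<alpha>) f" "holomorphic_ball f" and w: "norm w = 1"
  shows "integrable (nu \<alpha>) (\<lambda>z. f (cinner z w *s w) * cnj (cinner z w) ^ k)"
    "(\<integral>z. f (cinner z w *s w) * cnj (cinner z w) ^ k \<partial>nu \<alpha>) = (\<integral>z. f z * cnj (cinner z w) ^ k \<partial>nu \<alpha>)"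
proof -
  define T where "T t z = cinner z w *s w + unit_phase t *s (z - cinner z w *s w)" for t z
  let ?h = "\<lambda>z. f z * cnj (cinner z w) ^ k"
  have ww: "cinner w w = 1" using w by (simp add: cinner_self)
  have Tw: "cinner (T t z) w = cinner z w" for t z by (simp add: T_def cinner_add_left cinner_diff_left cinner_scale_left ww)
  have norm_decomp: "(norm (a *s w + c *s u))\<^sup>2 = (norm a)\<^sup>2 + (norm c)\<^sup>2 * (norm u)\<^sup>2" if u: "cinner u w = 0" for a c and u :: "complex ^ 'n"
  proof -
    have u': "cinner w u = 0" using u cinner_commute[of w u] by simp
    have "complex_of_real ((norm (a *s w + c *s u))\<^sup>2) = cinner (a *s w + c *s u) (a *s w + c *s u)" by (simp add: cinner_self)
    also have "... = a * cnj a + c * cnj c * cinner u u"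
      by (simp add: cinner_add_left cinner_add_right cinner_scale_left cinner_scale_right ww u u')
    also have "... = complex_of_real ((norm a)\<^sup>2 + (norm c)\<^sup>2 * (norm u)\<^sup>2)"
      by (simp add: cinner_self complex_norm_square[symmetric] del: of_real_power)
    finally show ?thesis using of_real_eq_iff by blast
  qed
  have perp: "cinner (z - cinner z w *s w) w = 0" for z by (simp add: cinner_diff_left cinner_scale_left ww)
  have nz: "(norm z)\<^sup>2 = (norm (cinner z w))\<^sup>2 + (norm (z - cinner z w *s w))\<^sup>2" for z
  proof -
    have "z = cinner z w *s w + 1 *s (z - cinner z w *s w)" by simp
    then have "(norm z)\<^sup>2 = (norm (cinner z w *s w + 1 *s (z - cinner z w *s w)))\<^sup>2" by simp
    also have "... = (norm (cinner z w))\<^sup>2 + (norm (z - cinner z w *s w))\<^sup>2" unfolding norm_decomp[OF perp] by simp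
    finally show ?thesis .
  qed
  have iso: "norm (T t z) = norm z" for t z
  proof -
    have "(norm (T t z))\<^sup>2 = (norm z)\<^sup>2" unfolding T_def norm_decomp[OF perp] nz[of z] by simp
    then show ?thesis by (simp add: power2_eq_iff_nonneg)
  qed
  have lin: "linear (T t)" for t unfolding T_def
    by (rule linearI) (simp_all add: vec_eq_iff cinner_add_left scaleR_eq_smult cinner_scale_left algebra_simps)
  have cont: "continuous_on UNIV (\<lambda>(t, z). T t z)" unfolding T_def split_beta' by (intro continuous_intros)
  have mh: "(\<lambda>z. cnj (cinner z w) ^ k) \<in> borel_measurable (nu \<alpha>)" by (intro measurable_continuous_nu continuous_intros)
  have ih: "integrable (nu \<alpha>) ?h" using f(1) mh by (rule integrable_mult_bounded[where B=1])
       (auto simp: norm_power intro!: power_le_one order.strict_implies_order[OF norm_cinner_ball_le[OF _ w]])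
  have avg: "integral\<^sup>L unit_interval (\<lambda>t. ?h (T t z)) = f (cinner z w *s w) * cnj (cinner z w) ^ k"
    if z: "z \<in> ball 0 1" for z
  proof -
    define u where "u = z - cinner z w *s w"
    define a where "a = cinner z w"
    define F where "F l = f (a *s w + l *s u) * cnj a ^ k" for l
    \<comment> \<open>With a = \<open>cinner z w\<close> and u orthogonal to w, the point a w + l u
      lies in the ball as long as |l| < R, and R > 1 because |a|^2 + |u|^2 < 1. For u = 0 every
      radius works, and 2 is one above 1.\<close>
    define R where "R = (if norm u = 0 then 2 else sqrt (1 - (norm a)\<^sup>2) / norm u)"
    have zz: "(norm a)\<^sup>2 + (norm u)\<^sup>2 < 1" unfolding a_def u_def nz[of z, symmetric] using z by (simp add: abs_square_less_1)
    have R1: "R > 1"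
    proof (cases "norm u = 0")
      case False
      have "norm u < sqrt (1 - (norm a)\<^sup>2)" using zz by (intro real_less_rsqrt) simp
      then show ?thesis using False by (simp add: R_def)
    qed (simp add: R_def)
    have inb: "a *s w + l *s u \<in> ball 0 1" if "l \<in> ball 0 R" for l
    proof -
      have "(norm l)\<^sup>2 * (norm u)\<^sup>2 < 1 - (norm a)\<^sup>2"
      proof (cases "norm u = 0")
        case True then show ?thesis using zz by simp
      next
        case False
        then have "norm l * norm u < sqrt (1 - (norm a)\<^sup>2)" using that by (simp add: R_def field_simps)
        then have "(norm l * norm u)\<^sup>2 < (sqrt (1 - (norm a)\<^sup>2))\<^sup>2" by (intro power_strict_mono) auto
        moreover have "1 - (norm a)\<^sup>2 \<ge> 0" using zz by (smt (verit) zero_le_power2)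
        ultimately show ?thesis by (simp add: power_mult_distrib)
      qed
      then have "(norm (a *s w + l *s u))\<^sup>2 < 1" using norm_decomp[of u a l] perp[of z] by (simp add: u_def)
      then show ?thesis by (simp add: abs_square_less_1)
    qed
    have "F holomorphic_on ball 0 R" unfolding F_def using f(2) inb by (intro holomorphic_intros hol_ball_slice_on) auto
    from circle_coefficient[OF this R1, of 0]
    have "integral\<^sup>L unit_interval (\<lambda>t. F (unit_phase t)) = F 0" by simp
    moreover have eqF: "?h (T t z) = F (unit_phase t)" for t unfolding Tw by (simp add: F_def T_def a_def u_def)
    ultimately have "integral\<^sup>L unit_interval (\<lambda>t. ?h (T t z)) = F 0" by (simp only:)
    then show ?thesis by (simp only: F_def a_def) simp
  qed
  show "integrable (nu \<alpha>) (\<lambda>z. f (cinner z w *s w) * cnj (cinner z w) ^ k)"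
    "(\<integral>z. f (cinner z w *s w) * cnj (cinner z w) ^ k \<partial>nu \<alpha>) = (\<integral>z. f z * cnj (cinner z w) ^ k \<partial>nu \<alpha>)"
    using nu_average[OF al ih lin iso cont avg] by auto
qed

text \<open>After the projection the integrand depends on \<zeta> = \<open>cinner z w\<close> alone.
  Averaging over a common phase of all coordinates keeps only the term of degree k in \<zeta>, to
  match the degree of the conjugate power.\<close>

lemma integral_nu_taylor:
  fixes f :: "complex ^ 'n \<Rightarrow> complex"
  assumes al: "\<alpha> > -1" and f: "integrable (nu \<alpha>) f" "holomorphic_ball f" and w: "norm w = 1"
  shows "(\<integral>z. f z * cnj (cinner z w) ^ k \<partial>nu \<alpha>)
    = (deriv ^^ k) (\<lambda>\<zeta>. f (\<zeta> *s w)) 0 / fact k * (\<integral>z. of_real (norm (cinner z w) ^ (2 * k)) \<partial>nu \<alpha>)"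
proof -
  let ?\<phi> = "\<lambda>\<zeta>. f (\<zeta> *s w)"
  let ?a = "(deriv ^^ k) ?\<phi> 0 / fact k"
  have hol: "?\<phi> holomorphic_on ball 0 1" using hol_ball_slice_on[OF f(2), of "ball 0 1" 0 w] w by simp
  have "integral\<^sup>L (nu \<alpha>) (\<lambda>z. ?a * of_real (norm (cinner z w) ^ (2 * k))) = (\<integral>z. f (cinner z w *s w) * cnj (cinner z w) ^ k \<partial>nu \<alpha>)"
  proof (rule nu_average(2)[OF al integral_nu_project(1)[OF al f w], of "\<lambda>t z. unit_phase t *s z"])
    show "linear ((*s) (unit_phase t))" for t using bounded_linear_smult_right bounded_linear.linear by blast
    show "continuous_on UNIV (\<lambda>(t, z). unit_phase t *s (z :: complex ^ 'n))" unfolding split_beta' by (intro continuous_intros)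
    fix z :: "complex ^ 'n" assume z: "z \<in> ball 0 1"
    define \<zeta> where "\<zeta> = cinner z w"
    have \<zeta>: "norm \<zeta> < 1" unfolding \<zeta>_def by (rule norm_cinner_ball_le[OF z w])
    define R where "R = (if \<zeta> = 0 then 2 else 1 / norm \<zeta>)"
    have R1: "R > 1" using \<zeta> by (auto simp: R_def)
    have inb: "\<zeta> * l \<in> ball 0 1" if "l \<in> ball 0 R" for l
      using that \<zeta> by (auto simp: R_def norm_mult field_simps split: if_splits)
    let ?F = "\<lambda>l. ?\<phi> (\<zeta> * l)"
    have "?F holomorphic_on ball 0 R" using holomorphic_on_compose_gen[of "\<lambda>l. \<zeta> * l" "ball 0 R" ?\<phi> "ball 0 1"] hol inb
      by (auto simp: o_def image_subset_iff intro!: holomorphic_intros)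
    from circle_coefficient[OF this R1, of k]
    have "integral\<^sup>L unit_interval (\<lambda>t. ?F (unit_phase t) * cnj (unit_phase t) ^ k) = (deriv ^^ k) ?F 0 / fact k" .
    also have "(deriv ^^ k) ?F 0 = \<zeta> ^ k * (deriv ^^ k) ?\<phi> (\<zeta> * 0)"
      using R1 inb by (intro higher_deriv_compose_linear[OF hol, of "ball 0 R"]) auto
    finally have 1: "integral\<^sup>L unit_interval (\<lambda>t. ?F (unit_phase t) * cnj (unit_phase t) ^ k) = \<zeta> ^ k * ?a" by simp
    have "integral\<^sup>L unit_interval (\<lambda>t. f (cinner (unit_phase t *s z) w *s w) * cnj (cinner (unit_phase t *s z) w) ^ k)
       = integral\<^sup>L unit_interval (\<lambda>t. (?F (unit_phase t) * cnj (unit_phase t) ^ k) * cnj \<zeta> ^ k)"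
      by (simp add: cinner_scale_left \<zeta>_def power_mult_distrib mult_ac)
    also have "... = (\<zeta> ^ k * ?a) * cnj \<zeta> ^ k" using 1 by (simp only: integral_mult_left_zero)
    also have "\<zeta> ^ k * cnj \<zeta> ^ k = of_real (norm \<zeta> ^ (2 * k))"
      by (simp add: power_mult_distrib[symmetric] complex_norm_square[symmetric] power_mult)
    then have "(\<zeta> ^ k * ?a) * cnj \<zeta> ^ k = ?a * of_real (norm (cinner z w) ^ (2 * k))" by (simp add: \<zeta>_def mult_ac)
    finally show "integral\<^sup>L unit_interval (\<lambda>t. f (cinner (unit_phase t *s z) w *s w) * cnj (cinner (unit_phase t *s z) w) ^ k)
       = ?a * of_real (norm (cinner z w) ^ (2 * k))" .
  qed simp
  then show ?thesis using integral_nu_project(2)[OF al f w, of k] by simp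
qed


section \<open>Closure properties of holomorphic functions on the ball\<close>

lemma hol_ball_const [simp]: "holomorphic_ball (\<lambda>z. c)"
  unfolding holomorphic_ball_def by (intro ballI exI[of _ "\<lambda>_. 0"]) auto

lemma hol_ball_cinner: "holomorphic_ball (\<lambda>z. cinner z w)"
  unfolding holomorphic_ball_def by (intro ballI exI[of _ "\<lambda>z. cinner z w"] conjI allI bounded_linear_imp_has_derivative
      bounded_linear_cinner_left cinner_scale_left)

lemma hol_ball_add:
  assumes "holomorphic_ball f" "holomorphic_ball g"
  shows "holomorphic_ball (\<lambda>z. f z + g z)"
  unfolding holomorphic_ball_def
proof
  fix z :: "complex ^ 'a" assume z: "z \<in> ball 0 1"
  obtain D where D: "(f has_derivative D) (at z)" "\<And>c v. D (c *s v) = c * D v" using assms(1) z unfolding holomorphic_ball_def by blast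
  obtain E where E: "(g has_derivative E) (at z)" "\<And>c v. E (c *s v) = c * E v" using assms(2) z unfolding holomorphic_ball_def by blast
  show "\<exists>D. ((\<lambda>z. f z + g z) has_derivative D) (at z) \<and> (\<forall>c v. D (c *s v) = c * D v)"
    using has_derivative_add[OF D(1) E(1)] D(2) E(2) by (intro exI[of _ "\<lambda>v. D v + E v"]) (simp add: distrib_left)
qed

lemma hol_ball_mult:
  assumes "holomorphic_ball f" "holomorphic_ball g"
  shows "holomorphic_ball (\<lambda>z. f z * g z)"
  unfolding holomorphic_ball_def
proof
  fix z :: "complex ^ 'a" assume z: "z \<in> ball 0 1"
  obtain D where D: "(f has_derivative D) (at z)" "\<And>c v. D (c *s v) = c * D v" using assms(1) z unfolding holomorphic_ball_def by blast
  obtain E where E: "(g has_derivative E) (at z)" "\<And>c v. E (c *s v) = c * E v" using assms(2) z unfolding holomorphic_ball_def by blast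
  show "\<exists>D. ((\<lambda>z. f z * g z) has_derivative D) (at z) \<and> (\<forall>c v. D (c *s v) = c * D v)"
    using has_derivative_mult[OF D(1) E(1)] D(2) E(2) by (intro exI[of _ "\<lambda>v. f z * E v + D v * g z"]) (simp add: algebra_simps)
qed

lemma hol_ball_cmult: "holomorphic_ball f \<Longrightarrow> holomorphic_ball (\<lambda>z. c * f z)"
  by (rule hol_ball_mult[OF hol_ball_const])

lemma hol_ball_power: "holomorphic_ball f \<Longrightarrow> holomorphic_ball (\<lambda>z. f z ^ k)"
  by (induction k) (simp_all add: hol_ball_mult)

lemma hol_ball_sum:
  "(\<And>i. i \<in> I \<Longrightarrow> holomorphic_ball (f i)) \<Longrightarrow> holomorphic_ball (\<lambda>z. \<Sum>i\<in>I. f i z)"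
  by (induction I rule: infinite_finite_induct) (auto intro: hol_ball_add)

lemma hol_ball_compose:
  assumes f: "holomorphic_ball f" and h: "h holomorphic_on S" "open S"
    and S: "\<And>z. z \<in> ball 0 1 \<Longrightarrow> f z \<in> S"
  shows "holomorphic_ball (\<lambda>z. h (f z))"
  unfolding holomorphic_ball_def
proof
  fix z :: "complex ^ 'a" assume z: "z \<in> ball 0 1"
  obtain D where D: "(f has_derivative D) (at z)" "\<And>c v. D (c *s v) = c * D v" using f z unfolding holomorphic_ball_def by blast
  have "(h has_field_derivative deriv h (f z)) (at (f z))" using h S[OF z] by (simp add: holomorphic_derivI)
  then have "(h has_derivative (*) (deriv h (f z))) (at (f z))" by (simp add: has_field_derivative_def)
  from has_derivative_compose[OF D(1) this]
  show "\<exists>D. ((\<lambda>z. h (f z)) has_derivative D) (at z) \<and> (\<forall>c v. D (c *s v) = c * D v)"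
    by (intro exI[of _ "\<lambda>v. deriv h (f z) * D v"]) (simp add: D(2))
qed

lemma hol_ball_dilate:
  assumes f: "holomorphic_ball f" and r: "0 \<le> r" "r \<le> 1"
  shows "holomorphic_ball (\<lambda>z. f (r *\<^sub>R z))"
  unfolding holomorphic_ball_def
proof
  fix z :: "complex ^ 'a" assume z: "z \<in> ball 0 1"
  then have "r *\<^sub>R z \<in> ball 0 1" using r mult_le_one[of r "norm z"] by (auto simp: intro: le_less_trans[OF mult_left_le_one_le])
  then obtain D where D: "(f has_derivative D) (at (r *\<^sub>R z))" "\<And>c v. D (c *s v) = c * D v"
    using f unfolding holomorphic_ball_def by blast
  have "((\<lambda>z. r *\<^sub>R z) has_derivative (\<lambda>z. r *\<^sub>R z)) (at z)" by (auto intro!: derivative_eq_intros)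
  from has_derivative_compose[OF this D(1)]
  show "\<exists>D. ((\<lambda>z. f (r *\<^sub>R z)) has_derivative D) (at z) \<and> (\<forall>c v. D (c *s v) = c * D v)"
    by (intro exI[of _ "\<lambda>v. D (r *\<^sub>R v)"]) (simp add: D(2) scaleR_eq_smult mult.left_commute)
qed

lemma hol_ball_cong:
  assumes "\<And>z. z \<in> ball 0 1 \<Longrightarrow> f z = g z"
  shows "holomorphic_ball f \<longleftrightarrow> holomorphic_ball g"
proof -
  have "holomorphic_ball g" if hf: "holomorphic_ball f" and fg: "\<And>z. z \<in> ball 0 1 \<Longrightarrow> f z = g z" for f g :: "complex ^ 'a \<Rightarrow> complex"
    unfolding holomorphic_ball_def
  proof
    fix z :: "complex ^ 'a" assume z: "z \<in> ball 0 1"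
    obtain D where D: "(f has_derivative D) (at z)" "\<And>c v. D (c *s v) = c * D v" using hf z unfolding holomorphic_ball_def by blast
    have "(g has_derivative D) (at z)" using D(1) open_ball z fg by (rule has_derivative_transform_within_open)
    then show "\<exists>D. (g has_derivative D) (at z) \<and> (\<forall>c v. D (c *s v) = c * D v)" using D(2) by blast
  qed
  from this[of f g] this[of g f] assms show ?thesis by auto
qed

lemma integrable_nu_bounded:
  assumes al: "\<alpha> > -1" and f: "f \<in> borel_measurable (nu \<alpha>)" and b: "\<And>z. z \<in> ball 0 1 \<Longrightarrow> norm (f z) \<le> B"
  shows "integrable (nu \<alpha>) (f :: complex ^ 'n \<Rightarrow> complex)"
  by (rule finite_measure.integrable_const_bound[OF finite_measure_nu[OF al], where B=B]) (auto intro!: AE_I2 f b)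

text \<open>For a coordinate direction u this is the moment already computed. For general w, the
  integral of \<open>cinner z w ^ k\<close> times the conjugate of \<open>cinner z u ^ k\<close> is
  evaluated by projecting once on u and once on w, and comparison gives c w = c u. A coordinate j
  with w_j nonzero allows the common factor \<open>cinner w u ^ k\<close> to be cancelled.\<close>

lemma integral_nu_cinner_power:
  fixes w :: "complex ^ 'n"
  assumes al: "\<alpha> > -1" and w: "norm w = 1"
  shows "(\<integral>z. of_real (norm (cinner z w) ^ (2 * k)) \<partial>nu \<alpha>) = complex_of_real (fact k / pochhammer (real CARD('n) + 1 + \<alpha>) k)"
proof -
  define c where "c w = (\<integral>z. norm (cinner z w) ^ (2 * k) \<partial>nu \<alpha>)" for w :: "complex ^ 'n"
  have c: "(\<integral>z. of_real (norm (cinner z w) ^ (2 * k)) \<partial>nu \<alpha>) = complex_of_real (c w)" for w :: "complex ^ 'n"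
    unfolding c_def by (rule integral_complex_of_real)
  have N: "real CARD('n) + 1 + \<alpha> > 0" using al by (simp add: add_pos_pos add_nonneg_pos)
  obtain j where j: "w $ j \<noteq> 0" using w by (metis norm_eq_zero vec_eq_iff zero_index zero_neq_one)
  define u :: "complex ^ 'n" where "u = axis j 1"
  have u: "norm u = 1" by (simp add: u_def)
  have zu: "cinner z u = z $ j" for z
  proof -
    have "cinner z u = (\<Sum>i\<in>UNIV. if i = j then z $ j else 0)" unfolding cinner_def u_def by (intro sum.cong) (auto simp: axis_def)
    then show ?thesis by simp
  qed
  have "c u = enn2real (\<integral>\<^sup>+z. ennreal (norm (z $ j) ^ (2 * k)) \<partial>(nu \<alpha> :: (complex ^ 'n) measure))"
    unfolding c_def zu by (intro integral_eq_nn_integral measurable_continuous_nu continuous_intros AE_I2) simp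
  also have "... = fact k / pochhammer (real CARD('n) + 1 + \<alpha>) k"
    unfolding nn_integral_nu_coord_power[OF al] using pochhammer_pos[OF N, of k] by simp
  finally have cu: "c u = fact k / pochhammer (real CARD('n) + 1 + \<alpha>) k" .
  have *: "(\<integral>z. cinner z v ^ k * cnj (cinner z w) ^ k \<partial>nu \<alpha>) = cinner w v ^ k * of_real (c w)"
    if v: "norm v = 1" and w: "norm w = 1" for v w :: "complex ^ 'n"
  proof -
    have hol: "holomorphic_ball (\<lambda>z. cinner z v ^ k)" by (intro hol_ball_power hol_ball_cinner)
    have int: "integrable (nu \<alpha>) (\<lambda>z. cinner z v ^ k)" using measurable_continuous_nu[OF hol_ball_imp_continuous_on[OF hol]]
      by (rule integrable_nu_bounded[OF al, where B=1])
         (auto simp: norm_power intro!: power_le_one order.strict_implies_order[OF norm_cinner_ball_le[OF _ v]])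
    have "(\<integral>z. cinner z v ^ k * cnj (cinner z w) ^ k \<partial>nu \<alpha>) = (\<integral>z. cinner (cinner z w *s w) v ^ k * cnj (cinner z w) ^ k \<partial>nu \<alpha>)"
      using integral_nu_project(2)[OF al int hol w, of k] by simp
    also have "... = (\<integral>z. cinner w v ^ k * of_real (norm (cinner z w) ^ (2 * k)) \<partial>nu \<alpha>)"
    proof (rule Bochner_Integration.integral_cong)
      fix z
      have "cinner z w ^ k * cnj (cinner z w) ^ k = of_real (norm (cinner z w) ^ (2 * k))"
        by (simp add: power_mult_distrib[symmetric] complex_norm_square[symmetric] power_mult)
      then show "cinner (cinner z w *s w) v ^ k * cnj (cinner z w) ^ k = cinner w v ^ k * of_real (norm (cinner z w) ^ (2 * k))"
        by (simp add: cinner_scale_left power_mult_distrib mult_ac)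
    qed simp
    finally show ?thesis using c[of w] by simp
  qed
  have "cinner w u ^ k * of_real (c w) = (\<integral>z. cnj (cinner z w ^ k * cnj (cinner z u) ^ k) \<partial>nu \<alpha>)"
    using *[OF u w] by (simp add: mult.commute)
  also have "... = cnj (\<integral>z. cinner z w ^ k * cnj (cinner z u) ^ k \<partial>nu \<alpha>)" by (rule Bochner_Integration.integral_cnj)
  also have "... = cinner w u ^ k * of_real (c u)" unfolding *[OF w u] using cinner_commute[of w u] by simp
  finally have "of_real (c w) = complex_of_real (c u)" using j by (simp add: zu)
  then show ?thesis using c[of w] cu by simp
qed

section \<open>The Bergman kernel\<close>

text \<open>With s = N this is the reproducing kernel for \<open>nu \<alpha>\<close>, with s = N + j
  the one for \<open>nu (\<alpha> + j)\<close>. It is holomorphic in the first argument and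
  antiholomorphic in the second.\<close>

definition bk :: "real \<Rightarrow> complex ^ 'n \<Rightarrow> complex ^ 'n \<Rightarrow> complex" where
  "bk s w z = (1 - cinner w z) powr of_real (- s)"

lemma norm_cinner_less_1:
  assumes "norm w * norm z < 1" shows "norm (cinner w z) < 1"
  using norm_cinner_le[of w z] assms by simp

lemma Re_one_minus_pos: "norm (x::complex) < 1 \<Longrightarrow> Re (1 - x) > 0"
  using complex_Re_le_cmod[of x] by simp

lemma norm_powr_of_real: "z \<noteq> 0 \<Longrightarrow> norm (z powr complex_of_real x) = norm z powr x"
  by (simp add: powr_def norm_exp_eq_Re)

lemma norm_bk:
  assumes "norm w * norm z < 1"
  shows "norm (bk s w z) = norm (1 - cinner w z) powr - s"
proof -
  have "1 - cinner w z \<noteq> 0" using norm_cinner_less_1[OF assms] by auto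
  then show ?thesis unfolding bk_def by (rule norm_powr_of_real)
qed

lemma cnj_bk:
  assumes "norm w * norm z < 1"
  shows "cnj (bk s w z) = bk s z w"
proof -
  have "Re (1 - cinner w z) > 0" by (intro Re_one_minus_pos norm_cinner_less_1 assms)
  then show ?thesis unfolding bk_def by (subst cnj_powr) (auto simp: cinner_commute[of w z])
qed

lemma bk_mult:
  assumes "norm w * norm z < 1"
  shows "bk s w z * bk t w z = bk (s + t) w z"
proof -
  have "1 - cinner w z \<noteq> 0" using norm_cinner_less_1[OF assms] by auto
  then show ?thesis unfolding bk_def powr_add[symmetric] by (simp add: algebra_simps)
qed

lemma norm_one_minus_cinner_ge:
  assumes "norm z \<le> 1" shows "1 - norm w \<le> norm (1 - cinner w z)"
proof -
  have "norm (cinner w z) \<le> norm w * norm z" by (rule norm_cinner_le)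
  also have "... \<le> norm w" using assms by (simp add: mult_left_le)
  finally show ?thesis using norm_triangle_ineq2[of 1 "cinner w z"] by simp
qed

lemma norm_one_minus_cinner_commute: "norm (1 - cinner w z) = norm (1 - cinner z w)"
proof -
  have "1 - cinner w z = cnj (1 - cinner z w)" by (simp add: cinner_commute[of w z])
  then show ?thesis by (simp only: complex_mod_cnj)
qed

lemma xd_le_2_norm:
  assumes "norm z \<le> 1" "norm w \<le> 1"
  shows "xd w \<le> 2 * norm (1 - cinner w z)" "xd z \<le> 2 * norm (1 - cinner w z)"
proof -
  have *: "xd w \<le> 2 * norm (1 - cinner w z)" if "norm z \<le> 1" "norm w \<le> 1" for w z :: "complex ^ 'a"
  proof -
    have "xd w = (1 - norm w) * (1 + norm w)" by (simp add: xd_def power2_eq_square algebra_simps)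
    also have "... \<le> (1 - norm w) * 2" using that by (intro mult_left_mono) auto
    finally show ?thesis using norm_one_minus_cinner_ge[OF that(1), of w] by simp
  qed
  show "xd w \<le> 2 * norm (1 - cinner w z)" "xd z \<le> 2 * norm (1 - cinner w z)"
    using *[OF assms] *[OF assms(2,1)] norm_one_minus_cinner_commute[of w z] by auto
qed

lemma norm_mult_ball_less: "norm w \<le> 1 \<Longrightarrow> z \<in> ball 0 1 \<Longrightarrow> norm w * norm z < 1"
  using mult_left_le_one_le[of "norm z" "norm w"] by auto

lemma norm_mult_ball_less': "norm w \<le> 1 \<Longrightarrow> z \<in> ball 0 1 \<Longrightarrow> norm z * norm w < 1"
  using norm_mult_ball_less[of w z] by (simp add: mult.commute)

lemma norm_bk_le:
  assumes "norm z \<le> 1" "w \<in> ball 0 1" "s \<ge> 0"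
  shows "norm (bk s w z) \<le> (1 - norm w) powr - s"
proof -
  have "norm (bk s w z) = norm (1 - cinner w z) powr - s" using norm_mult_ball_less'[OF assms(1,2)] by (rule norm_bk)
  also have "... \<le> (1 - norm w) powr - s" using assms norm_one_minus_cinner_ge[OF assms(1), of w] by (intro powr_mono2') auto
  finally show ?thesis .
qed

lemma holomorphic_on_one_minus_powr: "(\<lambda>x. (1 - x) powr (c::complex)) holomorphic_on ball 0 1"
proof (intro holomorphic_intros)
  fix x :: complex assume "x \<in> ball 0 1"
  then have "Re (1 - x) > 0" by (intro Re_one_minus_pos) simp
  then show "1 - x \<notin> \<real>\<^sub>\<le>\<^sub>0" by (auto simp: complex_nonpos_Reals_iff)
qed

lemma hol_ball_bk:
  assumes "norm w \<le> 1"
  shows "holomorphic_ball (\<lambda>z. bk s z w)"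
  unfolding bk_def
proof (rule hol_ball_compose[OF hol_ball_cinner holomorphic_on_one_minus_powr])
  show "cinner z w \<in> ball 0 1" if "z \<in> ball 0 1" for z using norm_cinner_less_1[OF norm_mult_ball_less'[OF assms that]] by simp
qed simp

lemma continuous_on_bk:
  assumes "w \<in> ball 0 1" shows "continuous_on (cball 0 1) (\<lambda>z. bk s w z)"
  unfolding bk_def
proof (rule continuous_on_compose2[OF holomorphic_on_imp_continuous_on[OF holomorphic_on_one_minus_powr]])
  show "continuous_on (cball 0 1) (cinner w)" by (intro continuous_intros)
  show "cinner w ` cball 0 1 \<subseteq> ball 0 1" using assms by (auto intro!: norm_cinner_less_1 norm_mult_ball_less')
qed

lemma measurable_bk:
  assumes "w \<in> ball 0 1"
  shows "(\<lambda>z. bk s w z) \<in> borel_measurable (nu \<alpha>)" "(\<lambda>z. bk s z w) \<in> borel_measurable (nu \<alpha>)"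
proof -
  show "(\<lambda>z. bk s w z) \<in> borel_measurable (nu \<alpha>)"
    using continuous_on_subset[OF continuous_on_bk[OF assms] ball_subset_cball] by (rule measurable_continuous_nu)
  show "(\<lambda>z. bk s z w) \<in> borel_measurable (nu \<alpha>)"
    using assms by (intro measurable_continuous_nu hol_ball_imp_continuous_on hol_ball_bk) auto
qed

lemma bk_sums:
  fixes x :: complex
  assumes "norm x < 1"
  shows "(\<lambda>k. of_real (pochhammer s k / fact k) * x ^ k) sums ((1 - x) powr of_real (- s))"
proof -
  have "(\<lambda>k. (of_real (- s) gchoose k) * (- x) ^ k) sums ((1 + - x) powr of_real (- s))"
    using assms by (intro gen_binomial_complex) simp
  moreover have "(complex_of_real (- s) gchoose k) * (- x) ^ k = of_real (pochhammer s k / fact k) * x ^ k" for k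
  proof -
    have "complex_of_real (- s) gchoose k = (-1) ^ k * of_real (pochhammer s k / fact k)"
      by (simp add: gbinomial_pochhammer pochhammer_of_real)
    moreover have "(- x) ^ k = (-1) ^ k * x ^ k" by (rule power_minus)
    moreover have "(-1) ^ k * ((-1) ^ k :: complex) = 1" by (simp flip: power_mult_distrib)
    ultimately have "(complex_of_real (- s) gchoose k) * (- x) ^ k = ((-1) ^ k * of_real (pochhammer s k / fact k)) * ((-1) ^ k * x ^ k)"
      by (simp only:)
    also have "... = ((-1) ^ k * (-1) ^ k) * (of_real (pochhammer s k / fact k) * x ^ k)" by (simp only: mult_ac)
    finally show ?thesis using \<open>(-1) ^ k * (-1) ^ k = 1\<close> by simp
  qed
  ultimately show ?thesis by simp
qed

text \<open>On the ray through w = r u the kernel is a binomial series in the conjugate of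
  \<open>cinner z u\<close>. Its k-th term integrates to the k-th Taylor coefficient of the slice of
  f times a moment, and the moment is the reciprocal of the binomial coefficient. What remains is
  the Taylor series of the slice at r.\<close>

theorem bergman_reproducing:
  fixes f :: "complex ^ 'n \<Rightarrow> complex"
  assumes al: "\<alpha> > -1" and f: "integrable (nu \<alpha>) f" "holomorphic_ball f" and w: "w \<in> ball 0 1"
  shows "(\<integral>z. f z * bk (real CARD('n) + 1 + \<alpha>) w z \<partial>nu \<alpha>) = f w"
proof -
  define N where "N = real CARD('n) + 1 + \<alpha>"
  have N: "N > 0" using al by (simp add: N_def add_pos_pos add_nonneg_pos)
  obtain u where u: "norm u = 1" "w = norm w *\<^sub>R u"
  proof (cases "w = 0")
    case True then show ?thesis using that[of "axis undefined 1"] by simp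
  next
    case False then show ?thesis using that[of "w /\<^sub>R norm w"] by simp
  qed
  define r where "r = norm w"
  have r: "0 \<le> r" "r < 1" using w by (auto simp: r_def)
  define b where "b k = pochhammer N k / fact k" for k
  define a where "a k = (deriv ^^ k) (\<lambda>\<zeta>. f (\<zeta> *s u)) 0 / fact k" for k
  \<comment> \<open>Absolute convergence at r follows from convergence at the larger radius (1 + r)
    / 2; it dominates the interchange of sum and integral.\<close>
  have ns: "summable (\<lambda>k. norm (of_real (b k) * complex_of_real r ^ k))"
  proof (rule powser_insidea)
    show "summable (\<lambda>n. complex_of_real (b n) * complex_of_real ((1 + r) / 2) ^ n)"
      using bk_sums[of "complex_of_real ((1 + r) / 2)" N] r unfolding b_def
      by (intro sums_summable) (auto simp: norm_mult norm_divide simp del: of_real_divide of_real_add)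
    show "norm (complex_of_real r) < norm (complex_of_real ((1 + r) / 2))" using r by (simp del: of_real_divide of_real_add)
  qed
  let ?t = "\<lambda>k z. (of_real (b k) * of_real r ^ k) * (f z * cnj (cinner z u) ^ k)"
  have cb: "norm (cnj (cinner z u) ^ k) \<le> 1" if "z \<in> ball 0 1" for z k
    using norm_cinner_ball_le[OF that u(1)] by (auto simp: norm_power intro!: power_le_one)
  have it0: "integrable (nu \<alpha>) (\<lambda>z. f z * cnj (cinner z u) ^ k)" for k by (rule integrable_mult_bounded[OF f(1), where B=1])
       (use cb in \<open>auto intro!: measurable_continuous_nu continuous_intros\<close>)
  then have it: "integrable (nu \<alpha>) (?t k)" for k by simp
  have nt: "norm (?t k z) \<le> norm (of_real (b k) * complex_of_real r ^ k) * norm (f z)" if "z \<in> ball 0 1" for k z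
    using mult_left_mono[OF cb[OF that, of k], of "norm (f z)"] by (simp add: norm_mult mult_left_mono)
  have S1: "(\<lambda>k. integral\<^sup>L (nu \<alpha>) (?t k)) sums (\<integral>z. (\<Sum>k. ?t k z) \<partial>nu \<alpha>)"
  proof (rule sums_integral[OF it])
    show "AE z in nu \<alpha>. summable (\<lambda>k. norm (?t k z))"
    proof (rule AE_I2)
      fix z assume "z \<in> space (nu \<alpha> :: (complex ^ 'n) measure)"
      then have z: "z \<in> ball 0 1" by simp
      show "summable (\<lambda>k. norm (?t k z))"
        by (rule summable_comparison_test'[OF summable_mult2[OF ns, of "norm (f z)"], of 0]) (use nt[OF z] in simp)
    qed
    show "summable (\<lambda>k. \<integral>z. norm (?t k z) \<partial>nu \<alpha>)"
    proof (rule summable_comparison_test'[OF summable_mult2[OF ns, of "\<integral>z. norm (f z) \<partial>nu \<alpha>"], of 0])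
      fix k
      have "(\<integral>z. norm (?t k z) \<partial>nu \<alpha>) \<le> (\<integral>z. norm (of_real (b k) * complex_of_real r ^ k) * norm (f z) \<partial>nu \<alpha>)"
        using it[of k] f(1) nt[of _ k] by (intro integral_mono) auto
      then show "norm (\<integral>z. norm (?t k z) \<partial>nu \<alpha>) \<le> norm (of_real (b k) * complex_of_real r ^ k) * (\<integral>z. norm (f z) \<partial>nu \<alpha>)"
        by simp
    qed
  qed
  have S2: "integral\<^sup>L (nu \<alpha>) (?t k) = a k * of_real r ^ k" for k
  proof -
    have "integral\<^sup>L (nu \<alpha>) (?t k) = (of_real (b k) * of_real r ^ k) * (a k * complex_of_real (fact k / pochhammer N k))"
      using integral_nu_taylor[OF al f u(1), of k] integral_nu_cinner_power[OF al u(1), of k] by (simp add: a_def N_def)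
    also have "... = (complex_of_real (b k) * complex_of_real (fact k / pochhammer N k)) * (a k * of_real r ^ k)" by (simp only: mult_ac)
    also have "complex_of_real (b k) * complex_of_real (fact k / pochhammer N k) = of_real 1"
      using pochhammer_pos[OF N, of k] unfolding of_real_mult[symmetric] b_def by simp
    finally show ?thesis by simp
  qed
  have S3: "(\<integral>z. (\<Sum>k. ?t k z) \<partial>nu \<alpha>) = (\<integral>z. f z * bk N w z \<partial>nu \<alpha>)"
  proof (rule Bochner_Integration.integral_cong)
    fix z assume "z \<in> space (nu \<alpha> :: (complex ^ 'n) measure)"
    then have z: "z \<in> ball 0 1" by simp
    have wz: "cinner w z = of_real r * cnj (cinner z u)" by (subst u(2)) (simp add: cinner_scaleR_left cinner_commute[of u z] r_def)
    have "norm (cinner w z) < 1" using w z by (intro norm_cinner_less_1 norm_mult_ball_less) auto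
    from bk_sums[OF this, of N]
    have "(\<lambda>k. f z * (of_real (b k) * cinner w z ^ k)) sums (f z * bk N w z)" unfolding bk_def b_def by (rule sums_mult)
    moreover have "f z * (of_real (b k) * cinner w z ^ k) = ?t k z" for k by (simp add: wz power_mult_distrib mult_ac)
    ultimately show "(\<Sum>k. ?t k z) = f z * bk N w z" by (simp add: sums_iff)
  qed simp
  from S1 have 1: "(\<lambda>k. a k * of_real r ^ k) sums (\<integral>z. f z * bk N w z \<partial>nu \<alpha>)" unfolding S2 S3 .
  have hol: "(\<lambda>\<zeta>. f (\<zeta> *s u)) holomorphic_on ball 0 1" using hol_ball_slice_on[OF f(2), of "ball 0 1" 0 u] u by simp
  have "(\<lambda>k. a k * (of_real r - 0) ^ k) sums f (of_real r *s u)"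
    unfolding a_def using holomorphic_power_series[OF hol, of "of_real r"] r by simp
  then have "(\<lambda>k. a k * of_real r ^ k) sums f w" using u(2) by (simp add: r_def scaleR_eq_smult[symmetric])
  with 1 show ?thesis using sums_unique2 unfolding N_def by blast
qed


section \<open>Integrals of powers of the kernel\<close>

lemma dim_exponent_pos:
  assumes "\<alpha> > -1" shows "real CARD('n::finite) + 1 + \<alpha> > 0"
  using assms by (simp add: add_pos_pos add_nonneg_pos)

lemma bk_self:
  assumes "w \<in> ball 0 1" shows "bk s w w = of_real (xd w powr - s)"
proof -
  have "1 - cinner w w = of_real (xd w)" by (simp add: cinner_self xd_def)
  moreover have "xd w > 0" using assms by (simp add: xd_pos_iff)
  ultimately show ?thesis by (simp add: bk_def powr_of_real[symmetric] del: of_real_minus) 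
qed

lemma bk_mult_conj:
  assumes "z \<in> ball 0 1" "w \<in> ball 0 1"
  shows "bk s z w * bk s w z = of_real (norm (1 - cinner z w) powr - (2 * s))"
proof -
  have zw: "norm z * norm w < 1" using assms by (intro norm_mult_ball_less) auto
  have "bk s z w * bk s w z = bk s z w * cnj (bk s z w)" using cnj_bk[OF zw] by simp
  also have "... = of_real ((norm (bk s z w))\<^sup>2)" by (rule complex_norm_square[symmetric])
  also have "(norm (bk s z w))\<^sup>2 = norm (1 - cinner z w) powr - (2 * s)"
    unfolding norm_bk[OF zw] power2_eq_square powr_add[symmetric] by simp
  finally show ?thesis .
qed

lemma measurable_norm_one_minus_cinner [measurable]:
  "(\<lambda>z. norm (1 - cinner z w)) \<in> borel_measurable (nu \<alpha>)"
  by (intro measurable_continuous_nu continuous_intros)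

lemma hol_ball_measurable:
  "holomorphic_ball f \<Longrightarrow> f \<in> borel_measurable (nu \<alpha>)"
  by (intro measurable_continuous_nu hol_ball_imp_continuous_on)

lemma norm_bk_le':
  assumes "z \<in> ball 0 1" "w \<in> ball 0 1" "s \<ge> 0"
  shows "norm (bk s z w) \<le> (1 - norm w) powr - s"
proof -
  have zw: "norm z * norm w < 1" using assms by (intro norm_mult_ball_less) auto
  have "norm (bk s z w) = norm (bk s w z)" using cnj_bk[OF zw, of s] by (metis complex_mod_cnj)
  then show ?thesis using norm_bk_le[of z w s] assms by auto
qed

lemma integrable_nu_bk:
  assumes "\<alpha> > -1" "w \<in> ball 0 1" "s \<ge> 0"
  shows "integrable (nu \<alpha>) (\<lambda>z. bk s z w)"
  by (rule integrable_nu_bounded[OF assms(1) measurable_bk(2)[OF assms(2)] norm_bk_le'[OF _ assms(2,3)]])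

lemma norm_integral_le_nn_integral:
  fixes f :: "'a \<Rightarrow> 'b::{banach, second_countable_topology}"
  shows "ennreal (norm (integral\<^sup>L M f)) \<le> (\<integral>\<^sup>+x. ennreal (norm (f x)) \<partial>M)"
  by (cases "integrable M f") (auto simp: integral_norm_bound_ennreal not_integrable_integral_eq)

text \<open>The reproducing formula is applied to F times \<open>bk N z w\<close>. The two kernels
  are conjugate, so their product is the positive kernel, and at z = w the extra factor becomes
  \<open>xd w powr - N\<close>.\<close>

lemma bergman_poisson:
  fixes F :: "complex ^ 'n \<Rightarrow> complex"
  assumes al: "\<alpha> > -1" and F: "integrable (nu \<alpha>) F" "holomorphic_ball F" and w: "w \<in> ball 0 1"
  defines "N \<equiv> real CARD('n) + 1 + \<alpha>"
  shows "(\<integral>z. F z * of_real (norm (1 - cinner z w) powr - (2 * N)) \<partial>nu \<alpha>) = F w * of_real (xd w powr - N)"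
proof -
  have N: "N \<ge> 0" using dim_exponent_pos[OF al, where 'n='n] by (simp add: N_def)
  have hol: "holomorphic_ball (\<lambda>z. F z * bk N z w)" using w F(2) by (intro hol_ball_mult hol_ball_bk) auto
  have int: "integrable (nu \<alpha>) (\<lambda>z. F z * bk N z w)"
    by (rule integrable_mult_bounded[OF F(1) measurable_bk(2)[OF w], where B="(1 - norm w) powr - N"]) (simp add: norm_bk_le'[OF _ w N])
  have "(\<integral>z. F z * of_real (norm (1 - cinner z w) powr - (2 * N)) \<partial>nu \<alpha>) = (\<integral>z. (F z * bk N z w) * bk N w z \<partial>nu \<alpha>)"
    by (intro Bochner_Integration.integral_cong) (use bk_mult_conj[OF _ w, of _ N] in \<open>auto simp: mult.assoc\<close>)
  also have "... = F w * bk N w w" unfolding N_def by (rule bergman_reproducing[OF al int[unfolded N_def] hol[unfolded N_def] w])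
  finally show ?thesis by (simp add: bk_self[OF w])
qed

text \<open>The case F = 1 of the previous formula. It makes
  \<open>xd w powr N * norm (1 - cinner z w) powr - (2 * N)\<close> a probability density, under
  which Jensen's inequality is applied later.\<close>

lemma forelli_rudin_N:
  fixes w :: "complex ^ 'n"
  assumes al: "\<alpha> > -1" and w: "w \<in> ball 0 1"
  defines "N \<equiv> real CARD('n) + 1 + \<alpha>"
  shows "(\<integral>\<^sup>+z. ennreal (norm (1 - cinner z w) powr - (2 * N)) \<partial>nu \<alpha>) = ennreal (xd w powr - N)"
proof -
  have N: "N \<ge> 0" using dim_exponent_pos[OF al, where 'n='n] by (simp add: N_def)
  have 1: "integrable (nu \<alpha>) (\<lambda>z. bk N z w * bk N w z)"
    by (rule integrable_mult_bounded[OF integrable_nu_bk[OF al w N] measurable_bk(1)[OF w], where B="(1 - norm w) powr - N"])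
       (use norm_bk_le[OF _ w N] in simp)
  have "integrable (nu \<alpha>) (\<lambda>z. complex_of_real (norm (1 - cinner z w) powr - (2 * N)))"
    using 1 by (rule Bochner_Integration.integrable_cong[THEN iffD1, rotated 2]) (simp_all add: bk_mult_conj[OF _ w])
  then have int: "integrable (nu \<alpha>) (\<lambda>z. norm (1 - cinner z w) powr - (2 * N))" by (simp add: complex_of_real_integrable_eq)
  have "complex_of_real (\<integral>z. norm (1 - cinner z w) powr - (2 * N) \<partial>nu \<alpha>) = of_real (xd w powr - N)"
    using bergman_poisson[OF al _ hol_ball_const[of 1] w] integrable_nu_bounded[OF al, of "\<lambda>_. 1" 1]
    by (simp add: N_def)
  then have "(\<integral>z. norm (1 - cinner z w) powr - (2 * N) \<partial>nu \<alpha>) = xd w powr - N" using of_real_eq_iff by blast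
  then show ?thesis using nn_integral_eq_integral[OF int] by simp
qed

text \<open>Taking norms under the positive kernel gives a mean value inequality, which takes the
  place of subharmonicity.\<close>

lemma norm_le_bergman_poisson:
  fixes F :: "complex ^ 'n \<Rightarrow> complex"
  assumes al: "\<alpha> > -1" and F: "integrable (nu \<alpha>) F" "holomorphic_ball F" and w: "w \<in> ball 0 1"
  defines "N \<equiv> real CARD('n) + 1 + \<alpha>"
  shows "ennreal (norm (F w)) \<le> ennreal (xd w powr N) * (\<integral>\<^sup>+z. ennreal (norm (F z)) * ennreal (norm (1 - cinner z w) powr - (2 * N)) \<partial>nu \<alpha>)"
proof -
  have x: "xd w > 0" using w by (simp add: xd_pos_iff)
  have N: "N \<ge> 0" using dim_exponent_pos[OF al, where 'n='n] by (simp add: N_def)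
  have "ennreal (norm (F w) * xd w powr - N) = ennreal (norm (F w * of_real (xd w powr - N)))" by (simp add: norm_mult)
  also have "... \<le> (\<integral>\<^sup>+z. ennreal (norm (F z * of_real (norm (1 - cinner z w) powr - (2 * N)))) \<partial>nu \<alpha>)"
    unfolding bergman_poisson[OF al F w, symmetric] N_def by (rule norm_integral_le_nn_integral)
  also have "... = (\<integral>\<^sup>+z. ennreal (norm (F z)) * ennreal (norm (1 - cinner z w) powr - (2 * N)) \<partial>nu \<alpha>)"
    by (intro nn_integral_cong) (simp add: norm_mult ennreal_mult)
  finally have "ennreal (xd w powr N) * ennreal (norm (F w) * xd w powr - N) \<le> ennreal (xd w powr N) * (\<integral>\<^sup>+z. ennreal (norm (F z)) * ennreal (norm (1 - cinner z w) powr - (2 * N)) \<partial>nu \<alpha>)"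
    by (rule mult_left_mono) simp
  moreover have "ennreal (xd w powr N) * ennreal (norm (F w) * xd w powr - N) = ennreal (norm (F w))"
    using x by (simp flip: ennreal_mult' add: powr_minus field_simps)
  ultimately show ?thesis by simp
qed

text \<open>For \<open>|\<zeta>| \<le> 1\<close> the radial integral on the right sees \<open>|1 - \<zeta>|\<close> on the scale \<open>u \<approx> |1 - \<zeta>|\<close>.\<close>

lemma radial_kernel_bound:
  fixes N c :: real
  assumes N: "N > 0" and c: "c > 0"
  obtains C where "C > 0" "\<And>\<zeta>. norm \<zeta> \<le> 1 \<Longrightarrow> \<zeta> \<noteq> 1 \<Longrightarrow>
    ennreal (norm (1 - \<zeta> :: complex) powr - (N + c)) \<le>
      ennreal C * (\<integral>\<^sup>+u. indicator {0<..<1} u * ennreal (u powr (N - c - 1) * norm (1 - (1 - of_real u) * \<zeta>) powr - (2 * N)) \<partial>lborel)"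
proof
  define e where "e = N - c - 1"
  \<comment> \<open>The factors are the length y/8 of (y/4, 3y/8) relative to y, a lower bound for
    (u/y) powr e on that interval, and the effect of |1 - (1 - u) \<zeta>| <= 2 y. Since y <= 2, the
    interval lies in (0,1).\<close>
  define K where "K = (1/8) * (1/4) powr \<bar>e\<bar> * 2 powr - (2 * N)"
  have K: "K > 0" by (simp add: K_def)
  then show "1 / K > 0" by simp
  fix \<zeta> :: complex assume \<zeta>: "norm \<zeta> \<le> 1" "\<zeta> \<noteq> 1"
  define y where "y = norm (1 - \<zeta>)"
  have y: "y > 0" "y \<le> 2" using \<zeta> norm_triangle_ineq4[of 1 \<zeta>] by (auto simp: y_def)
  let ?g = "\<lambda>u. indicator {0<..<1} u * ennreal (u powr e * norm (1 - (1 - of_real u) * \<zeta>) powr - (2 * N))"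
  have lower: "ennreal ((1/4) powr \<bar>e\<bar> * 2 powr - (2 * N) * y powr (e - 2 * N)) * indicator {y/4<..<y*3/8} u \<le> ?g u" for u
  proof (cases "u \<in> {y/4<..<y*3/8}")
    case True
    then have u: "y / 4 < u" "u < y * 3/8" by auto
    then have u01: "0 < u" "u < 1" using y by auto
    have uy: "1/4 \<le> u / y" "u / y \<le> 1" using u y by (auto simp: field_simps)
    have "(1/4) powr \<bar>e\<bar> \<le> (u / y) powr e"
    proof (cases "e \<ge> 0")
      case True then show ?thesis using uy by (simp add: powr_mono2)
    next
      case False
      have "(1/4::real) powr \<bar>e\<bar> \<le> 1" by (intro powr_le1) auto
      also have "1 \<le> (u / y) powr e"  using powr_mono2'[of e "u/y" 1] False uy by auto
      finally show ?thesis .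
    qed
    then have 1: "(1/4) powr \<bar>e\<bar> * y powr e \<le> u powr e" using y u01 by (simp add: powr_divide field_simps)
    have eq: "1 - (1 - of_real u) * \<zeta> = (1 - \<zeta>) + of_real u * \<zeta>" by (simp add: algebra_simps)
    have "norm (1 - (1 - of_real u) * \<zeta>) \<le> y + u * norm \<zeta>"
      unfolding eq using norm_triangle_ineq[of "1 - \<zeta>" "of_real u * \<zeta>"] u01 by (simp add: y_def norm_mult)
    also have "... \<le> 2 * y" using mult_left_le[OF \<zeta>(1), of u] u01 u y by linarith
    finally have le: "norm (1 - (1 - of_real u) * \<zeta>) \<le> 2 * y" .
    have "norm ((1 - of_real u) * \<zeta>) < 1"
    proof -
      have "norm (1 - complex_of_real u) = 1 - u" using u01 norm_of_real[of "1 - u"] by (simp del: norm_of_real)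
      then have "norm ((1 - of_real u) * \<zeta>) = (1 - u) * norm \<zeta>" by (simp add: norm_mult)
      also have "... \<le> 1 - u" using \<zeta>(1) u01 by (intro mult_left_le) auto
      finally show ?thesis using u01 by simp
    qed
    then have pos: "norm (1 - (1 - of_real u) * \<zeta>) > 0" by auto
    have 2: "2 powr - (2 * N) * y powr - (2 * N) \<le> norm (1 - (1 - of_real u) * \<zeta>) powr - (2 * N)"
    proof -
      have "(2 * y) powr - (2 * N) \<le> norm (1 - (1 - of_real u) * \<zeta>) powr - (2 * N)" using pos le N by (intro powr_mono2') auto
      then show ?thesis using y by (simp add: powr_mult)
    qed
    have "((1/4) powr \<bar>e\<bar> * y powr e) * (2 powr - (2 * N) * y powr - (2 * N)) \<le> u powr e * norm (1 - (1 - of_real u) * \<zeta>) powr - (2 * N)"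
      using 1 2 by (intro mult_mono) auto
    moreover have "y powr (e - 2 * N) = y powr e * y powr - (2 * N)" by (simp flip: powr_add)
    ultimately have "(1/4) powr \<bar>e\<bar> * 2 powr - (2 * N) * y powr (e - 2 * N) \<le> u powr e * norm (1 - (1 - of_real u) * \<zeta>) powr - (2 * N)"
      by (simp only: mult_ac)
    then show ?thesis using True u01 by (simp add: ennreal_leI)
  qed simp
  have "ennreal ((1/4) powr \<bar>e\<bar> * 2 powr - (2 * N) * y powr (e - 2 * N)) * ennreal (y / 8)
     = (\<integral>\<^sup>+u. ennreal ((1/4) powr \<bar>e\<bar> * 2 powr - (2 * N) * y powr (e - 2 * N)) * indicator {y/4<..<y*3/8} u \<partial>lborel)"
    using y by (subst nn_integral_cmult_indicator) auto
  also have "... \<le> (\<integral>\<^sup>+u. ?g u \<partial>lborel)" by (intro nn_integral_mono lower)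
  finally have "ennreal ((1/4) powr \<bar>e\<bar> * 2 powr - (2 * N) * y powr (e - 2 * N) * (y / 8)) \<le> (\<integral>\<^sup>+u. ?g u \<partial>lborel)"
    using y by (subst ennreal_mult'') auto
  moreover have "(1/4) powr \<bar>e\<bar> * 2 powr - (2 * N) * y powr (e - 2 * N) * (y / 8) = K * y powr - (N + c)"
  proof -
    have "y powr (e - 2 * N) * y = y powr (e - 2 * N) * y powr 1" using y by simp
    also have "... = y powr (e - 2 * N + 1)" by (rule powr_add[symmetric])
    also have "e - 2 * N + 1 = - (N + c)" by (simp add: e_def)
    finally have "y powr (e - 2 * N) * y = y powr - (N + c)" .
    moreover have "(1/4) powr \<bar>e\<bar> * 2 powr - (2 * N) * y powr (e - 2 * N) * (y / 8) = K * (y powr (e - 2 * N) * y)"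
      by (simp add: K_def)
    ultimately show ?thesis by (simp only:)
  qed
  ultimately have "ennreal (K * y powr - (N + c)) \<le> (\<integral>\<^sup>+u. ?g u \<partial>lborel)" by simp
  then have "ennreal (1 / K) * ennreal (K * y powr - (N + c)) \<le> ennreal (1 / K) * (\<integral>\<^sup>+u. ?g u \<partial>lborel)"
    by (rule mult_left_mono) simp
  moreover have "ennreal (1 / K) * ennreal (K * y powr - (N + c)) = ennreal (y powr - (N + c))" using K by (simp flip: ennreal_mult')
  ultimately show "ennreal (norm (1 - \<zeta>) powr - (N + c)) \<le> ennreal (1 / K) * (\<integral>\<^sup>+u. indicator {0<..<1} u * ennreal (u powr (N - c - 1) * norm (1 - (1 - of_real u) * \<zeta>) powr - (2 * N)) \<partial>lborel)"
    by (simp add: y_def e_def)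
qed

text \<open>Split at u = x. Below, the maximum is x and u powr (N - c - 1) is integrable at 0
  because c < N; above, the power is - c - 1, integrable at infinity because c > 0. Both pieces
  scale like x powr - c.\<close>

lemma nn_integral_split_powers:
  fixes N c x :: real
  assumes c: "0 < c" "c < N" and x: "x > 0"
  shows "(\<integral>\<^sup>+u. indicator {0<..<1} u * ennreal (u powr (N - c - 1) * (max u x) powr - N) \<partial>lborel) \<le> ennreal ((1 / (N - c) + 1 / c) * x powr - c)"
proof -
  have 1: "(\<integral>\<^sup>+u. ennreal (indicator {0..x} u * (u powr (N - c - 1) * x powr - N)) \<partial>lborel) = ennreal (x powr - c / (N - c))"
  proof -
    have "((\<lambda>u. u powr (N - c - 1) * x powr - N) has_integral (x powr (N - c - 1 + 1) / (N - c - 1 + 1) * x powr - N)) {0..x}"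
      using c x by (intro has_integral_mult_left has_integral_powr_from_0) auto
    moreover have "x powr (N - c - 1 + 1) / (N - c - 1 + 1) * x powr - N = x powr - c / (N - c)" using powr_add[of x "N - c" "-N"] by simp
    ultimately show ?thesis by (intro nn_integral_has_integral_lebesgue) auto
  qed
  have 2: "(\<integral>\<^sup>+u. ennreal (indicator {x..} u * u powr (- c - 1)) \<partial>lborel) = ennreal (x powr - c / c)"
  proof -
    have "((\<lambda>u. u powr (- c - 1)) has_integral (- (x powr (- c - 1 + 1)) / (- c - 1 + 1))) {x..}"
      using c x by (intro has_integral_powr_to_inf) auto
    then have "((\<lambda>u. u powr (- c - 1)) has_integral (x powr - c / c)) {x..}" by simp
    then show ?thesis by (intro nn_integral_has_integral_lebesgue) auto
  qed
  have "(\<integral>\<^sup>+u. indicator {0<..<1} u * ennreal (u powr (N - c - 1) * (max u x) powr - N) \<partial>lborel)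
    \<le> (\<integral>\<^sup>+u. ennreal (indicator {0..x} u * (u powr (N - c - 1) * x powr - N)) + ennreal (indicator {x..} u * u powr (- c - 1)) \<partial>lborel)"
  proof (rule nn_integral_mono)
    fix u :: real
    show "indicator {0<..<1} u * ennreal (u powr (N - c - 1) * (max u x) powr - N) \<le> ennreal (indicator {0..x} u * (u powr (N - c - 1) * x powr - N)) + ennreal (indicator {x..} u * u powr (- c - 1))"
    proof (cases "0 < u \<and> u < 1")
      case True
      show ?thesis
      proof (cases "u \<le> x")
        case le: True
        then show ?thesis using True by (auto simp: max_def indicator_def intro: add_increasing2)
      next
        case False
        have "u powr (N - c - 1) * u powr - N = u powr (- c - 1)" unfolding powr_add[symmetric] by simp
        then show ?thesis using True False by (auto simp: max_def indicator_def)
      qed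
    qed auto
  qed
  also have "... = ennreal (x powr - c / (N - c)) + ennreal (x powr - c / c)"
    unfolding 1[symmetric] 2[symmetric] by (rule nn_integral_add) auto
  also have "... = ennreal ((1 / (N - c) + 1 / c) * x powr - c)"
  proof -
    have "x powr - c / (N - c) + x powr - c / c = (1 / (N - c) + 1 / c) * x powr - c" by (simp add: distrib_right)
    moreover have "ennreal (x powr - c / (N - c)) + ennreal (x powr - c / c) = ennreal (x powr - c / (N - c) + x powr - c / c)"
      using c by (intro ennreal_plus[symmetric]) auto
    ultimately show ?thesis by (simp only:)
  qed
  finally show ?thesis .
qed

text \<open>Integrating the radial bound over z and moving 1 - u onto w reduces the exponent N + c
  to the exact exponent 2N at the points (1 - u) w. There \<open>xd\<close> is at least
  \<open>max u (xd w)\<close>, and the remaining integral in u is elementary.\<close>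

theorem forelli_rudin:
  fixes \<alpha> c :: real
  assumes al: "\<alpha> > -1" and c: "0 < c" "c < real CARD('n::finite) + 1 + \<alpha>"
  obtains C where "C > 0" "\<And>w. w \<in> ball 0 1 \<Longrightarrow>
    (\<integral>\<^sup>+(z::complex^'n). ennreal (norm (1 - cinner z w) powr - (real CARD('n) + 1 + \<alpha> + c)) \<partial>nu \<alpha>) \<le> ennreal (C * xd w powr - c)"
proof -
  define N where "N = real CARD('n) + 1 + \<alpha>"
  have N: "N > 0" using dim_exponent_pos[OF al, where 'n='n] by (simp add: N_def)
  have cN: "c < N" using c by (simp add: N_def)
  obtain K where K: "K > 0" "\<And>\<zeta>. norm \<zeta> \<le> 1 \<Longrightarrow> \<zeta> \<noteq> 1 \<Longrightarrow>
    ennreal (norm (1 - \<zeta> :: complex) powr - (N + c)) \<le>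
      ennreal K * (\<integral>\<^sup>+u. indicator {0<..<1} u * ennreal (u powr (N - c - 1) * norm (1 - (1 - of_real u) * \<zeta>) powr - (2 * N)) \<partial>lborel)"
    by (rule radial_kernel_bound[OF N c(1)]) (rule that)
  show thesis
  proof (rule that[of "K * (1 / (N - c) + 1 / c)"])
    show "K * (1 / (N - c) + 1 / c) > 0" using K c cN by (intro mult_pos_pos add_pos_pos) auto
    fix w :: "complex ^ 'n" assume w: "w \<in> ball 0 1"
    have x: "xd w > 0" using w by (simp add: xd_pos_iff)
    interpret nu: finite_measure "nu \<alpha> :: (complex ^ 'n) measure" by (rule finite_measure_nu[OF al])
    interpret P: pair_sigma_finite "lborel :: real measure" "nu \<alpha> :: (complex ^ 'n) measure" ..
    have [measurable]: "(\<lambda>z. cinner z w) \<in> borel_measurable (nu \<alpha>)" by (intro measurable_continuous_nu continuous_intros)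
    let ?G = "\<lambda>u z. indicator {0<..<1} u * ennreal (u powr (N - c - 1) * norm (1 - (1 - of_real u) * cinner z w) powr - (2 * N))"
    have "(\<integral>\<^sup>+(z::complex^'n). ennreal (norm (1 - cinner z w) powr - (N + c)) \<partial>nu \<alpha>)
      \<le> (\<integral>\<^sup>+z. ennreal K * (\<integral>\<^sup>+u. ?G u z \<partial>lborel) \<partial>nu \<alpha>)"
    proof (rule nn_integral_mono)
      fix z :: "complex ^ 'n" assume "z \<in> space (nu \<alpha>)"
      then have "norm (cinner z w) < 1" using w by (intro norm_cinner_less_1 norm_mult_ball_less) auto
      then show "ennreal (norm (1 - cinner z w) powr - (N + c)) \<le> ennreal K * (\<integral>\<^sup>+u. ?G u z \<partial>lborel)"
        by (intro K(2)) auto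
    qed
    also have "... = ennreal K * (\<integral>\<^sup>+z. \<integral>\<^sup>+u. ?G u z \<partial>lborel \<partial>nu \<alpha>)"
      by (rule nn_integral_cmult) measurable
    also have "(\<integral>\<^sup>+z. \<integral>\<^sup>+u. ?G u z \<partial>lborel \<partial>nu \<alpha>) = (\<integral>\<^sup>+u. \<integral>\<^sup>+z. ?G u z \<partial>nu \<alpha> \<partial>lborel)"
      by (rule P.Fubini') measurable
    also have "... \<le> (\<integral>\<^sup>+u. indicator {0<..<1} u * ennreal (u powr (N - c - 1) * (max u (xd w)) powr - N) \<partial>lborel)"
    proof (rule nn_integral_mono)
      fix u :: real
      show "(\<integral>\<^sup>+z. ?G u z \<partial>nu \<alpha>) \<le> indicator {0<..<1} u * ennreal (u powr (N - c - 1) * (max u (xd w)) powr - N)"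
      proof (cases "u \<in> {0<..<1}")
        case True
        then have u: "0 < u" "u < 1" by auto
        let ?w = "(1 - u) *\<^sub>R w"
        have nw: "norm ?w = (1 - u) * norm w" using u by simp
        have nw1: "norm ?w \<le> 1 - u" unfolding nw using u w by (intro mult_left_le) auto
        have nw2: "norm ?w \<le> norm w" unfolding nw using u by (intro mult_left_le_one_le) auto
        have wb: "?w \<in> ball 0 1" using nw1 u unfolding mem_ball_0 by linarith
        have "xd ?w \<ge> 1 - (1 - u)\<^sup>2" unfolding xd_def using nw1 power_mono[OF nw1, of 2] by simp
        moreover have "1 - (1 - u)\<^sup>2 \<ge> u" using u by (simp add: power2_eq_square algebra_simps mult_left_le)
        moreover have "xd ?w \<ge> xd w" unfolding xd_def using power_mono[OF nw2, of 2] by simp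
        ultimately have mx: "max u (xd w) \<le> xd ?w" by simp
        have "(\<integral>\<^sup>+z. ?G u z \<partial>nu \<alpha>) = (\<integral>\<^sup>+(z::complex^'n). ennreal (u powr (N - c - 1)) * ennreal (norm (1 - cinner z ?w) powr - (2 * N)) \<partial>nu \<alpha>)"
          using True by (intro nn_integral_cong) (simp add: cinner_scaleR_right ennreal_mult)
        also have "... = ennreal (u powr (N - c - 1)) * ennreal (xd ?w powr - N)"
          using forelli_rudin_N[OF al wb] by (subst nn_integral_cmult) (auto simp: N_def)
        also have "... \<le> ennreal (u powr (N - c - 1) * (max u (xd w)) powr - N)"
        proof -
          have "xd ?w powr - N \<le> (max u (xd w)) powr - N" using mx N u by (intro powr_mono2') auto
          then show ?thesis by (simp flip: ennreal_mult' add: ennreal_leI mult_left_mono)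
        qed
        finally show ?thesis using True by simp
      qed simp
    qed
    also have "... \<le> ennreal ((1 / (N - c) + 1 / c) * xd w powr - c)" by (rule nn_integral_split_powers[OF c(1) cN x])
    also have "ennreal K * ... = ennreal (K * (1 / (N - c) + 1 / c) * xd w powr - c)" using K by (simp flip: ennreal_mult' add: mult_ac)
    finally show "(\<integral>\<^sup>+(z::complex^'n). ennreal (norm (1 - cinner z w) powr - (real CARD('n) + 1 + \<alpha> + c)) \<partial>nu \<alpha>) \<le> ennreal (K * (1 / (N - c) + 1 / c) * xd w powr - c)"
      by (simp add: N_def mult_left_mono)
  qed
qed


section \<open>Fubini for the kernel and integration by parts\<close>

lemma measurable_xd_powr_nu: "(\<lambda>z. xd z powr a) \<in> borel_measurable (nu \<alpha>)"
  by (rule measurable_borel_nu) measurable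

lemma measurable_bk_pair:
  assumes r: "0 \<le> r" "r \<le> 1"
  shows "(\<lambda>(z, w). bk s (r *\<^sub>R z) w) \<in> borel_measurable ((nu \<alpha> :: (complex ^ 'n) measure) \<Otimes>\<^sub>M nu \<beta>)"
proof -
  let ?P = "(nu \<alpha> :: (complex ^ 'n) measure) \<Otimes>\<^sub>M (nu \<beta> :: (complex ^ 'n) measure)"
  let ?g = "\<lambda>x::complex. if x \<in> ball 0 1 then (1 - x) powr of_real (- s) else 0"
  have g: "?g \<in> borel_measurable borel" by (intro borel_measurable_continuous_on_if continuous_on_const
        holomorphic_on_imp_continuous_on[OF holomorphic_on_one_minus_powr]) auto
  have "(\<lambda>(z, w). cinner (r *\<^sub>R z) w) \<in> borel_measurable (borel \<Otimes>\<^sub>M (borel :: (complex ^ 'n) measure))"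
    unfolding borel_prod split_beta' by (intro borel_measurable_continuous_onI continuous_intros)
  moreover have "(\<lambda>p. (fst p, snd p)) \<in> measurable ?P (borel \<Otimes>\<^sub>M borel)"
    by (intro measurable_Pair measurable_compose[OF measurable_fst] measurable_compose[OF measurable_snd])
       (auto intro!: measurable_borel_nu)
  ultimately have c: "(\<lambda>p. case (fst p, snd p) of (z, w) \<Rightarrow> cinner (r *\<^sub>R z) w) \<in> borel_measurable ?P"
    by (rule measurable_compose[rotated])
  have "(\<lambda>(z, w). bk s (r *\<^sub>R z) w) \<in> borel_measurable ?P \<longleftrightarrow>
      (\<lambda>p. ?g (case (fst p, snd p) of (z, w) \<Rightarrow> cinner (r *\<^sub>R z) w)) \<in> borel_measurable ?P"
  proof (rule measurable_cong)
    fix p assume p: "p \<in> space ?P"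
    then have zw: "fst p \<in> ball 0 1" "snd p \<in> ball 0 1" by (auto simp: space_pair_measure)
    have "norm (r *\<^sub>R fst p) \<le> 1" using r zw by (auto intro!: mult_le_one)
    then have "norm (cinner (r *\<^sub>R fst p) (snd p)) < 1" using zw by (intro norm_cinner_less_1 norm_mult_ball_less) auto
    then show "(case p of (z, w) \<Rightarrow> bk s (r *\<^sub>R z) w) = ?g (case (fst p, snd p) of (z, w) \<Rightarrow> cinner (r *\<^sub>R z) w)"
      by (simp add: split_beta' bk_def)
  qed
  then show ?thesis using measurable_compose[OF c g] by simp
qed

lemma nu_Fubini:
  fixes K :: "(complex ^ 'n) \<times> (complex ^ 'n) \<Rightarrow> complex"
  assumes al: "\<alpha> > -1" and \<beta>: "\<beta> > -1"
    and K: "K \<in> borel_measurable (nu \<alpha> \<Otimes>\<^sub>M nu \<beta>)"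
    and fin: "(\<integral>\<^sup>+z. \<integral>\<^sup>+w. ennreal (norm (K (z, w))) \<partial>nu \<beta> \<partial>nu \<alpha>) < \<infinity>"
  shows "(\<integral>z. \<integral>w. K (z, w) \<partial>nu \<beta> \<partial>nu \<alpha>) = (\<integral>w. \<integral>z. K (z, w) \<partial>nu \<alpha> \<partial>nu \<beta>)"
proof -
  interpret a: finite_measure "nu \<alpha> :: (complex ^ 'n) measure" by (rule finite_measure_nu[OF al])
  interpret b: finite_measure "nu \<beta> :: (complex ^ 'n) measure" by (rule finite_measure_nu[OF \<beta>])
  interpret P: pair_sigma_finite "nu \<alpha> :: (complex ^ 'n) measure" "nu \<beta> :: (complex ^ 'n) measure" ..
  have "(\<integral>\<^sup>+p. ennreal (norm (K p)) \<partial>(nu \<alpha> \<Otimes>\<^sub>M nu \<beta>)) < \<infinity>"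
    using fin K by (subst b.nn_integral_fst[symmetric]) auto
  then have "integrable (nu \<alpha> \<Otimes>\<^sub>M nu \<beta>) K" using K by (intro integrableI_bounded) auto
  then have "integrable (nu \<alpha> \<Otimes>\<^sub>M nu \<beta>) (\<lambda>(z, w). K (z, w))" by (simp add: split_beta')
  from P.Fubini_integral[OF this] show ?thesis by simp
qed

text \<open>For s = N this is the Bergman projection of g. For holomorphic integrable g and s = N +
  j it is a combination of the radial derivatives of g up to order j.\<close>

definition bk_transform :: "real \<Rightarrow> real \<Rightarrow> (complex ^ 'n \<Rightarrow> complex) \<Rightarrow> complex ^ 'n \<Rightarrow> complex" where
  "bk_transform \<alpha> s g \<xi> = (\<integral>w. g w * bk s \<xi> w \<partial>nu \<alpha>)"

text \<open>F is reproduced with the kernel of \<open>nu (\<alpha> + m)\<close> and the integrals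
  are exchanged. That kernel has the critical exponent for its measure, where its L1 norm in \<xi>
  is not bounded in w; giving away \<epsilon> bounds it by a multiple of
  \<open>xd w powr - \<epsilon>\<close>, which the hypothesis on g absorbs.\<close>

lemma bergman_parts:
  fixes g F :: "complex ^ 'n \<Rightarrow> complex" and m :: nat
  assumes al: "\<alpha> > -1" and \<epsilon>: "0 < \<epsilon>" "\<epsilon> < 1 + \<alpha>"
    and g: "g \<in> borel_measurable (nu \<alpha>)" "(\<integral>\<^sup>+w. ennreal (norm (g w)) * ennreal (xd w powr - \<epsilon>) \<partial>nu \<alpha>) < \<infinity>"
    and F: "holomorphic_ball F" "\<And>z. z \<in> ball 0 1 \<Longrightarrow> norm (F z) \<le> B"
  shows "(\<integral>w. g w * cnj (F w) \<partial>nu \<alpha>) =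
    (\<integral>\<xi>. bk_transform \<alpha> (real CARD('n) + 1 + \<alpha> + real m) g \<xi> * cnj (F \<xi>) \<partial>nu (\<alpha> + real m))"
proof -
  define N where "N = real CARD('n) + 1 + \<alpha> + real m"
  have N': "real CARD('n) + 1 + (\<alpha> + real m) = N" by (simp add: N_def)
  have am: "\<alpha> + real m > -1" using al by simp
  have B: "B \<ge> 0" using F(2)[of 0] norm_ge_zero[of "F 0"] by (simp del: norm_ge_zero)
  have "\<epsilon> < real CARD('n) + 1 + (\<alpha> + real m)" using \<epsilon> by simp
  then obtain C where C: "C > 0" "\<And>w. w \<in> ball 0 1 \<Longrightarrow>
    (\<integral>\<^sup>+(z::complex^'n). ennreal (norm (1 - cinner z w) powr - (N + \<epsilon>)) \<partial>nu (\<alpha> + real m)) \<le> ennreal (C * xd w powr - \<epsilon>)"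
    by (rule forelli_rudin[OF am \<epsilon>(1)]) (use N' in auto)
  have Fm: "F \<in> borel_measurable (nu a)" for a by (rule hol_ball_measurable[OF F(1)])
  let ?K = "\<lambda>(w, \<xi>). g w * (cnj (F \<xi>) * bk N \<xi> w)"
  have Km: "?K \<in> borel_measurable (nu \<alpha> \<Otimes>\<^sub>M nu (\<alpha> + real m))"
  proof -
    have "(\<lambda>p. bk N (snd p) (fst p)) \<in> borel_measurable ((nu \<alpha> :: (complex ^ 'n) measure) \<Otimes>\<^sub>M nu (\<alpha> + real m))"
      using measurable_compose[OF measurable_pair_swap' measurable_bk_pair[of 1 N "\<alpha> + real m" \<alpha>]] by (simp add: split_beta')
    then show ?thesis using g(1) Fm[of "\<alpha> + real m"] unfolding split_beta' by measurable
  qed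
  have kb: "(\<integral>\<^sup>+\<xi>. ennreal (norm (bk N \<xi> w)) \<partial>nu (\<alpha> + real m)) \<le> ennreal (2 powr \<epsilon> * C * xd w powr - \<epsilon>)"
    if w: "w \<in> ball 0 1" for w :: "complex ^ 'n"
  proof -
    have "(\<integral>\<^sup>+\<xi>. ennreal (norm (bk N \<xi> w)) \<partial>nu (\<alpha> + real m))
      \<le> (\<integral>\<^sup>+(\<xi>::complex^'n). ennreal (2 powr \<epsilon>) * ennreal (norm (1 - cinner \<xi> w) powr - (N + \<epsilon>)) \<partial>nu (\<alpha> + real m))"
    proof (rule nn_integral_mono)
      fix \<xi> :: "complex ^ 'n" assume "\<xi> \<in> space (nu (\<alpha> + real m))"
      then have \<xi>: "\<xi> \<in> ball 0 1" by simp
      have nn: "norm \<xi> * norm w < 1" using \<xi> w by (intro norm_mult_ball_less) auto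
      define y where "y = norm (1 - cinner \<xi> w)"
      have y: "y > 0" "y \<le> 2" using norm_cinner_less_1[OF nn] norm_triangle_ineq4[of 1 "cinner \<xi> w"] by (auto simp: y_def)
      have "y powr - N = y powr \<epsilon> * y powr - (N + \<epsilon>)" unfolding powr_add[symmetric] by simp
      also have "... \<le> 2 powr \<epsilon> * y powr - (N + \<epsilon>)" using y \<epsilon> by (intro mult_right_mono powr_mono2) auto
      finally show "ennreal (norm (bk N \<xi> w)) \<le> ennreal (2 powr \<epsilon>) * ennreal (norm (1 - cinner \<xi> w) powr - (N + \<epsilon>))"
        unfolding norm_bk[OF nn] y_def[symmetric] by (subst ennreal_mult[symmetric]) (auto intro: ennreal_leI)
    qed
    also have "... = ennreal (2 powr \<epsilon>) * (\<integral>\<^sup>+(\<xi>::complex^'n). ennreal (norm (1 - cinner \<xi> w) powr - (N + \<epsilon>)) \<partial>nu (\<alpha> + real m))"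
      by (rule nn_integral_cmult) measurable
    also have "... \<le> ennreal (2 powr \<epsilon>) * ennreal (C * xd w powr - \<epsilon>)" by (intro mult_left_mono C(2)[OF w]) simp
    also have "... = ennreal (2 powr \<epsilon> * C * xd w powr - \<epsilon>)"
      using C(1) by (subst ennreal_mult[symmetric]) (auto simp: mult_ac)
    finally show ?thesis .
  qed
  have fin: "(\<integral>\<^sup>+w. \<integral>\<^sup>+\<xi>. ennreal (norm (?K (w, \<xi>))) \<partial>nu (\<alpha> + real m) \<partial>nu \<alpha>) < \<infinity>"
  proof -
    have "(\<integral>\<^sup>+w. \<integral>\<^sup>+\<xi>. ennreal (norm (?K (w, \<xi>))) \<partial>nu (\<alpha> + real m) \<partial>nu \<alpha>)
      \<le> (\<integral>\<^sup>+w. ennreal (B * (2 powr \<epsilon> * C)) * (ennreal (norm (g w)) * ennreal (xd w powr - \<epsilon>)) \<partial>nu \<alpha>)"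
    proof (rule nn_integral_mono)
      fix w :: "complex ^ 'n" assume "w \<in> space (nu \<alpha>)"
      then have w: "w \<in> ball 0 1" by simp
      have "(\<integral>\<^sup>+\<xi>. ennreal (norm (?K (w, \<xi>))) \<partial>nu (\<alpha> + real m))
        \<le> (\<integral>\<^sup>+\<xi>. ennreal (norm (g w) * B) * ennreal (norm (bk N \<xi> w)) \<partial>nu (\<alpha> + real m))"
      proof (rule nn_integral_mono)
        fix \<xi> :: "complex ^ 'n" assume "\<xi> \<in> space (nu (\<alpha> + real m))"
        then have "norm (F \<xi>) \<le> B" using F(2) by simp
        then have "norm (?K (w, \<xi>)) \<le> norm (g w) * B * norm (bk N \<xi> w)"
          by (simp add: norm_mult mult.assoc mult_left_mono mult_right_mono)
        then show "ennreal (norm (?K (w, \<xi>))) \<le> ennreal (norm (g w) * B) * ennreal (norm (bk N \<xi> w))"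
          using B by (subst ennreal_mult[symmetric]) (auto intro: ennreal_leI)
      qed
      also have "... = ennreal (norm (g w) * B) * (\<integral>\<^sup>+\<xi>. ennreal (norm (bk N \<xi> w)) \<partial>nu (\<alpha> + real m))"
        using measurable_bk(2)[OF w] by (intro nn_integral_cmult) auto
      also have "... \<le> ennreal (norm (g w) * B) * ennreal (2 powr \<epsilon> * C * xd w powr - \<epsilon>)"
        by (intro mult_left_mono kb[OF w]) simp
      also have "... = ennreal (B * (2 powr \<epsilon> * C)) * (ennreal (norm (g w)) * ennreal (xd w powr - \<epsilon>))"
        using B C(1) by (simp flip: ennreal_mult add: mult_ac)
      finally show "(\<integral>\<^sup>+\<xi>. ennreal (norm (?K (w, \<xi>))) \<partial>nu (\<alpha> + real m)) \<le>
        ennreal (B * (2 powr \<epsilon> * C)) * (ennreal (norm (g w)) * ennreal (xd w powr - \<epsilon>))" .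
    qed
    also have "... = ennreal (B * (2 powr \<epsilon> * C)) * (\<integral>\<^sup>+w. ennreal (norm (g w)) * ennreal (xd w powr - \<epsilon>) \<partial>nu \<alpha>)"
      by (intro nn_integral_cmult borel_measurable_times_ennreal measurable_compose[OF measurable_xd_powr_nu measurable_ennreal]
          measurable_compose[OF measurable_compose[OF g(1) borel_measurable_norm] measurable_ennreal])
    also have "... < \<infinity>" using g(2) by (simp add: ennreal_mult_less_top)
    finally show ?thesis .
  qed
  have intF: "integrable (nu (\<alpha> + real m)) F" by (rule integrable_nu_bounded[OF am Fm F(2)])
  have "(\<integral>w. g w * cnj (F w) \<partial>nu \<alpha>) = (\<integral>w. \<integral>\<xi>. ?K (w, \<xi>) \<partial>nu (\<alpha> + real m) \<partial>nu \<alpha>)"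
  proof (rule Bochner_Integration.integral_cong)
    fix w :: "complex ^ 'n" assume "w \<in> space (nu \<alpha>)"
    then have w: "w \<in> ball 0 1" by simp
    have "cnj (F w) = cnj (\<integral>\<xi>. F \<xi> * bk N w \<xi> \<partial>nu (\<alpha> + real m))"
      using bergman_reproducing[OF am intF F(1) w] by (simp add: N')
    also have "... = (\<integral>\<xi>. cnj (F \<xi> * bk N w \<xi>) \<partial>nu (\<alpha> + real m))" by (rule Bochner_Integration.integral_cnj[symmetric])
    also have "... = (\<integral>\<xi>. cnj (F \<xi>) * bk N \<xi> w \<partial>nu (\<alpha> + real m))"
    proof (rule Bochner_Integration.integral_cong)
      fix \<xi> :: "complex ^ 'n" assume "\<xi> \<in> space (nu (\<alpha> + real m))"
      then have "norm w * norm \<xi> < 1" using w by (intro norm_mult_ball_less) auto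
      then show "cnj (F \<xi> * bk N w \<xi>) = cnj (F \<xi>) * bk N \<xi> w" by (simp add: cnj_bk)
    qed simp
    finally have "g w * cnj (F w) = g w * (\<integral>\<xi>. cnj (F \<xi>) * bk N \<xi> w \<partial>nu (\<alpha> + real m))" by simp
    also have "... = (\<integral>\<xi>. g w * (cnj (F \<xi>) * bk N \<xi> w) \<partial>nu (\<alpha> + real m))" by (rule integral_mult_right_zero[symmetric])
    finally show "g w * cnj (F w) = (\<integral>\<xi>. ?K (w, \<xi>) \<partial>nu (\<alpha> + real m))" by simp
  qed simp
  also have "... = (\<integral>\<xi>. \<integral>w. ?K (w, \<xi>) \<partial>nu \<alpha> \<partial>nu (\<alpha> + real m))"
    by (rule nu_Fubini[OF al am Km fin])
  also have "... = (\<integral>\<xi>. bk_transform \<alpha> N g \<xi> * cnj (F \<xi>) \<partial>nu (\<alpha> + real m))"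
  proof (rule Bochner_Integration.integral_cong)
    fix \<xi> :: "complex ^ 'n"
    have "(\<integral>w. ?K (w, \<xi>) \<partial>nu \<alpha>) = (\<integral>w. (g w * bk N \<xi> w) * cnj (F \<xi>) \<partial>nu \<alpha>)" by (simp add: mult_ac)
    also have "... = bk_transform \<alpha> N g \<xi> * cnj (F \<xi>)" unfolding bk_transform_def by (rule integral_mult_left_zero)
    finally show "(\<integral>w. ?K (w, \<xi>) \<partial>nu \<alpha>) = bk_transform \<alpha> N g \<xi> * cnj (F \<xi>)" .
  qed simp
  finally show ?thesis by (simp add: N_def)
qed

lemma dilate_in_ball: "z \<in> ball 0 1 \<Longrightarrow> 0 \<le> r \<Longrightarrow> r \<le> 1 \<Longrightarrow> r *\<^sub>R (z :: 'a::real_normed_vector) \<in> ball 0 1"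
  using mult_left_le_one_le[of "norm z" r] by auto

text \<open>Both sides are one double integral of f, the conjugate of h and a kernel: the kernel
  between r \<xi> and z is conjugate to that between r z and \<xi>. For r < 1 it is bounded, which
  justifies Fubini.\<close>

lemma dilation_adjoint:
  fixes f h :: "complex ^ 'n \<Rightarrow> complex"
  assumes al: "\<alpha> > -1" and f: "integrable (nu \<alpha>) f" "holomorphic_ball f"
    and h: "integrable (nu \<alpha>) h" "holomorphic_ball h" and r: "0 \<le> r" "r < 1"
  shows "(\<integral>z. f (r *\<^sub>R z) * cnj (h z) \<partial>nu \<alpha>) = (\<integral>z. f z * cnj (h (r *\<^sub>R z)) \<partial>nu \<alpha>)"
proof -
  define N where "N = real CARD('n) + 1 + \<alpha>"
  have N: "N \<ge> 0" using dim_exponent_pos[OF al, where 'n='n] by (simp add: N_def)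
  have rb: "r *\<^sub>R z \<in> ball 0 1" if "z \<in> ball 0 1" for z :: "complex ^ 'n" using dilate_in_ball[OF that] r by auto
  let ?K = "\<lambda>(\<xi>, z). (f z * cnj (h \<xi>)) * bk N (r *\<^sub>R \<xi>) z"
  have Km: "?K \<in> borel_measurable (nu \<alpha> \<Otimes>\<^sub>M nu \<alpha>)"
  proof -
    have "f \<in> borel_measurable (nu \<alpha>)" "h \<in> borel_measurable (nu \<alpha>)" using f h by auto
    then show ?thesis using measurable_bk_pair[OF r(1) less_imp_le[OF r(2)], of N \<alpha> \<alpha>] unfolding split_beta' by measurable
  qed
  have kb: "norm (bk N (r *\<^sub>R \<xi>) z) \<le> (1 - r) powr - N" if "\<xi> \<in> ball 0 1" "z \<in> ball 0 1" for \<xi> z :: "complex ^ 'n"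
  proof -
    have "norm (bk N (r *\<^sub>R \<xi>) z) \<le> (1 - norm (r *\<^sub>R \<xi>)) powr - N" using that rb N by (intro norm_bk_le) auto
    also have "... \<le> (1 - r) powr - N" using that r N mult_left_le[of "norm \<xi>" r] by (intro powr_mono2') auto
    finally show ?thesis .
  qed
  have fin: "(\<integral>\<^sup>+\<xi>. \<integral>\<^sup>+z. ennreal (norm (?K (\<xi>, z))) \<partial>nu \<alpha> \<partial>nu \<alpha>) < \<infinity>"
  proof -
    have "(\<integral>\<^sup>+\<xi>. \<integral>\<^sup>+z. ennreal (norm (?K (\<xi>, z))) \<partial>nu \<alpha> \<partial>nu \<alpha>)
      \<le> (\<integral>\<^sup>+\<xi>. \<integral>\<^sup>+z. ennreal ((1 - r) powr - N) * ennreal (norm (h \<xi>)) * ennreal (norm (f z)) \<partial>nu \<alpha> \<partial>nu \<alpha>)"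
    proof (intro nn_integral_mono)
      fix \<xi> z :: "complex ^ 'n" assume "\<xi> \<in> space (nu \<alpha>)" "z \<in> space (nu \<alpha>)"
      then have "norm (?K (\<xi>, z)) \<le> norm (f z) * norm (h \<xi>) * (1 - r) powr - N"
        using kb[of \<xi> z] by (auto simp: norm_mult intro!: mult_left_mono)
      also have "... = (1 - r) powr - N * norm (h \<xi>) * norm (f z)" by simp
      finally show "ennreal (norm (?K (\<xi>, z))) \<le> ennreal ((1 - r) powr - N) * ennreal (norm (h \<xi>)) * ennreal (norm (f z))"
        by (simp flip: ennreal_mult add: ennreal_leI)
    qed
    also have "... = ennreal ((1 - r) powr - N) * (\<integral>\<^sup>+\<xi>. ennreal (norm (h \<xi>)) \<partial>nu \<alpha>) * (\<integral>\<^sup>+z. ennreal (norm (f z)) \<partial>nu \<alpha>)"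
      using f(1) h(1) by (simp add: nn_integral_cmult nn_integral_multc)
    also have "... < \<infinity>" using f(1) h(1) unfolding integrable_iff_bounded by (simp add: ennreal_mult_less_top)
    finally show ?thesis .
  qed
  have "(\<integral>z. f (r *\<^sub>R z) * cnj (h z) \<partial>nu \<alpha>) = (\<integral>\<xi>. \<integral>z. ?K (\<xi>, z) \<partial>nu \<alpha> \<partial>nu \<alpha>)"
  proof (rule Bochner_Integration.integral_cong)
    fix \<xi> :: "complex ^ 'n" assume "\<xi> \<in> space (nu \<alpha>)"
    then have "f (r *\<^sub>R \<xi>) = (\<integral>z. f z * bk N (r *\<^sub>R \<xi>) z \<partial>nu \<alpha>)"
      using bergman_reproducing[OF al f, of "r *\<^sub>R \<xi>"] rb[of \<xi>] by (simp add: N_def)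
    then have "f (r *\<^sub>R \<xi>) * cnj (h \<xi>) = (\<integral>z. (f z * bk N (r *\<^sub>R \<xi>) z) * cnj (h \<xi>) \<partial>nu \<alpha>)" by simp
    also have "... = (\<integral>z. ?K (\<xi>, z) \<partial>nu \<alpha>)" by (simp only: mult_ac prod.case)
    finally show "f (r *\<^sub>R \<xi>) * cnj (h \<xi>) = (\<integral>z. ?K (\<xi>, z) \<partial>nu \<alpha>)" .
  qed simp
  also have "... = (\<integral>z. \<integral>\<xi>. ?K (\<xi>, z) \<partial>nu \<alpha> \<partial>nu \<alpha>)"
    by (rule nu_Fubini[OF al al Km fin])
  also have "... = (\<integral>z. f z * cnj (h (r *\<^sub>R z)) \<partial>nu \<alpha>)"
  proof (rule Bochner_Integration.integral_cong)
    fix z :: "complex ^ 'n" assume "z \<in> space (nu \<alpha>)"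
    then have z: "z \<in> ball 0 1" by simp
    have "cnj (h (r *\<^sub>R z)) = cnj (\<integral>\<xi>. h \<xi> * bk N (r *\<^sub>R z) \<xi> \<partial>nu \<alpha>)"
      using bergman_reproducing[OF al h, of "r *\<^sub>R z"] rb[of z] z by (simp add: N_def)
    also have "... = (\<integral>\<xi>. cnj (h \<xi> * bk N (r *\<^sub>R z) \<xi>) \<partial>nu \<alpha>)" by (rule Bochner_Integration.integral_cnj[symmetric])
    also have "... = (\<integral>\<xi>. cnj (h \<xi>) * bk N (r *\<^sub>R \<xi>) z \<partial>nu \<alpha>)"
    proof (rule Bochner_Integration.integral_cong)
      fix \<xi> :: "complex ^ 'n" assume "\<xi> \<in> space (nu \<alpha>)"
      then have "norm (r *\<^sub>R z) * norm \<xi> < 1" using rb[OF z] by (intro norm_mult_ball_less) auto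
      then have "cnj (bk N (r *\<^sub>R z) \<xi>) = bk N \<xi> (r *\<^sub>R z)" by (rule cnj_bk)
      also have "... = bk N (r *\<^sub>R \<xi>) z" by (simp add: bk_def cinner_scaleR_left cinner_scaleR_right)
      finally show "cnj (h \<xi> * bk N (r *\<^sub>R z) \<xi>) = cnj (h \<xi>) * bk N (r *\<^sub>R \<xi>) z" by simp
    qed simp
    finally have "f z * cnj (h (r *\<^sub>R z)) = (\<integral>\<xi>. f z * (cnj (h \<xi>) * bk N (r *\<^sub>R \<xi>) z) \<partial>nu \<alpha>)" by simp
    then show "(\<integral>\<xi>. ?K (\<xi>, z) \<partial>nu \<alpha>) = f z * cnj (h (r *\<^sub>R z))" by (simp only: prod.case mult.assoc)
  qed simp
  finally show ?thesis .
qed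


section \<open>Radial derivatives\<close>

lemma vec_eq_sum_axis: "(z :: complex ^ 'n) = (\<Sum>j\<in>UNIV. z $ j *s axis j 1)"
proof -
  have "(\<Sum>j\<in>UNIV. z $ j * (axis j 1 :: complex ^ 'n) $ i) = z $ i" for i
  proof -
    have "(\<Sum>j\<in>UNIV. z $ j * (axis j 1 :: complex ^ 'n) $ i) = (\<Sum>j\<in>UNIV. if j = i then z $ j else 0)"
      by (intro sum.cong) (auto simp: axis_def)
    then show ?thesis by simp
  qed
  then show ?thesis by (simp add: vec_eq_iff)
qed

lemma radial_deriv_eq:
  assumes D: "(f has_derivative D) (at (z :: complex ^ 'n))" "\<And>c v. D (c *s v) = c * D v"
  shows "radial_deriv f z = D z"
proof -
  have "deriv (\<lambda>w. f (z + axis j w)) 0 = D (axis j 1)" for j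
  proof -
    have ax: "axis j w = w *s (axis j 1 :: complex ^ 'n)" for w by (simp add: vec_eq_iff axis_def)
    have "((\<lambda>l. z + l *s axis j 1) has_derivative (\<lambda>h. h *s axis j 1)) (at 0)"
      using has_derivative_add[OF has_derivative_const bounded_linear_imp_has_derivative[OF bounded_linear_smult_left]] by simp
    moreover have "(f has_derivative D) (at (z + 0 *s axis j 1))" using D(1) by simp
    ultimately have "((\<lambda>l. f (z + l *s axis j 1)) has_derivative (\<lambda>h. D (h *s axis j 1))) (at 0)"
      by (rule has_derivative_compose)
    then have "((\<lambda>l. f (z + l *s axis j 1)) has_field_derivative D (axis j 1)) (at 0)"
      by (simp add: D(2) has_field_derivative_def mult_commute_abs)
    moreover have "(\<lambda>l. f (z + axis j l)) = (\<lambda>l. f (z + l *s axis j 1))" by (rule ext) (subst ax, rule refl)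
    ultimately have "((\<lambda>w. f (z + axis j w)) has_field_derivative D (axis j 1)) (at 0)" by (simp only:)
    then show ?thesis by (rule DERIV_imp_deriv)
  qed
  then have "radial_deriv f z = (\<Sum>j\<in>UNIV. z $ j * D (axis j 1))" by (simp add: radial_deriv_def)
  also have "... = (\<Sum>j\<in>UNIV. D (z $ j *s axis j 1))" by (simp add: D(2))
  also have "... = D (\<Sum>j\<in>UNIV. z $ j *s axis j 1)" using has_derivative_linear[OF D(1)] by (rule linear_sum[symmetric])
  also have "... = D z" using vec_eq_sum_axis[of z] by simp
  finally show ?thesis .
qed

lemma radial_deriv_cong:
  assumes "\<And>w. w \<in> ball 0 1 \<Longrightarrow> f w = g w" and z: "(z :: complex ^ 'n) \<in> ball 0 1"
    and f: "holomorphic_ball f"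
  shows "radial_deriv f z = radial_deriv g z"
proof -
  obtain D where D: "(f has_derivative D) (at z)" "\<And>c v. D (c *s v) = c * D v" using f z unfolding holomorphic_ball_def by blast
  have "(g has_derivative D) (at z)" using D(1) open_ball z assms(1) by (rule has_derivative_transform_within_open)
  then show ?thesis using radial_deriv_eq[OF D] radial_deriv_eq[of g D z] D(2) by simp
qed

lemma radial_deriv_sum:
  assumes "\<And>i. i \<in> I \<Longrightarrow> holomorphic_ball (f i)" and z: "(z :: complex ^ 'n) \<in> ball 0 1"
  shows "radial_deriv (\<lambda>z. \<Sum>i\<in>I. c i * f i z) z = (\<Sum>i\<in>I. c i * radial_deriv (f i) z)"
proof -
  have "\<forall>i\<in>I. \<exists>D. (f i has_derivative D) (at z) \<and> (\<forall>c v. D (c *s v) = c * D v)"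
    using assms unfolding holomorphic_ball_def by blast
  from bchoice[OF this] obtain D where D: "\<And>i. i \<in> I \<Longrightarrow> (f i has_derivative D i) (at z)" "\<And>i c v. i \<in> I \<Longrightarrow> D i (c *s v) = c * D i v"
    by auto
  have "((\<lambda>z. \<Sum>i\<in>I. c i * f i z) has_derivative (\<lambda>v. \<Sum>i\<in>I. c i * D i v)) (at z)"
    by (intro has_derivative_sum has_derivative_mult_right D(1))
  then have "radial_deriv (\<lambda>z. \<Sum>i\<in>I. c i * f i z) z = (\<Sum>i\<in>I. c i * D i z)"
    by (rule radial_deriv_eq) (simp add: D(2) sum_distrib_left mult.left_commute)
  also have "... = (\<Sum>i\<in>I. c i * radial_deriv (f i) z)" by (intro sum.cong) (simp_all add: radial_deriv_eq[OF D])
  finally show ?thesis .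
qed

lemma radial_deriv_funpow_cong:
  assumes "\<And>w. w \<in> ball 0 1 \<Longrightarrow> f w = g w" and hol: "\<And>i. holomorphic_ball ((radial_deriv ^^ i) f)"
    and z: "(z :: complex ^ 'n) \<in> ball 0 1"
  shows "(radial_deriv ^^ i) f z = (radial_deriv ^^ i) g z"
  using z
proof (induction i arbitrary: z)
  case 0 then show ?case using assms(1) by simp
next
  case (Suc i)
  then show ?case using radial_deriv_cong[of "(radial_deriv ^^ i) f" "(radial_deriv ^^ i) g" z] hol[of i] by simp
qed

section \<open>Functionals on bounded holomorphic functions, tested on kernels\<close>

lemma has_derivative_quadratic_remainder:
  fixes f :: "'a::real_normed_vector \<Rightarrow> 'b::real_normed_vector"
  assumes D: "bounded_linear D" and d: "d > 0"
    and rem: "\<And>h. norm h < d \<Longrightarrow> norm (f (x + h) - f x - D h) \<le> C * (norm h)\<^sup>2"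
  shows "(f has_derivative D) (at x)"
  unfolding has_derivative_at
proof
  show "(\<lambda>h. norm (f (x + h) - f x - D h) / norm h) \<midarrow>0\<rightarrow> 0"
  proof (rule Lim_null_comparison)
    show "\<forall>\<^sub>F h in at 0. norm (norm (f (x + h) - f x - D h) / norm h) \<le> C * norm h" unfolding eventually_at
    proof (intro exI[of _ d] conjI d ballI impI)
      fix h :: 'a assume h: "h \<noteq> 0 \<and> dist h 0 < d"
      then have "norm (f (x + h) - f x - D h) \<le> C * norm h * norm h" using rem[of h] by (simp add: power2_eq_square mult.assoc)
      then show "norm (norm (f (x + h) - f x - D h) / norm h) \<le> C * norm h" using h by (simp add: divide_le_eq)
    qed
    show "(\<lambda>h. C * norm h) \<midarrow>0\<rightarrow> 0" by (auto intro!: tendsto_eq_intros)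
  qed
qed (rule D)

text \<open>Uniformity over the disc of radius \<rho> is the point: it bounds the remainder of the
  kernel in the sup norm over z, so that a functional can be applied to it.\<close>

lemma one_minus_powr_Taylor:
  fixes \<rho> s :: real
  assumes \<rho>: "0 \<le> \<rho>" "\<rho> < 1" and x: "norm (x::complex) \<le> \<rho>" and y: "norm y \<le> \<rho>" and s: "s \<ge> 0"
  shows "norm ((1 - y) powr of_real (- s) - (1 - x) powr of_real (- s) - of_real s * (1 - x) powr of_real (- (s + 1)) * (y - x))
     \<le> s * (s + 1) * (1 - \<rho>) powr - (s + 2) * (norm (y - x))\<^sup>2"
proof -
  define f where "f i z = (if i = 0 then (1 - z) powr of_real (- s) else if i = Suc 0 then of_real s * (1 - z) powr of_real (- (s + 1))
    else of_real (s * (s + 1)) * (1 - z) powr of_real (- (s + 2)))" for i :: nat and z :: complex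
  have nr: "1 - z \<notin> \<real>\<^sub>\<le>\<^sub>0" if "z \<in> cball 0 \<rho>" for z :: complex
    using Re_one_minus_pos[of z] that \<rho> by (auto simp: complex_nonpos_Reals_iff)
  have d: "((\<lambda>z. (1 - z) powr of_real (- t)) has_field_derivative of_real t * (1 - z) powr of_real (- (t + 1))) (at z within S)"
    if "z \<in> cball 0 \<rho>" for z :: complex and S t
  proof -
    have "((\<lambda>z. (1 - z) powr of_real (- t)) has_field_derivative (of_real (- t) * (1 - z) powr (of_real (- t) - 1)) * (- 1)) (at z within S)"
      by (rule DERIV_chain2[of "\<lambda>x. x powr of_real (- t)"])
         (use nr[OF that] in \<open>auto intro!: has_field_derivative_powr derivative_eq_intros\<close>)
    moreover have "of_real (- t) - 1 = complex_of_real (- (t + 1))" by simp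
    ultimately show ?thesis by simp
  qed
  have "norm (f 0 y - (\<Sum>i\<le>Suc 0. f i x * (y - x) ^ i / fact i)) \<le> (s * (s + 1) * (1 - \<rho>) powr - (s + 2)) * norm (y - x) ^ (Suc (Suc 0)) / fact (Suc 0)"
  proof (rule complex_Taylor[where S = "cball 0 \<rho>"])
    show "(f i has_field_derivative f (Suc i) z) (at z within cball 0 \<rho>)" if "z \<in> cball 0 \<rho>" "i \<le> Suc 0" for i z
    proof (cases "i = 0")
      case True
      then show ?thesis using d[OF that(1), of s] unfolding f_def by simp
    next
      case False
      then have i: "i = Suc 0" using that by simp
      have "((\<lambda>z. of_real s * (1 - z) powr of_real (- (s + 1))) has_field_derivative of_real s * (of_real (s + 1) * (1 - z) powr of_real (- (s + 1 + 1)))) (at z within cball 0 \<rho>)"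
        by (intro DERIV_cmult d that)
      moreover have "f (Suc 0) = (\<lambda>z. of_real s * (1 - z) powr of_real (- (s + 1)))" by (simp add: f_def fun_eq_iff)
      moreover have "- (s + 1 + 1) = - (s + 2)" by simp
      then have "f (Suc (Suc 0)) z = of_real s * (of_real (s + 1) * (1 - z) powr of_real (- (s + 1 + 1)))"
        by (simp only: f_def of_real_mult mult.assoc) simp
      ultimately show ?thesis unfolding i by (simp only:)
    qed
    fix z :: complex assume z: "z \<in> cball 0 \<rho>"
    have nz: "1 - z \<noteq> 0" using nr[OF z] by auto
    have "1 - \<rho> \<le> norm (1 - z)" using z norm_triangle_ineq2[of 1 z] by simp
    then have "norm (1 - z) powr - (s + 2) \<le> (1 - \<rho>) powr - (s + 2)" using \<rho> s by (intro powr_mono2') auto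
    moreover have "norm (f (Suc (Suc 0)) z) = s * (s + 1) * norm (1 - z) powr - (s + 2)"
    proof -
      have "f (Suc (Suc 0)) z = of_real (s * (s + 1)) * (1 - z) powr of_real (- (s + 2))" by (simp add: f_def)
      then have "norm (f (Suc (Suc 0)) z) = \<bar>s * (s + 1)\<bar> * norm (1 - z) powr - (s + 2)"
        using norm_powr_of_real[OF nz, of "- (s + 2)"] by (simp only: norm_mult norm_of_real)
      then show ?thesis using s by simp
    qed
    ultimately show "norm (f (Suc (Suc 0)) z) \<le> s * (s + 1) * (1 - \<rho>) powr - (s + 2)" using s by (simp add: mult_left_mono)
  qed (use x y in auto)
  then show ?thesis unfolding f_def by (simp add: power2_eq_square diff_diff_eq)
qed

text \<open>Two kinds of L occur: integration against a conjugate symbol, and a bounded functional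
  on a Bergman-Orlicz space. Linearity on bounded functions and a sup norm bound are common to both
  and suffice to differentiate along kernels.\<close>

locale bounded_hol_functional =
  fixes L :: "(complex ^ 'n \<Rightarrow> complex) \<Rightarrow> complex" and B :: real
  assumes add: "\<And>f g. holomorphic_ball f \<Longrightarrow> bounded (f ` ball 0 1) \<Longrightarrow> holomorphic_ball g \<Longrightarrow> bounded (g ` ball 0 1) \<Longrightarrow>
      L (\<lambda>z. f z + g z) = L f + L g"
    and cmult: "\<And>f c. holomorphic_ball f \<Longrightarrow> bounded (f ` ball 0 1) \<Longrightarrow> L (\<lambda>z. c * f z) = c * L f"
    and bound: "\<And>f M. holomorphic_ball f \<Longrightarrow> (\<And>z. z \<in> ball 0 1 \<Longrightarrow> norm (f z) \<le> M) \<Longrightarrow> norm (L f) \<le> B * M"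
begin

text \<open>The kernel is antiholomorphic in w, and the conjugate makes \<open>E s\<close>
  holomorphic. For integration against the conjugate of g it is \<open>bk_transform\<close>.\<close>

definition E :: "real \<Rightarrow> complex ^ 'n \<Rightarrow> complex" where
  "E s w = cnj (L (\<lambda>z. bk s z w))"

lemma bounded_bk: "w \<in> ball 0 1 \<Longrightarrow> s \<ge> 0 \<Longrightarrow> bounded ((\<lambda>z. bk s z w) ` ball 0 1)"
  unfolding bounded_iff using norm_bk_le' by blast

lemma hol_bk: "w \<in> ball 0 1 \<Longrightarrow> holomorphic_ball (\<lambda>z. bk s z w)"
  by (rule hol_ball_bk) simp

text \<open>The candidate for the derivative of \<open>E s\<close>, with L applied to the derivative
  of the kernel in w. Conjugation turns its antilinear dependence on v into a linear one.\<close>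

definition dE :: "real \<Rightarrow> complex ^ 'n \<Rightarrow> complex ^ 'n \<Rightarrow> complex" where
  "dE s w v = of_real s * cnj (L (\<lambda>z. cinner z v * bk (s + 1) z w))"

lemma bounded_mult_images:
  assumes "bounded (f ` S)" "bounded (g ` S)"
  shows "bounded ((\<lambda>z. f z * g z :: complex) ` S)"
proof -
  obtain a where "\<And>z. z \<in> S \<Longrightarrow> norm (f z) \<le> a" using assms(1) unfolding bounded_iff by auto
  moreover obtain b where "\<And>z. z \<in> S \<Longrightarrow> norm (g z) \<le> b" using assms(2) unfolding bounded_iff by auto
  ultimately have "norm (f z * g z) \<le> a * b" if "z \<in> S" for z
    unfolding norm_mult using that by (intro mult_mono) (auto intro: order_trans[OF norm_ge_zero])
  then show ?thesis unfolding bounded_iff by blast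
qed

lemma bounded_cinner: "bounded ((\<lambda>z. cinner z (v :: complex ^ 'n)) ` ball 0 1)"
  unfolding bounded_iff
proof (intro exI[of _ "norm v"] ballI, clarify)
  fix z :: "complex ^ 'n" assume "z \<in> ball 0 1"
  then show "norm (cinner z v) \<le> norm v" using norm_cinner_le[of z v] mult_left_le_one_le[of "norm v" "norm z"] by auto
qed

lemma hol_cinner_bk: "w \<in> ball 0 1 \<Longrightarrow> holomorphic_ball (\<lambda>z. cinner z v * bk s z w)"
  by (intro hol_ball_mult hol_ball_cinner hol_bk)

lemma bounded_cinner_bk: "w \<in> ball 0 1 \<Longrightarrow> s \<ge> 0 \<Longrightarrow> bounded ((\<lambda>z. cinner z v * bk s z (w :: complex ^ 'n)) ` ball 0 1)"
  by (intro bounded_mult_images bounded_cinner bounded_bk)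

lemma dE_smult:
  assumes "w \<in> ball 0 1" "s \<ge> 0"
  shows "dE s w (c *s v) = c * dE s w v"
proof -
  have "(\<lambda>z. cinner z (c *s v) * bk (s + 1) z w) = (\<lambda>z. cnj c * (cinner z v * bk (s + 1) z w))"
    by (simp add: cinner_scale_right mult.assoc)
  then show ?thesis unfolding dE_def
    using cmult[OF hol_cinner_bk[OF assms(1), of v "s + 1"] bounded_cinner_bk[OF assms(1), of "s + 1" v], of "cnj c"] assms by simp
qed

lemma dE_add:
  assumes "w \<in> ball 0 1" "s \<ge> 0"
  shows "dE s w (u + v) = dE s w u + dE s w v"
proof -
  have "(\<lambda>z. cinner z (u + v) * bk (s + 1) z w) = (\<lambda>z. cinner z u * bk (s + 1) z w + cinner z v * bk (s + 1) z w)"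
    by (simp add: cinner_add_right distrib_right)
  then show ?thesis unfolding dE_def using add[OF hol_cinner_bk[OF assms(1), of u "s + 1"] bounded_cinner_bk[OF assms(1), of "s + 1" u]
        hol_cinner_bk[OF assms(1), of v "s + 1"] bounded_cinner_bk[OF assms(1), of "s + 1" v]] assms
    by (simp add: distrib_left)
qed

lemma bounded_linear_dE:
  assumes w: "w \<in> ball 0 1" and s: "s \<ge> 0"
  shows "bounded_linear (dE s w)"
proof (rule bounded_linear_intro[where K = "s * (B * ((1 - norm w) powr - (s + 1)))"])
  show "dE s w (u + v) = dE s w u + dE s w v" for u v by (rule dE_add[OF w s])
  show "dE s w (r *\<^sub>R v) = r *\<^sub>R dE s w v" for r v by (simp add: scaleR_eq_smult dE_smult[OF w s] scaleR_conv_of_real)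
  fix v
  have "norm (L (\<lambda>z. cinner z v * bk (s + 1) z w)) \<le> B * (norm v * (1 - norm w) powr - (s + 1))"
  proof (rule bound[OF hol_cinner_bk[OF w]])
    fix z :: "complex ^ 'n" assume z: "z \<in> ball 0 1"
    have "norm (cinner z v) \<le> norm v" using z norm_cinner_le[of z v] mult_left_le_one_le[of "norm v" "norm z"] by auto
    then show "norm (cinner z v * bk (s + 1) z w) \<le> norm v * (1 - norm w) powr - (s + 1)"
      unfolding norm_mult using z w s by (intro mult_mono norm_bk_le') auto
  qed
  then have "s * norm (L (\<lambda>z. cinner z v * bk (s + 1) z w)) \<le> s * (B * (norm v * (1 - norm w) powr - (s + 1)))"
    using s by (rule mult_left_mono)
  then show "norm (dE s w v) \<le> norm v * (s * (B * ((1 - norm w) powr - (s + 1))))"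
    using s unfolding dE_def by (simp add: norm_mult mult_ac)
qed

text \<open>The Taylor remainder of the kernel in w is O(|h|^2) uniformly in z, so its image under L
  is O(|h|^2). The radius \<rho> midway between |w| and 1 keeps w + h away from the sphere.\<close>

lemma E_has_derivative:
  assumes w: "w \<in> ball 0 1" and s: "s \<ge> 0"
  shows "(E s has_derivative dE s w) (at w)"
proof -
  define \<rho> where "\<rho> = (1 + norm w) / 2"
  have \<rho>: "0 \<le> \<rho>" "\<rho> < 1" "norm w < \<rho>" using w by (auto simp: \<rho>_def)
  define K where "K = s * (s + 1) * (1 - \<rho>) powr - (s + 2)"
  have K0: "K \<ge> 0" using s by (simp add: K_def)
  show ?thesis
  proof (rule has_derivative_quadratic_remainder[OF bounded_linear_dE[OF w s], of "\<rho> - norm w" _ _ "B * K"])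
    show "\<rho> - norm w > 0" using \<rho> by simp
    fix h :: "complex ^ 'n" assume "norm h < \<rho> - norm w"
    then have wh: "norm (w + h) < \<rho>" using norm_triangle_ineq[of w h] by simp
    then have whb: "w + h \<in> ball 0 1" using \<rho> by simp
    let ?r = "\<lambda>z. bk s z (w + h) + (- 1) * (bk s z w + of_real s * (cinner z h * bk (s + 1) z w))"
    have h1: "holomorphic_ball (\<lambda>z. of_real s * (cinner z h * bk (s + 1) z w))" by (intro hol_ball_cmult hol_cinner_bk w)
    have b1: "bounded ((\<lambda>z. of_real s * (cinner z h * bk (s + 1) z w)) ` ball 0 1)"
      using s by (intro bounded_mult_images[OF _ bounded_cinner_bk[OF w]]) (auto simp: bounded_iff)
    have h2: "holomorphic_ball (\<lambda>z. bk s z w + of_real s * (cinner z h * bk (s + 1) z w))" by (intro hol_ball_add hol_bk w h1)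
    have b2: "bounded ((\<lambda>z. bk s z w + of_real s * (cinner z h * bk (s + 1) z w)) ` ball 0 1)"
      using bounded_plus_comp[OF bounded_bk[OF w s] b1] .
    have h3: "holomorphic_ball (\<lambda>z. (- 1) * (bk s z w + of_real s * (cinner z h * bk (s + 1) z w)))" by (rule hol_ball_cmult[OF h2])
    have b3: "bounded ((\<lambda>z. (- 1) * (bk s z w + of_real s * (cinner z h * bk (s + 1) z w))) ` ball 0 1)"
      by (rule bounded_mult_images[OF _ b2]) (auto simp: bounded_iff)
    have "L ?r = L (\<lambda>z. bk s z (w + h)) + L (\<lambda>z. (- 1) * (bk s z w + of_real s * (cinner z h * bk (s + 1) z w)))"
      by (rule add[OF hol_bk[OF whb] bounded_bk[OF whb s] h3 b3])
    also have "L (\<lambda>z. (- 1) * (bk s z w + of_real s * (cinner z h * bk (s + 1) z w))) = (- 1) * L (\<lambda>z. bk s z w + of_real s * (cinner z h * bk (s + 1) z w))"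
      by (rule cmult[OF h2 b2])
    also have "L (\<lambda>z. bk s z w + of_real s * (cinner z h * bk (s + 1) z w)) = L (\<lambda>z. bk s z w) + L (\<lambda>z. of_real s * (cinner z h * bk (s + 1) z w))"
      by (rule add[OF hol_bk[OF w] bounded_bk[OF w s] h1 b1])
    also have "L (\<lambda>z. of_real s * (cinner z h * bk (s + 1) z w)) = of_real s * L (\<lambda>z. cinner z h * bk (s + 1) z w)"
      using s by (intro cmult hol_cinner_bk bounded_cinner_bk w) auto
    finally have "cnj (L ?r) = E s (w + h) - E s w - dE s w h" unfolding E_def dE_def by simp
    then have "norm (E s (w + h) - E s w - dE s w h) = norm (cnj (L ?r))" by (simp only:)
    also have "... = norm (L ?r)" by (rule complex_mod_cnj)
    also have "... \<le> B * (K * (norm h)\<^sup>2)"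
    proof (rule bound)
      show "holomorphic_ball ?r" by (intro hol_ball_add hol_bk whb h3)
      fix z :: "complex ^ 'n" assume z: "z \<in> ball 0 1"
      have c: "norm (cinner z v) \<le> norm v" for v using z norm_cinner_le[of z v] mult_left_le_one_le[of "norm v" "norm z"] by auto
      have "norm (?r z) = norm ((1 - cinner z (w + h)) powr of_real (- s) - (1 - cinner z w) powr of_real (- s)
          - of_real s * (1 - cinner z w) powr of_real (- (s + 1)) * (cinner z (w + h) - cinner z w))"
        unfolding bk_def by (simp add: cinner_add_right algebra_simps)
      also have "... \<le> K * (norm (cinner z (w + h) - cinner z w))\<^sup>2"
        unfolding K_def using \<rho> wh c[of w] c[of "w + h"] s by (intro one_minus_powr_Taylor) auto
      also have "... \<le> K * (norm h)\<^sup>2" using c[of h] K0 by (intro mult_left_mono power_mono) (auto simp: cinner_add_right)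
      finally show "norm (?r z) \<le> K * (norm h)\<^sup>2" .
    qed
    finally show "norm (E s (w + h) - E s w - dE s w h) \<le> B * K * (norm h)\<^sup>2" by (simp add: mult.assoc)
  qed
qed

lemma hol_ball_E: "s \<ge> 0 \<Longrightarrow> holomorphic_ball (E s)"
  unfolding holomorphic_ball_def using E_has_derivative dE_smult by blast

text \<open>On the ball \<open>cinner z w * bk (s + 1) z w = bk (s + 1) z w - bk s z w\<close>, so a
  radial derivative raises the exponent of the kernel by one, up to a lower term.\<close>

lemma radial_deriv_E:
  assumes w: "w \<in> ball 0 1" and s: "s \<ge> 0"
  shows "radial_deriv (E s) w = of_real s * (E (s + 1) w - E s w)"
proof -
  have "(\<lambda>z. bk (s + 1) z w) = (\<lambda>z. bk (s + 1) z w)" ..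
  have "L (\<lambda>z. cinner z w * bk (s + 1) z w) = L (\<lambda>z. bk (s + 1) z w + (- 1) * bk s z w)"
  proof -
    \<comment> \<open>The identity of kernels holds on the ball only; the bound with M = 0 shows
      that L does not see the difference.\<close>
    have "norm (L (\<lambda>z. cinner z w * bk (s + 1) z w + (- 1) * (bk (s + 1) z w + (- 1) * bk s z w))) \<le> B * 0"
    proof (rule bound)
      show "holomorphic_ball (\<lambda>z. cinner z w * bk (s + 1) z w + (- 1) * (bk (s + 1) z w + (- 1) * bk s z w))"
        by (intro hol_ball_add hol_ball_cmult hol_cinner_bk hol_bk w)
      fix z :: "complex ^ 'n" assume z: "z \<in> ball 0 1"
      have nz: "1 - cinner z w \<noteq> 0" using norm_cinner_less_1[OF norm_mult_ball_less[of z w]] z w by auto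
      have "bk s z w = (1 - cinner z w) powr (1 + of_real (- (s + 1)))" by (simp add: bk_def)
      also have "... = (1 - cinner z w) * bk (s + 1) z w" unfolding powr_add bk_def using nz by (simp add: powr_to_1)
      finally show "norm (cinner z w * bk (s + 1) z w + (- 1) * (bk (s + 1) z w + (- 1) * bk s z w)) \<le> 0" by (simp add: algebra_simps)
    qed
    then have "L (\<lambda>z. cinner z w * bk (s + 1) z w + (- 1) * (bk (s + 1) z w + (- 1) * bk s z w)) = 0" by simp
    moreover have h1: "holomorphic_ball (\<lambda>z. bk (s + 1) z w + (- 1) * bk s z w)" by (intro hol_ball_add hol_ball_cmult hol_bk w)
    moreover have bm: "bounded ((\<lambda>z. - 1 * f z) ` ball 0 1)" if "bounded (f ` ball 0 1)" for f :: "complex ^ 'n \<Rightarrow> complex"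
      by (rule bounded_mult_images[OF _ that]) (auto simp: bounded_iff)
    moreover have b1: "bounded ((\<lambda>z. bk (s + 1) z w + (- 1) * bk s z w) ` ball 0 1)"
      using s by (intro bounded_plus_comp bm bounded_bk w) auto
    ultimately have "L (\<lambda>z. cinner z w * bk (s + 1) z w) + (- 1) * L (\<lambda>z. bk (s + 1) z w + (- 1) * bk s z w) = 0"
      using add[OF hol_cinner_bk[OF w] bounded_cinner_bk[OF w] hol_ball_cmult[OF h1] bm[OF b1], of "s + 1" w] s
        cmult[OF h1 b1, of "- 1"] by simp
    then show ?thesis by simp
  qed
  also have "... = L (\<lambda>z. bk (s + 1) z w) + L (\<lambda>z. (- 1) * bk s z w)"
    using s by (intro add hol_bk bounded_bk w hol_ball_cmult bounded_mult_images) (auto simp: bounded_iff)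
  also have "L (\<lambda>z. (- 1) * bk s z w) = (- 1) * L (\<lambda>z. bk s z w)" using s by (intro cmult hol_bk bounded_bk w) auto
  finally have "dE s w w = of_real s * (E (s + 1) w - E s w)" unfolding dE_def E_def by simp
  then show ?thesis using radial_deriv_eq[OF E_has_derivative[OF w s] dE_smult[OF w s]] by simp
qed

lemma radial_funpow_E:
  assumes s: "s \<ge> 0"
  shows "\<exists>c. \<forall>w\<in>ball 0 1. (radial_deriv ^^ k) (E s) w = (\<Sum>j\<le>k. c j * E (s + real j) w)"
proof (induction k)
  case 0
  show ?case by (intro exI[of _ "\<lambda>_. 1"]) simp
next
  case (Suc k)
  then obtain c where "\<forall>w\<in>ball 0 1. (radial_deriv ^^ k) (E s) w = (\<Sum>j\<le>k. c j * E (s + real j) w)" ..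
  then have c: "\<And>w. w \<in> ball 0 1 \<Longrightarrow> (\<Sum>j\<le>k. c j * E (s + real j) w) = (radial_deriv ^^ k) (E s) w" by simp
  define c' where "c' j = (if j = 0 then 0 else c (j - 1) * of_real (s + real (j - 1))) - (if j \<le> k then c j * of_real (s + real j) else 0)" for j
  have "(radial_deriv ^^ Suc k) (E s) w = (\<Sum>j\<le>Suc k. c' j * E (s + real j) w)" if w: "w \<in> ball 0 1" for w
  proof -
    have hol: "holomorphic_ball (\<lambda>z. \<Sum>j\<le>k. c j * E (s + real j) z)"
      using s by (intro hol_ball_sum hol_ball_cmult hol_ball_E) auto
    have "(radial_deriv ^^ Suc k) (E s) w = radial_deriv (\<lambda>z. \<Sum>j\<le>k. c j * E (s + real j) z) w"
      using radial_deriv_cong[OF c w hol] by simp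
    also have "... = (\<Sum>j\<le>k. c j * radial_deriv (E (s + real j)) w)" using s w by (intro radial_deriv_sum hol_ball_E) auto
    also have "... = (\<Sum>j\<le>k. c j * of_real (s + real j) * E (s + real (Suc j)) w - c j * of_real (s + real j) * E (s + real j) w)"
      using s w by (intro sum.cong) (auto simp: radial_deriv_E algebra_simps)
    also have "... = (\<Sum>j\<le>k. c j * of_real (s + real j) * E (s + real (Suc j)) w) - (\<Sum>j\<le>k. c j * of_real (s + real j) * E (s + real j) w)"
      by (rule sum_subtractf)
    also have "(\<Sum>j\<le>k. c j * of_real (s + real j) * E (s + real (Suc j)) w) = (\<Sum>j\<le>Suc k. (if j = 0 then 0 else c (j - 1) * of_real (s + real (j - 1))) * E (s + real j) w)"
      by (subst sum.atMost_Suc_shift) simp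
    also have "(\<Sum>j\<le>k. c j * of_real (s + real j) * E (s + real j) w) = (\<Sum>j\<le>Suc k. (if j \<le> k then c j * of_real (s + real j) else 0) * E (s + real j) w)"
      by simp
    also have "(\<Sum>j\<le>Suc k. (if j = 0 then 0 else c (j - 1) * of_real (s + real (j - 1))) * E (s + real j) w) - (\<Sum>j\<le>Suc k. (if j \<le> k then c j * of_real (s + real j) else 0) * E (s + real j) w) = (\<Sum>j\<le>Suc k. c' j * E (s + real j) w)"
      unfolding c'_def by (subst sum_subtractf[symmetric]) (simp only: left_diff_distrib)
    finally show ?thesis .
  qed
  then show ?case by blast
qed

lemma hol_ball_radial_funpow_E:
  assumes s: "s \<ge> 0" shows "holomorphic_ball ((radial_deriv ^^ k) (E s))"
proof -
  obtain c where c: "\<And>w. w \<in> ball 0 1 \<Longrightarrow> (radial_deriv ^^ k) (E s) w = (\<Sum>j\<le>k. c j * E (s + real j) w)"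
    using radial_funpow_E[OF s] by blast
  have "holomorphic_ball (\<lambda>w. \<Sum>j\<le>k. c j * E (s + real j) w)" using s by (intro hol_ball_sum hol_ball_cmult hol_ball_E) auto
  then show ?thesis using c hol_ball_cong[of "(radial_deriv ^^ k) (E s)" "\<lambda>w. \<Sum>j\<le>k. c j * E (s + real j) w"] by blast
qed

text \<open>The relation between radial derivatives and raised exponents is triangular. Since s > 0,
  the factors s + m are invertible and it can be solved for the raised exponents.\<close>

lemma E_shift:
  assumes s: "s > 0"
  shows "\<exists>d. \<forall>w\<in>ball 0 1. E (s + real m) w = (\<Sum>i\<le>m. d i * (radial_deriv ^^ i) (E s) w)"
proof (induction m)
  case 0
  show ?case by (intro exI[of _ "\<lambda>_. 1"]) simp
next
  case (Suc m)
  then obtain d where d: "\<And>w. w \<in> ball 0 1 \<Longrightarrow> E (s + real m) w = (\<Sum>i\<le>m. d i * (radial_deriv ^^ i) (E s) w)" by blast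
  define a where "a = complex_of_real (1 / (s + real m))"
  define d' where "d' i = (if i \<le> m then d i else 0) + (if i = 0 then 0 else a * d (i - 1))" for i
  have "E (s + real (Suc m)) w = (\<Sum>i\<le>Suc m. d' i * (radial_deriv ^^ i) (E s) w)" if w: "w \<in> ball 0 1" for w
  proof -
    have sm: "s + real m > 0" using s by simp
    have "a * of_real (s + real m) = 1" using sm unfolding a_def of_real_mult[symmetric] by simp
    then have "a * radial_deriv (E (s + real m)) w = E (s + real m + 1) w - E (s + real m) w"
      using radial_deriv_E[OF w, of "s + real m"] sm by (simp only: mult.assoc[symmetric] less_imp_le) simp
    then have "E (s + real (Suc m)) w = E (s + real m) w + a * radial_deriv (E (s + real m)) w" by (simp add: add.assoc add.commute[of 1])
    also have "radial_deriv (E (s + real m)) w = radial_deriv (\<lambda>w. \<Sum>i\<le>m. d i * (radial_deriv ^^ i) (E s) w) w"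
      using sm by (intro radial_deriv_cong[OF d w] hol_ball_E) auto
    also have "... = (\<Sum>i\<le>m. d i * radial_deriv ((radial_deriv ^^ i) (E s)) w)"
      using s w by (intro radial_deriv_sum hol_ball_radial_funpow_E) auto
    also have "a * ... = (\<Sum>i\<le>Suc m. (if i = 0 then 0 else a * d (i - 1)) * (radial_deriv ^^ i) (E s) w)"
      by (subst sum.atMost_Suc_shift) (simp add: sum_distrib_left mult.assoc)
    also have "E (s + real m) w = (\<Sum>i\<le>Suc m. (if i \<le> m then d i else 0) * (radial_deriv ^^ i) (E s) w)" using d[OF w] by simp
    finally show ?thesis by (simp only: d'_def distrib_right sum.distrib)
  qed
  then show ?case by blast
qed

end

lemma bounded_hol_functional_pairing:
  fixes g :: "complex ^ 'n \<Rightarrow> complex"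
  assumes al: "\<alpha> > -1" and g: "integrable (nu \<alpha>) g"
  shows "bounded_hol_functional (\<lambda>f. \<integral>z. f z * cnj (g z) \<partial>nu \<alpha>) (\<integral>z. norm (g z) \<partial>nu \<alpha>)"
proof -
  have int: "integrable (nu \<alpha>) (\<lambda>z. f z * cnj (g z))" if f: "holomorphic_ball f" "bounded (f ` ball 0 1)" for f
  proof -
    obtain M where "\<And>z. z \<in> ball 0 1 \<Longrightarrow> norm (f z) \<le> M" using f(2) unfolding bounded_iff by blast
    then have "integrable (nu \<alpha>) (\<lambda>z. cnj (g z) * f z)"
      using g hol_ball_measurable[OF f(1)] by (intro integrable_mult_bounded[where B=M]) auto
    then show ?thesis by (simp add: mult.commute)
  qed
  show ?thesis
  proof
    fix f h :: "complex ^ 'n \<Rightarrow> complex"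
    assume f: "holomorphic_ball f" "bounded (f ` ball 0 1)" and h: "holomorphic_ball h" "bounded (h ` ball 0 1)"
    show "(\<integral>z. (f z + h z) * cnj (g z) \<partial>nu \<alpha>) = (\<integral>z. f z * cnj (g z) \<partial>nu \<alpha>) + (\<integral>z. h z * cnj (g z) \<partial>nu \<alpha>)"
      using int[OF f] int[OF h] by (simp add: distrib_right)
  next
    fix f :: "complex ^ 'n \<Rightarrow> complex" and c
    show "(\<integral>z. (c * f z) * cnj (g z) \<partial>nu \<alpha>) = c * (\<integral>z. f z * cnj (g z) \<partial>nu \<alpha>)"
      by (simp add: mult.assoc)
  next
    fix f :: "complex ^ 'n \<Rightarrow> complex" and M
    assume f: "holomorphic_ball f" "\<And>z. z \<in> ball 0 1 \<Longrightarrow> norm (f z) \<le> M"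
    then have "bounded (f ` ball 0 1)" unfolding bounded_iff by blast
    then have "norm (\<integral>z. f z * cnj (g z) \<partial>nu \<alpha>) \<le> (\<integral>z. norm (f z * cnj (g z)) \<partial>nu \<alpha>)"
      using integral_norm_bound by blast
    also have "... \<le> (\<integral>z. norm (g z) * M \<partial>nu \<alpha>)"
    proof (rule integral_mono)
      show "integrable (nu \<alpha>) (\<lambda>z. norm (f z * cnj (g z)))"
        using int[OF f(1) \<open>bounded _\<close>] by (rule integrable_norm)
      show "norm (f z * cnj (g z)) \<le> norm (g z) * M" if "z \<in> space (nu \<alpha>)" for z
        using f(2)[of z] that mult_right_mono[of "norm (f z)" M "norm (g z)"] by (simp add: norm_mult mult.commute)
    qed (use g in auto)
    finally show "norm (\<integral>z. f z * cnj (g z) \<partial>nu \<alpha>) \<le> (\<integral>z. norm (g z) \<partial>nu \<alpha>) * M" by simp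
  qed
qed

lemma E_pairing:
  fixes g :: "complex ^ 'n \<Rightarrow> complex"
  assumes al: "\<alpha> > -1" and g: "integrable (nu \<alpha>) g" and w: "w \<in> ball 0 1"
  shows "bounded_hol_functional.E (\<lambda>f. \<integral>z. f z * cnj (g z) \<partial>nu \<alpha>) s w = bk_transform \<alpha> s g w"
proof -
  interpret bounded_hol_functional "\<lambda>f. \<integral>z. f z * cnj (g z) \<partial>nu \<alpha>" "\<integral>z. norm (g z) \<partial>nu \<alpha>"
    by (rule bounded_hol_functional_pairing[OF al g])
  have "E s w = (\<integral>z. cnj (bk s z w * cnj (g z)) \<partial>nu \<alpha>)"
    unfolding E_def by (rule Bochner_Integration.integral_cnj[symmetric])
  also have "... = (\<integral>z. g z * bk s w z \<partial>nu \<alpha>)"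
  proof (rule Bochner_Integration.integral_cong)
    fix z :: "complex ^ 'n" assume "z \<in> space (nu \<alpha>)"
    then have "norm z * norm w < 1" using w by (intro norm_mult_ball_less) auto
    then show "cnj (bk s z w * cnj (g z)) = g z * bk s w z" by (simp add: cnj_bk)
  qed simp
  finally show ?thesis by (simp add: bk_transform_def)
qed


section \<open>Holomorphy of radial derivatives\<close>

lemma bounded_hol_dilate:
  fixes f :: "complex ^ 'n \<Rightarrow> complex"
  assumes f: "holomorphic_ball f" and r: "0 \<le> r" "r < 1"
  obtains M where "\<And>z. z \<in> ball 0 1 \<Longrightarrow> norm (f (r *\<^sub>R z)) \<le> M"
proof -
  have "compact (f ` cball 0 r)" using r by (intro compact_continuous_image continuous_on_subset[OF hol_ball_imp_continuous_on[OF f]]) auto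
  then have "bounded (f ` cball 0 r)" by (rule compact_imp_bounded)
  then obtain M where M: "\<And>y. y \<in> f ` cball 0 r \<Longrightarrow> norm y \<le> M" unfolding bounded_iff by blast
  show thesis
  proof (rule that)
    fix z :: "complex ^ 'n" assume "z \<in> ball 0 1"
    then have "norm (r *\<^sub>R z) \<le> r" using r mult_left_le[of "norm z" r] by simp
    then show "norm (f (r *\<^sub>R z)) \<le> M" by (intro M imageI) simp
  qed
qed

lemma radial_deriv_dilate:
  fixes f :: "complex ^ 'n \<Rightarrow> complex"
  assumes f: "holomorphic_ball f" and z: "r *\<^sub>R z \<in> ball 0 1"
  shows "radial_deriv (\<lambda>z. f (r *\<^sub>R z)) z = radial_deriv f (r *\<^sub>R z)"
proof -
  obtain D where D: "(f has_derivative D) (at (r *\<^sub>R z))" "\<And>c v. D (c *s v) = c * D v"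
    using f z unfolding holomorphic_ball_def by blast
  have "((\<lambda>z. r *\<^sub>R z) has_derivative (\<lambda>z. r *\<^sub>R z)) (at z)" by (auto intro!: derivative_eq_intros)
  from has_derivative_compose[OF this D(1)]
  have "radial_deriv (\<lambda>z. f (r *\<^sub>R z)) z = D (r *\<^sub>R z)"
    by (rule radial_deriv_eq) (simp add: D(2) scaleR_eq_smult mult.left_commute)
  then show ?thesis using radial_deriv_eq[OF D] by simp
qed

text \<open>\<open>holomorphic_ball\<close> speaks of one derivative only. Near z0 the function f
  is, up to rescaling, the bounded dilate g, which by the reproducing formula for \<alpha> = 0 is
  \<open>E N\<close> of a pairing; its radial derivative is a combination of functions E and hence
  holomorphic.\<close>

lemma hol_ball_radial_deriv:
  fixes f :: "complex ^ 'n \<Rightarrow> complex"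
  assumes f: "holomorphic_ball f"
  shows "holomorphic_ball (radial_deriv f)"
  unfolding holomorphic_ball_def
proof
  fix z0 :: "complex ^ 'n" assume z0: "z0 \<in> ball 0 1"
  define r where "r = (1 + norm z0) / 2"
  have r: "0 < r" "r < 1" "norm z0 < r" using z0 norm_ge_zero[of z0] by (auto simp: r_def simp del: norm_ge_zero)
  define g where "g z = f (r *\<^sub>R z)" for z
  define N where "N = real CARD('n) + 1 + 0"
  have g: "holomorphic_ball g" unfolding g_def using r by (intro hol_ball_dilate f) auto
  obtain M where "\<And>z. z \<in> ball 0 1 \<Longrightarrow> norm (g z) \<le> M"
    unfolding g_def by (rule bounded_hol_dilate[OF f less_imp_le[OF r(1)] r(2)]) blast
  then have int: "integrable (nu 0) g" by (intro integrable_nu_bounded hol_ball_measurable g) auto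
  interpret bounded_hol_functional "\<lambda>h. \<integral>z. h z * cnj (g z) \<partial>nu 0" "\<integral>z. norm (g z) \<partial>nu 0"
    by (rule bounded_hol_functional_pairing[OF _ int]) simp
  have gE: "g z = E N z" if "z \<in> ball 0 1" for z
    using E_pairing[OF _ int that, of N] bergman_reproducing[OF _ int g that] by (simp add: N_def bk_transform_def)
  have "holomorphic_ball (radial_deriv (E N))" using hol_ball_radial_funpow_E[of N 1] by (simp add: N_def)
  then have Rg: "holomorphic_ball (radial_deriv g)"
    using hol_ball_cong[of "radial_deriv g" "radial_deriv (E N)"] radial_deriv_cong[OF gE _ g] by blast
  have inb: "(1 / r) *\<^sub>R z0 \<in> ball 0 1" using r by simp
  then obtain D where D: "(radial_deriv g has_derivative D) (at ((1 / r) *\<^sub>R z0))" "\<And>c v. D (c *s v) = c * D v"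
    using Rg unfolding holomorphic_ball_def by blast
  have "((\<lambda>z. (1 / r) *\<^sub>R z) has_derivative (\<lambda>z. (1 / r) *\<^sub>R z)) (at z0)" by (auto intro!: derivative_eq_intros)
  from has_derivative_compose[OF this D(1)]
  have 1: "((\<lambda>z. radial_deriv g ((1 / r) *\<^sub>R z)) has_derivative (\<lambda>v. D ((1 / r) *\<^sub>R v))) (at z0)" .
  have "(radial_deriv f has_derivative (\<lambda>v. D ((1 / r) *\<^sub>R v))) (at z0)"
  proof (rule has_derivative_transform_within_open[OF 1])
    show "open (ball (0 :: complex ^ 'n) r)" "z0 \<in> ball 0 r" using r by auto
    fix z :: "complex ^ 'n" assume z: "z \<in> ball 0 r"
    have "r *\<^sub>R ((1 / r) *\<^sub>R z) = z" using r by simp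
    moreover have "z \<in> ball 0 1" using z r by simp
    ultimately show "radial_deriv g ((1 / r) *\<^sub>R z) = radial_deriv f z"
      unfolding g_def using radial_deriv_dilate[OF f, of r "(1 / r) *\<^sub>R z"] by simp
  qed
  moreover have "D ((1 / r) *\<^sub>R (c *s v)) = c * D ((1 / r) *\<^sub>R v)" for c v by (simp add: D(2) scaleR_eq_smult mult.left_commute)
  ultimately show "\<exists>D. (radial_deriv f has_derivative D) (at z0) \<and> (\<forall>c v. D (c *s v) = c * D v)" by blast
qed

lemma hol_ball_radial_funpow:
  "holomorphic_ball f \<Longrightarrow> holomorphic_ball ((radial_deriv ^^ i) f)"
  by (induction i) (simp_all add: hol_ball_radial_deriv)

section \<open>Growth functions and their inverses\<close>

lemma growth_nonneg: "growth_function \<Phi> \<Longrightarrow> t \<ge> 0 \<Longrightarrow> \<Phi> t \<ge> 0"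
  unfolding growth_function_def by (metis atLeast_iff image_eqI)

lemma growth_mono: "growth_function \<Phi> \<Longrightarrow> 0 \<le> s \<Longrightarrow> s \<le> t \<Longrightarrow> \<Phi> s \<le> \<Phi> t"
  unfolding growth_function_def mono_on_def by auto

lemma growth_inverse_nonneg: "growth_function \<Phi> \<Longrightarrow> s \<ge> 0 \<Longrightarrow> growth_inverse \<Phi> s \<ge> 0"
  unfolding growth_function_def growth_inverse_def using inv_into_into[of s \<Phi> "{0..}"] by auto

lemma growth_inverse_eq: "growth_function \<Phi> \<Longrightarrow> s \<ge> 0 \<Longrightarrow> \<Phi> (growth_inverse \<Phi> s) = s"
  unfolding growth_function_def growth_inverse_def using f_inv_into_f[of s \<Phi> "{0..}"] by auto

lemma growth_zero: assumes "growth_function \<Phi>" shows "\<Phi> 0 = 0"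
  using growth_nonneg[OF assms, of 0] growth_mono[OF assms, of 0 "growth_inverse \<Phi> 0"]
    growth_inverse_nonneg[OF assms, of 0] growth_inverse_eq[OF assms, of 0] by simp

text \<open>\<open>growth_inverse\<close> chooses preimages, so it is a right inverse of \<Phi>.
  That alone makes it strictly increasing, even where \<Phi> has flat pieces.\<close>

lemma growth_inverse_less:
  assumes "growth_function \<Phi>" "0 \<le> s" "s < t" shows "growth_inverse \<Phi> s < growth_inverse \<Phi> t"
proof (rule ccontr)
  assume "\<not> ?thesis"
  then have "\<Phi> (growth_inverse \<Phi> t) \<le> \<Phi> (growth_inverse \<Phi> s)"
    using assms by (intro growth_mono[OF assms(1)] growth_inverse_nonneg) auto
  then show False using assms by (simp add: growth_inverse_eq)
qed

lemma growth_inverse_mono: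
  "growth_function \<Phi> \<Longrightarrow> 0 \<le> s \<Longrightarrow> s \<le> t \<Longrightarrow> growth_inverse \<Phi> s \<le> growth_inverse \<Phi> t"
  using growth_inverse_less[of \<Phi> s t] by (cases "s = t") auto

lemma growth_inverse_pos: "growth_function \<Phi> \<Longrightarrow> s > 0 \<Longrightarrow> growth_inverse \<Phi> s > 0"
  using growth_inverse_less[of \<Phi> 0 s] growth_inverse_nonneg[of \<Phi> 0] by simp

lemma growth_measurable:
  fixes f :: "'a \<Rightarrow> 'b::real_normed_vector"
  assumes "growth_function \<Phi>" and f: "f \<in> borel_measurable M" and c: "c > 0"
  shows "(\<lambda>x. \<Phi> (norm (f x) / c)) \<in> borel_measurable M"
proof -
  \<comment> \<open>The values of \<Phi> on negative reals are arbitrary; composing with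
    \<open>max 0\<close> gives a function continuous on the whole line.\<close>
  have "continuous_on UNIV (\<lambda>t. \<Phi> (max 0 t))" using assms(1) unfolding growth_function_def
    by (intro continuous_on_compose2[where f = "\<lambda>t. max 0 t" and g = \<Phi> and t = "{0..}"] continuous_intros) auto
  then have "(\<lambda>t. \<Phi> (max 0 t)) \<in> borel_measurable borel" by (rule borel_measurable_continuous_onI)
  moreover have "(\<lambda>x. norm (f x) / c) \<in> borel_measurable M" using f by measurable
  ultimately have "(\<lambda>x. \<Phi> (max 0 (norm (f x) / c))) \<in> borel_measurable M" by (rule measurable_compose[rotated])
  then show ?thesis using c by (simp add: max_def)
qed

text \<open>The properties shared by \<open>\<Phi>\<^sub>1\<close> and by \<Phi>. The latter is
  known through its inverse, from which the type and the antitone quotient can be derived.\<close>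

definition quasi_concave :: "real \<Rightarrow> (real \<Rightarrow> real) \<Rightarrow> bool" where
  "quasi_concave p \<Phi> \<longleftrightarrow> 0 < p \<and> growth_function \<Phi> \<and> growth_lower_type p \<Phi> \<and> antimono_on {0<..} (\<lambda>t. \<Phi> t / t)"

lemma quasi_concave_growth: "quasi_concave p \<Phi> \<Longrightarrow> growth_function \<Phi>"
  by (simp add: quasi_concave_def)

lemma quasi_concave_scale:
  assumes "quasi_concave p \<Phi>" "0 < s" "s \<le> t" shows "s * \<Phi> t \<le> t * \<Phi> s"
proof -
  have "\<Phi> t / t \<le> \<Phi> s / s" using assms unfolding quasi_concave_def monotone_on_def by auto
  then show ?thesis using assms by (simp add: field_simps)
qed

text \<open>A zero at t would, by the antitone quotient, force \<Phi> to vanish beyond t, against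
  surjectivity.\<close>

lemma quasi_concave_pos:
  assumes "quasi_concave p \<Phi>" "t > 0" shows "\<Phi> t > 0"
proof (rule ccontr)
  assume "\<not> ?thesis"
  then have 0: "\<Phi> t = 0" using growth_nonneg[OF quasi_concave_growth[OF assms(1)], of t] assms(2) by simp
  define u where "u = max t (growth_inverse \<Phi> 1)"
  have "t * \<Phi> u \<le> u * \<Phi> t" using assms by (intro quasi_concave_scale) (auto simp: u_def)
  then have "\<Phi> u \<le> 0" using 0 assms(2) by (simp add: mult_le_0_iff)
  moreover have "\<Phi> (growth_inverse \<Phi> 1) \<le> \<Phi> u"
    by (intro growth_mono[OF quasi_concave_growth[OF assms(1)]] growth_inverse_nonneg[OF quasi_concave_growth[OF assms(1)]]) (auto simp: u_def)
  ultimately show False using growth_inverse_eq[OF quasi_concave_growth[OF assms(1)], of 1] by simp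
qed

lemma quasi_concave_subadditive:
  assumes "quasi_concave p \<Phi>" "0 \<le> s" "0 \<le> t" shows "\<Phi> (s + t) \<le> \<Phi> s + \<Phi> t"
proof (cases "s = 0 \<or> t = 0")
  case True then show ?thesis using growth_zero[OF quasi_concave_growth[OF assms(1)]] by auto
next
  case False
  then have st: "s > 0" "t > 0" using assms by auto
  have "s * \<Phi> (s + t) + t * \<Phi> (s + t) \<le> (s + t) * \<Phi> s + (s + t) * \<Phi> t"
    using st by (intro add_mono quasi_concave_scale[OF assms(1)]) auto
  then have "(s + t) * \<Phi> (s + t) \<le> (s + t) * (\<Phi> s + \<Phi> t)" by (simp add: algebra_simps)
  then show ?thesis using st by simp
qed

lemma quasi_concave_lower:
  assumes "quasi_concave p \<Phi>"
  obtains C where "C \<ge> 1" "\<And>s t. s \<ge> 0 \<Longrightarrow> 0 < t \<Longrightarrow> t \<le> 1 \<Longrightarrow> \<Phi> (s * t) \<le> C * t powr p * \<Phi> s"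
proof -
  obtain C where C: "C > 0" "\<And>s t. s > 0 \<Longrightarrow> 0 < t \<Longrightarrow> t \<le> 1 \<Longrightarrow> \<Phi> (s * t) \<le> C * t powr p * \<Phi> s"
    using assms unfolding quasi_concave_def growth_lower_type_def by blast
  show thesis
  proof (rule that[of "max 1 C"])
    fix s t :: real assume st: "s \<ge> 0" "0 < t" "t \<le> 1"
    have n: "\<Phi> s \<ge> 0" using growth_nonneg[OF quasi_concave_growth[OF assms] st(1)] .
    show "\<Phi> (s * t) \<le> max 1 C * t powr p * \<Phi> s"
    proof (cases "s = 0")
      case True then show ?thesis using growth_zero[OF quasi_concave_growth[OF assms]] by simp
    next
      case False
      then have "\<Phi> (s * t) \<le> C * t powr p * \<Phi> s" using C(2) st by simp
      also have "... \<le> max 1 C * t powr p * \<Phi> s" using n by (intro mult_right_mono) auto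
      finally show ?thesis .
    qed
  qed simp
qed

text \<open>Apply the lower type at b = \<open>growth_inverse \<Phi> t\<close> with the ratio a / b
  <= 1 and solve for b / a; the exponent p becomes 1/p.\<close>

lemma quasi_concave_inverse_upper:
  assumes "quasi_concave p \<Phi>"
  obtains C where "C \<ge> 1" "\<And>s t. 0 < s \<Longrightarrow> s \<le> t \<Longrightarrow> growth_inverse \<Phi> t \<le> C * (t / s) powr (1 / p) * growth_inverse \<Phi> s"
proof -
  have p: "p > 0" and gf: "growth_function \<Phi>" using assms by (auto simp: quasi_concave_def)
  obtain C where C: "C \<ge> 1" "\<And>s t. s \<ge> 0 \<Longrightarrow> 0 < t \<Longrightarrow> t \<le> 1 \<Longrightarrow> \<Phi> (s * t) \<le> C * t powr p * \<Phi> s"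
    using quasi_concave_lower[OF assms] by blast
  show thesis
  proof (rule that[of "C powr (1 / p)"])
    show "C powr (1 / p) \<ge> 1" using C p by (intro ge_one_powr_ge_zero) auto
    fix s t :: real assume st: "0 < s" "s \<le> t"
    define a where "a = growth_inverse \<Phi> s"
    define b where "b = growth_inverse \<Phi> t"
    have a: "a > 0" "\<Phi> a = s" and b: "b > 0" "\<Phi> b = t"
      unfolding a_def b_def using st by (auto intro: growth_inverse_pos[OF gf] growth_inverse_eq[OF gf])
    have ab: "a \<le> b" unfolding a_def b_def using st by (intro growth_inverse_mono[OF gf]) auto
    have "s = \<Phi> (b * (a / b))" using a b by simp
    also have "... \<le> C * (a / b) powr p * \<Phi> b" using a b ab by (intro C(2)) auto
    finally have "s \<le> C * (a / b) powr p * t" using b by simp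
    then have "(b / a) powr p \<le> C * (t / s)" using a b st by (simp add: powr_divide field_simps)
    then have "((b / a) powr p) powr (1 / p) \<le> (C * (t / s)) powr (1 / p)" using p by (intro powr_mono2) auto
    moreover have "((b / a) powr p) powr (1 / p) = b / a" using p a b by (simp add: powr_powr)
    moreover have "(C * (t / s)) powr (1 / p) = C powr (1 / p) * (t / s) powr (1 / p)" by (rule powr_mult)
    ultimately have "b / a \<le> C powr (1 / p) * (t / s) powr (1 / p)" by (simp only:)
    then show "growth_inverse \<Phi> t \<le> C powr (1 / p) * (t / s) powr (1 / p) * growth_inverse \<Phi> s"
      using a b unfolding a_def[symmetric] b_def[symmetric] by (simp add: field_simps)
  qed
qed

lemma quasi_concave_inverse_scale:
  assumes "quasi_concave p \<Phi>" "0 < s" "s \<le> t"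
  shows "growth_inverse \<Phi> s / s \<le> growth_inverse \<Phi> t / t"
proof -
  have gf: "growth_function \<Phi>" using assms by (auto simp: quasi_concave_def)
  have "growth_inverse \<Phi> s * \<Phi> (growth_inverse \<Phi> t) \<le> growth_inverse \<Phi> t * \<Phi> (growth_inverse \<Phi> s)"
    using assms by (intro quasi_concave_scale[OF assms(1)] growth_inverse_pos[OF gf] growth_inverse_mono[OF gf]) auto
  then show ?thesis using assms by (simp add: growth_inverse_eq[OF gf] field_simps)
qed

lemma class_L_quasi_concave:
  assumes "\<Phi> \<in> class_L p" "0 < p" shows "quasi_concave p \<Phi>"
  using assms by (simp add: class_L_def quasi_concave_def)

text \<open>Strictness comes from \<Phi>'(t) >= c \<Phi>(t) / t > 0. It makes
  \<open>growth_inverse\<close> a two-sided inverse for members of the class.\<close>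

lemma class_L_strict:
  assumes L: "\<Phi> \<in> class_L p" "0 < p" and st: "0 \<le> s" "s < t"
  shows "\<Phi> s < \<Phi> t"
proof (cases "s = 0")
  case True
  then show ?thesis using quasi_concave_pos[OF class_L_quasi_concave[OF L], of t] st
      growth_zero[OF quasi_concave_growth[OF class_L_quasi_concave[OF L]]] by simp
next
  case False
  then have s: "s > 0" using st by simp
  obtain \<Phi>' c where d: "\<And>t. t > 0 \<Longrightarrow> (\<Phi> has_real_derivative \<Phi>' t) (at t)" and c: "c > 0" "\<And>t. t > 0 \<Longrightarrow> c * (\<Phi> t / t) \<le> \<Phi>' t"
    using L unfolding class_L_def regular_C1_def by blast
  have pos: "\<Phi>' t > 0" if "t > 0" for t using c(2)[OF that] c(1) that quasi_concave_pos[OF class_L_quasi_concave[OF L] that]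
      mult_pos_pos[OF c(1) divide_pos_pos[OF quasi_concave_pos[OF class_L_quasi_concave[OF L] that] that]] by linarith
  show ?thesis
  proof (rule DERIV_pos_imp_increasing[OF st(2)])
    fix x assume "s \<le> x" "x \<le> t"
    then show "\<exists>y. (\<Phi> has_real_derivative y) (at x) \<and> y > 0" using d[of x] pos[of x] s by auto
  qed
qed

section \<open>Quasi-convex growth functions and the Dini condition\<close>

definition quasi_convex :: "(real \<Rightarrow> real) \<Rightarrow> bool" where
  "quasi_convex \<Phi> \<longleftrightarrow> growth_function \<Phi> \<and> mono_on {0<..} (\<lambda>t. \<Phi> t / t)"

lemma quasi_convex_scale:
  assumes "quasi_convex \<Phi>" "0 \<le> \<theta>" "\<theta> \<le> 1" "0 \<le> t" shows "\<Phi> (\<theta> * t) \<le> \<theta> * \<Phi> t"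
proof (cases "\<theta> = 0 \<or> t = 0")
  case True
  then show ?thesis using growth_zero[of \<Phi>] assms by (auto simp: quasi_convex_def)
next
  case False
  then have p: "\<theta> > 0" "t > 0" using assms by auto
  then have "\<theta> * t \<le> t" using assms by simp
  then have "\<Phi> (\<theta> * t) / (\<theta> * t) \<le> \<Phi> t / t" using assms(1) p unfolding quasi_convex_def mono_on_def by auto
  then show ?thesis using p by (simp add: field_simps)
qed

lemma quasi_convex_inverse_scale:
  assumes "quasi_convex \<Phi>" "0 < s" "s \<le> t"
  shows "growth_inverse \<Phi> t / t \<le> growth_inverse \<Phi> s / s"
proof -
  have gf: "growth_function \<Phi>" using assms by (auto simp: quasi_convex_def)
  let ?a = "growth_inverse \<Phi> s" and ?b = "growth_inverse \<Phi> t"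
  have ab: "0 < ?a" "?a \<le> ?b" using assms by (auto intro!: growth_inverse_pos[OF gf] growth_inverse_mono[OF gf])
  have "\<Phi> ((?a / ?b) * ?b) \<le> (?a / ?b) * \<Phi> ?b" using ab by (intro quasi_convex_scale[OF assms(1)]) auto
  then have "s \<le> (?a / ?b) * t" using ab assms by (simp add: growth_inverse_eq[OF gf])
  then show ?thesis using assms ab by (simp add: field_simps)
qed

lemma class_U_quasi_convex: "\<Phi> \<in> class_U q \<Longrightarrow> quasi_convex \<Phi>"
  by (simp add: class_U_def quasi_convex_def)

text \<open>With \<open>\<phi>(t) = \<Phi>(t)/t\<close>, the Dini condition gives \<open>\<phi>(\<tau>t) ln (1/\<tau>) \<le> C \<phi>(t)\<close>, hence geometric decay.\<close>

lemma Dini_lower_type: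
  assumes qc: "quasi_convex \<Phi>" and Dini: "Dini_condition \<Phi>"
  obtains \<epsilon> C where "\<epsilon> > 0" "C > 0" "\<And>t \<tau>. t > 0 \<Longrightarrow> 0 < \<tau> \<Longrightarrow> \<tau> \<le> 1 \<Longrightarrow> \<Phi> (\<tau> * t) \<le> C * \<tau> powr (1 + \<epsilon>) * \<Phi> t"
proof -
  have gf: "growth_function \<Phi>" using qc by (simp add: quasi_convex_def)
  obtain C where C: "C > 0" "\<And>t. t > 0 \<Longrightarrow> (\<integral>\<^sup>+s\<in>{0<..<t}. ennreal (\<Phi> s / s\<^sup>2) \<partial>lborel) \<le> ennreal (C * (\<Phi> t / t))"
    using Dini unfolding Dini_condition_def by blast
  have phi_mono: "\<Phi> s / s \<le> \<Phi> t / t" if "0 < s" "s \<le> t" for s t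
    using qc that unfolding quasi_convex_def mono_on_def by auto
  have phi_nonneg: "\<Phi> t / t \<ge> 0" if "t > 0" for t using growth_nonneg[OF gf, of t] that by simp
  \<comment> \<open>Chosen so that ln (1 / \<tau>0) = 2 C, twice the Dini constant: one step by
    \<tau>0 then halves \<Phi>(t) / t.\<close>
  define \<tau>0 where "\<tau>0 = exp (- (2 * C))"
  have \<tau>0: "0 < \<tau>0" "\<tau>0 < 1" using C by (auto simp: \<tau>0_def)
  have step: "\<Phi> (\<tau>0 * t) / (\<tau>0 * t) \<le> (\<Phi> t / t) / 2" if t: "t > 0" for t
  proof -
    have a: "0 < \<tau>0 * t" "\<tau>0 * t < t" using \<tau>0 t by auto
    define c where "c = \<Phi> (\<tau>0 * t) / (\<tau>0 * t)"
    define d where "d = \<Phi> t / t"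
    have c0: "c \<ge> 0" and d0: "d \<ge> 0" using phi_nonneg[OF a(1)] phi_nonneg[OF t] by (auto simp: c_def d_def)
    have "((\<lambda>s. c * inverse s) has_integral (c * ln t - c * ln (\<tau>0 * t))) {\<tau>0 * t..t}"
      using a \<tau>0 by (intro fundamental_theorem_of_calculus)
        (auto intro!: derivative_eq_intros simp flip: has_real_derivative_iff_has_vector_derivative simp: field_simps)
    moreover have "c * ln t - c * ln (\<tau>0 * t) = c * (2 * C)" using \<tau>0 t by (simp add: ln_mult \<tau>0_def algebra_simps)
    ultimately have I: "((\<lambda>s. c * inverse s) has_integral (c * (2 * C))) {\<tau>0 * t..t}" by simp
    have "ennreal (c * (2 * C)) = (\<integral>\<^sup>+s. ennreal (indicator {\<tau>0 * t..t} s * (c * inverse s)) \<partial>lborel)"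
      using c0 a by (intro nn_integral_has_integral_lebesgue[symmetric] I) auto
    also have "... \<le> (\<integral>\<^sup>+s\<in>{0<..<t}. ennreal (\<Phi> s / s\<^sup>2) \<partial>lborel)"
    proof (rule nn_integral_mono_AE)
      have "AE s in lborel. s \<noteq> t" by (rule AE_lborel_singleton)
      then show "AE s in lborel. ennreal (indicator {\<tau>0 * t..t} s * (c * inverse s)) \<le> ennreal (\<Phi> s / s\<^sup>2) * indicator {0<..<t} s"
      proof eventually_elim
        case (elim s)
        show ?case
        proof (cases "s \<in> {\<tau>0 * t..<t}")
          case True
          then have s: "\<tau>0 * t \<le> s" "s < t" "0 < s" using a by auto
          have "c * inverse s \<le> (\<Phi> s / s) * inverse s" unfolding c_def using phi_mono[of "\<tau>0 * t" s] a s by (intro mult_right_mono) auto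
          then show ?thesis using s by (auto intro!: ennreal_leI simp: power2_eq_square field_simps)
        next
          case False then show ?thesis using elim by (auto simp: indicator_def)
        qed
      qed
    qed
    also have "... \<le> ennreal (C * (\<Phi> t / t))" by (rule C(2)[OF t])
    finally have "c * (2 * C) \<le> C * d" unfolding d_def[symmetric] using d0 C(1) by (simp add: ennreal_le_iff)
    then have "c \<le> d / 2" using C(1) by (simp add: field_simps)
    then show ?thesis by (simp only: c_def d_def)
  qed
  have iter: "\<Phi> (\<tau>0 ^ k * t) / (\<tau>0 ^ k * t) \<le> (\<Phi> t / t) / 2 ^ k" if t: "t > 0" for k t
  proof (induction k)
    case (Suc k)
    have "\<Phi> (\<tau>0 * (\<tau>0 ^ k * t)) / (\<tau>0 * (\<tau>0 ^ k * t)) \<le> (\<Phi> (\<tau>0 ^ k * t) / (\<tau>0 ^ k * t)) / 2"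
      using \<tau>0 t by (intro step) auto
    also have "... \<le> ((\<Phi> t / t) / 2 ^ k) / 2" using Suc by (rule divide_right_mono) simp
    finally show ?case by (simp add: mult_ac)
  qed simp
  \<comment> \<open>Makes \<tau>0 powr \<epsilon> = 1/2, so that halving at each step is decay like
    \<tau> powr \<epsilon>.\<close>
  define \<epsilon> where "\<epsilon> = ln 2 / (2 * C)"
  have \<epsilon>: "\<epsilon> > 0" using C by (simp add: \<epsilon>_def)
  have \<tau>0e: "\<tau>0 powr \<epsilon> = 1 / 2" 
  proof -
    have "\<epsilon> * ln \<tau>0 = - ln 2" using C by (simp add: \<tau>0_def \<epsilon>_def)
    then show ?thesis using \<tau>0 by (simp add: powr_def exp_minus)
  qed
  show thesis
  proof (rule that[OF \<epsilon>, of 2])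
    fix t \<tau> :: real assume t: "t > 0" and \<tau>: "0 < \<tau>" "\<tau> \<le> 1"
    \<comment> \<open>The number of full steps: \<tau>0^(k+1) <= \<tau> <= \<tau>0^k. The incomplete
      last step costs the constant 2.\<close>
    define k where "k = nat \<lfloor>- ln \<tau> / (2 * C)\<rfloor>"
    have q: "- ln \<tau> / (2 * C) \<ge> 0" using \<tau> C by (intro divide_nonneg_pos) auto
    have k: "real k \<le> - ln \<tau> / (2 * C)" "- ln \<tau> / (2 * C) < real k + 1" using q unfolding k_def by linarith+
    have "\<tau> \<le> \<tau>0 ^ k"
    proof -
      have "ln \<tau> \<le> - (2 * C) * real k" using k(1) C by (simp add: field_simps)
      then have "exp (ln \<tau>) \<le> exp (- (2 * C) * real k)" by simp
      then show ?thesis using \<tau> by (simp add: \<tau>0_def exp_of_nat_mult[symmetric] mult.commute)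
    qed
    have "\<tau>0 ^ (k + 1) \<le> \<tau>"
    proof -
      have "- (2 * C) * real (k + 1) \<le> ln \<tau>" using k(2) C by (simp add: field_simps)
      then have "exp (- (2 * C) * real (k + 1)) \<le> exp (ln \<tau>)" by simp
      then show ?thesis using \<tau> exp_of_nat_mult[of "k + 1" "- (2 * C)"] by (simp add: \<tau>0_def mult.commute)
    qed
    then have "(\<tau>0 ^ (k + 1)) powr \<epsilon> \<le> \<tau> powr \<epsilon>" using \<tau>0 \<epsilon> by (intro powr_mono2) auto
    moreover have "(\<tau>0 ^ (k + 1)) powr \<epsilon> = (1 / 2) ^ (k + 1)"
    proof -
      have "(\<tau>0 ^ (k + 1)) powr \<epsilon> = (\<tau>0 powr \<epsilon>) ^ (k + 1)"
        using \<tau>0 by (simp only: powr_realpow[symmetric] powr_powr powr_gt_zero) (simp add: mult.commute powr_powr[symmetric] powr_realpow)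
      then show ?thesis by (simp only: \<tau>0e)
    qed
    ultimately have two: "1 / 2 ^ k \<le> 2 * \<tau> powr \<epsilon>" by (simp add: power_divide)
    have "\<Phi> (\<tau> * t) / (\<tau> * t) \<le> \<Phi> (\<tau>0 ^ k * t) / (\<tau>0 ^ k * t)"
      using \<tau> t \<open>\<tau> \<le> \<tau>0 ^ k\<close> by (intro phi_mono mult_right_mono) auto
    also have "... \<le> (\<Phi> t / t) / 2 ^ k" by (rule iter[OF t])
    also have "... \<le> (\<Phi> t / t) * (2 * \<tau> powr \<epsilon>)" using mult_left_mono[OF two phi_nonneg[OF t]] by simp
    finally have "\<Phi> (\<tau> * t) \<le> (\<tau> * t) * ((\<Phi> t / t) * (2 * \<tau> powr \<epsilon>))"
      using \<tau> t by (simp add: divide_le_eq mult.commute)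
    also have "... = 2 * \<tau> powr (1 + \<epsilon>) * \<Phi> t" using \<tau> t by (simp add: powr_add)
    finally show "\<Phi> (\<tau> * t) \<le> 2 * \<tau> powr (1 + \<epsilon>) * \<Phi> t" .
  qed simp
qed

text \<open>The growth data, separated from \<alpha> and the dimension. Of \<Phi> it is assumed that
  it is a growth function with the prescribed \<rho>; its quasi-concavity is derived below from the
  formula for its inverse.\<close>

locale hankel_growth =
  fixes p q :: real and \<Phi>\<^sub>1 \<Phi>\<^sub>2 \<Phi> \<rho> :: "real \<Rightarrow> real"
  assumes p: "0 < p" and L1: "\<Phi>\<^sub>1 \<in> class_L p" and U2: "\<Phi>\<^sub>2 \<in> class_U q"
    and rho12: "\<And>t. t > 0 \<Longrightarrow> \<rho> t = rho_of \<Phi>\<^sub>1 t / rho_of \<Phi>\<^sub>2 t"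
    and gfPhi: "growth_function \<Phi>" and rhoPhi: "\<And>t. t > 0 \<Longrightarrow> \<rho> t = rho_of \<Phi> t"
begin

abbreviation "\<Psi>\<^sub>1 \<equiv> growth_inverse \<Phi>\<^sub>1"
abbreviation "\<Psi>\<^sub>2 \<equiv> growth_inverse \<Phi>\<^sub>2"
abbreviation "\<Psi> \<equiv> growth_inverse \<Phi>"

lemma qc1: "quasi_concave p \<Phi>\<^sub>1" by (rule class_L_quasi_concave[OF L1 p])
lemma gf1: "growth_function \<Phi>\<^sub>1" by (rule quasi_concave_growth[OF qc1])
lemma qv2: "quasi_convex \<Phi>\<^sub>2" by (rule class_U_quasi_convex[OF U2])
lemma gf2: "growth_function \<Phi>\<^sub>2" using qv2 by (simp add: quasi_convex_def)

lemma rho_eq12: assumes "s > 0" shows "\<rho> (1 / s) = \<Psi>\<^sub>2 s / \<Psi>\<^sub>1 s"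
  using rho12[of "1 / s"] assms growth_inverse_pos[OF gf1 assms] growth_inverse_pos[OF gf2 assms] by (simp add: rho_of_def)

lemma rho_eq: assumes "s > 0" shows "\<rho> (1 / s) = s / \<Psi> s"
  using rhoPhi[of "1 / s"] assms by (simp add: rho_of_def)

lemma Psi_eq: assumes "s > 0" shows "\<Psi> s = \<Psi>\<^sub>1 s * (s / \<Psi>\<^sub>2 s)"
proof -
  have "s / \<Psi> s = \<Psi>\<^sub>2 s / \<Psi>\<^sub>1 s" using rho_eq12[OF assms] rho_eq[OF assms] by simp
  then show ?thesis using growth_inverse_pos[OF gf1 assms] growth_inverse_pos[OF gf2 assms] growth_inverse_pos[OF gfPhi assms] assms
    by (simp add: field_simps)
qed

lemma inv2_scale: "0 < s \<Longrightarrow> s \<le> t \<Longrightarrow> s / \<Psi>\<^sub>2 s \<le> t / \<Psi>\<^sub>2 t"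
  using quasi_convex_inverse_scale[OF qv2, of s t] growth_inverse_pos[OF gf2, of s] growth_inverse_pos[OF gf2, of t]
  by (simp add: field_simps)

lemma Psi1_Phi1: assumes "a > 0" shows "\<Psi>\<^sub>1 (\<Phi>\<^sub>1 a) = a"
proof -
  have pos: "\<Phi>\<^sub>1 a > 0" by (rule quasi_concave_pos[OF qc1 assms])
  have "\<Phi>\<^sub>1 (\<Psi>\<^sub>1 (\<Phi>\<^sub>1 a)) = \<Phi>\<^sub>1 a" using pos by (intro growth_inverse_eq[OF gf1]) simp
  moreover have "\<Psi>\<^sub>1 (\<Phi>\<^sub>1 a) > 0" by (rule growth_inverse_pos[OF gf1 pos])
  ultimately show ?thesis using class_L_strict[OF L1 p, of a "\<Psi>\<^sub>1 (\<Phi>\<^sub>1 a)"] class_L_strict[OF L1 p, of "\<Psi>\<^sub>1 (\<Phi>\<^sub>1 a)" a] assms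
    by (cases a "\<Psi>\<^sub>1 (\<Phi>\<^sub>1 a)" rule: linorder_cases) auto
qed

lemma Phi1_right_limit:
  assumes a: "a > 0"
  shows "((\<lambda>x. \<Phi>\<^sub>1 x * x / c) \<longlongrightarrow> \<Phi>\<^sub>1 a * a / c) (at a)"
proof -
  have "isCont \<Phi>\<^sub>1 a"
  proof -
    have "continuous_on {0<..} \<Phi>\<^sub>1" using gf1 unfolding growth_function_def by (auto intro: continuous_on_subset)
    then show ?thesis using a by (simp add: continuous_on_eq_continuous_at)
  qed
  then have "(\<Phi>\<^sub>1 \<longlongrightarrow> \<Phi>\<^sub>1 a) (at a)" by (simp add: isCont_def)
  then show ?thesis unfolding divide_inverse by (intro tendsto_mult tendsto_const tendsto_ident_at)
qed

text \<open>A flat piece of \<Phi> would be an upward jump of \<Psi>. The factor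
  \<open>\<Psi>\<^sub>1\<close> has none, since \<open>\<Phi>\<^sub>1\<close> is strictly
  increasing, and the increasing \<open>\<Psi>\<^sub>2\<close> in the denominator cannot create one.
  Concretely, with y = \<Phi> t and a = \<open>\<Psi>\<^sub>1 y\<close>, the number t is squeezed
  between the values of \<Psi> at \<open>\<Phi>\<^sub>1 x\<close> for x below and above a.
  Monotonicity freezes \<open>\<Psi>\<^sub>2\<close> at y, so both bounds become
  \<open>\<Phi>\<^sub>1 x * x / \<Psi>\<^sub>2 y\<close>, which is continuous in x.\<close>

lemma Psi_Phi: assumes t: "t > 0" shows "\<Phi> t > 0" "\<Psi> (\<Phi> t) = t"
proof -
  show pos: "\<Phi> t > 0"
  proof (rule ccontr)
    assume "\<not> ?thesis"
    then have 0: "\<Phi> t = 0" using growth_nonneg[OF gfPhi, of t] t by simp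
    \<comment> \<open>Small enough that \<Psi> at \<open>\<Phi>\<^sub>1 a\<close> is at most t: the
      first entry of the minimum keeps \<open>\<Phi>\<^sub>1 a\<close> below 1, the second then
      bounds the product by t.\<close>
    define a where "a = min (\<Psi>\<^sub>1 1) (t * \<Psi>\<^sub>2 1)"
    have pos1: "\<Psi>\<^sub>1 1 > 0" "\<Psi>\<^sub>2 1 > 0" by (auto intro: growth_inverse_pos[OF gf1] growth_inverse_pos[OF gf2])
    have a: "a > 0" using pos1 t by (simp add: a_def)
    have y: "\<Phi>\<^sub>1 a > 0" by (rule quasi_concave_pos[OF qc1 a])
    have y1: "\<Phi>\<^sub>1 a \<le> 1" using growth_mono[OF gf1, of a "\<Psi>\<^sub>1 1"] a growth_inverse_eq[OF gf1, of 1] by (simp add: a_def)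
    have "\<Psi> (\<Phi>\<^sub>1 a) = a * (\<Phi>\<^sub>1 a / \<Psi>\<^sub>2 (\<Phi>\<^sub>1 a))" using Psi_eq[OF y] Psi1_Phi1[OF a] by simp
    also have "... \<le> a * (1 / \<Psi>\<^sub>2 1)" using a inv2_scale[OF y y1] by (intro mult_left_mono) auto
    also have "... \<le> t" using pos1 by (simp add: a_def field_simps)
    finally have "\<Phi> (\<Psi> (\<Phi>\<^sub>1 a)) \<le> \<Phi> t" using y by (intro growth_mono[OF gfPhi] growth_inverse_nonneg[OF gfPhi]) auto
    then show False using 0 y growth_inverse_eq[OF gfPhi, of "\<Phi>\<^sub>1 a"] by simp
  qed
  define y where "y = \<Phi> t"
  have y: "y > 0" using pos by (simp add: y_def)
  define a where "a = \<Psi>\<^sub>1 y"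
  have a: "a > 0" "\<Phi>\<^sub>1 a = y" using y unfolding a_def by (auto intro: growth_inverse_pos[OF gf1] growth_inverse_eq[OF gf1])
  let ?c = "\<Psi>\<^sub>2 y"
  have c: "?c > 0" by (rule growth_inverse_pos[OF gf2 y])
  have Psiy: "\<Psi> y = \<Phi>\<^sub>1 a * a / ?c" using Psi_eq[OF y] a by (simp add: a_def)
  have up: "t \<le> \<Phi>\<^sub>1 x * x / ?c" if x: "x > a" for x
  proof -
    have x0: "x > 0" using a x by simp
    have yx: "y < \<Phi>\<^sub>1 x" using class_L_strict[OF L1 p, of a x] a x by simp
    then have y0: "\<Phi>\<^sub>1 x > 0" using y by simp
    have "t \<le> \<Psi> (\<Phi>\<^sub>1 x)"
    proof (rule ccontr)
      assume "\<not> ?thesis"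
      then have "\<Phi> (\<Psi> (\<Phi>\<^sub>1 x)) \<le> \<Phi> t" using y0 by (intro growth_mono[OF gfPhi] growth_inverse_nonneg[OF gfPhi]) auto
      then show False using yx y0 growth_inverse_eq[OF gfPhi, of "\<Phi>\<^sub>1 x"] by (simp add: y_def)
    qed
    also have "... = x * \<Phi>\<^sub>1 x / \<Psi>\<^sub>2 (\<Phi>\<^sub>1 x)" using Psi_eq[OF y0] Psi1_Phi1[OF x0] by simp
    also have "... \<le> x * \<Phi>\<^sub>1 x / ?c"
      using x0 y0 y yx c by (intro divide_left_mono growth_inverse_mono[OF gf2]) (auto intro!: mult_pos_pos growth_inverse_pos[OF gf2])
    finally show ?thesis by (simp add: mult.commute)
  qed
  have lo: "\<Phi>\<^sub>1 x * x / ?c \<le> t" if x: "0 < x" "x < a" for x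
  proof -
    have yx: "\<Phi>\<^sub>1 x < y" using class_L_strict[OF L1 p, of x a] a x by simp
    have y0: "\<Phi>\<^sub>1 x > 0" by (rule quasi_concave_pos[OF qc1 x(1)])
    have "x * \<Phi>\<^sub>1 x / ?c \<le> x * \<Phi>\<^sub>1 x / \<Psi>\<^sub>2 (\<Phi>\<^sub>1 x)"
      using x y0 y yx c by (intro divide_left_mono growth_inverse_mono[OF gf2]) (auto intro!: mult_pos_pos growth_inverse_pos[OF gf2])
    also have "... = \<Psi> (\<Phi>\<^sub>1 x)" using Psi_eq[OF y0] Psi1_Phi1[OF x(1)] by simp
    also have "... \<le> t"
    proof (rule ccontr)
      assume "\<not> ?thesis"
      then have "\<Phi> t \<le> \<Phi> (\<Psi> (\<Phi>\<^sub>1 x))" using t by (intro growth_mono[OF gfPhi]) auto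
      then show False using yx y0 growth_inverse_eq[OF gfPhi, of "\<Phi>\<^sub>1 x"] by (simp add: y_def)
    qed
    finally show ?thesis by (simp add: mult.commute)
  qed
  have "t \<le> \<Phi>\<^sub>1 a * a / ?c"
  proof (rule tendsto_lowerbound[OF tendsto_mono[OF _ Phi1_right_limit[OF a(1)]]])
    show "at_right a \<le> at a" by (rule at_le) simp
    show "\<forall>\<^sub>F x in at_right a. t \<le> \<Phi>\<^sub>1 x * x / ?c"
      unfolding eventually_at_right_field using up by (intro exI[of _ "a + 1"]) auto
  qed simp
  moreover have "\<Phi>\<^sub>1 a * a / ?c \<le> t"
  proof (rule tendsto_upperbound[OF tendsto_mono[OF _ Phi1_right_limit[OF a(1)]]])
    show "at_left a \<le> at a" by (rule at_le) simp
    show "\<forall>\<^sub>F x in at_left a. \<Phi>\<^sub>1 x * x / ?c \<le> t"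
      unfolding eventually_at_left_field using lo a by (intro exI[of _ 0]) auto
  qed simp
  ultimately show "\<Psi> (\<Phi> t) = t" using Psiy by (simp add: y_def)
qed

lemma Psi_scale: assumes "0 < s" "s \<le> t" shows "\<Psi> s / s \<le> \<Psi> t / t"
proof -
  have t: "t > 0" using assms by simp
  have "\<Psi>\<^sub>1 s / \<Psi>\<^sub>2 s = (\<Psi>\<^sub>1 s / s) * (s / \<Psi>\<^sub>2 s)" using assms by simp
  also have "... \<le> (\<Psi>\<^sub>1 t / t) * (t / \<Psi>\<^sub>2 t)"
    using assms t quasi_concave_inverse_scale[OF qc1 assms] inv2_scale[OF assms]
      growth_inverse_pos[OF gf1 assms(1)] growth_inverse_pos[OF gf2 assms(1)] growth_inverse_pos[OF gf1 t]
    by (intro mult_mono) auto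
  also have "... = \<Psi>\<^sub>1 t / \<Psi>\<^sub>2 t" using t by simp
  finally show ?thesis using assms t by (simp add: Psi_eq)
qed

text \<open>\<open>\<Psi>\<^sub>1\<close> contributes the exponent 1/p, and
  \<open>t / \<Psi>\<^sub>2 t\<close> contributes 1 because \<open>\<Psi>\<^sub>2\<close>
  increases.\<close>

lemma Psi_upper:
  obtains C where "C \<ge> 1" "\<And>s t. 0 < s \<Longrightarrow> s \<le> t \<Longrightarrow> \<Psi> t \<le> C * (t / s) powr (1 + 1 / p) * \<Psi> s"
proof -
  obtain C where C: "C \<ge> 1" "\<And>s t. 0 < s \<Longrightarrow> s \<le> t \<Longrightarrow> \<Psi>\<^sub>1 t \<le> C * (t / s) powr (1 / p) * \<Psi>\<^sub>1 s"
    using quasi_concave_inverse_upper[OF qc1] by blast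
  show thesis
  proof (rule that[OF C(1)])
    fix s t :: real assume st: "0 < s" "s \<le> t"
    then have t: "t > 0" by simp
    have "\<Psi> t = \<Psi>\<^sub>1 t * (t / \<Psi>\<^sub>2 t)" by (rule Psi_eq[OF t])
    also have "... \<le> (C * (t / s) powr (1 / p) * \<Psi>\<^sub>1 s) * (t / \<Psi>\<^sub>2 s)"
      using st t C(1) growth_inverse_pos[OF gf1 st(1)] growth_inverse_pos[OF gf2 st(1)] growth_inverse_pos[OF gf2 t] growth_inverse_mono[OF gf2, of s t]
      by (intro mult_mono C(2) divide_left_mono) (auto intro!: mult_nonneg_nonneg)
    also have "... = C * (t / s) powr (1 + 1 / p) * \<Psi> s" using st by (simp add: Psi_eq powr_add)
    finally show "\<Psi> t \<le> C * (t / s) powr (1 + 1 / p) * \<Psi> s" .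
  qed
qed

text \<open>Both properties are read off \<Psi>, by now a two-sided inverse; p / (1 + p) is the
  reciprocal of its exponent 1 + 1/p.\<close>

lemma qcPhi: "quasi_concave (p / (1 + p)) \<Phi>"
  unfolding quasi_concave_def
proof (intro conjI)
  show "0 < p / (1 + p)" using p by simp
  show "growth_function \<Phi>" by (rule gfPhi)
  show "antimono_on {0<..} (\<lambda>t. \<Phi> t / t)"
  proof (rule monotone_onI)
    fix s t :: real assume st: "s \<in> {0<..}" "t \<in> {0<..}" "s \<le> t"
    then have "\<Phi> s \<le> \<Phi> t" by (intro growth_mono[OF gfPhi]) auto
    then have "\<Psi> (\<Phi> s) / \<Phi> s \<le> \<Psi> (\<Phi> t) / \<Phi> t" using Psi_Phi(1)[of s] st by (intro Psi_scale) auto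
    then show "\<Phi> s / s \<ge> \<Phi> t / t" using st Psi_Phi[of s] Psi_Phi[of t] by (simp add: field_simps)
  qed
  obtain C where C: "C \<ge> 1" "\<And>s t. 0 < s \<Longrightarrow> s \<le> t \<Longrightarrow> \<Psi> t \<le> C * (t / s) powr (1 + 1 / p) * \<Psi> s"
    using Psi_upper by blast
  define e where "e = p / (1 + p)"
  have e: "e > 0" "(1 + 1 / p) * e = 1" using add_pos_pos[OF p mult_pos_pos[OF p p]] p by (auto simp: e_def field_simps)
  show "growth_lower_type (p / (1 + p)) \<Phi>" unfolding growth_lower_type_def
  proof (intro exI[of _ "C powr e"] conjI allI impI)
    show "C powr e > 0" using C by simp
    fix s t :: real assume s: "s > 0" and t: "0 < t \<and> t \<le> 1"
    define y where "y = \<Phi> (s * t)"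
    define z where "z = \<Phi> s"
    have st: "s * t > 0" using s t by simp
    have y: "y > 0" "\<Psi> y = s * t" using Psi_Phi[OF st] by (auto simp: y_def)
    have z: "z > 0" "\<Psi> z = s" using Psi_Phi[OF s] by (auto simp: z_def)
    have "y \<le> z" unfolding y_def z_def using s t by (intro growth_mono[OF gfPhi]) (auto simp: mult_left_le)
    then have "s \<le> C * (z / y) powr (1 + 1 / p) * (s * t)" using C(2)[OF y(1)] y z by metis
    then have "1 \<le> C * t * (z / y) powr (1 + 1 / p)" using s by (simp add: mult_ac)
    then have "1 powr e \<le> (C * t * (z / y) powr (1 + 1 / p)) powr e" using e by (intro powr_mono2) auto
    also have "... = C powr e * t powr e * (z / y)" using C t y z e(2) by (simp add: powr_mult powr_powr)
    finally have "y \<le> C powr e * t powr e * z" using y by (simp add: field_simps)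
    then show "\<Phi> (s * t) \<le> C powr e * t powr (p / (1 + p)) * \<Phi> s" by (simp add: y_def z_def e_def)
  qed
qed

lemma rho_pos: assumes "t > 0" shows "\<rho> t > 0"
  using rho_eq[of "1 / t"] assms growth_inverse_pos[OF gfPhi, of "1 / t"] by simp

lemma rho_mono: assumes "0 < s" "s \<le> t" shows "\<rho> s \<le> \<rho> t"
proof -
  have t: "t > 0" using assms by simp
  have "\<Psi> (1 / t) / (1 / t) \<le> \<Psi> (1 / s) / (1 / s)" using assms by (intro Psi_scale) (auto simp: field_simps)
  then have "t * \<Psi> (1 / t) \<le> s * \<Psi> (1 / s)" by (simp add: mult.commute)
  moreover have "0 < t * \<Psi> (1 / t)" using t growth_inverse_pos[OF gfPhi, of "1 / t"] by simp
  ultimately have "1 / (s * \<Psi> (1 / s)) \<le> 1 / (t * \<Psi> (1 / t))" by (intro divide_left_mono) auto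
  then show ?thesis using rho_eq[of "1 / t"] rho_eq[of "1 / s"] assms t by simp
qed

text \<open>As \<rho>(1/s) = s / \<Psi> s, the exponent 1 + 1/p of \<Psi> drops by one.\<close>

lemma rho_upper: "rho_upper_type (1 / p) \<rho>"
  unfolding rho_upper_type_def
proof (intro conjI allI impI)
  show "0 < \<rho> t" if "0 < t \<and> t \<le> 1" for t using that by (intro rho_pos) simp
  obtain C where C: "C \<ge> 1" "\<And>s t. 0 < s \<Longrightarrow> s \<le> t \<Longrightarrow> \<Psi> t \<le> C * (t / s) powr (1 + 1 / p) * \<Psi> s"
    using Psi_upper by blast
  show "\<exists>C>0. \<forall>s t. 1 < s \<and> 0 < t \<and> s * t \<le> 1 \<longrightarrow> \<rho> (s * t) \<le> C * s powr (1 / p) * \<rho> t"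
  proof (intro exI[of _ C] conjI allI impI)
    show "C > 0" using C by simp
    fix s t :: real assume st: "1 < s \<and> 0 < t \<and> s * t \<le> 1"
    then have st0: "s * t > 0" by simp
    define u where "u = 1 / (s * t)"
    have u: "u > 0" "u \<le> 1 / t" "(1 / t) / u = s" using st st0 by (auto simp: u_def field_simps)
    have 1: "\<Psi> (1 / t) \<le> C * s powr (1 + 1 / p) * \<Psi> u" using C(2)[OF u(1,2)] u(3) by simp
    have pos: "\<Psi> (1 / t) > 0" "\<Psi> u > 0" using st u by (auto intro!: growth_inverse_pos[OF gfPhi])
    have "\<rho> (s * t) = u / \<Psi> u" using rho_eq[OF u(1)] by (simp add: u_def)
    also have "... \<le> u * (C * s powr (1 + 1 / p) / \<Psi> (1 / t))" using 1 pos u(1) by (simp add: field_simps)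
    also have "... = C * s powr (1 / p) * ((1 / t) / \<Psi> (1 / t))" using st by (simp add: u_def powr_add)
    also have "(1 / t) / \<Psi> (1 / t) = \<rho> t" using rho_eq[of "1 / t"] st by simp
    finally show "\<rho> (s * t) \<le> C * s powr (1 / p) * \<rho> t" .
  qed
qed

end


section \<open>Pointwise estimates\<close>

abbreviation modular :: "real \<Rightarrow> (real \<Rightarrow> real) \<Rightarrow> (complex ^ 'n \<Rightarrow> complex) \<Rightarrow> ennreal" where
  "modular \<alpha> \<Phi> f \<equiv> \<integral>\<^sup>+z. ennreal (\<Phi> (norm (f z))) \<partial>nu \<alpha>"

lemma xd_le_1: "xd z \<le> 1"
  by (simp add: xd_def)

lemma xd_posI: "z \<in> ball 0 1 \<Longrightarrow> xd (z :: complex ^ 'n) > 0"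
  by (simp add: xd_pos_iff)

lemma xd_powr_ge_1: "z \<in> ball 0 1 \<Longrightarrow> a \<ge> 0 \<Longrightarrow> 1 \<le> xd (z :: complex ^ 'n) powr - a"
  using powr_mono2'[of "- a" "xd z" 1] xd_le_1[of z] xd_posI[of z] by simp

lemma nn_integral_nu_shift:
  fixes f :: "complex ^ 'n \<Rightarrow> ennreal"
  assumes al: "\<alpha> > -1" and \<beta>: "\<beta> > -1" and f: "f \<in> borel_measurable (nu \<alpha>)"
  shows "(\<integral>\<^sup>+z. f z \<partial>nu \<beta>) =
    (\<integral>\<^sup>+z. ennreal (nu_const TYPE('n) \<beta> / nu_const TYPE('n) \<alpha> * xd z powr (\<beta> - \<alpha>)) * f z \<partial>nu \<alpha>)"
  unfolding nu_shift[OF al \<beta>]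
proof (rule nn_integral_density[OF _ f])
  have "(\<lambda>z::complex^'n. nu_const TYPE('n) \<beta> / nu_const TYPE('n) \<alpha> * xd z powr (\<beta> - \<alpha>)) \<in> borel_measurable (nu \<alpha>)"
    by (rule measurable_borel_nu) measurable
  then show "(\<lambda>z::complex^'n. ennreal (nu_const TYPE('n) \<beta> / nu_const TYPE('n) \<alpha> * xd z powr (\<beta> - \<alpha>))) \<in> borel_measurable (nu \<alpha>)"
    by (rule measurable_compose[OF _ measurable_ennreal])
qed

text \<open>The factor (xd z / |1 - cinner w z|)^(N+j) pays for moving the weight W from z to w. If
  xd w <= xd z, then W z <= W w already. Otherwise W z / W w grows at most like (xd w / xd z)^(N/p),
  while the factor decays with the exponent N + j >= N/p.\<close>

lemma weight_kernel_bound: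
  fixes z w :: "complex ^ 'n"
  assumes qc: "quasi_concave p \<Phi>" and N: "N > 0"
    and C1: "C1 \<ge> 1" "\<And>s t. 0 < s \<Longrightarrow> s \<le> t \<Longrightarrow> growth_inverse \<Phi> t \<le> C1 * (t / s) powr (1 / p) * growth_inverse \<Phi> s"
    and j: "N / p \<le> N + j"
    and zw: "z \<in> ball 0 1" "w \<in> ball 0 1"
  defines "W \<equiv> \<lambda>z :: complex ^ 'n. growth_inverse \<Phi> (xd z powr - N)"
  shows "W z * (xd z powr (N + j) * norm (1 - cinner w z) powr - (N + j)) \<le> C1 * 2 powr (N + j) * W w"
proof -
  have p: "p > 0" and gf: "growth_function \<Phi>" using qc by (auto simp: quasi_concave_def)
  define y where "y = norm (1 - cinner w z)"
  have x: "xd z > 0" "xd w > 0" using zw by (auto intro: xd_posI)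
  have y: "xd w \<le> 2 * y" "xd z \<le> 2 * y" using xd_le_2_norm[of z w] zw by (auto simp: y_def)
  have y0: "y > 0" using y x by simp
  have W0: "W v > 0" if "v \<in> ball 0 1" for v unfolding W_def using xd_posI[OF that] by (intro growth_inverse_pos[OF gf]) simp
  have Nj: "N + j \<ge> 0" using j N p by (smt (verit) divide_nonneg_pos)
  have k: "xd v powr (N + j) * y powr - (N + j) \<le> 2 powr (N + j)" if "0 < xd v" "xd v \<le> 2 * y" for v :: "complex ^ 'n"
  proof -
    have "xd v powr (N + j) * y powr - (N + j) = (xd v / y) powr (N + j)"
      unfolding powr_minus_divide[of y "N + j"] using that y0 by (simp add: powr_divide)
    also have "... \<le> 2 powr (N + j)" using that y0 Nj by (intro powr_mono2) (auto simp: field_simps)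
    finally show ?thesis .
  qed
  show ?thesis
  proof (cases "xd w \<le> xd z")
    case True
    have "W z \<le> W w" unfolding W_def using True x N by (intro growth_inverse_mono[OF gf] powr_mono2') auto
    then have "W z * (xd z powr (N + j) * y powr - (N + j)) \<le> W w * 2 powr (N + j)"
      using k[OF x(1) y(2)] W0[OF zw(1)] W0[OF zw(2)] by (intro mult_mono) auto
    also have "... \<le> C1 * (2 powr (N + j) * W w)"
      using C1(1) W0[OF zw(2)] mult_right_mono[of 1 C1 "2 powr (N + j) * W w"] by (simp add: mult.commute)
    finally show ?thesis by (simp add: y_def mult.assoc)
  next
    case False
    define t where "t = xd w / xd z"
    have t: "t > 1" using False x by (simp add: t_def)
    have xw: "xd w = t * xd z" using x by (simp add: t_def)
    have "xd w powr - N \<le> xd z powr - N" using False x N by (intro powr_mono2') auto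
    then have "growth_inverse \<Phi> (xd z powr - N) \<le> C1 * ((xd z powr - N) / (xd w powr - N)) powr (1 / p) * growth_inverse \<Phi> (xd w powr - N)"
      using x by (intro C1(2)) auto
    also have "(xd z powr - N) / (xd w powr - N) = t powr N" using x t by (simp add: xw powr_mult powr_minus_divide)
    also have "(t powr N) powr (1 / p) = t powr (N / p)" by (simp add: powr_powr)
    finally have 3: "W z \<le> C1 * t powr (N / p) * W w" by (simp add: W_def)
    have "xd z powr (N + j) = t powr - (N + j) * xd w powr (N + j)"
    proof -
      have "t powr - (N + j) * t powr (N + j) = 1" using t by (subst powr_add[symmetric]) simp
      then show ?thesis using x t by (simp only: xw powr_mult mult.assoc[symmetric])
    qed
    then have "xd z powr (N + j) * y powr - (N + j) = t powr - (N + j) * (xd w powr (N + j) * y powr - (N + j))" by simp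
    also have "... \<le> t powr - (N + j) * 2 powr (N + j)" using k[OF x(2) y(1)] by (intro mult_left_mono) auto
    finally have 4: "xd z powr (N + j) * y powr - (N + j) \<le> t powr - (N + j) * 2 powr (N + j)" .
    have "W z * (xd z powr (N + j) * y powr - (N + j)) \<le> (C1 * t powr (N / p) * W w) * (t powr - (N + j) * 2 powr (N + j))"
      by (rule mult_mono[OF 3 4]) (use W0[OF zw(2)] C1(1) in auto)
    also have "... = (C1 * 2 powr (N + j) * W w) * t powr (N / p - (N + j))"
    proof -
      have "N / p - (N + j) = (N / p) + - (N + j)" by simp
      then have "t powr (N / p - (N + j)) = t powr (N / p) * t powr - (N + j)" by (simp only: powr_add)
      then show ?thesis by (simp only: mult_ac)
    qed
    also have "... \<le> (C1 * 2 powr (N + j) * W w) * 1"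
    proof (rule mult_left_mono)
      show "t powr (N / p - (N + j)) \<le> 1" using t j powr_mono[of "N / p - (N + j)" 0 t] by simp
      show "0 \<le> C1 * 2 powr (N + j) * W w" using C1(1) W0[OF zw(2)] by simp
    qed
    finally show ?thesis by (simp add: y_def)
  qed
qed

text \<open>The constant is obtained by absorption: with \<open>M\<close> the supremum of \<open>|f| / W\<close>, the reproducing
  formula for \<open>\<nu>\<^bsub>\<alpha>+j\<^esub>\<close> and \<open>|f| \<le> C M\<^bsup>1-p\<^esup> \<Phi>(|f|) W xd\<^bsup>N\<^esup>\<close> give \<open>M \<le> D M\<^bsup>1-p\<^esup>\<close>. Boundedness
  of \<open>f\<close> only serves to make \<open>M\<close> finite.\<close>

lemma pointwise_quasi_concave_bounded:
  fixes \<alpha> p B :: real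
  assumes al: "\<alpha> > -1" and qc: "quasi_concave p \<Phi>" and B: "B \<ge> 0"
  defines "N \<equiv> real CARD('n::finite) + 1 + \<alpha>"
  obtains C where "C > 0" "\<And>f w K. holomorphic_ball f \<Longrightarrow> \<forall>z\<in>ball 0 1. norm (f z) \<le> K \<Longrightarrow>
     modular \<alpha> \<Phi> (f :: complex ^ 'n \<Rightarrow> complex) \<le> ennreal B \<Longrightarrow> w \<in> ball 0 1 \<Longrightarrow>
     norm (f w) \<le> C * growth_inverse \<Phi> (xd w powr - N)"
proof -
  have p: "p > 0" and gf: "growth_function \<Phi>" using qc by (auto simp: quasi_concave_def)
  have N: "N > 0" unfolding N_def by (rule dim_exponent_pos[OF al])
  obtain C0 where C0: "C0 \<ge> 1" "\<And>s t. s \<ge> 0 \<Longrightarrow> 0 < t \<Longrightarrow> t \<le> 1 \<Longrightarrow> \<Phi> (s * t) \<le> C0 * t powr p * \<Phi> s"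
    using quasi_concave_lower[OF qc] by blast
  obtain C1 where C1: "C1 \<ge> 1" "\<And>s t. 0 < s \<Longrightarrow> s \<le> t \<Longrightarrow> growth_inverse \<Phi> t \<le> C1 * (t / s) powr (1 / p) * growth_inverse \<Phi> s"
    using quasi_concave_inverse_upper[OF qc] by blast
  obtain j :: nat where j: "real j \<ge> N / p" using real_arch_simple by blast
  have jN: "N / p \<le> N + real j" using j N by simp
  define \<beta> where "\<beta> = \<alpha> + real j"
  have \<beta>: "\<beta> > -1" using al by (simp add: \<beta>_def)
  define \<kappa> where "\<kappa> = nu_const TYPE('n) \<beta> / nu_const TYPE('n) \<alpha>"
  have \<kappa>: "\<kappa> > 0" unfolding \<kappa>_def by (intro divide_pos_pos nu_const_eq al \<beta>)
  define D where "D = \<kappa> * C0 * (C1 * 2 powr (N + real j)) * B"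
  have D: "D \<ge> 0" using \<kappa> C0 C1 B by (simp add: D_def)
  \<comment> \<open>The summands cover the cases M <= 1 and M powr p <= D.\<close>
  define C where "C = 1 + D powr (1 / p)"
  have C: "C \<ge> 1" by (simp add: C_def)
  show thesis
  proof (rule that[of C])
    show "C > 0" using C by simp
    fix f :: "complex ^ 'n \<Rightarrow> complex" and w :: "complex ^ 'n" and K
    assume f: "holomorphic_ball f" and bd: "\<forall>z\<in>ball 0 1. norm (f z) \<le> K"
      and fB: "modular \<alpha> \<Phi> f \<le> ennreal B" and w: "w \<in> ball 0 1"
    note K = bspec[OF bd]
    have fm: "f \<in> borel_measurable (nu a)" for a by (rule hol_ball_measurable[OF f])
    have K0: "K \<ge> 0" using order.trans[OF norm_ge_zero K[of 0]] by simp
    have \<Phi>m: "(\<lambda>z. ennreal (\<Phi> (norm (f z)))) \<in> borel_measurable (nu a)" for a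
      using growth_measurable[OF gf fm, of 1 a] by simp
    have intf: "integrable (nu \<beta>) f" by (rule integrable_nu_bounded[OF \<beta> fm K])
    define W where "W z = growth_inverse \<Phi> (xd z powr - N)" for z :: "complex ^ 'n"
    have W0: "W v > 0" if "v \<in> ball 0 1" for v unfolding W_def using xd_posI[OF that] by (intro growth_inverse_pos[OF gf]) simp
    have \<Psi>1: "growth_inverse \<Phi> 1 > 0" by (rule growth_inverse_pos[OF gf]) simp
    define M where "M = (SUP z\<in>ball 0 1. norm (f z) / W z)"
    have bdd: "bdd_above ((\<lambda>z. norm (f z) / W z) ` ball 0 1)"
    proof (rule bdd_aboveI2)
      fix z :: "complex ^ 'n" assume z: "z \<in> ball 0 1"
      have "growth_inverse \<Phi> 1 \<le> W z" unfolding W_def using xd_powr_ge_1[OF z, of N] N by (intro growth_inverse_mono[OF gf]) auto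
      then show "norm (f z) / W z \<le> K / growth_inverse \<Phi> 1" using K[OF z] K0 \<Psi>1 by (intro frac_le) auto
    qed
    have fM: "norm (f z) \<le> M * W z" if z: "z \<in> ball 0 1" for z
    proof -
      have "norm (f z) / W z \<le> M" unfolding M_def by (rule cSUP_upper[OF z bdd])
      then show ?thesis using W0[OF z] by (simp add: divide_le_eq)
    qed
    have MC: "M \<le> C"
    proof (cases "M \<le> 1")
      case True then show ?thesis using C by simp
    next
      case False
      then have M: "M > 1" by simp
      \<comment> \<open>With s = \<Phi>(W z), the lower type at ratio 1/M gives s <= C0 M^(-p)
        \<Phi>(M W z). Since |f z| <= M W z, the antitone quotient passes from \<Phi>(M W z) to
        \<Phi>(|f z|).\<close>
      have key: "norm (f z) \<le> C0 * M powr (1 - p) * \<Phi> (norm (f z)) * W z * xd z powr N" if z: "z \<in> ball 0 1" for z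
      proof (cases "f z = 0")
        case True then show ?thesis using growth_zero[OF gf] by simp
      next
        case nz: False
        define s where "s = xd z powr - N"
        have s: "s > 0" using xd_posI[OF z] by (simp add: s_def)
        have Wz: "W z > 0" by (rule W0[OF z])
        have "s = \<Phi> (W z)" using growth_inverse_eq[OF gf, of s] s by (simp add: W_def s_def)
        also have "... = \<Phi> ((M * W z) * (1 / M))" using M by simp
        also have "... \<le> C0 * (1 / M) powr p * \<Phi> (M * W z)" using M Wz by (intro C0(2)) auto
        finally have 1: "s * M powr p \<le> C0 * \<Phi> (M * W z)" using M by (simp add: powr_divide field_simps)
        have "norm (f z) * (s * M powr p) \<le> norm (f z) * (C0 * \<Phi> (M * W z))" using 1 by (rule mult_left_mono) simp
        also have "... = C0 * (norm (f z) * \<Phi> (M * W z))" by simp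
        also have "... \<le> C0 * ((M * W z) * \<Phi> (norm (f z)))"
          using C0(1) nz fM[OF z] by (intro mult_left_mono quasi_concave_scale[OF qc]) auto
        finally have "norm (f z) * s * M powr p \<le> C0 * M * W z * \<Phi> (norm (f z))" by (simp add: mult_ac)
        then have "norm (f z) \<le> C0 * M * W z * \<Phi> (norm (f z)) / (s * M powr p)" using s M by (simp add: field_simps)
        also have "... = C0 * (M / M powr p) * \<Phi> (norm (f z)) * W z * (1 / s)" by (simp add: mult_ac)
        also have "M / M powr p = M powr (1 - p)" using M by (simp add: powr_diff)
        also have "1 / s = xd z powr N" using xd_posI[OF z] by (simp add: s_def powr_minus_divide)
        finally show ?thesis .
      qed
      have bound: "norm (f v) \<le> (D * M powr (1 - p)) * W v" if v: "v \<in> ball 0 1" for v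
      proof -
        have N\<beta>: "real CARD('n) + 1 + \<beta> = N + real j" by (simp add: N_def \<beta>_def)
        have "ennreal (norm (f v)) = ennreal (norm (\<integral>z. f z * bk (N + real j) v z \<partial>nu \<beta>))"
          using bergman_reproducing[OF \<beta> intf f v] by (simp add: N\<beta>)
        also have "... \<le> (\<integral>\<^sup>+z. ennreal (norm (f z * bk (N + real j) v z)) \<partial>nu \<beta>)"
          by (rule norm_integral_le_nn_integral)
        also have "... = (\<integral>\<^sup>+z. ennreal (\<kappa> * xd z powr (\<beta> - \<alpha>)) * ennreal (norm (f z * bk (N + real j) v z)) \<partial>nu \<alpha>)"
          unfolding \<kappa>_def using fm[of \<alpha>] measurable_bk(1)[OF v, of "N + real j" \<alpha>]
          by (intro nn_integral_nu_shift[OF al \<beta>] measurable_compose[OF _ measurable_ennreal] borel_measurable_norm[THEN measurable_compose[rotated]] borel_measurable_times)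
        also have "... \<le> (\<integral>\<^sup>+z. ennreal (\<kappa> * C0 * M powr (1 - p) * (C1 * 2 powr (N + real j) * W v)) * ennreal (\<Phi> (norm (f z))) \<partial>nu \<alpha>)"
        proof (rule nn_integral_mono)
          fix z :: "complex ^ 'n" assume "z \<in> space (nu \<alpha>)"
          then have z: "z \<in> ball 0 1" by simp
          have nn: "norm v * norm z < 1" using v z by (intro norm_mult_ball_less) auto
          define y where "y = norm (1 - cinner v z)"
          have ph: "\<Phi> (norm (f z)) \<ge> 0" by (rule growth_nonneg[OF gf]) simp
          have "xd z powr real j * (norm (f z) * y powr - (N + real j))
            \<le> xd z powr real j * ((C0 * M powr (1 - p) * \<Phi> (norm (f z)) * W z * xd z powr N) * y powr - (N + real j))"
            by (intro mult_left_mono mult_right_mono key z) auto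
          also have "... = C0 * M powr (1 - p) * \<Phi> (norm (f z)) * (W z * (xd z powr (N + real j) * y powr - (N + real j)))"
            by (simp add: powr_add)
          also have "... \<le> C0 * M powr (1 - p) * \<Phi> (norm (f z)) * (C1 * 2 powr (N + real j) * W v)"
            unfolding y_def W_def using C0(1) ph by (intro mult_left_mono weight_kernel_bound[OF qc N C1 jN z v] mult_nonneg_nonneg) auto
          finally have "\<kappa> * (xd z powr real j * (norm (f z) * y powr - (N + real j))) \<le> \<kappa> * (C0 * M powr (1 - p) * \<Phi> (norm (f z)) * (C1 * 2 powr (N + real j) * W v))"
            using \<kappa> by (intro mult_left_mono) auto
          then have "\<kappa> * xd z powr (\<beta> - \<alpha>) * norm (f z * bk (N + real j) v z) \<le> \<kappa> * C0 * M powr (1 - p) * (C1 * 2 powr (N + real j) * W v) * \<Phi> (norm (f z))"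
            by (simp add: \<beta>_def norm_mult norm_bk[OF nn] y_def mult_ac)
          then show "ennreal (\<kappa> * xd z powr (\<beta> - \<alpha>)) * ennreal (norm (f z * bk (N + real j) v z)) \<le> ennreal (\<kappa> * C0 * M powr (1 - p) * (C1 * 2 powr (N + real j) * W v)) * ennreal (\<Phi> (norm (f z)))"
            using \<kappa> C0(1) C1(1) W0[OF v] ph by (subst (1 2) ennreal_mult[symmetric]) (auto intro!: ennreal_leI)
        qed
        also have "... = ennreal (\<kappa> * C0 * M powr (1 - p) * (C1 * 2 powr (N + real j) * W v)) * modular \<alpha> \<Phi> f"
          by (rule nn_integral_cmult[OF \<Phi>m])
        also have "... \<le> ennreal (\<kappa> * C0 * M powr (1 - p) * (C1 * 2 powr (N + real j) * W v)) * ennreal B"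
          by (intro mult_left_mono fB) simp
        also have "... = ennreal ((D * M powr (1 - p)) * W v)" using B by (subst ennreal_mult''[symmetric]) (auto simp: D_def mult_ac)
        finally show ?thesis using D W0[OF v] by (subst (asm) ennreal_le_iff) auto
      qed
      have "M \<le> D * M powr (1 - p)" unfolding M_def
      proof (rule cSUP_least)
        fix z :: "complex ^ 'n" assume z: "z \<in> ball 0 1"
        show "norm (f z) / W z \<le> D * (SUP z\<in>ball 0 1. norm (f z) / W z) powr (1 - p)"
          using bound[OF z] W0[OF z] by (simp add: M_def divide_le_eq)
      qed auto
      also have "... = D * (M / M powr p)" using M by (simp add: powr_diff)
      finally have "M * M powr p \<le> M * D" using M by (simp add: field_simps)
      then have "M powr p \<le> D" using M by simp
      then have "(M powr p) powr (1 / p) \<le> D powr (1 / p)" using p by (intro powr_mono2) auto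
      moreover have "(M powr p) powr (1 / p) = M" using p M by (simp add: powr_powr)
      ultimately show ?thesis by (simp add: C_def)
    qed
    have "norm (f w) \<le> M * W w" by (rule fM[OF w])
    also have "... \<le> C * W w" using MC W0[OF w] by (intro mult_right_mono) auto
    finally show "norm (f w) \<le> C * growth_inverse \<Phi> (xd w powr - N)" by (simp add: W_def)
  qed
qed


text \<open>If y >= 4 \<eta> a, the shift is at most y/2 and the weight changes by a bounded factor.
  Otherwise y / a < 4 \<eta>, and the integral over all t > 1, namely y^(\<alpha>+1) / (a
  (\<alpha>+1)) for y > 0, is already of size \<eta> y^\<alpha>.\<close>

lemma nn_integral_pos_powr_average:
  assumes al: "\<alpha> > -1" and a: "a \<ge> 0" and \<eta>: "\<eta> > 0"
  shows "(\<integral>\<^sup>+t. indicator {1 + \<eta>..1 + 2 * \<eta>} t * ennreal (pos_powr \<alpha> (y - (t - 1) * a)) \<partial>lborel)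
    \<le> ennreal (\<eta> * (max 1 (2 powr - \<alpha>) + 4 / (\<alpha> + 1)) * pos_powr \<alpha> y)" (is "?I \<le> ennreal (\<eta> * (?M + ?D) * _)")
proof (cases "y > 0")
  case False
  have "?I = (\<integral>\<^sup>+(t::real). 0 \<partial>lborel)"
  proof (rule nn_integral_cong)
    fix t :: real
    show "indicator {1 + \<eta>..1 + 2 * \<eta>} t * ennreal (pos_powr \<alpha> (y - (t - 1) * a)) = 0"
    proof (cases "t \<ge> 1 + \<eta>")
      case True
      then have "(t - 1) * a \<ge> 0" using \<eta> a by simp
      then have "\<not> 0 < y - (t - 1) * a" using False by linarith
      then show ?thesis by (simp add: pos_powr_def)
    qed simp
  qed
  then show ?thesis by simp
next
  case y: True
  have D: "?D \<ge> 0" and M: "?M \<ge> 1" using al by auto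
  show ?thesis
  proof (cases "y \<ge> 4 * \<eta> * a")
    case True
    have "?I \<le> (\<integral>\<^sup>+t. ennreal (?M * y powr \<alpha>) * indicator {1 + \<eta>..1 + 2 * \<eta>} t \<partial>lborel)"
    proof (rule nn_integral_mono)
      fix t :: real
      show "indicator {1 + \<eta>..1 + 2 * \<eta>} t * ennreal (pos_powr \<alpha> (y - (t - 1) * a)) \<le> ennreal (?M * y powr \<alpha>) * indicator {1 + \<eta>..1 + 2 * \<eta>} t"
      proof (cases "t \<in> {1 + \<eta>..1 + 2 * \<eta>}")
        case t: True
        define z where "z = y - (t - 1) * a"
        have "(t - 1) * a \<ge> 0" "(t - 1) * a \<le> 2 * \<eta> * a" using t a \<eta> by (auto intro!: mult_right_mono)
        then have z: "y / 2 \<le> z" "z \<le> y" using True by (auto simp: z_def)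
        have "z powr \<alpha> \<le> ?M * y powr \<alpha>"
        proof (cases "\<alpha> \<ge> 0")
          case True
          then have "z powr \<alpha> \<le> 1 * y powr \<alpha>" using z y by (simp add: powr_mono2)
          also have "... \<le> ?M * y powr \<alpha>" by (rule mult_right_mono) auto
          finally show ?thesis .
        next
          case False
          have "z powr \<alpha> \<le> (y / 2) powr \<alpha>" using z y False by (intro powr_mono2') auto
          also have "... = 2 powr - \<alpha> * y powr \<alpha>" using y by (simp add: powr_divide powr_minus_divide)
          also have "... \<le> ?M * y powr \<alpha>" by (rule mult_right_mono) auto
          finally show ?thesis .
        qed
        then show ?thesis using t z y by (auto simp: pos_powr_def z_def[symmetric] ennreal_leI)
      qed simp
    qed
    also have "... = ennreal (?M * y powr \<alpha> * \<eta>)"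
      using \<eta> M by (subst nn_integral_cmult_indicator) (auto simp flip: ennreal_mult')
    also have "... \<le> ennreal (\<eta> * (?M + ?D) * pos_powr \<alpha> y)"
    proof (rule ennreal_leI)
      have "?M * (y powr \<alpha> * \<eta>) \<le> (?M + ?D) * (y powr \<alpha> * \<eta>)" using D \<eta> by (intro mult_right_mono) auto
      then show "?M * y powr \<alpha> * \<eta> \<le> \<eta> * (?M + ?D) * pos_powr \<alpha> y" using y by (simp add: pos_powr_def mult_ac)
    qed
    finally show ?thesis .
  next
    case False
    then have "0 < 4 * \<eta> * a" using y by linarith
    then have a0: "a > 0" using \<eta> by (simp add: zero_less_mult_iff)
    have "?I \<le> (\<integral>\<^sup>+t. ennreal (1 / a) * (indicator {1<..} t * ennreal (a * pos_powr \<alpha> (y - (t - 1) * a))) \<partial>lborel)"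
    proof (rule nn_integral_mono)
      fix t :: real
      have "ennreal (1 / a) * ennreal (a * pos_powr \<alpha> (y - (t - 1) * a)) = ennreal (pos_powr \<alpha> (y - (t - 1) * a))"
        using a0 by (simp flip: ennreal_mult')
      then show "indicator {1 + \<eta>..1 + 2 * \<eta>} t * ennreal (pos_powr \<alpha> (y - (t - 1) * a))
        \<le> ennreal (1 / a) * (indicator {1<..} t * ennreal (a * pos_powr \<alpha> (y - (t - 1) * a)))"
        using \<eta> by (auto simp: indicator_def)
    qed
    also have "... = ennreal (1 / a) * ennreal (pos_powr (\<alpha> + 1) y / (\<alpha> + 1))"
      by (subst nn_integral_cmult) (auto simp: nn_integral_pos_powr_affine[OF al a0])
    also have "... = ennreal (1 / a * (pos_powr (\<alpha> + 1) y / (\<alpha> + 1)))" using a0 by (intro ennreal_mult'[symmetric]) simp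
    also have "... \<le> ennreal (\<eta> * (?M + ?D) * pos_powr \<alpha> y)"
    proof (rule ennreal_leI)
      have "1 / a * (pos_powr (\<alpha> + 1) y / (\<alpha> + 1)) = (y / a) * (y powr \<alpha> / (\<alpha> + 1))"
        using y by (simp add: pos_powr_def powr_add)
      also have "... \<le> (4 * \<eta>) * (y powr \<alpha> / (\<alpha> + 1))"
        using False a0 al by (intro mult_right_mono) (auto simp: field_simps)
      also have "... = \<eta> * ?D * y powr \<alpha>" by simp
      also have "... \<le> \<eta> * (?M + ?D) * y powr \<alpha>" using \<eta> M by (intro mult_right_mono mult_left_mono) auto
      finally show "1 / a * (pos_powr (\<alpha> + 1) y / (\<alpha> + 1)) \<le> \<eta> * (?M + ?D) * pos_powr \<alpha> y" using y by (simp add: pos_powr_def)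
    qed
    finally show ?thesis .
  qed
qed

text \<open>For \<open>\<alpha> < 0\<close> the dilations are not bounded on \<open>L\<^sup>1\<close> uniformly in the ratio, but their average over
  ratios \<open>1 / sqrt t\<close> with \<open>t - 1\<close> of size \<open>\<eta>\<close> is: \<open>t\<close> enters the weight \<open>1 - t |\<xi>|\<^sup>2\<close> linearly.\<close>

lemma exists_dilation_bound:
  fixes \<alpha> :: real
  assumes al: "\<alpha> > -1"
  obtains C where "C > 0" "\<And>(u :: complex ^ 'n \<Rightarrow> ennreal) \<eta> \<delta>. u \<in> borel_measurable (nu \<alpha>) \<Longrightarrow> 0 < \<eta> \<Longrightarrow> \<eta> \<le> 1 / 2 \<Longrightarrow> \<delta> > 0 \<Longrightarrow>
     (\<integral>\<^sup>+z. u z \<partial>nu \<alpha>) < \<infinity> \<Longrightarrow>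
     \<exists>t\<in>{1 + \<eta>..1 + 2 * \<eta>}. (\<integral>\<^sup>+z. u ((1 / sqrt t) *\<^sub>R z) \<partial>nu \<alpha>) \<le> ennreal C * (\<integral>\<^sup>+z. u z \<partial>nu \<alpha>) + ennreal \<delta>"
proof -
  define d where "d = DIM(complex ^ 'n)"
  define A where "A = max 1 (2 powr - \<alpha>) + 4 / (\<alpha> + 1)"
  have "4 / (\<alpha> + 1) \<ge> 0" using al by simp
  then have A: "A \<ge> 1" by (simp add: A_def add_increasing2)
  define C where "C = 2 ^ d * A"
  have C: "C > 0" using A by (simp add: C_def)
  let ?k = "nu_const TYPE('n) \<alpha>"
  have k: "?k > 0" by (rule nu_const_eq(2)[OF al])
  show ?thesis
  proof (rule that[OF C])
    fix u :: "complex ^ 'n \<Rightarrow> ennreal" and \<eta> \<delta> :: real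
    assume u: "u \<in> borel_measurable (nu \<alpha>)" and \<eta>: "0 < \<eta>" "\<eta> \<le> 1 / 2" and \<delta>: "\<delta> > 0"
      and fin: "(\<integral>\<^sup>+z. u z \<partial>nu \<alpha>) < \<infinity>"
    define U where "U = (\<integral>\<^sup>+z. u z \<partial>nu \<alpha>)"
    \<comment> \<open>The extension of u by zero; u is measurable on the ball only.\<close>
    define v where "v z = u z * ennreal (pos_powr 0 (xd z))" for z
    have vm[measurable]: "v \<in> borel_measurable borel" unfolding v_def by (rule measurable_nu_times_weight[OF u])
    have v: "v z = u z" if "z \<in> ball 0 1" for z using xd_posI[OF that] by (simp add: v_def pos_powr_def)
    have vu: "v z * ennreal (pos_powr \<alpha> (xd z)) = u z * ennreal (pos_powr \<alpha> (xd z))" for z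
      using v[of z] xd_pos_iff[of z] by (cases "z \<in> ball 0 1") (auto simp: pos_powr_def)
    let ?I = "{1 + \<eta>..1 + 2 * \<eta>}"
    define G where "G t = (\<integral>\<^sup>+(z::complex^'n). v z * ennreal (pos_powr \<alpha> (xd z - (t - 1) * (norm z)\<^sup>2)) \<partial>lborel)" for t
    have J: "(\<integral>\<^sup>+z. u ((1 / sqrt t) *\<^sub>R z) \<partial>nu \<alpha>) \<le> ennreal (?k * 2 ^ d) * G t" if t: "t \<in> ?I" for t
    proof -
      have t1: "1 \<le> sqrt t" "sqrt t \<le> 2" "t \<ge> 0" using t \<eta> by (auto intro: real_le_lsqrt)
      let ?F = "\<lambda>z. v ((1 / sqrt t) *\<^sub>R z) * ennreal (pos_powr \<alpha> (xd z))"
      have "(\<integral>\<^sup>+z. u ((1 / sqrt t) *\<^sub>R z) \<partial>nu \<alpha>) = (\<integral>\<^sup>+z. v ((1 / sqrt t) *\<^sub>R z) \<partial>nu \<alpha>)"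
        using t1 by (intro nn_integral_cong v[symmetric] dilate_in_ball) auto
      also have "... = ennreal ?k * (\<integral>\<^sup>+z. ?F z \<partial>lborel)"
        by (rule nn_integral_nu[OF al]) (rule measurable_borel_nu, measurable)
      also have "(\<integral>\<^sup>+z. ?F z \<partial>lborel) = ennreal (sqrt t ^ d) * G t"
      proof -
        have "(\<integral>\<^sup>+z. ?F (sqrt t *\<^sub>R z) \<partial>lborel) = ennreal (1 / sqrt t ^ d) * (\<integral>\<^sup>+z. ?F z \<partial>lborel)"
          unfolding d_def using t1 by (intro nn_integral_lborel_scaleR) auto
        moreover have "?F (sqrt t *\<^sub>R z) = v z * ennreal (pos_powr \<alpha> (xd z - (t - 1) * (norm z)\<^sup>2))" for z
        proof -
          have 3: "(norm (sqrt t *\<^sub>R z))\<^sup>2 = t * (norm z)\<^sup>2" using t1 by (simp add: power_mult_distrib)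
          have "xd (sqrt t *\<^sub>R z) = xd z - (t - 1) * (norm z)\<^sup>2" unfolding xd_def 3 by (simp add: algebra_simps)
          then show ?thesis using t1 by simp
        qed
        ultimately have "G t = ennreal (1 / sqrt t ^ d) * (\<integral>\<^sup>+z. ?F z \<partial>lborel)" by (simp add: G_def)
        then have "ennreal (sqrt t ^ d) * G t = ennreal (sqrt t ^ d * (1 / sqrt t ^ d)) * (\<integral>\<^sup>+z. ?F z \<partial>lborel)"
          using t1 by (simp only: ennreal_mult' mult.assoc[symmetric] zero_le_power real_sqrt_ge_zero)
        then show ?thesis using t1 by simp
      qed
      also have "ennreal ?k * (ennreal (sqrt t ^ d) * G t) \<le> ennreal ?k * (ennreal (2 ^ d) * G t)"
        using t1 by (intro mult_left_mono mult_right_mono ennreal_leI power_mono) auto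
      also have "... = ennreal (?k * 2 ^ d) * G t" using k by (simp add: ennreal_mult mult.assoc)
      finally show ?thesis .
    qed
    have avg: "(\<integral>\<^sup>+t. indicator ?I t * G t \<partial>lborel) \<le> ennreal (\<eta> * A / ?k) * U"
    proof -
      have "(\<integral>\<^sup>+t. indicator ?I t * G t \<partial>lborel) =
          (\<integral>\<^sup>+t. \<integral>\<^sup>+(z::complex^'n). indicator ?I t * (v z * ennreal (pos_powr \<alpha> (xd z - (t - 1) * (norm z)\<^sup>2))) \<partial>lborel \<partial>lborel)"
        unfolding G_def by (intro nn_integral_cong nn_integral_cmult[symmetric]) measurable
      also have "... = (\<integral>\<^sup>+(z::complex^'n). \<integral>\<^sup>+t. indicator ?I t * (v z * ennreal (pos_powr \<alpha> (xd z - (t - 1) * (norm z)\<^sup>2))) \<partial>lborel \<partial>lborel)"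
        by (rule lborel_pair.Fubini') measurable
      also have "... = (\<integral>\<^sup>+(z::complex^'n). v z * (\<integral>\<^sup>+t. indicator ?I t * ennreal (pos_powr \<alpha> (xd z - (t - 1) * (norm z)\<^sup>2)) \<partial>lborel) \<partial>lborel)"
        by (intro nn_integral_cong, subst nn_integral_cmult[symmetric]) (auto simp: mult_ac)
      also have "... \<le> (\<integral>\<^sup>+(z::complex^'n). v z * ennreal (\<eta> * A * pos_powr \<alpha> (xd z)) \<partial>lborel)"
        unfolding A_def using \<eta> by (intro nn_integral_mono mult_left_mono nn_integral_pos_powr_average[OF al]) auto
      also have "... = (\<integral>\<^sup>+(z::complex^'n). ennreal (\<eta> * A) * (u z * ennreal (pos_powr \<alpha> (xd z))) \<partial>lborel)"
        using \<eta> A by (intro nn_integral_cong) (simp add: ennreal_mult vu[symmetric] mult_ac)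
      also have "... = ennreal (\<eta> * A) * (\<integral>\<^sup>+(z::complex^'n). u z * ennreal (pos_powr \<alpha> (xd z)) \<partial>lborel)"
        using measurable_nu_times_weight[OF u] by (intro nn_integral_cmult) simp
      also have "(\<integral>\<^sup>+(z::complex^'n). u z * ennreal (pos_powr \<alpha> (xd z)) \<partial>lborel) = ennreal (1 / ?k) * U"
      proof -
        have "ennreal (1 / ?k) * U = ennreal (1 / ?k * ?k) * (\<integral>\<^sup>+(z::complex^'n). u z * ennreal (pos_powr \<alpha> (xd z)) \<partial>lborel)"
          unfolding U_def nn_integral_nu[OF al u] using k by (simp only: ennreal_mult' mult.assoc[symmetric] zero_le_divide_1_iff less_imp_le)
        then show ?thesis using k by simp
      qed
      also have "ennreal (\<eta> * A) * (ennreal (1 / ?k) * U) = ennreal (\<eta> * A / ?k) * U"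
        using \<eta> A k by (simp flip: ennreal_mult' mult.assoc)
      finally show ?thesis .
    qed
    show "\<exists>t\<in>?I. (\<integral>\<^sup>+z. u ((1 / sqrt t) *\<^sub>R z) \<partial>nu \<alpha>) \<le> ennreal C * (\<integral>\<^sup>+z. u z \<partial>nu \<alpha>) + ennreal \<delta>"
    proof (rule ccontr)
      assume "\<not> ?thesis"
      \<comment> \<open>C is the constant of the averaged bound. If every t in the interval failed,
        integration over the interval would exceed that bound by \<delta> \<eta>.\<close>
      then have gt: "ennreal C * U + ennreal \<delta> \<le> ennreal (?k * 2 ^ d) * G t" if "t \<in> ?I" for t
        using that J[OF that] unfolding U_def by (meson linear order_trans)
      have "(ennreal C * U + ennreal \<delta>) * ennreal \<eta> = (\<integral>\<^sup>+t. (ennreal C * U + ennreal \<delta>) * indicator ?I t \<partial>lborel)"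
        using \<eta> by (subst nn_integral_cmult_indicator) auto
      also have "... \<le> (\<integral>\<^sup>+t. ennreal (?k * 2 ^ d) * (indicator ?I t * G t) \<partial>lborel)"
        using gt by (intro nn_integral_mono) (auto simp: indicator_def)
      also have "... = ennreal (?k * 2 ^ d) * (\<integral>\<^sup>+t. indicator ?I t * G t \<partial>lborel)"
        unfolding G_def by (rule nn_integral_cmult) measurable
      also have "... \<le> ennreal (?k * 2 ^ d) * (ennreal (\<eta> * A / ?k) * U)" by (rule mult_left_mono[OF avg]) simp
      also have "... = ennreal (?k * 2 ^ d * (\<eta> * A / ?k)) * U"
        using \<eta> A k by (simp only: ennreal_mult' mult.assoc[symmetric] mult_nonneg_nonneg divide_nonneg_nonneg less_imp_le zero_le_power zero_le_numeral)
      also have "?k * 2 ^ d * (\<eta> * A / ?k) = C * \<eta>" using k by (simp add: C_def)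
      also have "ennreal (C * \<eta>) * U = ennreal C * U * ennreal \<eta>" using C \<eta> by (simp add: ennreal_mult mult_ac)
      finally have le: "ennreal C * U * ennreal \<eta> + ennreal \<delta> * ennreal \<eta> \<le> ennreal C * U * ennreal \<eta>" by (simp add: distrib_right)
      have "ennreal C * U * ennreal \<eta> < \<infinity>" using fin by (simp add: U_def ennreal_mult_less_top)
      moreover have "ennreal \<delta> * ennreal \<eta> > 0" using \<delta> \<eta> by (simp add: ennreal_zero_less_mult_iff)
      ultimately show False using le by (simp add: ennreal_add_left_cancel_le less_top[symmetric] add.commute not_le[symmetric])
    qed
  qed
qed

text \<open>Dilates by r < 1 are bounded, so the bounded case applies to them. Along ratios tending
  to 1 their modulars stay below D B + 1, and continuity at w gives the bound for f.\<close>

theorem pointwise_quasi_concave: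
  fixes \<alpha> p B :: real
  assumes al: "\<alpha> > -1" and qc: "quasi_concave p \<Phi>" and B: "B \<ge> 0"
  defines "N \<equiv> real CARD('n::finite) + 1 + \<alpha>"
  obtains C where "C > 0" "\<And>f w. holomorphic_ball f \<Longrightarrow>
     modular \<alpha> \<Phi> (f :: complex ^ 'n \<Rightarrow> complex) \<le> ennreal B \<Longrightarrow> w \<in> ball 0 1 \<Longrightarrow>
     norm (f w) \<le> C * growth_inverse \<Phi> (xd w powr - N)"
proof -
  have gf: "growth_function \<Phi>" using qc by (simp add: quasi_concave_def)
  obtain D where D: "D > 0" "\<And>(u :: complex ^ 'n \<Rightarrow> ennreal) \<eta> \<delta>. u \<in> borel_measurable (nu \<alpha>) \<Longrightarrow> 0 < \<eta> \<Longrightarrow> \<eta> \<le> 1 / 2 \<Longrightarrow> \<delta> > 0 \<Longrightarrow>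
     (\<integral>\<^sup>+z. u z \<partial>nu \<alpha>) < \<infinity> \<Longrightarrow>
     \<exists>t\<in>{1 + \<eta>..1 + 2 * \<eta>}. (\<integral>\<^sup>+z. u ((1 / sqrt t) *\<^sub>R z) \<partial>nu \<alpha>) \<le> ennreal D * (\<integral>\<^sup>+z. u z \<partial>nu \<alpha>) + ennreal \<delta>"
    by (rule exists_dilation_bound[OF al]) (rule that)
  have B1: "D * B + 1 \<ge> 0" using D(1) B by simp
  obtain C where C: "C > 0" "\<And>f w K. holomorphic_ball f \<Longrightarrow> \<forall>z\<in>ball 0 1. norm (f z) \<le> K \<Longrightarrow>
     modular \<alpha> \<Phi> (f :: complex ^ 'n \<Rightarrow> complex) \<le> ennreal (D * B + 1) \<Longrightarrow> w \<in> ball 0 1 \<Longrightarrow>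
     norm (f w) \<le> C * growth_inverse \<Phi> (xd w powr - N)"
    by (rule pointwise_quasi_concave_bounded[OF al qc B1, where 'n='n, folded N_def]) (rule that)
  show thesis
  proof (rule that[OF C(1)])
    fix f :: "complex ^ 'n \<Rightarrow> complex" and w :: "complex ^ 'n"
    assume f: "holomorphic_ball f" and fB: "modular \<alpha> \<Phi> f \<le> ennreal B" and w: "w \<in> ball 0 1"
    have \<Phi>m: "(\<lambda>z. ennreal (\<Phi> (norm (f z)))) \<in> borel_measurable (nu \<alpha>)"
      using growth_measurable[OF gf hol_ball_measurable[OF f, of \<alpha>], of 1] by simp
    define \<eta> where "\<eta> j = inverse (real (Suc (Suc j)))" for j
    have \<eta>: "0 < \<eta> j" "\<eta> j \<le> 1 / 2" for j by (auto simp: \<eta>_def field_simps)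
    have "modular \<alpha> \<Phi> f < \<infinity>" using fB by (rule order.strict_trans1) simp
    then have "\<forall>j. \<exists>t\<in>{1 + \<eta> j..1 + 2 * \<eta> j}. (\<integral>\<^sup>+z. ennreal (\<Phi> (norm (f ((1 / sqrt t) *\<^sub>R z)))) \<partial>nu \<alpha>)
        \<le> ennreal D * modular \<alpha> \<Phi> f + ennreal 1"
      using D(2)[OF \<Phi>m \<eta> zero_less_one] by blast
    then obtain t where t: "\<And>j. t j \<in> {1 + \<eta> j..1 + 2 * \<eta> j}"
        "\<And>j. (\<integral>\<^sup>+z. ennreal (\<Phi> (norm (f ((1 / sqrt (t j)) *\<^sub>R z)))) \<partial>nu \<alpha>)
          \<le> ennreal D * modular \<alpha> \<Phi> f + ennreal 1"
      by metis
    define r where "r j = 1 / sqrt (t j)" for j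
    have t1: "t j > 1" for j using t(1)[of j] \<eta>(1)[of j] by auto
    have r: "0 \<le> r j" "r j \<le> 1" "r j < 1" for j using t1[of j] by (auto simp: r_def)
    have "norm (f (r j *\<^sub>R w)) \<le> C * growth_inverse \<Phi> (xd w powr - N)" for j
    proof -
      obtain M where M: "\<And>z. z \<in> ball 0 1 \<Longrightarrow> norm (f (r j *\<^sub>R z)) \<le> M" by (rule bounded_hol_dilate[OF f r(1,3)]) (rule that)
      have "(\<integral>\<^sup>+z. ennreal (\<Phi> (norm (f (r j *\<^sub>R z)))) \<partial>nu \<alpha>) \<le> ennreal D * ennreal B + ennreal 1"
        unfolding r_def by (rule order.trans[OF t(2)]) (intro add_mono mult_left_mono fB, auto)
      also have "... = ennreal (D * B + 1)" using D(1) B by (simp add: ennreal_mult)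
      finally show ?thesis using M by (intro C(2)[OF hol_ball_dilate[OF f r(1,2)] _ _ w]) auto
    qed
    moreover have "(\<lambda>j. norm (f (r j *\<^sub>R w))) \<longlonglongrightarrow> norm (f (1 *\<^sub>R w))"
    proof (intro tendsto_norm isCont_tendsto_compose[of _ f] tendsto_scaleR tendsto_const)
      show "isCont f (1 *\<^sub>R w)" using hol_ball_imp_continuous_on[OF f] w by (simp add: continuous_on_eq_continuous_at)
      have \<eta>0: "\<eta> \<longlonglongrightarrow> 0" unfolding \<eta>_def by (rule LIMSEQ_Suc[OF LIMSEQ_inverse_real_of_nat])
      have "t \<longlonglongrightarrow> 1"
      proof (rule tendsto_sandwich)
        show "(\<lambda>j. 1 + \<eta> j) \<longlonglongrightarrow> 1" "(\<lambda>j. 1 + 2 * \<eta> j) \<longlonglongrightarrow> 1" using \<eta>0 by (auto intro!: tendsto_eq_intros)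
      qed (use t(1) in auto)
      then have "(\<lambda>j. 1 / sqrt (t j)) \<longlonglongrightarrow> 1 / sqrt 1" by (intro tendsto_intros) auto
      then show "r \<longlonglongrightarrow> 1" by (simp add: r_def[abs_def])
    qed
    ultimately show "norm (f w) \<le> C * growth_inverse \<Phi> (xd w powr - N)" by (intro tendsto_upperbound) auto
  qed
qed

text \<open>Where g exceeds t = \<open>growth_inverse \<Phi> A\<close>, the monotone quotient gives
  g <= (t / A) \<Phi>(g). Hence g <= t + (t / A) \<Phi>(g) everywhere, and each summand integrates
  to at most t.\<close>

lemma quasi_Jensen:
  fixes g :: "'a \<Rightarrow> real"
  assumes qv: "quasi_convex \<Phi>" and g: "\<And>x. x \<in> space M \<Longrightarrow> 0 \<le> g x" "g \<in> borel_measurable M" and M: "emeasure M (space M) \<le> 1"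
    and A: "A > 0" "(\<integral>\<^sup>+x. ennreal (\<Phi> (g x)) \<partial>M) \<le> ennreal A" and \<Phi>g: "(\<lambda>x. ennreal (\<Phi> (g x))) \<in> borel_measurable M"
  shows "(\<integral>\<^sup>+x. ennreal (g x) \<partial>M) \<le> ennreal (2 * growth_inverse \<Phi> A)"
proof -
  have gf: "growth_function \<Phi>" using qv by (simp add: quasi_convex_def)
  define t where "t = growth_inverse \<Phi> A"
  have t: "t > 0" "\<Phi> t = A" using A by (auto simp: t_def intro: growth_inverse_pos[OF gf] growth_inverse_eq[OF gf])
  have "(\<integral>\<^sup>+x. ennreal (g x) \<partial>M) \<le> (\<integral>\<^sup>+x. ennreal t + ennreal (t / A) * ennreal (\<Phi> (g x)) \<partial>M)"
  proof (rule nn_integral_mono)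
    fix x assume x: "x \<in> space M"
    have ph: "\<Phi> (g x) \<ge> 0" by (rule growth_nonneg[OF gf g(1)[OF x]])
    have "g x \<le> t + t / A * \<Phi> (g x)"
    proof (cases "g x \<le> t")
      case True then show ?thesis using ph t A by (simp add: add_increasing2)
    next
      case False
      have "\<Phi> ((t / g x) * g x) \<le> (t / g x) * \<Phi> (g x)" using False t by (intro quasi_convex_scale[OF qv]) auto
      then have "A * g x \<le> t * \<Phi> (g x)" using False t by (simp add: field_simps)
      then have "g x \<le> t / A * \<Phi> (g x)" using A by (simp add: field_simps)
      then show ?thesis using t by simp
    qed
    then show "ennreal (g x) \<le> ennreal t + ennreal (t / A) * ennreal (\<Phi> (g x))"
      using t A ph by (simp flip: ennreal_mult ennreal_plus add: ennreal_leI)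
  qed
  also have "... = ennreal t * emeasure M (space M) + ennreal (t / A) * (\<integral>\<^sup>+x. ennreal (\<Phi> (g x)) \<partial>M)"
    using \<Phi>g by (subst nn_integral_add) (auto simp: nn_integral_cmult)
  also have "... \<le> ennreal t * 1 + ennreal (t / A) * ennreal A" by (intro add_mono mult_left_mono M A) auto
  also have "... = ennreal (2 * t)" using t A by (simp flip: ennreal_mult' ennreal_plus)
  finally show ?thesis by (simp add: t_def)
qed

lemma lux_admissible_mono:
  assumes gf: "growth_function \<Phi>" and c: "0 < c" "c \<le> d" and f: "(\<integral>\<^sup>+z. ennreal (\<Phi> (norm (f z) / c)) \<partial>M) \<le> 1"
  shows "(\<integral>\<^sup>+z. ennreal (\<Phi> (norm (f z) / d)) \<partial>M) \<le> 1"
proof -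
  have "(\<integral>\<^sup>+z. ennreal (\<Phi> (norm (f z) / d)) \<partial>M) \<le> (\<integral>\<^sup>+z. ennreal (\<Phi> (norm (f z) / c)) \<partial>M)"
    using c by (intro nn_integral_mono ennreal_leI growth_mono[OF gf] divide_left_mono) auto
  with f show ?thesis by simp
qed

text \<open>Jensen's inequality under the probability density of exponent 2N centred at w. As |1 -
  cinner z w| >= xd w / 2, the density is at most \<open>?A\<close>, and so is the modular under it.
  The factor 4 powr N comes out of the inverse by quasi-convexity.\<close>

lemma pointwise_quasi_convex:
  fixes F :: "complex ^ 'n \<Rightarrow> complex"
  assumes al: "\<alpha> > -1" and qv: "quasi_convex \<Phi>" and F: "holomorphic_ball F" and c: "c > 0"
    and adm: "(\<integral>\<^sup>+z. ennreal (\<Phi> (norm (F z) / c)) \<partial>nu \<alpha>) \<le> 1" and w: "w \<in> ball 0 1"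
  defines "N \<equiv> real CARD('n) + 1 + \<alpha>"
  shows "norm (F w) \<le> 2 * 4 powr N * c * growth_inverse \<Phi> (xd w powr - N)"
proof -
  have gf: "growth_function \<Phi>" using qv by (simp add: quasi_convex_def)
  have N: "N > 0" unfolding N_def by (rule dim_exponent_pos[OF al])
  have x: "xd w > 0" by (rule xd_posI[OF w])
  have Fm: "F \<in> borel_measurable (nu \<alpha>)" by (rule hol_ball_measurable[OF F])
  let ?g = "\<lambda>z. norm (F z) / c"
  have gm: "?g \<in> borel_measurable (nu \<alpha>)" using Fm by measurable
  have \<Phi>m: "(\<lambda>z. ennreal (\<Phi> (?g z))) \<in> borel_measurable (nu \<alpha>)"
    using growth_measurable[OF gf Fm c] by measurable
  have g0: "0 \<le> ?g z" for z using c by simp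
  have e1: "emeasure (nu \<alpha>) (space (nu \<alpha> :: (complex ^ 'n) measure)) \<le> 1" by (simp add: emeasure_nu_space[OF al])
  \<comment> \<open>A first use of Jensen's inequality, under \<open>nu \<alpha>\<close> itself: it
    makes F integrable, as the mean value inequality requires.\<close>
  have "(\<integral>\<^sup>+z. ennreal (?g z) \<partial>nu \<alpha>) \<le> ennreal (2 * growth_inverse \<Phi> 1)"
    by (rule quasi_Jensen[OF qv g0 gm e1 _ _ \<Phi>m]) (use adm in auto)
  also have "... < \<infinity>" by simp
  finally have "integrable (nu \<alpha>) ?g" using gm g0 by (intro integrableI_nonneg) auto
  then have "integrable (nu \<alpha>) (\<lambda>z. c * (norm (F z) / c))" by (rule integrable_mult_right)
  then have "integrable (nu \<alpha>) (\<lambda>z. norm (F z))" using c by simp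
  then have intF: "integrable (nu \<alpha>) F" using Fm by (simp add: integrable_norm_iff)
  let ?w = "\<lambda>z. xd w powr N * norm (1 - cinner z w) powr - (2 * N)"
  let ?M = "density (nu \<alpha>) (\<lambda>z. ennreal (?w z))"
  have wm: "(\<lambda>z. ennreal (?w z)) \<in> borel_measurable (nu \<alpha>)" by measurable
  note [measurable] = Fm gm
  have "emeasure ?M (space ?M) = (\<integral>\<^sup>+z. ennreal (?w z) \<partial>nu \<alpha>)"
  proof -
    have "emeasure ?M (space (nu \<alpha>)) = (\<integral>\<^sup>+z. ennreal (?w z) * indicator (space (nu \<alpha>)) z \<partial>nu \<alpha>)"
      by (rule emeasure_density[OF wm sets.top])
    also have "... = (\<integral>\<^sup>+z. ennreal (?w z) \<partial>nu \<alpha>)" by (intro nn_integral_cong) simp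
    finally show ?thesis by simp
  qed
  also have "... = ennreal (xd w powr N) * (\<integral>\<^sup>+z. ennreal (norm (1 - cinner z w) powr - (2 * N)) \<partial>nu \<alpha>)"
    by (subst nn_integral_cmult[symmetric]) (auto simp: ennreal_mult)
  also have "... = 1" unfolding N_def forelli_rudin_N[OF al w] using x by (simp flip: ennreal_mult' powr_add)
  finally have e2: "emeasure ?M (space ?M) \<le> 1" by simp
  let ?A = "4 powr N * xd w powr - N"
  have "(\<integral>\<^sup>+z. ennreal (\<Phi> (?g z)) \<partial>?M) = (\<integral>\<^sup>+z. ennreal (?w z) * ennreal (\<Phi> (?g z)) \<partial>nu \<alpha>)"
    by (rule nn_integral_density[OF wm \<Phi>m])
  also have "... \<le> (\<integral>\<^sup>+z. ennreal ?A * ennreal (\<Phi> (?g z)) \<partial>nu \<alpha>)"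
  proof (intro nn_integral_mono mult_right_mono ennreal_leI)
    fix z :: "complex ^ 'n" assume "z \<in> space (nu \<alpha>)"
    then have z: "z \<in> ball 0 1" by simp
    have "xd w / 2 \<le> norm (1 - cinner z w)" using xd_le_2_norm(2)[of w z] z w by simp
    then have "norm (1 - cinner z w) powr - (2 * N) \<le> (xd w / 2) powr - (2 * N)" using x N by (intro powr_mono2') auto
    also have "(xd w / 2) powr - (2 * N) = xd w powr - N * xd w powr - N * 4 powr N"
    proof -
      have "(2::real) powr (2 * N) = 4 powr N" by (simp add: powr_powr[symmetric])
      then show ?thesis using x by (simp add: powr_divide powr_minus_divide powr_add[symmetric])
    qed
    finally have "?w z \<le> xd w powr N * (xd w powr - N * xd w powr - N * 4 powr N)" by (intro mult_left_mono) auto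
    also have "... = (xd w powr N * xd w powr - N) * ?A" by simp
    also have "xd w powr N * xd w powr - N = 1" using x by (subst powr_add[symmetric]) simp
    finally show "?w z \<le> ?A" by simp
  qed simp
  also have "... = ennreal ?A * (\<integral>\<^sup>+z. ennreal (\<Phi> (?g z)) \<partial>nu \<alpha>)" by (rule nn_integral_cmult[OF \<Phi>m])
  also have "... \<le> ennreal ?A * 1" by (intro mult_left_mono adm) simp
  finally have AM: "(\<integral>\<^sup>+z. ennreal (\<Phi> (?g z)) \<partial>?M) \<le> ennreal ?A" by simp
  have A0: "?A > 0" using x by simp
  have J: "(\<integral>\<^sup>+z. ennreal (?g z) \<partial>?M) \<le> ennreal (2 * growth_inverse \<Phi> ?A)"
    by (rule quasi_Jensen[OF qv g0 _ e2 A0 AM]) (use gm \<Phi>m in auto)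
  have "ennreal (norm (F w)) \<le> ennreal (xd w powr N) * (\<integral>\<^sup>+z. ennreal (norm (F z)) * ennreal (norm (1 - cinner z w) powr - (2 * N)) \<partial>nu \<alpha>)"
    unfolding N_def by (rule norm_le_bergman_poisson[OF al intF F w])
  also have "... = (\<integral>\<^sup>+z. ennreal (xd w powr N) * (ennreal (norm (F z)) * ennreal (norm (1 - cinner z w) powr - (2 * N))) \<partial>nu \<alpha>)"
    by (intro nn_integral_cmult[symmetric]) measurable
  also have "... = (\<integral>\<^sup>+z. ennreal c * (ennreal (?w z) * ennreal (?g z)) \<partial>nu \<alpha>)"
    using c by (intro nn_integral_cong) (simp flip: ennreal_mult)
  also have "... = ennreal c * (\<integral>\<^sup>+z. ennreal (?w z) * ennreal (?g z) \<partial>nu \<alpha>)"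
    by (intro nn_integral_cmult) measurable
  also have "(\<integral>\<^sup>+z. ennreal (?w z) * ennreal (?g z) \<partial>nu \<alpha>) = (\<integral>\<^sup>+z. ennreal (?g z) \<partial>?M)"
    by (intro nn_integral_density[symmetric] wm) measurable
  also have "ennreal c * ... \<le> ennreal c * ennreal (2 * growth_inverse \<Phi> ?A)" by (intro mult_left_mono J) simp
  also have "... = ennreal (c * (2 * growth_inverse \<Phi> ?A))" using c by (simp add: ennreal_mult')
  finally have 1: "norm (F w) \<le> c * (2 * growth_inverse \<Phi> ?A)"
    using c growth_inverse_nonneg[OF gf, of ?A] by (subst (asm) ennreal_le_iff) auto
  have "growth_inverse \<Phi> ?A / ?A \<le> growth_inverse \<Phi> (xd w powr - N) / xd w powr - N"
    using x N ge_one_powr_ge_zero[of 4 N] by (intro quasi_convex_inverse_scale[OF qv]) auto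
  then have "growth_inverse \<Phi> ?A \<le> 4 powr N * growth_inverse \<Phi> (xd w powr - N)" using x by (simp add: field_simps)
  then have "c * (2 * growth_inverse \<Phi> ?A) \<le> c * (2 * (4 powr N * growth_inverse \<Phi> (xd w powr - N)))"
    using c by (intro mult_left_mono) auto
  with 1 show ?thesis by (simp add: mult_ac)
qed

text \<open>The condition \<open>m p \<ge> 2 N\<close> reduces the estimate to the exactly computable exponent \<open>2 N\<close>.\<close>

lemma kernel_admissible:
  fixes \<alpha> p m0 :: real
  assumes al: "\<alpha> > -1" and qc: "quasi_concave p \<Phi>" and m0: "m0 * p \<ge> 2 * (real CARD('n::finite) + 1 + \<alpha>)"
  defines "N \<equiv> real CARD('n::finite) + 1 + \<alpha>"
  obtains C where "C > 0" "\<And>(w :: complex ^ 'n) s. w \<in> ball 0 1 \<Longrightarrow> 0 \<le> s \<Longrightarrow> s \<le> m0 \<Longrightarrow>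
    (\<integral>\<^sup>+z. ennreal (\<Phi> (norm (bk s z w) / (C * (xd w powr - m0 / growth_inverse \<Phi> (xd w powr - N))))) \<partial>nu \<alpha>) \<le> 1"
proof -
  have p: "p > 0" and gf: "growth_function \<Phi>" using qc by (auto simp: quasi_concave_def)
  have N: "N > 0" unfolding N_def by (rule dim_exponent_pos[OF al])
  have m0p: "m0 * p \<ge> 2 * N" using m0 by (simp add: N_def)
  then have "m0 * p > 0" using N by simp
  then have m00: "m0 > 0" using p by (simp add: zero_less_mult_iff)
  obtain C0 where C0: "C0 \<ge> 1" "\<And>s t. s \<ge> 0 \<Longrightarrow> 0 < t \<Longrightarrow> t \<le> 1 \<Longrightarrow> \<Phi> (s * t) \<le> C0 * t powr p * \<Phi> s"
    using quasi_concave_lower[OF qc] by blast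
  \<comment> \<open>4 powr m0 arises from y / 2 = xd w / (4 u), and C0 powr (1/p) cancels the
    constant of the lower type.\<close>
  define C where "C = 4 powr m0 * C0 powr (1 / p)"
  have C: "C > 0" using C0 by (simp add: C_def)
  show thesis
  proof (rule that[OF C])
    fix w :: "complex ^ 'n" and s :: real assume w: "w \<in> ball 0 1" and s: "0 \<le> s" "s \<le> m0"
    have x: "xd w > 0" by (rule xd_posI[OF w])
    define a where "a = growth_inverse \<Phi> (xd w powr - N)"
    have a: "a > 0" "\<Phi> a = xd w powr - N" using x by (auto simp: a_def intro!: growth_inverse_pos[OF gf] growth_inverse_eq[OF gf])
    let ?c = "C * (xd w powr - m0 / a)"
    have "(\<integral>\<^sup>+z. ennreal (\<Phi> (norm (bk s z w) / ?c)) \<partial>nu \<alpha>) \<le> (\<integral>\<^sup>+(z::complex^'n). ennreal (xd w powr N) * ennreal (norm (1 - cinner z w) powr - (2 * N)) \<partial>nu \<alpha>)"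
    proof (rule nn_integral_mono)
      fix z :: "complex ^ 'n" assume "z \<in> space (nu \<alpha>)"
      then have z: "z \<in> ball 0 1" by simp
      have nn: "norm z * norm w < 1" using z w by (intro norm_mult_ball_less) auto
      define y where "y = norm (1 - cinner z w)"
      have y: "y > 0" "y \<le> 2" "xd w \<le> 2 * y"
        using norm_cinner_less_1[OF nn] norm_triangle_ineq4[of 1 "cinner z w"] xd_le_2_norm(2)[of w z] z w by (auto simp: y_def)
      define u where "u = xd w / (2 * y)"
      have u: "0 < u" "u \<le> 1" using x y by (auto simp: u_def)
      have "norm (bk s z w) = y powr - s" unfolding y_def by (rule norm_bk[OF nn])
      also have "... = 2 powr - s * (y / 2) powr - s" using y by (simp add: powr_divide powr_minus_divide)
      \<comment> \<open>Passing to y / 2 <= 1 makes the power monotone in the exponent, so that m0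
        serves for all s in [0, m0].\<close>
      also have "... \<le> 1 * (y / 2) powr - m0"
      proof (intro mult_mono)
        show "2 powr - s \<le> 1" using s powr_mono[of "- s" 0 2] by simp
        show "(y / 2) powr - s \<le> (y / 2) powr - m0" using y s by (intro powr_mono') auto
      qed auto
      also have "... = 4 powr m0 * (u powr m0 * xd w powr - m0)"
      proof -
        have "y / 2 = xd w / (4 * u)" using x y by (simp add: u_def)
        then show ?thesis using x u by (simp add: powr_divide powr_mult powr_minus_divide)
      qed
      finally have "norm (bk s z w) / ?c \<le> 4 powr m0 * (u powr m0 * xd w powr - m0) / ?c" using C x a by (intro divide_right_mono) auto
      also have "... = a * (u powr m0 / C0 powr (1 / p))" using x C0(1) by (simp add: C_def)
      finally have "\<Phi> (norm (bk s z w) / ?c) \<le> \<Phi> (a * (u powr m0 / C0 powr (1 / p)))"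
        using C x a by (intro growth_mono[OF gf]) auto
      also have "... \<le> C0 * (u powr m0 / C0 powr (1 / p)) powr p * \<Phi> a"
      proof (rule C0(2))
        have "u powr m0 \<le> 1" using u m00 by (intro powr_le1) auto
        moreover have "1 \<le> C0 powr (1 / p)" using C0(1) p by (intro ge_one_powr_ge_zero) auto
        ultimately show "u powr m0 / C0 powr (1 / p) \<le> 1" by (simp add: divide_le_eq)
      qed (use a u C0 in auto)
      also have "(u powr m0 / C0 powr (1 / p)) powr p = u powr (m0 * p) / C0" using C0(1) p u by (simp add: powr_divide powr_powr)
      also have "C0 * (u powr (m0 * p) / C0) * \<Phi> a = u powr (m0 * p) * xd w powr - N" using C0(1) a by simp
      also have "... \<le> u powr (2 * N) * xd w powr - N" using u m0p by (intro mult_right_mono powr_mono') auto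
      also have "... = (xd w powr (2 * N) * xd w powr - N) * (2 * y) powr - (2 * N)"
        using x y by (simp add: u_def powr_divide powr_minus_divide)
      also have "xd w powr (2 * N) * xd w powr - N = xd w powr N" by (simp flip: powr_add)
      also have "(2 * y) powr - (2 * N) \<le> y powr - (2 * N)" using y N by (intro powr_mono2') auto
      finally have "\<Phi> (norm (bk s z w) / ?c) \<le> xd w powr N * y powr - (2 * N)" by (simp add: mult_left_mono)
      then show "ennreal (\<Phi> (norm (bk s z w) / ?c)) \<le> ennreal (xd w powr N) * ennreal (norm (1 - cinner z w) powr - (2 * N))"
        by (simp flip: ennreal_mult add: y_def ennreal_leI)
    qed
    also have "... = ennreal (xd w powr N) * (\<integral>\<^sup>+(z::complex^'n). ennreal (norm (1 - cinner z w) powr - (2 * N)) \<partial>nu \<alpha>)"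
      by (rule nn_integral_cmult) measurable
    also have "... = 1" unfolding N_def forelli_rudin_N[OF al w] using x by (simp flip: ennreal_mult' powr_add)
    finally show "(\<integral>\<^sup>+z. ennreal (\<Phi> (norm (bk s z w) / (C * (xd w powr - m0 / growth_inverse \<Phi> (xd w powr - N))))) \<partial>nu \<alpha>) \<le> 1"
      by (simp add: a_def)
  qed
qed


section \<open>Growth of functions in the spaces \<open>\<Gamma>\<close>\<close>

lemma radial_path_derivative:
  assumes F: "holomorphic_ball F" and w: "(w :: complex ^ 'n) \<in> ball 0 1" and t: "0 < t" "t \<le> 1"
  shows "((\<lambda>t. F (t *\<^sub>R w)) has_vector_derivative (radial_deriv F (t *\<^sub>R w) / of_real t)) (at t)"
proof -
  have "t *\<^sub>R w \<in> ball 0 1" using dilate_in_ball[OF w] t by auto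
  then obtain D where D: "(F has_derivative D) (at (t *\<^sub>R w))" "\<And>c v. D (c *s v) = c * D v"
    using F unfolding holomorphic_ball_def by blast
  have "((\<lambda>t. t *\<^sub>R w) has_derivative (\<lambda>h. h *\<^sub>R w)) (at t)" by (auto intro!: derivative_eq_intros)
  from has_derivative_compose[OF this D(1)]
  have "((\<lambda>t. F (t *\<^sub>R w)) has_derivative (\<lambda>h. D (h *\<^sub>R w))) (at t)" .
  moreover have "D (h *\<^sub>R w) = h *\<^sub>R (radial_deriv F (t *\<^sub>R w) / of_real t)" for h
    using t radial_deriv_eq[OF D] by (simp add: scaleR_eq_smult D(2) scaleR_conv_of_real)
  ultimately show ?thesis by (simp add: has_vector_derivative_def)
qed

text \<open>The derivative of F(t w) is RF(t w) / t. Starting the path at 1/2 keeps 1/t at most 2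
  and leaves a value of F on a compact set.\<close>

lemma radial_integration:
  assumes F: "holomorphic_ball F" and w: "(w :: complex ^ 'n) \<in> ball 0 1"
    and d: "\<And>t. 1/2 \<le> t \<Longrightarrow> t \<le> 1 \<Longrightarrow> (\<phi> has_real_derivative \<phi>' t) (at t)"
    and le: "\<And>t. 1/2 \<le> t \<Longrightarrow> t \<le> 1 \<Longrightarrow> 2 * norm (radial_deriv F (t *\<^sub>R w)) \<le> \<phi>' t"
  shows "norm (F w) \<le> norm (F ((1/2) *\<^sub>R w)) + (\<phi> 1 - \<phi> (1/2))"
proof -
  have "norm (F (1 *\<^sub>R w) - F ((1/2) *\<^sub>R w)) \<le> \<phi> 1 - \<phi> (1/2)"
  proof (rule differentiable_bound_general)
    show "continuous_on {1/2..1} (\<lambda>t. F (t *\<^sub>R w))"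
      by (rule continuous_on_vector_derivative[OF has_vector_derivative_at_within[OF radial_path_derivative[OF F w]]]) auto
    show "continuous_on {1/2..1} \<phi>" using d by (intro DERIV_continuous_on[of _ _ \<phi>']) (auto intro: has_field_derivative_at_within)
    fix t :: real assume t: "1/2 < t" "t < 1"
    show "((\<lambda>t. F (t *\<^sub>R w)) has_vector_derivative (radial_deriv F (t *\<^sub>R w) / of_real t)) (at t)"
      using t by (intro radial_path_derivative[OF F w]) auto
    show "(\<phi> has_vector_derivative \<phi>' t) (at t)" using d[of t] t by (simp add: has_real_derivative_iff_has_vector_derivative)
    have "norm (radial_deriv F (t *\<^sub>R w) / of_real t) = norm (radial_deriv F (t *\<^sub>R w)) / t" using t by (simp add: norm_divide)
    also have "... \<le> 2 * norm (radial_deriv F (t *\<^sub>R w))"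
    proof -
      have "norm (radial_deriv F (t *\<^sub>R w)) * 1 \<le> norm (radial_deriv F (t *\<^sub>R w)) * (2 * t)" using t by (intro mult_left_mono) auto
      then show ?thesis using t by (simp add: divide_le_eq mult_ac)
    qed
    also have "... \<le> \<phi>' t" using t by (intro le) auto
    finally show "norm (radial_deriv F (t *\<^sub>R w) / of_real t) \<le> \<phi>' t" .
  qed simp
  then show ?thesis using norm_triangle_ineq2[of "F w" "F ((1/2) *\<^sub>R w)"] by simp
qed

lemma half_ball_bound:
  assumes F: "holomorphic_ball F"
  obtains M where "M \<ge> 0" "\<And>z :: complex ^ 'n. norm z \<le> 1/2 \<Longrightarrow> norm (F z) \<le> M"
proof -
  have "compact (F ` cball 0 (1/2))" by (intro compact_continuous_image continuous_on_subset[OF hol_ball_imp_continuous_on[OF F]]) auto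
  then have "bounded (F ` cball 0 (1/2))" by (rule compact_imp_bounded)
  then obtain M where M: "\<And>y. y \<in> F ` cball 0 (1/2) \<Longrightarrow> norm y \<le> M" unfolding bounded_iff by blast
  have "norm (F z) \<le> M" if "norm z \<le> 1/2" for z using that by (intro M imageI) simp
  moreover from this[of 0] have "M \<ge> 0" using norm_ge_zero[of "F 0"] by (simp del: norm_ge_zero)
  ultimately show thesis using that by blast
qed

text \<open>Along the ray \<open>xd\<close> is at least 1 - t |w|, whose negative power has an
  explicit primitive; integration gains one power of the distance to the sphere.\<close>

lemma radial_integrate_power:
  assumes F: "holomorphic_ball F" and e: "e > 0"
    and le: "\<And>z :: complex ^ 'n. z \<in> ball 0 1 \<Longrightarrow> norm (radial_deriv F z) \<le> K * xd z powr - (e + 1)"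
  shows "\<exists>K'. \<forall>z\<in>ball 0 1. norm (F z) \<le> K' * xd z powr - e"
proof -
  obtain M where M: "M \<ge> 0" "\<And>z :: complex ^ 'n. norm z \<le> 1/2 \<Longrightarrow> norm (F z) \<le> M"
    using half_ball_bound[OF F] by blast
  have K: "K \<ge> 0" using le[of 0] norm_ge_zero[of "radial_deriv F 0"] by (simp add: xd_def del: norm_ge_zero)
  define K' where "K' = M + (4 * K / e) * 2 powr e"
  have "norm (F w) \<le> K' * xd w powr - e" if w: "w \<in> ball 0 1" for w :: "complex ^ 'n"
  proof (cases "norm w \<le> 1/2")
    case True
    then have "norm (F w) \<le> M * 1" using M by simp
    also have "... \<le> K' * xd w powr - e" using M K e xd_powr_ge_1[OF w, of e] by (intro mult_mono) (auto simp: K'_def)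
    finally show ?thesis .
  next
    case False
    define r where "r = norm w"
    have r: "1/2 < r" "r < 1" using False w by (auto simp: r_def)
    define \<phi> where "\<phi> t = (2 * K / (e * r)) * (1 - t * r) powr - e" for t
    have pos: "1 - t * r > 0" if "t \<le> 1" for t
    proof -
      have "t * r \<le> 1 * r" using that r by (intro mult_right_mono) auto
      then show ?thesis using r by linarith
    qed
    have "norm (F w) \<le> norm (F ((1/2) *\<^sub>R w)) + (\<phi> 1 - \<phi> (1/2))"
    proof (rule radial_integration[OF F w])
      fix t :: real assume t: "1/2 \<le> t" "t \<le> 1"
      have "(\<phi> has_real_derivative (2 * K / (e * r)) * (- e * (1 - t * r) powr (- e - 1) * (- r))) (at t)"
        unfolding \<phi>_def using pos[OF t(2)] by (auto intro!: derivative_eq_intros simp: powr_diff field_simps)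
      moreover have "(2 * K / (e * r)) * (- e * (1 - t * r) powr (- e - 1) * (- r)) = 2 * (K * (1 - t * r) powr - (e + 1))"
      proof -
        have "- e - 1 = - (e + 1)" by simp
        then show ?thesis using e r by (simp only:) simp
      qed
      ultimately show "(\<phi> has_real_derivative 2 * (K * (1 - t * r) powr - (e + 1))) (at t)" by simp
      have tw: "t *\<^sub>R w \<in> ball 0 1" using dilate_in_ball[OF w] t by auto
      have "xd (t *\<^sub>R w) = (1 - t * r) * (1 + t * r)" using t by (simp add: xd_def r_def power2_eq_square algebra_simps)
      moreover have "(1 - t * r) * 1 \<le> (1 - t * r) * (1 + t * r)" using pos[OF t(2)] t r by (intro mult_left_mono) auto
      ultimately have "1 - t * r \<le> xd (t *\<^sub>R w)" by simp
      then have "xd (t *\<^sub>R w) powr - (e + 1) \<le> (1 - t * r) powr - (e + 1)" using pos[OF t(2)] e by (intro powr_mono2') auto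
      then have "norm (radial_deriv F (t *\<^sub>R w)) \<le> K * (1 - t * r) powr - (e + 1)"
        using le[OF tw] K by (meson mult_left_mono order_trans)
      then show "2 * norm (radial_deriv F (t *\<^sub>R w)) \<le> 2 * (K * (1 - t * r) powr - (e + 1))" by simp
    qed
    also have "norm (F ((1/2) *\<^sub>R w)) \<le> M" using w by (intro M(2)) simp
    also have "\<phi> 1 - \<phi> (1/2) \<le> \<phi> 1" using K e r by (simp add: \<phi>_def)
    also have "\<phi> 1 \<le> (4 * K / e) * (2 powr e * xd w powr - e)"
    proof -
      have "xd w = (1 - r) * (1 + r)" by (simp add: xd_def r_def power2_eq_square algebra_simps)
      also have "... \<le> (1 - r) * 2" using r by (intro mult_left_mono) auto
      finally have "xd w / 2 \<le> 1 - r" by simp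
      then have "(1 - r) powr - e \<le> (xd w / 2) powr - e" using xd_posI[OF w] e by (intro powr_mono2') auto
      also have "... = 2 powr e * xd w powr - e" using xd_posI[OF w] by (simp add: powr_divide powr_minus_divide)
      finally have 1: "(1 - r) powr - e \<le> 2 powr e * xd w powr - e" .
      have "2 * K / (e * r) \<le> 2 * K / (e * (1/2))" using K e r by (intro divide_left_mono mult_left_mono mult_pos_pos) auto
      then have 2: "2 * K / (e * r) \<le> 4 * K / e" by simp
      show ?thesis unfolding \<phi>_def using 1 2 K e by (intro mult_mono) auto
    qed
    finally have "norm (F w) \<le> M * 1 + (4 * K / e) * (2 powr e * xd w powr - e)" by simp
    also have "M * 1 \<le> M * xd w powr - e" using M(1) xd_powr_ge_1[OF w, of e] e by (intro mult_left_mono) auto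
    finally show ?thesis by (simp add: K'_def algebra_simps)
  qed
  then show ?thesis by blast
qed

text \<open>No power is gained: \<open>xd\<close> decreases outwards along the ray, so H at t w is
  at most c times H at w, and the path has bounded length. One weight H thus serves for a derivative
  and the function below it.\<close>

lemma radial_integrate_almost_decreasing:
  assumes F: "holomorphic_ball F" and H: "\<And>x y. 0 < x \<Longrightarrow> x \<le> y \<Longrightarrow> y \<le> 1 \<Longrightarrow> H y \<le> c * H x" and c: "c > 0" and H1: "H 1 > 0"
    and le: "\<And>z :: complex ^ 'n. z \<in> ball 0 1 \<Longrightarrow> norm (radial_deriv F z) \<le> K * H (xd z)"
  shows "\<exists>K'. \<forall>z\<in>ball 0 1. norm (F z) \<le> K' * H (xd z)"
proof -
  obtain M where M: "M \<ge> 0" "\<And>z :: complex ^ 'n. norm z \<le> 1/2 \<Longrightarrow> norm (F z) \<le> M"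
    using half_ball_bound[OF F] by blast
  have "0 \<le> K * H 1" using order_trans[OF norm_ge_zero le[of 0]] by (simp add: xd_def)
  then have K: "K \<ge> 0" using H1 by (simp add: zero_le_mult_iff)
  have "norm (F w) \<le> (M * c / H 1 + K * c) * H (xd w)" if w: "w \<in> ball 0 1" for w :: "complex ^ 'n"
  proof -
    have x: "0 < xd w" "xd w \<le> 1" using xd_posI[OF w] xd_le_1 by auto
    have "norm (F w) \<le> norm (F ((1/2) *\<^sub>R w)) + ((2 * (K * (c * H (xd w)))) * 1 - (2 * (K * (c * H (xd w)))) * (1/2))"
    proof (rule radial_integration[OF F w])
      fix t :: real assume t: "1/2 \<le> t" "t \<le> 1"
      show "((\<lambda>t. (2 * (K * (c * H (xd w)))) * t) has_real_derivative 2 * (K * (c * H (xd w)))) (at t)"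
        by (auto intro!: derivative_eq_intros)
      have tw: "t *\<^sub>R w \<in> ball 0 1" using dilate_in_ball[OF w] t by auto
      have "norm (t *\<^sub>R w) \<le> norm w" using t by (simp add: mult_left_le_one_le)
      then have "xd w \<le> xd (t *\<^sub>R w)" unfolding xd_def by (simp add: power_mono del: norm_scaleR)
      then have "H (xd (t *\<^sub>R w)) \<le> c * H (xd w)" using x xd_le_1 by (intro H) auto
      then have "K * H (xd (t *\<^sub>R w)) \<le> K * (c * H (xd w))" using K by (rule mult_left_mono)
      then show "2 * norm (radial_deriv F (t *\<^sub>R w)) \<le> 2 * (K * (c * H (xd w)))" using le[OF tw] by linarith
    qed
    also have "norm (F ((1/2) *\<^sub>R w)) \<le> M" using w by (intro M(2)) simp
    also have "M \<le> M * (c * H (xd w) / H 1)"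
    proof -
      have "1 \<le> c * H (xd w) / H 1" using H[OF x] H1 by simp
      then show ?thesis using M(1) mult_left_mono[of 1 "c * H (xd w) / H 1" M] by simp
    qed
    finally show ?thesis by (simp add: algebra_simps)
  qed
  then show ?thesis by blast
qed

text \<open>Up to a constant this is the total mass of
  \<open>nu (\<alpha> - \<eta>)\<close>.\<close>

lemma nn_integral_xd_powr_finite:
  assumes al: "\<alpha> > -1" and \<eta>: "\<eta> < 1 + \<alpha>"
  shows "(\<integral>\<^sup>+(z::complex^'n). ennreal (xd z powr - \<eta>) \<partial>nu \<alpha>) < \<infinity>"
proof -
  have \<beta>: "\<alpha> - \<eta> > -1" using \<eta> by simp
  define \<kappa> where "\<kappa> = nu_const TYPE('n) (\<alpha> - \<eta>) / nu_const TYPE('n) \<alpha>"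
  have \<kappa>: "\<kappa> > 0" unfolding \<kappa>_def by (intro divide_pos_pos nu_const_eq al \<beta>)
  have "1 = (\<integral>\<^sup>+(z::complex^'n). 1 \<partial>nu (\<alpha> - \<eta>))" by (simp add: emeasure_nu_space[OF \<beta>])
  also have "... = (\<integral>\<^sup>+(z::complex^'n). ennreal (\<kappa> * xd z powr - \<eta>) * 1 \<partial>nu \<alpha>)"
    using nn_integral_nu_shift[OF al \<beta>, of "\<lambda>_::complex^'n. 1"] by (simp add: \<kappa>_def)
  also have "... = (\<integral>\<^sup>+(z::complex^'n). ennreal \<kappa> * ennreal (xd z powr - \<eta>) \<partial>nu \<alpha>)"
    using \<kappa> by (intro nn_integral_cong) (simp add: ennreal_mult)
  also have "... = ennreal \<kappa> * (\<integral>\<^sup>+(z::complex^'n). ennreal (xd z powr - \<eta>) \<partial>nu \<alpha>)"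
    by (intro nn_integral_cmult measurable_compose[OF measurable_xd_powr_nu measurable_ennreal])
  finally have "ennreal \<kappa> * (\<integral>\<^sup>+(z::complex^'n). ennreal (xd z powr - \<eta>) \<partial>nu \<alpha>) < \<infinity>" by simp
  then show ?thesis using \<kappa> by (auto simp: ennreal_mult_less_top)
qed

context hankel_growth
begin

lemma rho_xd: assumes "x > 0" shows "\<rho> (x powr N) = \<Psi>\<^sub>2 (x powr - N) / \<Psi>\<^sub>1 (x powr - N)" "\<rho> (x powr N) = x powr - N / \<Psi> (x powr - N)"
proof -
  have "x powr N = 1 / x powr - N" using assms by (simp add: powr_minus_divide)
  then show "\<rho> (x powr N) = \<Psi>\<^sub>2 (x powr - N) / \<Psi>\<^sub>1 (x powr - N)" "\<rho> (x powr N) = x powr - N / \<Psi> (x powr - N)"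
    using rho_eq12[of "x powr - N"] rho_eq[of "x powr - N"] assms by auto
qed

text \<open>The bound on the k-th radial derivative is integrated in two ways. With the weight H,
  all orders up to k keep H, which bounds the transform of exponent N + k. With powers, each step
  gains one, ending with |g| <= K xd^(-\<delta>); this gives integrability with the margin
  \<epsilon> = \<delta>.\<close>

lemma Gamma_spaceD:
  fixes g :: "complex ^ 'n \<Rightarrow> complex"
  assumes al: "\<alpha> > -1" and g: "g \<in> Gamma_space \<alpha> \<rho>"
  defines "N \<equiv> real CARD('n) + 1 + \<alpha>"
  obtains k :: nat and C c \<epsilon> where "holomorphic_ball g" "integrable (nu \<alpha>) g" "0 < \<epsilon>" "\<epsilon> < 1 + \<alpha>"
    "(\<integral>\<^sup>+w. ennreal (norm (g w)) * ennreal (xd w powr - \<epsilon>) \<partial>nu \<alpha>) < \<infinity>"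
    "C > 0" "\<And>w. w \<in> ball 0 1 \<Longrightarrow> norm (bk_transform \<alpha> (N + real k) g w) \<le> C * (xd w powr - real k * \<rho> (xd w powr N))"
    "c > 0" "\<And>x y. 0 < x \<Longrightarrow> x \<le> y \<Longrightarrow> y \<le> 1 \<Longrightarrow> y powr - real k * \<rho> (y powr N) \<le> c * (x powr - real k * \<rho> (x powr N))"
proof -
  have N: "N > 0" unfolding N_def by (rule dim_exponent_pos[OF al])
  have hol: "holomorphic_ball g" using g by (simp add: Gamma_space_def)
  obtain \<gamma> k C0 where \<gamma>: "\<gamma> \<ge> 0" "rho_upper_type \<gamma> \<rho>" and k: "real k > \<gamma> * N" and C0: "C0 > 0"
    and Rk: "\<And>z. z \<in> ball 0 1 \<Longrightarrow> norm ((radial_deriv ^^ k) g z) \<le> C0 * (1 - (norm z)\<^sup>2) powr (- real k) * \<rho> ((1 - (norm z)\<^sup>2) powr N)"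
    using g unfolding Gamma_space_def N_def by auto
  obtain c0 where c0: "c0 > 0" "\<And>s t. 1 < s \<Longrightarrow> 0 < t \<Longrightarrow> s * t \<le> 1 \<Longrightarrow> \<rho> (s * t) \<le> c0 * s powr \<gamma> * \<rho> t"
    using \<gamma>(2) unfolding rho_upper_type_def by blast
  define H where "H x = x powr - real k * \<rho> (x powr N)" for x
  define c where "c = max 1 c0"
  \<comment> \<open>k > \<gamma> N makes the decay of y powr - k outweigh the growth of \<rho> (y
    powr N).\<close>
  have H: "H y \<le> c * H x" if xy: "0 < x" "x \<le> y" "y \<le> 1" for x y
  proof (cases "x = y")
    case True
    have "H x \<ge> 0" using xy rho_pos[of "x powr N"] by (simp add: H_def)
    then show ?thesis using True mult_right_mono[of 1 c "H x"] by (simp add: c_def)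
  next
    case False
    then have lt: "x < y" using xy by simp
    define t where "t = y / x"
    have t: "t > 1" "y = t * x" using lt xy by (auto simp: t_def)
    have rp: "\<rho> (x powr N) > 0" using xy by (intro rho_pos) simp
    have tN: "t powr N > 1" using t N by (intro gr_one_powr)
    have "t powr N * x powr N = y powr N" using t xy by (simp add: powr_mult)
    moreover have "y powr N \<le> 1" using xy N by (intro powr_le1) auto
    ultimately have "\<rho> (y powr N) \<le> c0 * (t powr N) powr \<gamma> * \<rho> (x powr N)" using c0(2)[OF tN, of "x powr N"] xy by simp
    also have "... \<le> c * t powr real k * \<rho> (x powr N)"
    proof -
      have "(t powr N) powr \<gamma> = t powr (\<gamma> * N)" by (simp add: powr_powr mult.commute)
      also have "... \<le> t powr real k" using t k by (intro powr_mono) auto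
      finally have "c0 * (t powr N) powr \<gamma> \<le> c * t powr real k" using c0(1) by (intro mult_mono) (auto simp: c_def)
      then show ?thesis using rp by (intro mult_right_mono) auto
    qed
    finally have "y powr - real k * \<rho> (y powr N) \<le> y powr - real k * (c * t powr real k * \<rho> (x powr N))"
      by (intro mult_left_mono) auto
    also have "... = c * (y powr - real k * t powr real k) * \<rho> (x powr N)" by simp
    also have "y powr - real k * t powr real k = x powr - real k" using t xy by (simp add: powr_mult powr_minus_divide)
    finally show ?thesis by (simp add: H_def mult.assoc)
  qed
  have c: "c > 0" by (simp add: c_def)
  have H1: "H 1 > 0" using rho_pos[of 1] by (simp add: H_def)
  have Ri: "holomorphic_ball ((radial_deriv ^^ i) g)" for i by (rule hol_ball_radial_funpow[OF hol])
  have Hi: "\<exists>K. \<forall>z\<in>ball 0 1. norm ((radial_deriv ^^ i) g z) \<le> K * H (xd z)" if "i \<le> k" for i using that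
  proof (induction i rule: inc_induct)
    case base
    show ?case using Rk by (intro exI[of _ C0]) (simp add: H_def xd_def mult.assoc)
  next
    case (step i)
    then obtain K where "\<forall>z\<in>ball 0 1. norm ((radial_deriv ^^ Suc i) g z) \<le> K * H (xd z)" by blast
    then have KH: "norm (radial_deriv ((radial_deriv ^^ i) g) z) \<le> K * H (xd z)" if "z \<in> ball 0 1" for z using that by simp
    show ?case by (rule radial_integrate_almost_decreasing[where F = "(radial_deriv ^^ i) g" and H = H, OF Ri H c H1 KH])
  qed
  \<comment> \<open>A positive \<delta> keeps the exponents i + \<delta> away from 0, where
    integration would produce a logarithm; 2 \<delta> < 1 + \<alpha> leaves room for the extra
    weight.\<close>
  define \<delta> where "\<delta> = (1 + \<alpha>) / 4"
  have \<delta>: "\<delta> > 0" using al by (simp add: \<delta>_def)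
  have Pi: "\<exists>K. \<forall>z\<in>ball 0 1. norm ((radial_deriv ^^ i) g z) \<le> K * xd z powr - (real i + \<delta>)" if "i \<le> k" for i
    using that
  proof (induction i rule: inc_induct)
    case base
    have "norm ((radial_deriv ^^ k) g z) \<le> (C0 * \<rho> 1) * xd z powr - (real k + \<delta>)" if z: "z \<in> ball 0 1" for z
    proof -
      have x: "0 < xd z" "xd z \<le> 1" using xd_posI[OF z] xd_le_1 by auto
      have "norm ((radial_deriv ^^ k) g z) \<le> C0 * xd z powr (- real k) * \<rho> (xd z powr N)" using Rk[OF z] by (simp add: xd_def)
      also have "... \<le> C0 * xd z powr - (real k + \<delta>) * \<rho> 1"
      proof (intro mult_mono rho_mono)
        show "xd z powr - real k \<le> xd z powr - (real k + \<delta>)" using x \<delta> by (intro powr_mono') auto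
        show "xd z powr N \<le> 1" using x N by (intro powr_le1) auto
      qed (use x C0 rho_pos[of "xd z powr N"] in auto)
      finally show ?thesis by (simp add: mult_ac)
    qed
    then show ?case by blast
  next
    case (step i)
    then obtain K where "\<forall>z\<in>ball 0 1. norm ((radial_deriv ^^ Suc i) g z) \<le> K * xd z powr - (real (Suc i) + \<delta>)" by blast
    moreover have "real (Suc i) + \<delta> = (real i + \<delta>) + 1" by simp
    ultimately have K: "norm (radial_deriv ((radial_deriv ^^ i) g) z) \<le> K * xd z powr - ((real i + \<delta>) + 1)" if "z \<in> ball 0 1" for z
      using that by (simp only:) simp
    show ?case by (rule radial_integrate_power[where F = "(radial_deriv ^^ i) g", OF Ri _ K]) (use \<delta> in auto)
  qed
  from Pi[of 0] obtain K where "\<forall>z\<in>ball 0 1. norm ((radial_deriv ^^ 0) g z) \<le> K * xd z powr - (real 0 + \<delta>)" by blast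
  then have K: "norm (g z) \<le> K * xd z powr - \<delta>" if "z \<in> ball 0 1" for z using that by simp
  have K0: "K \<ge> 0" using K[of 0] norm_ge_zero[of "g 0"] by (simp add: xd_def del: norm_ge_zero)
  have gm: "g \<in> borel_measurable (nu \<alpha>)" by (rule hol_ball_measurable[OF hol])
  have fin: "(\<integral>\<^sup>+w. ennreal (norm (g w)) * ennreal (xd w powr - \<delta>) \<partial>nu \<alpha>) < \<infinity>"
  proof -
    have "(\<integral>\<^sup>+w. ennreal (norm (g w)) * ennreal (xd w powr - \<delta>) \<partial>nu \<alpha>) \<le> (\<integral>\<^sup>+(w::complex^'n). ennreal K * ennreal (xd w powr - (2 * \<delta>)) \<partial>nu \<alpha>)"
    proof (rule nn_integral_mono)
      fix w :: "complex ^ 'n" assume "w \<in> space (nu \<alpha>)"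
      then have w: "w \<in> ball 0 1" by simp
      have "norm (g w) * xd w powr - \<delta> \<le> (K * xd w powr - \<delta>) * xd w powr - \<delta>" by (intro mult_right_mono K w) simp
      also have "... = K * xd w powr - (2 * \<delta>)" by (simp add: mult.assoc powr_add[symmetric])
      finally show "ennreal (norm (g w)) * ennreal (xd w powr - \<delta>) \<le> ennreal K * ennreal (xd w powr - (2 * \<delta>))"
        using K0 by (simp flip: ennreal_mult add: ennreal_leI)
    qed
    also have "... = ennreal K * (\<integral>\<^sup>+(w::complex^'n). ennreal (xd w powr - (2 * \<delta>)) \<partial>nu \<alpha>)"
      by (intro nn_integral_cmult measurable_compose[OF measurable_xd_powr_nu measurable_ennreal])
    also have "... < \<infinity>" using nn_integral_xd_powr_finite[where 'n = 'n, OF al, of "2 * \<delta>"] al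
      by (simp add: ennreal_mult_less_top \<delta>_def)
    finally show ?thesis .
  qed
  have int: "integrable (nu \<alpha>) g"
  proof (rule integrableI_bounded[OF gm])
    have "(\<integral>\<^sup>+w. ennreal (norm (g w)) \<partial>nu \<alpha>) \<le> (\<integral>\<^sup>+w. ennreal (norm (g w)) * ennreal (xd w powr - \<delta>) \<partial>nu \<alpha>)"
    proof (rule nn_integral_mono)
      fix w :: "complex ^ 'n" assume "w \<in> space (nu \<alpha>)"
      then have "1 \<le> xd w powr - \<delta>" using \<delta> by (intro xd_powr_ge_1) auto
      then have "norm (g w) * 1 \<le> norm (g w) * xd w powr - \<delta>" by (intro mult_left_mono) auto
      then show "ennreal (norm (g w)) \<le> ennreal (norm (g w)) * ennreal (xd w powr - \<delta>)"
        by (simp flip: ennreal_mult add: ennreal_leI)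
    qed
    with fin show "(\<integral>\<^sup>+w. ennreal (norm (g w)) \<partial>nu \<alpha>) < \<infinity>" by simp
  qed
  interpret bounded_hol_functional "\<lambda>f. \<integral>z. f z * cnj (g z) \<partial>nu \<alpha>" "\<integral>z. norm (g z) \<partial>nu \<alpha>"
    by (rule bounded_hol_functional_pairing[OF al int])
  have EN: "E N z = g z" if z: "z \<in> ball 0 1" for z
    using E_pairing[OF al int z, of N] bergman_reproducing[OF al int hol z] by (simp add: N_def bk_transform_def)
  obtain d where d: "\<And>w. w \<in> ball 0 1 \<Longrightarrow> E (N + real k) w = (\<Sum>i\<le>k. d i * (radial_deriv ^^ i) (E N) w)"
    using E_shift[OF N, of k] by blast
  have RE: "(radial_deriv ^^ i) (E N) w = (radial_deriv ^^ i) g w" if "w \<in> ball 0 1" for w i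
    using radial_deriv_funpow_cong[OF EN hol_ball_radial_funpow_E[OF less_imp_le[OF N]] that] .
  obtain Ks where Ks: "\<And>i z. i \<le> k \<Longrightarrow> z \<in> ball 0 1 \<Longrightarrow> norm ((radial_deriv ^^ i) g z) \<le> Ks i * H (xd z)"
    using bchoice[of "{..k}" "\<lambda>i K. \<forall>z\<in>ball 0 1. norm ((radial_deriv ^^ i) g z) \<le> K * H (xd z)"] Hi by (metis atMost_iff)
  define C where "C = (\<Sum>i\<le>k. norm (d i) * \<bar>Ks i\<bar>) + 1"
  have C: "C > 0" unfolding C_def by (intro add_nonneg_pos sum_nonneg) auto
  have bound: "norm (bk_transform \<alpha> (N + real k) g w) \<le> C * H (xd w)" if w: "w \<in> ball 0 1" for w
  proof -
    have H0: "H (xd w) \<ge> 0" using xd_posI[OF w] rho_pos[of "xd w powr N"] by (simp add: H_def)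
    have "norm (bk_transform \<alpha> (N + real k) g w) = norm (\<Sum>i\<le>k. d i * (radial_deriv ^^ i) g w)"
      using E_pairing[OF al int w, of "N + real k"] d[OF w] RE[OF w] by simp
    also have "... \<le> (\<Sum>i\<le>k. norm (d i) * (\<bar>Ks i\<bar> * H (xd w)))"
    proof (rule order_trans[OF norm_sum], rule sum_mono)
      fix i assume "i \<in> {..k}"
      then have "norm ((radial_deriv ^^ i) g w) \<le> Ks i * H (xd w)" using Ks w by simp
      also have "... \<le> \<bar>Ks i\<bar> * H (xd w)" using H0 by (intro mult_right_mono) auto
      finally show "norm (d i * (radial_deriv ^^ i) g w) \<le> norm (d i) * (\<bar>Ks i\<bar> * H (xd w))"
        by (simp add: norm_mult mult_left_mono)
    qed
    also have "... = (\<Sum>i\<le>k. norm (d i) * \<bar>Ks i\<bar>) * H (xd w)" by (simp add: sum_distrib_right mult.assoc)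
    also have "... \<le> C * H (xd w)" using H0 by (intro mult_right_mono) (auto simp: C_def)
    finally show ?thesis .
  qed
  show thesis
    by (rule that[of \<delta> C k c]) (use hol int \<delta> fin C c bound H al in \<open>auto simp: H_def \<delta>_def N_def\<close>)
qed

text \<open>The m-th radial derivative of \<open>E N\<close> is a combination of the
  \<open>E (N + j)\<close> with j <= m, so bounding these by the common power -m is enough. The
  witness for the upper type is \<gamma> = 1/p.\<close>

lemma Gamma_spaceI:
  fixes g :: "complex ^ 'n \<Rightarrow> complex" and m :: nat
  assumes al: "\<alpha> > -1" and L: "bounded_hol_functional L B"
    and g: "\<And>w. w \<in> ball 0 1 \<Longrightarrow> g w = bounded_hol_functional.E L (real CARD('n) + 1 + \<alpha>) w"
    and m: "real m > (1 / p) * (real CARD('n) + 1 + \<alpha>)"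
    and le: "\<And>j w. j \<le> m \<Longrightarrow> w \<in> ball 0 1 \<Longrightarrow> norm (bounded_hol_functional.E L (real CARD('n) + 1 + \<alpha> + real j) w)
        \<le> C * (xd w powr - real m * \<rho> (xd w powr (real CARD('n) + 1 + \<alpha>)))"
  shows "g \<in> Gamma_space \<alpha> \<rho>"
proof -
  define N where "N = real CARD('n) + 1 + \<alpha>"
  have N: "N > 0" unfolding N_def by (rule dim_exponent_pos[OF al])
  interpret bounded_hol_functional L B by (rule L)
  have hol: "holomorphic_ball g" using hol_ball_cong[of g "E N"] hol_ball_E[of N] N g by (simp add: N_def)
  obtain c where c: "\<And>w. w \<in> ball 0 1 \<Longrightarrow> (radial_deriv ^^ m) (E N) w = (\<Sum>j\<le>m. c j * E (N + real j) w)"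
    using radial_funpow_E[of N m] N by auto
  have RE: "(radial_deriv ^^ m) (E N) w = (radial_deriv ^^ m) g w" if "w \<in> ball 0 1" for w
  proof (rule radial_deriv_funpow_cong[OF _ _ that])
    show "E N w = g w" if "w \<in> ball 0 1" for w using g[OF that] by (simp add: N_def)
    show "holomorphic_ball ((radial_deriv ^^ i) (E N))" for i using N by (intro hol_ball_radial_funpow_E) simp
  qed
  define K where "K = (\<Sum>j\<le>m. norm (c j) * \<bar>C\<bar>) + 1"
  have K: "K > 0" unfolding K_def by (intro add_nonneg_pos sum_nonneg) auto
  have bound: "norm ((radial_deriv ^^ m) g w) \<le> K * (1 - (norm w)\<^sup>2) powr (- real m) * \<rho> ((1 - (norm w)\<^sup>2) powr N)"
    if w: "w \<in> ball 0 1" for w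
  proof -
    let ?H = "xd w powr - real m * \<rho> (xd w powr N)"
    have H0: "?H \<ge> 0" using xd_posI[OF w] rho_pos[of "xd w powr N"] by simp
    have "norm ((radial_deriv ^^ m) g w) = norm (\<Sum>j\<le>m. c j * E (N + real j) w)" using c[OF w] RE[OF w] by simp
    also have "... \<le> (\<Sum>j\<le>m. norm (c j) * (\<bar>C\<bar> * ?H))"
    proof (rule order_trans[OF norm_sum], rule sum_mono)
      fix j assume "j \<in> {..m}"
      then have "norm (E (N + real j) w) \<le> C * ?H" using le[of j w] w by (simp add: N_def)
      also have "... \<le> \<bar>C\<bar> * ?H" using H0 by (intro mult_right_mono) auto
      finally show "norm (c j * E (N + real j) w) \<le> norm (c j) * (\<bar>C\<bar> * ?H)"
        unfolding norm_mult by (intro mult_left_mono) auto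
    qed
    also have "... = (\<Sum>j\<le>m. norm (c j) * \<bar>C\<bar>) * ?H" unfolding sum_distrib_right by (simp add: mult.assoc)
    also have "... \<le> K * ?H" using H0 by (intro mult_right_mono) (auto simp: K_def)
    finally show ?thesis by (simp add: xd_def mult.assoc)
  qed
  have "\<exists>C>0. \<forall>z\<in>ball 0 1. norm ((radial_deriv ^^ m) g z) \<le> C * (1 - (norm z)\<^sup>2) powr (- real m) * \<rho> ((1 - (norm z)\<^sup>2) powr (real CARD('n) + 1 + \<alpha>))"
    using K bound by (intro exI[of _ K]) (simp add: N_def)
  moreover have "1 / p \<ge> 0" using p by simp
  ultimately show ?thesis unfolding Gamma_space_def using hol rho_upper m by blast
qed

end


section \<open>The Bergman projection on Orlicz spaces\<close>

text \<open>The weight turns \<open>nu \<alpha>\<close> into a multiple of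
  \<open>nu (\<alpha> - b)\<close>, whose critical exponent is N - b, so N exceeds it by b. The
  bound on b keeps \<alpha> - b > -1 and b < N - b.\<close>

lemma forelli_rudin_weight:
  fixes \<alpha> b :: real
  assumes al: "\<alpha> > -1" and b: "0 < b" "b \<le> (1 + \<alpha>) / 2"
  defines "N \<equiv> real CARD('n::finite) + 1 + \<alpha>"
  obtains K where "K > 0" "\<And>w. w \<in> ball 0 1 \<Longrightarrow>
    (\<integral>\<^sup>+(z::complex^'n). ennreal (xd z powr - b * norm (1 - cinner z w) powr - N) \<partial>nu \<alpha>) \<le> ennreal (K * xd w powr - b)"
proof -
  have \<beta>: "\<alpha> - b > -1" using al b by simp
  have bN: "b < real CARD('n) + 1 + (\<alpha> - b)" 
  proof -
    have "real CARD('n) > 0" by simp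
    moreover have "2 * b \<le> 1 + \<alpha>" using b by simp
    ultimately show ?thesis by linarith
  qed
  have N': "real CARD('n) + 1 + (\<alpha> - b) + b = N" by (simp add: N_def)
  define \<kappa> where "\<kappa> = nu_const TYPE('n) (\<alpha> - b) / nu_const TYPE('n) \<alpha>"
  have \<kappa>: "\<kappa> > 0" unfolding \<kappa>_def by (intro divide_pos_pos nu_const_eq al \<beta>)
  obtain C where C: "C > 0" "\<And>w. w \<in> ball 0 1 \<Longrightarrow>
    (\<integral>\<^sup>+(z::complex^'n). ennreal (norm (1 - cinner z w) powr - N) \<partial>nu (\<alpha> - b)) \<le> ennreal (C * xd w powr - b)"
    by (rule forelli_rudin[OF \<beta> b(1) bN, unfolded N']) blast
  show thesis
  proof (rule that[of "C / \<kappa>"])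
    show "C / \<kappa> > 0" using C \<kappa> by simp
    fix w :: "complex ^ 'n" assume w: "w \<in> ball 0 1"
    have eq: "(\<integral>\<^sup>+(z::complex^'n). ennreal (norm (1 - cinner z w) powr - N) \<partial>nu (\<alpha> - b))
      = (\<integral>\<^sup>+(z::complex^'n). ennreal (\<kappa> * xd z powr - b) * ennreal (norm (1 - cinner z w) powr - N) \<partial>nu \<alpha>)"
      using nn_integral_nu_shift[OF al \<beta>, of "\<lambda>z. ennreal (norm (1 - cinner z w) powr - N)"] by (simp add: \<kappa>_def)
    have "(\<integral>\<^sup>+(z::complex^'n). ennreal (xd z powr - b * norm (1 - cinner z w) powr - N) \<partial>nu \<alpha>)
      = (\<integral>\<^sup>+(z::complex^'n). ennreal (1 / \<kappa>) * (ennreal (\<kappa> * xd z powr - b) * ennreal (norm (1 - cinner z w) powr - N)) \<partial>nu \<alpha>)"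
      using \<kappa> by (intro nn_integral_cong) (simp flip: ennreal_mult)
    also have "... = ennreal (1 / \<kappa>) * (\<integral>\<^sup>+(z::complex^'n). ennreal (norm (1 - cinner z w) powr - N) \<partial>nu (\<alpha> - b))"
      unfolding eq
    proof (rule nn_integral_cmult)
      have [measurable]: "(\<lambda>z::complex^'n. xd z powr - b) \<in> borel_measurable (nu \<alpha>)" by (rule measurable_xd_powr_nu)
      show "(\<lambda>z::complex^'n. ennreal (\<kappa> * xd z powr - b) * ennreal (norm (1 - cinner z w) powr - N)) \<in> borel_measurable (nu \<alpha>)" by measurable
    qed
    also have "... \<le> ennreal (1 / \<kappa>) * ennreal (C * xd w powr - b)" by (intro mult_left_mono C(2)[OF w]) simp
    also have "... = ennreal (C / \<kappa> * xd w powr - b)" using C(1) \<kappa> by (simp flip: ennreal_mult)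
    finally show "(\<integral>\<^sup>+(z::complex^'n). ennreal (xd z powr - b * norm (1 - cinner z w) powr - N) \<partial>nu \<alpha>) \<le> ennreal (C / \<kappa> * xd w powr - b)" .
  qed
qed

text \<open>The previous inequality is inverted by applying \<Phi>. It asks for a positive A, so the
  value r of the integral is approached from above by r + e.\<close>

lemma quasi_Jensen':
  fixes g :: "'a \<Rightarrow> real"
  assumes qv: "quasi_convex \<Phi>" and g: "\<And>x. x \<in> space M \<Longrightarrow> 0 \<le> g x" "g \<in> borel_measurable M" and M: "emeasure M (space M) \<le> 1"
    and \<Phi>g: "(\<lambda>x. ennreal (\<Phi> (g x))) \<in> borel_measurable M"
    and v: "v \<ge> 0" "ennreal v \<le> (\<integral>\<^sup>+x. ennreal (g x) \<partial>M)"
  shows "ennreal (\<Phi> (v / 2)) \<le> (\<integral>\<^sup>+x. ennreal (\<Phi> (g x)) \<partial>M)"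
proof -
  have gf: "growth_function \<Phi>" using qv by (simp add: quasi_convex_def)
  have *: "\<Phi> (v / 2) \<le> A" if A: "A > 0" "(\<integral>\<^sup>+x. ennreal (\<Phi> (g x)) \<partial>M) \<le> ennreal A" for A
  proof -
    have "ennreal v \<le> ennreal (2 * growth_inverse \<Phi> A)" using v(2) quasi_Jensen[OF qv g M A \<Phi>g] by (rule order_trans)
    then have "v / 2 \<le> growth_inverse \<Phi> A" using growth_inverse_nonneg[OF gf, of A] A by (subst (asm) ennreal_le_iff) auto
    then have "\<Phi> (v / 2) \<le> \<Phi> (growth_inverse \<Phi> A)" using v by (intro growth_mono[OF gf]) auto
    then show ?thesis using growth_inverse_eq[OF gf, of A] A by simp
  qed
  show ?thesis
  proof (cases "\<integral>\<^sup>+x. ennreal (\<Phi> (g x)) \<partial>M")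
    case (real r)
    have "\<Phi> (v / 2) \<le> r"
    proof (rule field_le_epsilon)
      fix e :: real assume "e > 0"
      then show "\<Phi> (v / 2) \<le> r + e" using real by (intro *) (auto intro: ennreal_leI)
    qed
    then show ?thesis using real by (simp add: ennreal_leI)
  qed simp
qed

text \<open>A Schur test in modular form: Jensen's inequality for the measures
  \<open>h(w) |1 - \<langle>z,w\<rangle>|\<^bsup>-N\<^esup> d\<nu>(w) / (K h(z))\<close> with \<open>h = xd powr -a\<close>.\<close>

theorem bergman_projection_modular:
  fixes \<alpha> q \<epsilon> :: real
  assumes al: "\<alpha> > -1" and qv: "quasi_convex \<Phi>" and q: "q \<ge> 0" "growth_upper_type q \<Phi>"
    and low: "\<epsilon> > 0" "D > 0" "\<And>t \<tau>. t > 0 \<Longrightarrow> 0 < \<tau> \<Longrightarrow> \<tau> \<le> 1 \<Longrightarrow> \<Phi> (\<tau> * t) \<le> D * \<tau> powr (1 + \<epsilon>) * \<Phi> t"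
  defines "N \<equiv> real CARD('n::finite) + 1 + \<alpha>"
  obtains C where "C > 0" "\<And>G :: complex ^ 'n \<Rightarrow> complex. G \<in> borel_measurable (nu \<alpha>) \<Longrightarrow>
      modular \<alpha> \<Phi> G \<le> 1 \<Longrightarrow>
      (\<integral>\<^sup>+z. ennreal (\<Phi> (norm (bk_transform \<alpha> N G z) / C)) \<partial>nu \<alpha>) \<le> 1"
proof -
  have gf: "growth_function \<Phi>" using qv by (simp add: quasi_convex_def)
  \<comment> \<open>X dominates 1, Q and \<epsilon>, so the exponents a, a Q and a \<epsilon> of the
    weights are all at most (1 + \<alpha>) / 2.\<close>
  define X where "X = 1 + q + \<epsilon>"
  have den: "X > 0" using q low by (simp add: X_def)
  define a where "a = (1 + \<alpha>) / (2 * X)"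
  have a: "a > 0" using al den by (simp add: a_def)
  define Q where "Q = q + 1"
  have Q: "Q > 0" using q by (simp add: Q_def)
  have small: "a * s \<le> (1 + \<alpha>) / 2" if "s \<le> 1 + q + \<epsilon>" for s
  proof -
    have "a * s \<le> a * X" using that a by (intro mult_left_mono) (auto simp: X_def)
    also have "... = (1 + \<alpha>) / 2" using den by (simp add: a_def)
    finally show ?thesis .
  qed
  obtain K where K: "K > 0" "\<And>w. w \<in> ball 0 1 \<Longrightarrow>
    (\<integral>\<^sup>+(z::complex^'n). ennreal (xd z powr - a * norm (1 - cinner z w) powr - N) \<partial>nu \<alpha>) \<le> ennreal (K * xd w powr - a)"
    by (rule forelli_rudin_weight[OF al a, where 'n = 'n, folded N_def]) (use small[of 1] q low in auto)
  obtain KQ where KQ: "KQ > 0" "\<And>w. w \<in> ball 0 1 \<Longrightarrow>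
    (\<integral>\<^sup>+(z::complex^'n). ennreal (xd z powr - (a * Q) * norm (1 - cinner z w) powr - N) \<partial>nu \<alpha>) \<le> ennreal (KQ * xd w powr - (a * Q))"
    by (rule forelli_rudin_weight[OF al mult_pos_pos[OF a Q], where 'n = 'n, folded N_def]) (use small[of Q] q low in \<open>auto simp: Q_def\<close>)
  obtain Ke where Ke: "Ke > 0" "\<And>w. w \<in> ball 0 1 \<Longrightarrow>
    (\<integral>\<^sup>+(z::complex^'n). ennreal (xd z powr - (a * \<epsilon>) * norm (1 - cinner z w) powr - N) \<partial>nu \<alpha>) \<le> ennreal (Ke * xd w powr - (a * \<epsilon>))"
    by (rule forelli_rudin_weight[OF al mult_pos_pos[OF a low(1)], where 'n = 'n, folded N_def]) (use small[of \<epsilon>] q low in auto)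
  obtain C0 where C0: "C0 > 0" "\<And>s t. s > 0 \<Longrightarrow> t \<ge> 1 \<Longrightarrow> \<Phi> (s * t) \<le> C0 * t powr q * \<Phi> s"
    using q(2) unfolding growth_upper_type_def by blast
  define K1 where "K1 = max 1 K"
  define C2 where "C2 = C0 * K1 powr q * (C0 + D)"
  have C2: "C2 > 0" using C0 low K1_def by (simp add: C2_def)
  \<comment> \<open>Below, \<tau> is the ratio h(z) / h(w), and the density contributes 1/\<tau>.
    Upper type handles \<tau> > 1 and lower type 1 + \<epsilon> handles \<tau> <= 1. After division
    by \<tau> the exponents Q and \<epsilon> remain, positive as the kernel estimates
    require.\<close>
  have comp: "\<Phi> (K * \<tau> * t) \<le> C2 * (\<tau> powr (1 + Q) + \<tau> powr (1 + \<epsilon>)) * \<Phi> t" if \<tau>: "\<tau> > 0" and t: "t \<ge> 0" for \<tau> t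
  proof (cases "t = 0")
    case True then show ?thesis using growth_zero[OF gf] by simp
  next
    case False
    then have t0: "t > 0" using t by simp
    have ph: "\<Phi> t \<ge> 0" by (rule growth_nonneg[OF gf t])
    have 1: "\<Phi> (\<tau> * t) \<le> (C0 + D) * (\<tau> powr (1 + Q) + \<tau> powr (1 + \<epsilon>)) * \<Phi> t"
    proof (cases "\<tau> \<le> 1")
      case True
      have "\<Phi> (\<tau> * t) \<le> D * \<tau> powr (1 + \<epsilon>) * \<Phi> t" by (rule low(3)[OF t0 \<tau> True])
      also have "... \<le> (C0 + D) * (\<tau> powr (1 + Q) + \<tau> powr (1 + \<epsilon>)) * \<Phi> t"
        using C0 low ph by (intro mult_right_mono mult_mono) auto
      finally show ?thesis .
    next
      case False
      have "\<Phi> (\<tau> * t) \<le> C0 * \<tau> powr q * \<Phi> t" using C0(2)[OF t0, of \<tau>] False by (simp add: mult.commute)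
      also have "... \<le> (C0 + D) * (\<tau> powr (1 + Q) + \<tau> powr (1 + \<epsilon>)) * \<Phi> t"
      proof (intro mult_right_mono mult_mono)
        have "\<tau> powr q \<le> \<tau> powr (1 + Q)" using False by (intro powr_mono) (auto simp: Q_def)
        then show "\<tau> powr q \<le> \<tau> powr (1 + Q) + \<tau> powr (1 + \<epsilon>)" by (simp add: add_increasing2)
      qed (use C0 low ph in auto)
      finally show ?thesis .
    qed
    have "K * (\<tau> * t) \<le> K1 * (\<tau> * t)" using \<tau> t by (intro mult_right_mono) (auto simp: K1_def)
    then have "K * \<tau> * t \<le> (\<tau> * t) * K1" by (simp only: mult_ac)
    then have "\<Phi> (K * \<tau> * t) \<le> \<Phi> ((\<tau> * t) * K1)" using K(1) \<tau> t by (intro growth_mono[OF gf]) auto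
    also have "... \<le> C0 * K1 powr q * \<Phi> (\<tau> * t)" using \<tau> t0 by (intro C0(2)) (auto simp: K1_def)
    also have "... \<le> C0 * K1 powr q * ((C0 + D) * (\<tau> powr (1 + Q) + \<tau> powr (1 + \<epsilon>)) * \<Phi> t)"
      using 1 C0 by (intro mult_left_mono) auto
    finally show ?thesis by (simp add: C2_def mult_ac)
  qed
  define C3 where "C3 = C2 / K * (KQ + Ke)"
  define C4 where "C4 = max 1 C3"
  have C3: "C3 > 0" using C2 K(1) KQ(1) Ke(1) by (simp add: C3_def)
  have C4: "C4 \<ge> 1" "C3 \<le> C4" by (auto simp: C4_def)
  \<comment> \<open>The factor 2 is that of Jensen's inequality; C4 >= C3 brings the last integral
    below 1 through \<Phi>(x / C4) <= \<Phi>(x) / C4.\<close>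
  show thesis
  proof (rule that[of "2 * C4"])
    show "2 * C4 > 0" using C4 by simp
    fix G :: "complex ^ 'n \<Rightarrow> complex"
    assume Gm[measurable]: "G \<in> borel_measurable (nu \<alpha>)" and G1: "modular \<alpha> \<Phi> G \<le> 1"
    have [measurable]: "(\<lambda>z::complex^'n. xd z powr s) \<in> borel_measurable (nu \<alpha>)" for s by (rule measurable_xd_powr_nu)
    have \<Phi>Gm[measurable]: "(\<lambda>z. \<Phi> (norm (G z))) \<in> borel_measurable (nu \<alpha>)" using growth_measurable[OF gf Gm, of 1] by simp
    have kc: "norm (1 - cinner z w) = norm (1 - cinner w z)" for z w :: "complex ^ 'n" by (rule norm_one_minus_cinner_commute)
    let ?k = "\<lambda>z w :: complex ^ 'n. norm (1 - cinner w z) powr - N"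
    \<comment> \<open>The kernel of a positive linear operator acting on \<Phi>(|G|); it remains to
      bound its integral over z uniformly in w.\<close>
    define T where "T z w = C2 / K * (xd z powr - (a * Q) * xd w powr (a * Q) + xd z powr - (a * \<epsilon>) * xd w powr (a * \<epsilon>)) * ?k z w" for z w :: "complex ^ 'n"
    let ?\<nu> = "nu \<alpha> :: (complex ^ 'n) measure" and ?P = "\<lambda>w. ennreal (\<Phi> (norm (G w)))"
    let ?I = "\<lambda>z. \<integral>\<^sup>+w. ennreal (T z w) * ?P w \<partial>?\<nu>" and ?c = "\<lambda>s w. ennreal (C2 / K * xd w powr (a * s))"
    let ?h = "\<lambda>s z w. ennreal (xd z powr - (a * s) * norm (1 - cinner z w) powr - N)"
    have pt: "ennreal (\<Phi> (norm (bk_transform \<alpha> N G z) / 2)) \<le> ?I z"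
      if z: "z \<in> ball 0 1" for z
    proof -
      have x: "xd z > 0" by (rule xd_posI[OF z])
      let ?m = "\<lambda>w. xd z powr a / K * (xd w powr - a * ?k z w)"
      let ?M = "density (nu \<alpha>) (\<lambda>w. ennreal (?m w))"
      let ?g = "\<lambda>w. K * (xd w powr a * xd z powr - a) * norm (G w)"
      have wm: "(\<lambda>w. ennreal (?m w)) \<in> borel_measurable (nu \<alpha>)" by measurable
      have gm: "?g \<in> borel_measurable (nu \<alpha>)" by measurable
      have \<Phi>gm: "(\<lambda>w. \<Phi> (?g w)) \<in> borel_measurable (nu \<alpha>)"
        using growth_measurable[OF gf gm, of 1] K(1) by (simp add: abs_mult)
      have "emeasure ?M (space (nu \<alpha>)) = (\<integral>\<^sup>+w. ennreal (?m w) * indicator (space (nu \<alpha>)) w \<partial>?\<nu>)"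
        by (rule emeasure_density[OF wm sets.top])
      also have "... = (\<integral>\<^sup>+w. ennreal (xd z powr a / K) * ennreal (xd w powr - a * ?k z w) \<partial>?\<nu>)"
        using K(1) by (intro nn_integral_cong) (simp flip: ennreal_mult)
      also have "... = ennreal (xd z powr a / K) * (\<integral>\<^sup>+w. ennreal (xd w powr - a * ?k z w) \<partial>?\<nu>)"
        by (rule nn_integral_cmult) measurable
      also have "... \<le> ennreal (xd z powr a / K) * ennreal (K * xd z powr - a)" by (intro mult_left_mono K(2)[OF z]) simp
      also have "... = 1" using x K(1) by (simp flip: ennreal_mult add: powr_minus_divide)
      finally have e1: "emeasure ?M (space ?M) \<le> 1" by simp
      have "ennreal (norm (bk_transform \<alpha> N G z)) \<le> (\<integral>\<^sup>+w. ennreal (norm (G w * bk N z w)) \<partial>?\<nu>)"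
        unfolding bk_transform_def by (rule norm_integral_le_nn_integral)
      also have "... = (\<integral>\<^sup>+w. ennreal (?m w) * ennreal (?g w) \<partial>?\<nu>)"
      proof (rule nn_integral_cong)
        fix w :: "complex ^ 'n" assume "w \<in> space (nu \<alpha>)"
        then have w: "w \<in> ball 0 1" by simp
        have xw: "xd w > 0" by (rule xd_posI[OF w])
        have nn: "norm z * norm w < 1" using z w by (intro norm_mult_ball_less) auto
        have "?m w * ?g w = (xd z powr a * xd z powr - a) * (xd w powr - a * xd w powr a) * (norm (G w) * ?k z w)" using K(1) by simp
        also have "... = norm (G w * bk N z w)" using x xw by (simp add: norm_mult norm_bk[OF nn] kc[of z w] powr_minus_divide)
        finally show "ennreal (norm (G w * bk N z w)) = ennreal (?m w) * ennreal (?g w)" using K(1) by (simp flip: ennreal_mult)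
      qed
      also have "... = (\<integral>\<^sup>+w. ennreal (?g w) \<partial>?M)"
        using gm by (intro nn_integral_density[symmetric] wm measurable_compose[OF _ measurable_ennreal])
      finally have v: "ennreal (norm (bk_transform \<alpha> N G z)) \<le> (\<integral>\<^sup>+w. ennreal (?g w) \<partial>?M)" .
      have "ennreal (\<Phi> (norm (bk_transform \<alpha> N G z) / 2)) \<le> (\<integral>\<^sup>+w. ennreal (\<Phi> (?g w)) \<partial>?M)"
        by (rule quasi_Jensen'[OF qv _ _ e1 _ _ v]) (use K(1) gm \<Phi>gm in auto)
      also have "... = (\<integral>\<^sup>+w. ennreal (?m w) * ennreal (\<Phi> (?g w)) \<partial>?\<nu>)"
        by (rule nn_integral_density[OF wm measurable_compose[OF \<Phi>gm measurable_ennreal]])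
      also have "... \<le> ?I z"
      proof (rule nn_integral_mono)
        fix w :: "complex ^ 'n" assume "w \<in> space (nu \<alpha>)"
        then have w: "w \<in> ball 0 1" by simp
        have xw: "xd w > 0" by (rule xd_posI[OF w])
        define \<tau> where "\<tau> = xd w powr a * xd z powr - a"
        have \<tau>: "\<tau> > 0" using x xw by (simp add: \<tau>_def)
        have \<tau>s: "\<tau> powr s = xd z powr - (a * s) * xd w powr (a * s)" for s
          unfolding \<tau>_def by (simp add: powr_mult powr_powr)
        have inv: "xd z powr a * xd w powr - a = 1 / \<tau>" using x xw by (simp add: \<tau>_def powr_minus_divide)
        have "?m w * \<Phi> (?g w) \<le> ?m w * (C2 * (\<tau> powr (1 + Q) + \<tau> powr (1 + \<epsilon>)) * \<Phi> (norm (G w)))"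
          using comp[OF \<tau>, of "norm (G w)"] K(1) by (intro mult_left_mono) (auto simp: \<tau>_def)
        also have "... = (xd z powr a * xd w powr - a) * (\<tau> powr (1 + Q) + \<tau> powr (1 + \<epsilon>)) * (C2 / K * ?k z w * \<Phi> (norm (G w)))"
          by simp
        also have "(xd z powr a * xd w powr - a) * (\<tau> powr (1 + Q) + \<tau> powr (1 + \<epsilon>)) = \<tau> powr Q + \<tau> powr \<epsilon>"
          unfolding inv powr_add using \<tau> by (simp add: field_simps)
        also have "(\<tau> powr Q + \<tau> powr \<epsilon>) * (C2 / K * ?k z w * \<Phi> (norm (G w))) = T z w * \<Phi> (norm (G w))"
          by (simp add: T_def \<tau>s)
        finally show "ennreal (?m w) * ennreal (\<Phi> (?g w)) \<le> ennreal (T z w) * ?P w"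
          using growth_nonneg[OF gf, of "norm (G w)"] growth_nonneg[OF gf, of "?g w"] K(1) C2
          by (simp add: T_def flip: ennreal_mult add: ennreal_leI)
      qed
      finally show ?thesis .
    qed
    have Tint: "(\<integral>\<^sup>+z. ennreal (T z w) \<partial>?\<nu>) \<le> ennreal C3" if w: "w \<in> ball 0 1" for w
    proof -
      have xw: "xd w > 0" by (rule xd_posI[OF w])
      have "(\<integral>\<^sup>+z. ennreal (T z w) \<partial>?\<nu>) = (\<integral>\<^sup>+z. ?c Q w * ?h Q z w
         + ?c \<epsilon> w * ?h \<epsilon> z w \<partial>?\<nu>)"
        using C2 K(1) by (intro nn_integral_cong) (simp add: T_def kc[of _ w] algebra_simps flip: ennreal_mult ennreal_plus)
      also have "... = (\<integral>\<^sup>+z. ?c Q w * ?h Q z w \<partial>?\<nu>)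
         + (\<integral>\<^sup>+z. ?c \<epsilon> w * ?h \<epsilon> z w \<partial>?\<nu>)"
        by (rule nn_integral_add) measurable
      also have "... = ?c Q w * (\<integral>\<^sup>+z. ?h Q z w \<partial>?\<nu>)
         + ?c \<epsilon> w * (\<integral>\<^sup>+z. ?h \<epsilon> z w \<partial>?\<nu>)"
        by (subst nn_integral_cmult, measurable)+
      also have "... \<le> ?c Q w * ennreal (KQ * xd w powr - (a * Q)) + ?c \<epsilon> w * ennreal (Ke * xd w powr - (a * \<epsilon>))"
        by (intro add_mono mult_left_mono KQ(2)[OF w] Ke(2)[OF w]) auto
      also have "... = ennreal (C2 / K * KQ) + ennreal (C2 / K * Ke)"
        using C2 K(1) KQ(1) Ke(1) xw by (simp flip: ennreal_mult add: powr_minus_divide)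
      also have "... = ennreal C3" using C2 K(1) KQ(1) Ke(1) by (subst ennreal_plus[symmetric]) (auto simp: C3_def distrib_left)
      finally show ?thesis .
    qed
    interpret nu: finite_measure "?\<nu>" by (rule finite_measure_nu[OF al])
    interpret P: pair_sigma_finite "?\<nu>" "?\<nu>" ..
    have Tm: "(\<lambda>(z, w). ennreal (T z w) * ?P w) \<in> borel_measurable (nu \<alpha> \<Otimes>\<^sub>M nu \<alpha>)"
    proof -
      have "(\<lambda>(z, w). norm (bk N z w)) \<in> borel_measurable (?\<nu> \<Otimes>\<^sub>M ?\<nu>)"
        using measurable_compose[OF measurable_bk_pair[of 1 N \<alpha> \<alpha>] borel_measurable_norm] by (simp add: split_beta')
      also have "?this \<longleftrightarrow> (\<lambda>(z, w). ?k z w) \<in> borel_measurable (?\<nu> \<Otimes>\<^sub>M ?\<nu>)"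
      proof (rule measurable_cong)
        fix p assume p: "p \<in> space (?\<nu> \<Otimes>\<^sub>M ?\<nu>)"
        then have "norm (fst p) * norm (snd p) < 1" by (intro norm_mult_ball_less) (auto simp: space_pair_measure)
        then show "(case p of (z, w) \<Rightarrow> norm (bk N z w)) = (case p of (z, w) \<Rightarrow> ?k z w)"
          by (simp add: split_beta' norm_bk kc)
      qed
      finally have [measurable]: "(\<lambda>p. ?k (fst p) (snd p)) \<in> borel_measurable (?\<nu> \<Otimes>\<^sub>M ?\<nu>)"
        by (simp add: split_beta')
      show ?thesis unfolding T_def split_beta' by measurable
    qed
    have "(\<integral>\<^sup>+z. ennreal (\<Phi> (norm (bk_transform \<alpha> N G z) / (2 * C4))) \<partial>?\<nu>) \<le> (\<integral>\<^sup>+z. ennreal (1 / C4) * ?I z \<partial>?\<nu>)"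
    proof (rule nn_integral_mono)
      fix z :: "complex ^ 'n" assume "z \<in> space (nu \<alpha>)"
      then have z: "z \<in> ball 0 1" by simp
      let ?v = "norm (bk_transform \<alpha> N G z)"
      have "\<Phi> ((1 / C4) * (?v / 2)) \<le> (1 / C4) * \<Phi> (?v / 2)" using C4 by (intro quasi_convex_scale[OF qv]) auto
      then have "ennreal (\<Phi> (?v / (2 * C4))) \<le> ennreal (1 / C4 * \<Phi> (?v / 2))" by (intro ennreal_leI) (simp add: mult.commute)
      also have "... = ennreal (1 / C4) * ennreal (\<Phi> (?v / 2))" using C4 by (intro ennreal_mult') simp
      also have "... \<le> ennreal (1 / C4) * ?I z" by (intro mult_left_mono pt[OF z]) simp
      finally show "ennreal (\<Phi> (?v / (2 * C4))) \<le> ennreal (1 / C4) * ?I z" .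
    qed
    also have "... = ennreal (1 / C4) * (\<integral>\<^sup>+z. ?I z \<partial>?\<nu>)"
      using nu.borel_measurable_nn_integral[OF Tm] by (intro nn_integral_cmult) simp
    also have "(\<integral>\<^sup>+z. ?I z \<partial>?\<nu>) = (\<integral>\<^sup>+w. \<integral>\<^sup>+z. ennreal (T z w) * ?P w \<partial>?\<nu> \<partial>?\<nu>)"
      by (rule P.Fubini'[OF Tm, symmetric])
    also have "... \<le> (\<integral>\<^sup>+w. ennreal C3 * ?P w \<partial>?\<nu>)"
    proof (rule nn_integral_mono)
      fix w :: "complex ^ 'n" assume "w \<in> space (nu \<alpha>)"
      then have w: "w \<in> ball 0 1" by simp
      have "(\<lambda>z. T z w) \<in> borel_measurable (nu \<alpha>)" unfolding T_def kc[of w] by measurable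
      then have "(\<integral>\<^sup>+z. ennreal (T z w) * ?P w \<partial>?\<nu>) = (\<integral>\<^sup>+z. ennreal (T z w) \<partial>?\<nu>) * ?P w"
        by (intro nn_integral_multc) simp
      also have "... \<le> ennreal C3 * ?P w" by (intro mult_right_mono Tint[OF w]) simp
      finally show "(\<integral>\<^sup>+z. ennreal (T z w) * ?P w \<partial>?\<nu>) \<le> ennreal C3 * ?P w" .
    qed
    also have "... = ennreal C3 * (\<integral>\<^sup>+w. ?P w \<partial>?\<nu>)" by (rule nn_integral_cmult) measurable
    also have "... \<le> ennreal C3 * 1" by (intro mult_left_mono G1) simp
    also have "ennreal (1 / C4) * (ennreal C3 * 1) = ennreal (C3 / C4)" using C4 C3 by (simp flip: ennreal_mult)
    also have "... \<le> 1" using C4 by simp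
    finally show "(\<integral>\<^sup>+z. ennreal (\<Phi> (norm (bk_transform \<alpha> N G z) / (2 * C4))) \<partial>?\<nu>) \<le> 1"
      by (simp add: mult_left_mono)
  qed
qed


section \<open>Small Hankel operators\<close>

lemma hankel_eq_bk_transform:
  fixes b f :: "complex ^ 'n \<Rightarrow> complex"
  shows "hankel \<alpha> b f z = bk_transform \<alpha> (real CARD('n) + 1 + \<alpha>) (\<lambda>\<xi>. b \<xi> * cnj (f \<xi>)) z"
  unfolding hankel_def bergman_proj_def bk_transform_def bk_def of_real_minus powr_minus by (simp only: divide_inverse)

lemma hol_ball_bk_transform:
  fixes g :: "complex ^ 'n \<Rightarrow> complex"
  assumes al: "\<alpha> > -1" and g: "integrable (nu \<alpha>) g" and s: "s \<ge> 0"
  shows "holomorphic_ball (bk_transform \<alpha> s g)"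
proof -
  interpret bounded_hol_functional "\<lambda>f. \<integral>z. f z * cnj (g z) \<partial>nu \<alpha>" "\<integral>z. norm (g z) \<partial>nu \<alpha>"
    by (rule bounded_hol_functional_pairing[OF al g])
  show ?thesis using hol_ball_cong[of "E s" "bk_transform \<alpha> s g"] E_pairing[OF al g] hol_ball_E[OF s] by blast
qed

lemma lux_norm_le:
  "c > 0 \<Longrightarrow> (\<integral>\<^sup>+z. ennreal (\<Phi> (norm (f z) / c)) \<partial>nu \<alpha>) \<le> 1 \<Longrightarrow> lux_norm \<alpha> \<Phi> f \<le> ennreal c"
  unfolding lux_norm_def by (rule INF_lower) simp

lemma lux_norm_lessD:
  assumes gf: "growth_function \<Phi>" and less: "lux_norm \<alpha> \<Phi> f < ennreal c"
  shows "(\<integral>\<^sup>+z. ennreal (\<Phi> (norm (f z) / c)) \<partial>nu \<alpha>) \<le> 1"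
proof -
  obtain d where d: "0 < d" "(\<integral>\<^sup>+z. ennreal (\<Phi> (norm (f z) / d)) \<partial>nu \<alpha>) \<le> 1" "ennreal d < ennreal c"
    using less unfolding lux_norm_def INF_less_iff by auto
  then have "d \<le> c" by (simp add: ennreal_less_iff)
  then show ?thesis using lux_admissible_mono[OF gf d(1) _ d(2)] by blast
qed

lemma le_mult_lux_norm:
  assumes C: "C > 0" and le: "\<And>c. c > 0 \<Longrightarrow> (\<integral>\<^sup>+z. ennreal (\<Phi> (norm (f z) / c)) \<partial>nu \<alpha>) \<le> 1 \<Longrightarrow> x \<le> ennreal (C * c)"
  shows "x \<le> ennreal C * lux_norm \<alpha> \<Phi> f"
proof -
  have "ennreal (1 / C) * x \<le> lux_norm \<alpha> \<Phi> f" unfolding lux_norm_def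
  proof (rule INF_greatest)
    fix c assume "c \<in> {c. 0 < c \<and> (\<integral>\<^sup>+z. ennreal (\<Phi> (norm (f z) / c)) \<partial>nu \<alpha>) \<le> 1}"
    then have c: "c > 0" "x \<le> ennreal (C * c)" using le by auto
    have "ennreal (1 / C) * x \<le> ennreal (1 / C) * ennreal (C * c)" by (rule mult_left_mono[OF c(2)]) simp
    also have "... = ennreal c" using C c(1) by (simp flip: ennreal_mult)
    finally show "ennreal (1 / C) * x \<le> ennreal c" .
  qed
  then have "ennreal C * (ennreal (1 / C) * x) \<le> ennreal C * lux_norm \<alpha> \<Phi> f" by (rule mult_left_mono) simp
  moreover have "ennreal C * (ennreal (1 / C) * x) = x" using C by (simp flip: ennreal_mult' mult.assoc)
  ultimately show ?thesis by simp
qed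

lemma bergman_A2_integrable:
  fixes b :: "complex ^ 'n \<Rightarrow> complex"
  assumes al: "\<alpha> > -1" and b: "b \<in> bergman_orlicz \<alpha> (\<lambda>t. t\<^sup>2)"
  shows "holomorphic_ball b" "integrable (nu \<alpha>) b"
proof -
  show hol: "holomorphic_ball b" using b by (simp add: bergman_orlicz_def)
  have bm: "b \<in> borel_measurable (nu \<alpha>)" by (rule hol_ball_measurable[OF hol])
  show "integrable (nu \<alpha>) b"
  proof (rule integrableI_bounded[OF bm])
    have "(\<integral>\<^sup>+z. ennreal (norm (b z)) \<partial>nu \<alpha>) \<le> (\<integral>\<^sup>+z. 1 + ennreal ((norm (b z))\<^sup>2) \<partial>nu \<alpha>)"
    proof (rule nn_integral_mono)
      fix z
      have "0 \<le> (norm (b z) - 1)\<^sup>2" by simp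
      then have "2 * norm (b z) \<le> 1 + (norm (b z))\<^sup>2" by (simp add: power2_diff)
      then have "norm (b z) \<le> 1 + (norm (b z))\<^sup>2" using norm_ge_zero[of "b z"] by linarith
      then have "ennreal (norm (b z)) \<le> ennreal (1 + (norm (b z))\<^sup>2)" by (rule ennreal_leI)
      then show "ennreal (norm (b z)) \<le> 1 + ennreal ((norm (b z))\<^sup>2)" by simp
    qed
    also have "... = emeasure (nu \<alpha>) (space (nu \<alpha> :: (complex ^ 'n) measure)) + (\<integral>\<^sup>+z. ennreal ((norm (b z))\<^sup>2) \<partial>nu \<alpha>)"
      using bm by (subst nn_integral_add) auto
    also have "... < \<infinity>" using b by (simp add: bergman_orlicz_def emeasure_nu_space[OF al])
    finally show "(\<integral>\<^sup>+z. ennreal (norm (b z)) \<partial>nu \<alpha>) < \<infinity>" .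
  qed
qed

lemma bk_nat_power_conj:
  assumes "w \<in> ball 0 1" "z \<in> ball 0 1"
  shows "cnj (bk s z w) * bk t w z = bk (t + s) w z"
proof -
  have 1: "norm z * norm w < 1" "norm w * norm z < 1" using assms by (auto intro!: norm_mult_ball_less)
  show ?thesis unfolding cnj_bk[OF 1(1)] bk_mult[OF 1(2)] by (simp add: add.commute)
qed

context hankel_growth
begin

text \<open>Testing on \<open>bk j z w\<close> and evaluating the image at w itself produces
  \<open>E (N + j) w\<close>, because the conjugate test kernel multiplies the Bergman kernel. With
  s = \<open>xd w powr - N\<close>, the test kernel has norm at most of order
  \<open>xd w powr - m / \<Psi>\<^sub>1 s\<close> and point evaluation costs
  \<open>\<Psi>\<^sub>2 s\<close>; together they give \<rho>. The choice m p >= 2 N admits all j <=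
  m with one constant.\<close>

lemma hankel_bounded_imp_Gamma:
  fixes b :: "complex ^ 'n \<Rightarrow> complex"
  assumes al: "\<alpha> > -1" and b: "holomorphic_ball b" "integrable (nu \<alpha>) b"
    and H: "hankel_extends_bounded \<alpha> b \<Phi>\<^sub>1 \<Phi>\<^sub>2"
  shows "b \<in> Gamma_space \<alpha> \<rho>"
proof -
  define N where "N = real CARD('n) + 1 + \<alpha>"
  have N: "N > 0" unfolding N_def by (rule dim_exponent_pos[OF al])
  obtain m :: nat where m: "real m \<ge> 2 * N / p" using real_arch_simple by blast
  have mp: "real m * p \<ge> 2 * N" using m p by (simp add: divide_le_eq)
  have mN: "real m > (1 / p) * N"
  proof -
    have "(1 / p) * N < 2 * N / p" using N p by (simp add: divide_strict_right_mono)
    then show ?thesis using m by simp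
  qed
  obtain Ch where Ch: "Ch > 0" "\<And>f. holomorphic_ball f \<Longrightarrow> bounded (f ` ball 0 1) \<Longrightarrow>
      lux_norm \<alpha> \<Phi>\<^sub>2 (hankel \<alpha> b f) \<le> ennreal Ch * lux_norm \<alpha> \<Phi>\<^sub>1 f"
    using H unfolding hankel_extends_bounded_def by blast
  obtain K where K: "K > 0" "\<And>(w :: complex ^ 'n) s. w \<in> ball 0 1 \<Longrightarrow> 0 \<le> s \<Longrightarrow> s \<le> real m \<Longrightarrow>
    (\<integral>\<^sup>+z. ennreal (\<Phi>\<^sub>1 (norm (bk s z w) / (K * (xd w powr - real m / \<Psi>\<^sub>1 (xd w powr - N))))) \<partial>nu \<alpha>) \<le> 1"
    by (rule kernel_admissible[OF al qc1, where 'n = 'n, of "real m", folded N_def]) (use mp in auto)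
  interpret B: bounded_hol_functional "\<lambda>f. \<integral>z. f z * cnj (b z) \<partial>nu \<alpha>" "\<integral>z. norm (b z) \<partial>nu \<alpha>"
    by (rule bounded_hol_functional_pairing[OF al b(2)])
  have EN: "B.E s w = bk_transform \<alpha> s b w" if "w \<in> ball 0 1" for s w by (rule E_pairing[OF al b(2) that])
  define C where "C = 2 * 4 powr N * (2 * Ch * K)"
  show ?thesis
  proof (rule Gamma_spaceI[OF al B.bounded_hol_functional_axioms])
    show "b w = B.E (real CARD('n) + 1 + \<alpha>) w" if "w \<in> ball 0 1" for w
      using EN[OF that] bergman_reproducing[OF al b(2,1) that] by (simp add: bk_transform_def)
    show "real m > (1 / p) * (real CARD('n) + 1 + \<alpha>)" using mN by (simp add: N_def)
    fix j :: nat and w :: "complex ^ 'n" assume j: "j \<le> m" and w: "w \<in> ball 0 1"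
    have x: "xd w > 0" by (rule xd_posI[OF w])
    let ?f = "\<lambda>z. bk (real j) z w"
    have hf: "holomorphic_ball ?f" by (rule B.hol_bk[OF w])
    have bf: "bounded (?f ` ball 0 1)" by (rule B.bounded_bk[OF w]) simp
    define c1 where "c1 = K * (xd w powr - real m / \<Psi>\<^sub>1 (xd w powr - N))"
    have \<Psi>1: "\<Psi>\<^sub>1 (xd w powr - N) > 0" using x by (intro growth_inverse_pos[OF gf1]) simp
    have c1: "c1 > 0" using K(1) x \<Psi>1 by (simp add: c1_def)
    have "lux_norm \<alpha> \<Phi>\<^sub>1 ?f \<le> ennreal c1"
      using K(2)[OF w, of "real j"] j unfolding c1_def[symmetric] by (intro lux_norm_le c1) auto
    then have "lux_norm \<alpha> \<Phi>\<^sub>2 (hankel \<alpha> b ?f) \<le> ennreal Ch * ennreal c1"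
      using Ch(2)[OF hf bf] by (meson mult_left_mono order_trans zero_le)
    also have "... = ennreal (Ch * c1)" using Ch(1) by (simp add: ennreal_mult')
    \<comment> \<open>The factor 2 gives strict inequality, so that this number is itself admissible
      in the infimum defining the norm.\<close>
    also have "... < ennreal (2 * Ch * c1)" using Ch(1) c1 by (intro ennreal_lessI) auto
    finally have adm: "(\<integral>\<^sup>+z. ennreal (\<Phi>\<^sub>2 (norm (hankel \<alpha> b ?f z) / (2 * Ch * c1))) \<partial>nu \<alpha>) \<le> 1"
      by (rule lux_norm_lessD[OF gf2])
    have ig: "integrable (nu \<alpha>) (\<lambda>\<xi>. b \<xi> * cnj (?f \<xi>))"
    proof -
      obtain M where "\<And>z. z \<in> ball 0 1 \<Longrightarrow> norm (?f z) \<le> M" using norm_bk_le'[OF _ w, of _ "real j"] by auto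
      then show ?thesis using hol_ball_measurable[OF hf] by (intro integrable_mult_bounded[OF b(2), where B = M]) auto
    qed
    have hF: "holomorphic_ball (hankel \<alpha> b ?f)"
      using hol_ball_bk_transform[OF al ig, of N] N unfolding hankel_eq_bk_transform[abs_def] N_def by simp
    have "norm (hankel \<alpha> b ?f w) \<le> 2 * 4 powr N * (2 * Ch * c1) * \<Psi>\<^sub>2 (xd w powr - N)"
      unfolding N_def using Ch(1) c1 by (intro pointwise_quasi_convex[OF al qv2 hF _ adm w]) simp
    also have "... = C * (xd w powr - real m * \<rho> (xd w powr N))" unfolding rho_xd(1)[OF x] by (simp add: C_def c1_def)
    finally have "norm (hankel \<alpha> b ?f w) \<le> C * (xd w powr - real m * \<rho> (xd w powr N))" .
    moreover have "hankel \<alpha> b ?f w = B.E (N + real j) w" unfolding EN[OF w] hankel_eq_bk_transform bk_transform_def N_def[symmetric]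
    proof (rule Bochner_Integration.integral_cong)
      fix \<xi> :: "complex ^ 'n" assume "\<xi> \<in> space (nu \<alpha>)"
      then show "b \<xi> * cnj (?f \<xi>) * bk N w \<xi> = b \<xi> * bk (N + real j) w \<xi>"
        using bk_nat_power_conj[OF w, of \<xi> "real j" N] by (simp add: mult.assoc)
    qed simp
    ultimately show "norm (B.E (real CARD('n) + 1 + \<alpha> + real j) w) \<le> C * (xd w powr - real m * \<rho> (xd w powr (real CARD('n) + 1 + \<alpha>)))"
      by (simp add: N_def)
  qed
qed

text \<open>The pointwise estimate puts \<open>a = |f|\<close> below \<open>\<Psi>\<^sub>1 s\<close>, where \<open>s = xd powr -N\<close>, and there
  \<open>a \<rho> = a \<Psi>\<^sub>2 s / \<Psi>\<^sub>1 s \<le> (\<Phi>\<^sub>1 a / s) \<Psi>\<^sub>2 s\<close>.\<close>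

lemma Phi2_rho_le:
  assumes x: "x > 0" and a: "0 \<le> a" "a \<le> \<Psi>\<^sub>1 (x powr - N)"
  shows "\<Phi>\<^sub>2 (a * \<rho> (x powr N)) \<le> \<Phi>\<^sub>1 a"
proof (cases "a = 0")
  case True then show ?thesis using growth_zero[OF gf1] growth_zero[OF gf2] by simp
next
  case False
  then have a0: "a > 0" using a by simp
  define s where "s = x powr - N"
  have s: "s > 0" using x by (simp add: s_def)
  define y where "y = \<Phi>\<^sub>1 a"
  have y: "y > 0" using quasi_concave_pos[OF qc1 a0] by (simp add: y_def)
  have b: "\<Psi>\<^sub>1 s > 0" "\<Psi>\<^sub>2 s > 0" using growth_inverse_pos[OF gf1 s] growth_inverse_pos[OF gf2 s] by auto
  have "a * \<Phi>\<^sub>1 (\<Psi>\<^sub>1 s) \<le> \<Psi>\<^sub>1 s * \<Phi>\<^sub>1 a" using a0 a by (intro quasi_concave_scale[OF qc1]) (auto simp: s_def)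
  then have "a * s \<le> \<Psi>\<^sub>1 s * y" using growth_inverse_eq[OF gf1, of s] s by (simp add: y_def)
  then have "a / \<Psi>\<^sub>1 s \<le> y / s" using s b by (simp add: field_simps)
  then have "(a / \<Psi>\<^sub>1 s) * \<Psi>\<^sub>2 s \<le> (y / s) * \<Psi>\<^sub>2 s" using b by (intro mult_right_mono) auto
  then have "a * \<rho> (x powr N) \<le> (y / s) * \<Psi>\<^sub>2 s" unfolding rho_xd(1)[OF x] s_def by simp
  then have "\<Phi>\<^sub>2 (a * \<rho> (x powr N)) \<le> \<Phi>\<^sub>2 ((y / s) * \<Psi>\<^sub>2 s)"
    using a rho_pos[of "x powr N"] x by (intro growth_mono[OF gf2]) auto
  also have "... \<le> (y / s) * \<Phi>\<^sub>2 (\<Psi>\<^sub>2 s)"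
  proof (rule quasi_convex_scale[OF qv2])
    have "y \<le> \<Phi>\<^sub>1 (\<Psi>\<^sub>1 s)" unfolding y_def s_def using a by (intro growth_mono[OF gf1]) auto
    then show "y / s \<le> 1" using growth_inverse_eq[OF gf1, of s] s by simp
  qed (use y s b in auto)
  also have "... = y" using growth_inverse_eq[OF gf2, of s] s by simp
  finally show ?thesis by (simp add: y_def)
qed

text \<open>Integration by parts writes the image as the Bergman projection of a multiple of G,
  where G is xd^k D times the conjugate of f, up to normalisation. The factor xd^k reduces |D| to
  \<rho>, and \<open>Phi2_rho_le\<close> bounds the modular of G by that of f.\<close>

lemma Gamma_imp_hankel_bounded:
  fixes b :: "complex ^ 'n \<Rightarrow> complex"
  assumes al: "\<alpha> > -1" and q: "q \<ge> 0" and Dini: "Dini_condition \<Phi>\<^sub>2" and b: "b \<in> Gamma_space \<alpha> \<rho>"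
  shows "hankel_extends_bounded \<alpha> b \<Phi>\<^sub>1 \<Phi>\<^sub>2"
proof -
  define N where "N = real CARD('n) + 1 + \<alpha>"
  have N: "N > 0" unfolding N_def by (rule dim_exponent_pos[OF al])
  obtain k :: nat and Cb cb \<epsilon> where hol: "holomorphic_ball b" and int: "integrable (nu \<alpha>) b" and \<epsilon>: "0 < \<epsilon>" "\<epsilon> < 1 + \<alpha>"
    and fin: "(\<integral>\<^sup>+w. ennreal (norm (b w)) * ennreal (xd w powr - \<epsilon>) \<partial>nu \<alpha>) < \<infinity>"
    and Cb: "Cb > 0" "\<And>w. w \<in> ball 0 1 \<Longrightarrow> norm (bk_transform \<alpha> (N + real k) b w) \<le> Cb * (xd w powr - real k * \<rho> (xd w powr N))"
    by (rule Gamma_spaceD[OF al b, folded N_def]) blast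
  have \<beta>: "\<alpha> + real k > -1" using al by simp
  define \<kappa> where "\<kappa> = nu_const TYPE('n) (\<alpha> + real k) / nu_const TYPE('n) \<alpha>"
  have \<kappa>: "\<kappa> > 0" unfolding \<kappa>_def by (intro divide_pos_pos nu_const_eq al \<beta>)
  obtain e D where e: "e > 0" "D > 0" "\<And>t \<tau>. t > 0 \<Longrightarrow> 0 < \<tau> \<Longrightarrow> \<tau> \<le> 1 \<Longrightarrow> \<Phi>\<^sub>2 (\<tau> * t) \<le> D * \<tau> powr (1 + e) * \<Phi>\<^sub>2 t"
    by (rule Dini_lower_type[OF qv2 Dini]) blast
  have up: "growth_upper_type q \<Phi>\<^sub>2" using U2 by (simp add: class_U_def)
  obtain CP where CP: "CP > 0" "\<And>G :: complex ^ 'n \<Rightarrow> complex. G \<in> borel_measurable (nu \<alpha>) \<Longrightarrow>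
      modular \<alpha> \<Phi>\<^sub>2 G \<le> 1 \<Longrightarrow>
      (\<integral>\<^sup>+z. ennreal (\<Phi>\<^sub>2 (norm (bk_transform \<alpha> N G z) / CP)) \<partial>nu \<alpha>) \<le> 1"
    by (rule bergman_projection_modular[OF al qv2 q up e, where 'n = 'n, folded N_def]) (assumption | rule that)+
  obtain K where K: "K > 0" "\<And>f w. holomorphic_ball f \<Longrightarrow>
     modular \<alpha> \<Phi>\<^sub>1 (f :: complex ^ 'n \<Rightarrow> complex) \<le> ennreal 1 \<Longrightarrow> w \<in> ball 0 1 \<Longrightarrow>
     norm (f w) \<le> K * \<Psi>\<^sub>1 (xd w powr - N)"
    by (rule pointwise_quasi_concave[OF al qc1 zero_le_one, where 'n = 'n, folded N_def]) (rule that)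
  \<comment> \<open>K1 >= K puts a = |f| / (c K1) below the inverse, and K1 >= 1 keeps it below |f|
    / c.\<close>
  define K1 where "K1 = max 1 K"
  have K1: "K1 \<ge> 1" "K \<le> K1" by (auto simp: K1_def)
  define C where "C = \<kappa> * Cb * K1 * CP"
  have C: "C > 0" using \<kappa> Cb(1) K1 CP(1) by (simp add: C_def)
  show ?thesis unfolding hankel_extends_bounded_def
  proof (intro exI[of _ C] conjI allI impI C)
    fix f :: "complex ^ 'n \<Rightarrow> complex" assume f: "holomorphic_ball f \<and> bounded (f ` ball 0 1)"
    then have hf: "holomorphic_ball f" by simp
    obtain Mf where Mf: "\<And>y. y \<in> f ` ball 0 1 \<Longrightarrow> norm y \<le> Mf" using f unfolding bounded_iff by blast
    show "lux_norm \<alpha> \<Phi>\<^sub>2 (hankel \<alpha> b f) \<le> ennreal C * lux_norm \<alpha> \<Phi>\<^sub>1 f"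
    proof (rule le_mult_lux_norm[OF C])
      fix c :: real assume c: "c > 0" and adm: "(\<integral>\<^sup>+z. ennreal (\<Phi>\<^sub>1 (norm (f z) / c)) \<partial>nu \<alpha>) \<le> 1"
      define D where "D = bk_transform \<alpha> (N + real k) b"
      have hD: "holomorphic_ball D" unfolding D_def using N by (intro hol_ball_bk_transform[OF al int]) simp
      \<comment> \<open>The normalisation that gives G modular at most 1: \<kappa> comes from the
        change of measure, Cb from D, K1 from the pointwise bound and c from the norm of f.\<close>
      let ?r = "\<kappa> * Cb * K1 * c"
      have r: "?r > 0" using \<kappa> Cb(1) K1 c by simp
      define G where "G \<xi> = of_real (\<kappa> * xd \<xi> powr real k / ?r) * (D \<xi> * cnj (f \<xi>))" for \<xi>
      have Dm[measurable]: "D \<in> borel_measurable (nu \<alpha>)" and fm[measurable]: "f \<in> borel_measurable (nu \<alpha>)"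
        using hD hf by (auto intro: hol_ball_measurable)
      have [measurable]: "(\<lambda>z::complex^'n. xd z powr s) \<in> borel_measurable (nu \<alpha>)" for s by (rule measurable_xd_powr_nu)
      have Gm: "G \<in> borel_measurable (nu \<alpha>)" unfolding G_def by measurable
      have hfc: "holomorphic_ball (\<lambda>z. of_real (1 / c) * f z)" by (rule hol_ball_cmult[OF hf])
      have pw: "norm (f z) / c \<le> K * \<Psi>\<^sub>1 (xd z powr - N)" if z: "z \<in> ball 0 1" for z
        using K(2)[OF hfc _ z] adm c by (simp add: norm_mult norm_divide)
      have G1: "modular \<alpha> \<Phi>\<^sub>2 G \<le> 1"
      proof -
        have "modular \<alpha> \<Phi>\<^sub>2 G \<le> (\<integral>\<^sup>+z. ennreal (\<Phi>\<^sub>1 (norm (f z) / c)) \<partial>nu \<alpha>)"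
        proof (intro nn_integral_mono ennreal_leI)
          fix z :: "complex ^ 'n" assume "z \<in> space (nu \<alpha>)"
          then have z: "z \<in> ball 0 1" by simp
          have x: "xd z > 0" by (rule xd_posI[OF z])
          define a where "a = norm (f z) / (c * K1)"
          have a0: "a \<ge> 0" using c K1 by (simp add: a_def)
          have \<Psi>0: "\<Psi>\<^sub>1 (xd z powr - N) > 0" using x by (intro growth_inverse_pos[OF gf1]) simp
          have "norm (f z) / c \<le> K1 * \<Psi>\<^sub>1 (xd z powr - N)"
            using pw[OF z] mult_right_mono[OF K1(2), of "\<Psi>\<^sub>1 (xd z powr - N)"] \<Psi>0 by linarith
          then have a1: "a \<le> \<Psi>\<^sub>1 (xd z powr - N)" using c K1(1) by (simp add: a_def field_simps)
          have "norm (G z) = (xd z powr real k / (Cb * K1 * c)) * (norm (D z) * norm (f z))"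
            using \<kappa> Cb(1) K1(1) c by (simp add: G_def norm_mult norm_divide)
          also have "... \<le> (xd z powr real k / (Cb * K1 * c)) * ((Cb * (xd z powr - real k * \<rho> (xd z powr N))) * norm (f z))"
            using Cb K1(1) c z by (intro mult_left_mono mult_right_mono) (auto simp: D_def)
          also have "... = (xd z powr real k * xd z powr - real k) * (a * \<rho> (xd z powr N))" using Cb(1) by (simp add: a_def mult_ac)
          also have "xd z powr real k * xd z powr - real k = 1" using x by (subst powr_add[symmetric]) simp
          finally have "\<Phi>\<^sub>2 (norm (G z)) \<le> \<Phi>\<^sub>2 (a * \<rho> (xd z powr N))" by (intro growth_mono[OF gf2]) auto
          also have "... \<le> \<Phi>\<^sub>1 a" by (rule Phi2_rho_le[OF x a0 a1])
          also have "... \<le> \<Phi>\<^sub>1 (norm (f z) / c)"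
          proof (rule growth_mono[OF gf1 a0])
            have "c * 1 \<le> c * K1" using K1(1) c by (intro mult_left_mono) auto
            then show "a \<le> norm (f z) / c" unfolding a_def using c by (intro divide_left_mono) auto
          qed
          finally show "\<Phi>\<^sub>2 (norm (G z)) \<le> \<Phi>\<^sub>1 (norm (f z) / c)" .
        qed
        with adm show ?thesis by simp
      qed
      have hG: "hankel \<alpha> b f z = of_real ?r * bk_transform \<alpha> N G z" if z: "z \<in> ball 0 1" for z
      proof -
        let ?F = "\<lambda>\<xi>. f \<xi> * bk N \<xi> z"
        have hF: "holomorphic_ball ?F" using z by (intro hol_ball_mult hf hol_ball_bk) auto
        have bF: "norm (?F \<xi>) \<le> \<bar>Mf\<bar> * (1 - norm z) powr - N" if "\<xi> \<in> ball 0 1" for \<xi>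
          unfolding norm_mult using Mf[of "f \<xi>"] that z N by (intro mult_mono norm_bk_le') auto
        have "hankel \<alpha> b f z = (\<integral>\<xi>. b \<xi> * cnj (?F \<xi>) \<partial>nu \<alpha>)"
          unfolding hankel_eq_bk_transform bk_transform_def N_def[symmetric]
        proof (rule Bochner_Integration.integral_cong)
          fix \<xi> :: "complex ^ 'n" assume "\<xi> \<in> space (nu \<alpha>)"
          then have "norm \<xi> * norm z < 1" using z by (intro norm_mult_ball_less) auto
          then show "b \<xi> * cnj (f \<xi>) * bk N z \<xi> = b \<xi> * cnj (?F \<xi>)" by (simp add: cnj_bk)
        qed simp
        also have "... = (\<integral>\<xi>. D \<xi> * cnj (?F \<xi>) \<partial>nu (\<alpha> + real k))" unfolding D_def N_def
          by (rule bergman_parts[OF al \<epsilon> hol_ball_measurable[OF hol] fin hF[unfolded N_def] bF[unfolded N_def]])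
        also have "... = (\<integral>\<xi>. (\<kappa> * xd \<xi> powr real k) *\<^sub>R (D \<xi> * cnj (?F \<xi>)) \<partial>nu \<alpha>)"
          unfolding nu_shift[OF al \<beta>]
        proof (subst integral_density)
          show "(\<lambda>\<xi>. D \<xi> * cnj (?F \<xi>)) \<in> borel_measurable (nu \<alpha>)"
            using hol_ball_measurable[OF hF] by measurable
          show "AE \<xi> in nu \<alpha>. 0 \<le> nu_const TYPE('n) (\<alpha> + real k) / nu_const TYPE('n) \<alpha> * xd \<xi> powr (\<alpha> + real k - \<alpha>)"
            using \<kappa> unfolding \<kappa>_def[symmetric] by (intro AE_I2 mult_nonneg_nonneg) auto
        qed (simp_all add: \<kappa>_def)
        also have "... = (\<integral>\<xi>. of_real ?r * (G \<xi> * bk N z \<xi>) \<partial>nu \<alpha>)"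
        proof (rule Bochner_Integration.integral_cong)
          fix \<xi> :: "complex ^ 'n" assume "\<xi> \<in> space (nu \<alpha>)"
          then have "norm \<xi> * norm z < 1" using z by (intro norm_mult_ball_less) auto
          then have "cnj (?F \<xi>) = cnj (f \<xi>) * bk N z \<xi>" by (simp add: cnj_bk)
          moreover have "of_real ?r * G \<xi> = of_real (\<kappa> * xd \<xi> powr real k) * (D \<xi> * cnj (f \<xi>))"
          proof -
            have "?r * (\<kappa> * xd \<xi> powr real k / ?r) = \<kappa> * xd \<xi> powr real k"
              using r by (metis less_irrefl nonzero_mult_div_cancel_left times_divide_eq_right)
            moreover have "of_real ?r * G \<xi> = of_real (?r * (\<kappa> * xd \<xi> powr real k / ?r)) * (D \<xi> * cnj (f \<xi>))"
              unfolding G_def of_real_mult[of ?r] by (rule mult.assoc[symmetric])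
            ultimately show ?thesis by (simp only:)
          qed
          ultimately show "(\<kappa> * xd \<xi> powr real k) *\<^sub>R (D \<xi> * cnj (?F \<xi>)) = of_real ?r * (G \<xi> * bk N z \<xi>)"
            unfolding scaleR_conv_of_real by (simp only: mult.assoc[symmetric])
        qed simp
        also have "... = of_real ?r * bk_transform \<alpha> N G z" unfolding bk_transform_def by (rule integral_mult_right_zero)
        finally show ?thesis .
      qed
      have "(\<integral>\<^sup>+z. ennreal (\<Phi>\<^sub>2 (norm (hankel \<alpha> b f z) / (C * c))) \<partial>nu \<alpha>) = (\<integral>\<^sup>+z. ennreal (\<Phi>\<^sub>2 (norm (bk_transform \<alpha> N G z) / CP)) \<partial>nu \<alpha>)"
      proof (rule nn_integral_cong)
        fix z :: "complex ^ 'n" assume "z \<in> space (nu \<alpha>)"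
        then have "norm (hankel \<alpha> b f z) = ?r * norm (bk_transform \<alpha> N G z)"
          using abs_of_pos[OF r] by (simp only: hG norm_mult norm_of_real space_nu)
        moreover have "C * c = ?r * CP" by (simp add: C_def)
        ultimately have "norm (hankel \<alpha> b f z) / (C * c) = norm (bk_transform \<alpha> N G z) / CP"
          using mult_divide_mult_cancel_left[OF less_imp_neq[OF r, symmetric]] by (simp only:)
        then show "ennreal (\<Phi>\<^sub>2 (norm (hankel \<alpha> b f z) / (C * c))) = ennreal (\<Phi>\<^sub>2 (norm (bk_transform \<alpha> N G z) / CP))" by simp
      qed
      also have "... \<le> 1" by (rule CP(2)[OF Gm G1])
      finally show "lux_norm \<alpha> \<Phi>\<^sub>2 (hankel \<alpha> b f) \<le> ennreal (C * c)" using C c by (intro lux_norm_le) auto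
    qed
  qed
qed

end


section \<open>Density of the dilations\<close>


lemma bergman_orliczD:
  assumes "f \<in> bergman_orlicz \<alpha> \<Phi>"
  shows "holomorphic_ball f" "modular \<alpha> \<Phi> f < \<infinity>"
  using assms by (auto simp: bergman_orlicz_def)

lemma bergman_orlicz_add:
  assumes qc: "quasi_concave p \<Phi>" and f: "f \<in> bergman_orlicz \<alpha> \<Phi>" and g: "g \<in> bergman_orlicz \<alpha> \<Phi>"
  shows "(\<lambda>z. f z + g z) \<in> bergman_orlicz \<alpha> \<Phi>"
proof -
  note gf = quasi_concave_growth[OF qc]
  have m: "(\<lambda>z. ennreal (\<Phi> (norm (h z)))) \<in> borel_measurable (nu \<alpha>)" if "h \<in> bergman_orlicz \<alpha> \<Phi>" for h
    using growth_measurable[OF gf hol_ball_measurable[OF bergman_orliczD(1)[OF that]], of 1] by simp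
  have "(\<integral>\<^sup>+z. ennreal (\<Phi> (norm (f z + g z))) \<partial>nu \<alpha>) \<le> (\<integral>\<^sup>+z. ennreal (\<Phi> (norm (f z))) + ennreal (\<Phi> (norm (g z))) \<partial>nu \<alpha>)"
  proof (rule nn_integral_mono)
    fix z
    have "\<Phi> (norm (f z + g z)) \<le> \<Phi> (norm (f z) + norm (g z))" by (intro growth_mono[OF gf] norm_triangle_ineq) simp
    also have "... \<le> \<Phi> (norm (f z)) + \<Phi> (norm (g z))" by (intro quasi_concave_subadditive[OF qc]) auto
    finally show "ennreal (\<Phi> (norm (f z + g z))) \<le> ennreal (\<Phi> (norm (f z))) + ennreal (\<Phi> (norm (g z)))"
      using growth_nonneg[OF gf] by (simp flip: ennreal_plus add: ennreal_leI)
  qed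
  also have "... < \<infinity>" using bergman_orliczD(2)[OF f] bergman_orliczD(2)[OF g] by (simp add: nn_integral_add m f g)
  finally show ?thesis using hol_ball_add bergman_orliczD(1)[OF f] bergman_orliczD(1)[OF g] by (auto simp: bergman_orlicz_def)
qed

lemma bergman_orlicz_cmult:
  assumes qc: "quasi_concave p \<Phi>" and f: "f \<in> bergman_orlicz \<alpha> \<Phi>"
  shows "(\<lambda>z. c * f z) \<in> bergman_orlicz \<alpha> \<Phi>"
proof -
  note gf = quasi_concave_growth[OF qc]
  define K where "K = max 1 (norm c)"
  have K: "K \<ge> 1" "norm c \<le> K" by (auto simp: K_def)
  have le: "\<Phi> (norm (c * f z)) \<le> K * \<Phi> (norm (f z))" for z
  proof (cases "norm (f z) = 0")
    case False
    then have a: "norm (f z) > 0" by simp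
    have "\<Phi> (norm (c * f z)) \<le> \<Phi> (K * norm (f z))" using K by (intro growth_mono[OF gf]) (auto simp: norm_mult mult_right_mono)
    moreover have "1 * norm (f z) \<le> K * norm (f z)" using K by (intro mult_right_mono) auto
    then have "norm (f z) * \<Phi> (K * norm (f z)) \<le> K * norm (f z) * \<Phi> (norm (f z))" using a by (intro quasi_concave_scale[OF qc]) auto
    then have "\<Phi> (K * norm (f z)) \<le> K * \<Phi> (norm (f z))" using a by simp
    ultimately show ?thesis by linarith
  qed (simp add: growth_zero[OF gf])
  have m: "(\<lambda>z. ennreal (\<Phi> (norm (f z)))) \<in> borel_measurable (nu \<alpha>)"
    using growth_measurable[OF gf hol_ball_measurable[OF bergman_orliczD(1)[OF f]], of 1] by simp
  have "(\<integral>\<^sup>+z. ennreal (\<Phi> (norm (c * f z))) \<partial>nu \<alpha>) \<le> (\<integral>\<^sup>+z. ennreal K * ennreal (\<Phi> (norm (f z))) \<partial>nu \<alpha>)"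
    using le K by (intro nn_integral_mono) (simp flip: ennreal_mult' add: ennreal_leI)
  also have "... < \<infinity>" using bergman_orliczD(2)[OF f] by (simp add: nn_integral_cmult m ennreal_mult_less_top)
  finally show ?thesis using hol_ball_cmult bergman_orliczD(1)[OF f] by (auto simp: bergman_orlicz_def)
qed

lemma bergman_orlicz_bounded:
  fixes f :: "complex ^ 'n \<Rightarrow> complex"
  assumes al: "\<alpha> > -1" and gf: "growth_function \<Phi>" and f: "holomorphic_ball f" and M: "\<And>z. z \<in> ball 0 1 \<Longrightarrow> norm (f z) \<le> M"
  shows "f \<in> bergman_orlicz \<alpha> \<Phi>"
proof -
  have "modular \<alpha> \<Phi> f \<le> (\<integral>\<^sup>+(z::complex^'n). ennreal (\<Phi> M) \<partial>nu \<alpha>)"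
    using M by (intro nn_integral_mono ennreal_leI growth_mono[OF gf]) auto
  also have "... < \<infinity>" using emeasure_nu_space[OF al, where 'n = 'n] by (simp add: ennreal_mult_less_top)
  finally show ?thesis using f by (simp add: bergman_orlicz_def)
qed

text \<open>On a smaller ball uniform continuity makes the difference less than \<tau>. Near the
  sphere the modular of the difference is at most the tail of \<Phi>(|f|) plus a dilate of that
  tail, and the dilate is controlled for a suitably chosen ratio.\<close>

theorem dilations_dense:
  fixes f :: "complex ^ 'n \<Rightarrow> complex"
  assumes al: "\<alpha> > -1" and qc: "quasi_concave p \<Phi>" and f: "f \<in> bergman_orlicz \<alpha> \<Phi>" and \<epsilon>: "\<epsilon> > 0"
  shows "\<exists>r. 0 < r \<and> r < 1 \<and> (\<integral>\<^sup>+z. ennreal (\<Phi> (norm (f z - f (r *\<^sub>R z)))) \<partial>nu \<alpha>) \<le> ennreal \<epsilon>"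
proof -
  note gf = quasi_concave_growth[OF qc]
  have hol: "holomorphic_ball f" by (rule bergman_orliczD(1)[OF f])
  have fm[measurable]: "f \<in> borel_measurable (nu \<alpha>)" by (rule hol_ball_measurable[OF hol])
  define u where "u z = ennreal (\<Phi> (norm (f z)))" for z
  have um[measurable]: "u \<in> borel_measurable (nu \<alpha>)" unfolding u_def using growth_measurable[OF gf fm, of 1] by simp
  have u_fin: "(\<integral>\<^sup>+z. u z \<partial>nu \<alpha>) < \<infinity>" unfolding u_def by (rule bergman_orliczD(2)[OF f])
  obtain C where C: "C > 0" "\<And>(u :: complex ^ 'n \<Rightarrow> ennreal) \<eta> \<delta>. u \<in> borel_measurable (nu \<alpha>) \<Longrightarrow> 0 < \<eta> \<Longrightarrow> \<eta> \<le> 1 / 2 \<Longrightarrow> \<delta> > 0 \<Longrightarrow>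
     (\<integral>\<^sup>+z. u z \<partial>nu \<alpha>) < \<infinity> \<Longrightarrow>
     \<exists>t\<in>{1 + \<eta>..1 + 2 * \<eta>}. (\<integral>\<^sup>+z. u ((1 / sqrt t) *\<^sub>R z) \<partial>nu \<alpha>) \<le> ennreal C * (\<integral>\<^sup>+z. u z \<partial>nu \<alpha>) + ennreal \<delta>"
    by (rule exists_dilation_bound[OF al]) (rule that)
  \<comment> \<open>Three summands \<epsilon>' and one summand C \<epsilon>' appear at the
    end.\<close>
  define \<epsilon>' where "\<epsilon>' = \<epsilon> / (3 + C)"
  have \<epsilon>': "\<epsilon>' > 0" using \<epsilon> C(1) by (simp add: \<epsilon>'_def)
  define T where "T j = {z :: complex ^ 'n. norm z > 1 - 1 / real (Suc j)}" for j
  have Tm[measurable]: "indicator (T j) \<in> borel_measurable (nu \<alpha> :: (complex ^ 'n) measure)" for j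
    unfolding T_def by (rule measurable_borel_nu) measurable
  have "(\<lambda>j. \<integral>\<^sup>+z. u z * indicator (T j) z \<partial>nu \<alpha>) \<longlonglongrightarrow> (\<integral>\<^sup>+(z::complex^'n). 0 \<partial>nu \<alpha>)"
  proof (rule nn_integral_dominated_convergence[where w = u])
    show "AE z in nu \<alpha>. (\<lambda>j. u z * indicator (T j) z) \<longlonglongrightarrow> 0"
    proof (rule AE_I2)
      fix z :: "complex ^ 'n" assume "z \<in> space (nu \<alpha>)"
      then have "norm z < 1" by simp
      then obtain J where J: "inverse (real (Suc J)) < 1 - norm z" using reals_Archimedean[of "1 - norm z"] by auto
      have "z \<notin> T j" if "j \<ge> J" for j
      proof -
        have "1 / real (Suc j) \<le> inverse (real (Suc J))" using that by (simp add: field_simps)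
        then show ?thesis using J by (simp add: T_def)
      qed
      then have "\<forall>\<^sub>F j in sequentially. u z * indicator (T j) z = 0"
        unfolding eventually_sequentially by (intro exI[of _ J]) simp
      then show "(\<lambda>j. u z * indicator (T j) z) \<longlonglongrightarrow> 0" by (rule tendsto_eventually)
    qed
    show "AE z in nu \<alpha>. u z * indicator (T j) z \<le> u z" for j by (rule AE_I2) (simp add: indicator_def)
  qed (use u_fin in measurable)
  then have "\<forall>\<^sub>F j in sequentially. (\<integral>\<^sup>+z. u z * indicator (T j) z \<partial>nu \<alpha>) < ennreal \<epsilon>'"
    using \<epsilon>' by (intro order_tendstoD(2)) auto
  then obtain j where j: "(\<integral>\<^sup>+z. u z * indicator (T j) z \<partial>nu \<alpha>) < ennreal \<epsilon>'" by (auto simp: eventually_sequentially)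
  define R where "R = 1 - 1 / real (Suc j)"
  have R: "0 \<le> R" "R < 1" by (auto simp: R_def)
  \<comment> \<open>The gap between R and R1 ensures that for |z| > R1 the point r z still has norm
    above R, so both points lie in the tail set.\<close>
  define R1 where "R1 = (1 + R) / 2"
  have R1: "R < R1" "R1 < 1" "0 < R1" using R by (auto simp: R1_def)
  define \<tau> where "\<tau> = growth_inverse \<Phi> \<epsilon>'"
  have \<tau>: "\<tau> > 0" "\<Phi> \<tau> = \<epsilon>'" using growth_inverse_pos[OF gf \<epsilon>'] growth_inverse_eq[OF gf, of \<epsilon>'] \<epsilon>' by (auto simp: \<tau>_def)
  have "uniformly_continuous_on (cball 0 R1) f"
  proof (rule compact_uniformly_continuous)
    show "continuous_on (cball 0 R1) f" by (rule continuous_on_subset[OF hol_ball_imp_continuous_on[OF hol]]) (use R1 in auto)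
  qed simp
  then obtain \<delta> where \<delta>: "\<delta> > 0" "\<And>x y. x \<in> cball 0 R1 \<Longrightarrow> y \<in> cball 0 R1 \<Longrightarrow> dist x y < \<delta> \<Longrightarrow> dist (f x) (f y) < \<tau>"
    using \<tau>(1) unfolding uniformly_continuous_on_def by metis
  define \<delta>1 where "\<delta>1 = min \<delta> (1 - R / R1)"
  have \<delta>1: "\<delta>1 > 0" using \<delta>(1) R R1 by (simp add: \<delta>1_def)
  define \<eta> where "\<eta> = min (1 / 2) (\<delta>1 / 4)"
  have \<eta>: "0 < \<eta>" "\<eta> \<le> 1 / 2" "2 * \<eta> < \<delta>1" using \<delta>1 by (auto simp: \<eta>_def)
  let ?v = "\<lambda>z. u z * indicator (T j) z"
  have vm: "?v \<in> borel_measurable (nu \<alpha>)" by measurable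
  have v_fin: "(\<integral>\<^sup>+z. ?v z \<partial>nu \<alpha>) < \<infinity>" using j by (rule order.strict_trans) simp
  obtain t where t: "t \<in> {1 + \<eta>..1 + 2 * \<eta>}" "(\<integral>\<^sup>+z. ?v ((1 / sqrt t) *\<^sub>R z) \<partial>nu \<alpha>) \<le> ennreal C * (\<integral>\<^sup>+z. ?v z \<partial>nu \<alpha>) + ennreal \<epsilon>'"
    using C(2)[OF vm \<eta>(1,2) \<epsilon>' v_fin] by blast
  define r where "r = 1 / sqrt t"
  have t1: "t > 1" using t \<eta> by auto
  have r: "0 < r" "r < 1" using t1 by (auto simp: r_def)
  have r1: "1 - r < \<delta>1"
  proof -
    have "1 / t \<le> r" unfolding r_def using t1 by (intro divide_left_mono) (auto intro!: real_le_lsqrt simp: power2_eq_square)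
    moreover have "1 - 1 / t \<le> t - 1"
    proof -
      have "(t - 1) * 1 \<le> (t - 1) * t" using t1 by (intro mult_left_mono) auto
      then show ?thesis using t1 by (simp add: field_simps)
    qed
    ultimately show ?thesis using t(1) \<eta>(3) by auto
  qed
  have vrm: "(\<lambda>z. ?v (r *\<^sub>R z)) \<in> borel_measurable (nu \<alpha>)"
  proof -
    have "(\<lambda>z. f (r *\<^sub>R z)) \<in> borel_measurable (nu \<alpha>)" using r by (intro hol_ball_measurable hol_ball_dilate hol) auto
    then have [measurable]: "(\<lambda>z. u (r *\<^sub>R z)) \<in> borel_measurable (nu \<alpha>)" unfolding u_def using growth_measurable[OF gf, of "\<lambda>z. f (r *\<^sub>R z)" _ 1] by simp
    have [measurable]: "(\<lambda>z. indicator (T j) (r *\<^sub>R z) :: ennreal) \<in> borel_measurable (nu \<alpha>)" unfolding T_def by (rule measurable_borel_nu) measurable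
    show ?thesis by measurable
  qed
  have pt: "ennreal (\<Phi> (norm (f z - f (r *\<^sub>R z)))) \<le> ennreal \<epsilon>' + (?v z + ?v (r *\<^sub>R z))" if z: "z \<in> ball 0 1" for z
  proof (cases "norm z \<le> R1")
    case True
    have "norm (r *\<^sub>R z) \<le> norm z" using r by (simp add: mult_left_le_one_le)
    moreover have "dist z (r *\<^sub>R z) < \<delta>"
    proof -
      have "z - r *\<^sub>R z = (1 - r) *\<^sub>R z" by (simp add: scaleR_diff_left)
      then have "dist z (r *\<^sub>R z) = (1 - r) * norm z" using r by (simp add: dist_norm)
      also have "... \<le> (1 - r) * 1" using r z by (intro mult_left_mono) auto
      finally show ?thesis using r1 by (simp add: \<delta>1_def)
    qed
    ultimately have "norm (f z - f (r *\<^sub>R z)) < \<tau>" using \<delta>(2)[of z "r *\<^sub>R z"] True by (simp add: dist_norm)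
    then have "\<Phi> (norm (f z - f (r *\<^sub>R z))) \<le> \<epsilon>'" using growth_mono[OF gf, of "norm (f z - f (r *\<^sub>R z))" \<tau>] \<tau>(2) by simp
    then show ?thesis by (simp add: add_increasing2 ennreal_leI)
  next
    case False
    have "R < r * R1" using r1 R1 by (simp add: \<delta>1_def field_simps)
    also have "... \<le> r * norm z" using False r by (intro mult_left_mono) auto
    finally have "r *\<^sub>R z \<in> T j" "z \<in> T j" using False R1 r by (auto simp: T_def R_def)
    moreover have "\<Phi> (norm (f z - f (r *\<^sub>R z))) \<le> \<Phi> (norm (f z)) + \<Phi> (norm (f (r *\<^sub>R z)))"
      using growth_mono[OF gf _ norm_triangle_ineq4[of "f z" "f (r *\<^sub>R z)"]] quasi_concave_subadditive[OF qc, of "norm (f z)" "norm (f (r *\<^sub>R z))"] by simp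
    ultimately have "ennreal (\<Phi> (norm (f z - f (r *\<^sub>R z)))) \<le> ?v z + ?v (r *\<^sub>R z)"
      using growth_nonneg[OF gf] by (simp add: u_def flip: ennreal_plus add: ennreal_leI)
    then show ?thesis by (simp add: add_increasing)
  qed
  have "(\<integral>\<^sup>+z. ennreal (\<Phi> (norm (f z - f (r *\<^sub>R z)))) \<partial>nu \<alpha>) \<le> (\<integral>\<^sup>+z. ennreal \<epsilon>' + (?v z + ?v (r *\<^sub>R z)) \<partial>nu \<alpha>)"
    using pt by (intro nn_integral_mono) simp
  also have "... = ennreal \<epsilon>' + ((\<integral>\<^sup>+z. ?v z \<partial>nu \<alpha>) + (\<integral>\<^sup>+z. ?v (r *\<^sub>R z) \<partial>nu \<alpha>))"
    using emeasure_nu_space[OF al, where 'n = 'n] vm vrm by (subst nn_integral_add) (auto simp: nn_integral_add)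
  also have "... \<le> ennreal \<epsilon>' + (ennreal \<epsilon>' + (ennreal C * ennreal \<epsilon>' + ennreal \<epsilon>'))"
    using t(2) j unfolding r_def[symmetric] by (intro add_mono order.refl order.trans[OF t(2)[folded r_def]] mult_left_mono) auto
  also have "... = ennreal (\<epsilon>' + (\<epsilon>' + (C * \<epsilon>' + \<epsilon>')))"
    using \<epsilon>' C(1) by (simp only: ennreal_plus ennreal_mult mult_nonneg_nonneg add_nonneg_nonneg less_imp_le)
  also have "\<epsilon>' + (\<epsilon>' + (C * \<epsilon>' + \<epsilon>')) = \<epsilon>' * (3 + C)" by (simp add: algebra_simps)
  also have "... = \<epsilon>" using C(1) by (simp add: \<epsilon>'_def)
  finally show ?thesis using r by blast
qed


section \<open>The dual space\<close>

context hankel_growth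
begin

text \<open>From |f| <= K \<Psi> s the antitone quotient gives s / \<Psi> s <= K \<Phi>(|f|) / |f|,
  and the left side is \<rho>. Functions of bounded modular are thus bounded in L1 with the weight
  \<rho>.\<close>

lemma norm_mult_rho_le:
  fixes \<alpha> B :: real
  assumes al: "\<alpha> > -1" and B: "B \<ge> 0"
  defines "N \<equiv> real CARD('n::finite) + 1 + \<alpha>"
  obtains K where "K > 0" "\<And>f z. holomorphic_ball f \<Longrightarrow>
     modular \<alpha> \<Phi> (f :: complex ^ 'n \<Rightarrow> complex) \<le> ennreal B \<Longrightarrow> z \<in> ball 0 1 \<Longrightarrow>
     norm (f z) * \<rho> (xd z powr N) \<le> K * \<Phi> (norm (f z))"
proof -
  obtain K0 where K0: "K0 > 0" "\<And>f w. holomorphic_ball f \<Longrightarrow>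
     modular \<alpha> \<Phi> (f :: complex ^ 'n \<Rightarrow> complex) \<le> ennreal B \<Longrightarrow> w \<in> ball 0 1 \<Longrightarrow>
     norm (f w) \<le> K0 * \<Psi> (xd w powr - N)"
    by (rule pointwise_quasi_concave[OF al qcPhi B, where 'n = 'n, folded N_def]) (rule that)
  define K where "K = max 1 K0"
  have K: "K \<ge> 1" "K0 \<le> K" by (auto simp: K_def)
  show ?thesis
  proof (rule that[of K])
    fix f and z :: "complex ^ 'n"
    assume f: "holomorphic_ball f" "modular \<alpha> \<Phi> (f :: complex ^ 'n \<Rightarrow> complex) \<le> ennreal B" and z: "z \<in> ball 0 1"
    show "norm (f z) * \<rho> (xd z powr N) \<le> K * \<Phi> (norm (f z))"
    proof (cases "norm (f z) = 0")
      case False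
      define a where "a = norm (f z)"
      have a: "a > 0" using False by (simp add: a_def)
      define s where "s = xd z powr - N"
      have x: "xd z > 0" by (rule xd_posI[OF z])
      have s: "s > 0" using x by (simp add: s_def)
      have \<Psi>: "\<Psi> s > 0" by (rule growth_inverse_pos[OF gfPhi s])
      have "a \<le> K0 * \<Psi> s" using K0(2)[OF f z] by (simp add: a_def s_def)
      also have "... \<le> K * \<Psi> s" using K \<Psi> by (intro mult_right_mono) auto
      finally have le: "a \<le> K * \<Psi> s" .
      have "a * s = a * \<Phi> (\<Psi> s)" using growth_inverse_eq[OF gfPhi, of s] s by simp
      also have "... \<le> a * \<Phi> (K * \<Psi> s)"
      proof (intro mult_left_mono growth_mono[OF gfPhi])
        show "\<Psi> s \<le> K * \<Psi> s" using mult_right_mono[OF K(1), of "\<Psi> s"] \<Psi> by simp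
      qed (use a \<Psi> in auto)
      also have "... \<le> (K * \<Psi> s) * \<Phi> a" by (rule quasi_concave_scale[OF qcPhi a le])
      finally have "a * s / \<Psi> s \<le> K * \<Phi> a" using \<Psi> by (simp add: field_simps)
      then show ?thesis unfolding rho_xd(2)[OF x] by (simp add: a_def s_def)
    qed (simp add: growth_zero[OF gfPhi])
  qed (use K in simp)
qed

lemma one_in_bergman_orlicz: "\<alpha> > -1 \<Longrightarrow> (\<lambda>z. 1) \<in> (bergman_orlicz \<alpha> \<Phi> :: (complex ^ 'n \<Rightarrow> complex) set)"
  by (rule bergman_orlicz_bounded[OF _ gfPhi, where M = 1]) auto

text \<open>The product of f with the conjugate of g need not be integrable, whereas with D in place
  of g it is integrable for \<open>nu \<beta>\<close>, whose weight compensates xd^(-k). So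
  \<Lambda> is defined by D. Parts and the dilation adjoint move the ratio r from f onto D, and D at
  r z is dominated by a multiple of h z; dominated convergence gives the limit.\<close>

theorem Gamma_functional:
  fixes g :: "complex ^ 'n \<Rightarrow> complex"
  assumes al: "\<alpha> > -1" and g: "g \<in> Gamma_space \<alpha> \<rho>"
  shows "\<exists>\<Lambda>. bounded_functional \<alpha> \<Phi> \<Lambda> \<and> represents \<alpha> \<Phi> g \<Lambda>"
proof -
  let ?A = "bergman_orlicz \<alpha> \<Phi> :: (complex ^ 'n \<Rightarrow> complex) set"
  define N where "N = real CARD('n) + 1 + \<alpha>"
  have N: "N > 0" unfolding N_def by (rule dim_exponent_pos[OF al])
  obtain k :: nat and C c \<epsilon> where hol: "holomorphic_ball g" and int: "integrable (nu \<alpha>) g" and \<epsilon>: "0 < \<epsilon>" "\<epsilon> < 1 + \<alpha>"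
    and fin: "(\<integral>\<^sup>+w. ennreal (norm (g w)) * ennreal (xd w powr - \<epsilon>) \<partial>nu \<alpha>) < \<infinity>"
    and C: "C > 0" "\<And>w. w \<in> ball 0 1 \<Longrightarrow> norm (bk_transform \<alpha> (N + real k) g w) \<le> C * (xd w powr - real k * \<rho> (xd w powr N))"
    and c: "c > 0" "\<And>x y. 0 < x \<Longrightarrow> x \<le> y \<Longrightarrow> y \<le> 1 \<Longrightarrow> y powr - real k * \<rho> (y powr N) \<le> c * (x powr - real k * \<rho> (x powr N))"
    by (rule Gamma_spaceD[OF al g, folded N_def]) blast
  define \<beta> where "\<beta> = \<alpha> + real k"
  have \<beta>: "\<beta> > -1" using al by (simp add: \<beta>_def)
  define \<kappa> where "\<kappa> = nu_const TYPE('n) \<beta> / nu_const TYPE('n) \<alpha>"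
  have \<kappa>: "\<kappa> > 0" unfolding \<kappa>_def by (intro divide_pos_pos nu_const_eq al \<beta>)
  define D where "D = bk_transform \<alpha> (N + real k) g"
  have hD: "holomorphic_ball D" unfolding D_def using N by (intro hol_ball_bk_transform[OF al int]) simp
  define h where "h z = xd z powr - real k * \<rho> (xd z powr N)" for z :: "complex ^ 'n"
  have D: "norm (D z) \<le> C * h z" if "z \<in> ball 0 1" for z using C(2)[OF that] by (simp add: D_def h_def)
  have h_mono: "h y \<le> c * h z" if "z \<in> ball 0 1" "xd z \<le> xd y" for y z :: "complex ^ 'n"
    unfolding h_def using c(2)[OF xd_posI[OF that(1)] that(2) xd_le_1] .
  define \<Lambda> where "\<Lambda> f = (\<integral>z. f z * cnj (D z) \<partial>nu \<beta>)" for f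
  have m\<beta>: "f \<in> borel_measurable (nu \<beta>)" if "f \<in> ?A" for f
    by (rule hol_ball_measurable[OF bergman_orliczD(1)[OF that]])
  have Dm[measurable]: "D \<in> borel_measurable (nu \<beta>)" by (rule hol_ball_measurable[OF hD])
  \<comment> \<open>The density xd^k of \<open>nu \<beta>\<close> relative to
    \<open>nu \<alpha>\<close> cancels xd^(-k) and leaves the modular.\<close>
  have weight: "(\<integral>\<^sup>+z. ennreal (K * \<Phi> (norm (f z)) * xd z powr - real k) \<partial>nu \<beta>) = ennreal (\<kappa> * K) * modular \<alpha> \<Phi> f"
    if f: "holomorphic_ball f" and K: "K \<ge> 0" for f :: "complex ^ 'n \<Rightarrow> complex" and K
  proof -
    have fm: "(\<lambda>z. \<Phi> (norm (f z))) \<in> borel_measurable (nu \<alpha>)"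
      using growth_measurable[OF gfPhi hol_ball_measurable[OF f], of 1] by simp
    note [measurable] = fm measurable_xd_powr_nu
    have "(\<integral>\<^sup>+z. ennreal (K * \<Phi> (norm (f z)) * xd z powr - real k) \<partial>nu \<beta>)
      = (\<integral>\<^sup>+z. ennreal (\<kappa> * xd z powr (\<beta> - \<alpha>)) * ennreal (K * \<Phi> (norm (f z)) * xd z powr - real k) \<partial>nu \<alpha>)"
      unfolding \<kappa>_def by (rule nn_integral_nu_shift[OF al \<beta>]) measurable
    also have "... = (\<integral>\<^sup>+z. ennreal (\<kappa> * K) * ennreal (\<Phi> (norm (f z))) \<partial>nu \<alpha>)"
    proof (rule nn_integral_cong)
      fix z :: "complex ^ 'n" assume "z \<in> space (nu \<alpha>)"
      then have x: "xd z > 0" using xd_posI[of z] by simp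
      have 1: "xd z powr (\<beta> - \<alpha>) * xd z powr - real k = 1" using x by (simp add: \<beta>_def flip: powr_add)
      have "(\<kappa> * xd z powr (\<beta> - \<alpha>)) * (K * \<Phi> (norm (f z)) * xd z powr - real k)
        = \<kappa> * K * \<Phi> (norm (f z)) * (xd z powr (\<beta> - \<alpha>) * xd z powr - real k)" by (simp only: mult_ac)
      then have "(\<kappa> * xd z powr (\<beta> - \<alpha>)) * (K * \<Phi> (norm (f z)) * xd z powr - real k) = \<kappa> * K * \<Phi> (norm (f z))" unfolding 1 by simp
      then show "ennreal (\<kappa> * xd z powr (\<beta> - \<alpha>)) * ennreal (K * \<Phi> (norm (f z)) * xd z powr - real k) = ennreal (\<kappa> * K) * ennreal (\<Phi> (norm (f z)))"
        using \<kappa> K growth_nonneg[OF gfPhi] by (simp flip: ennreal_mult')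
    qed
    also have "... = ennreal (\<kappa> * K) * modular \<alpha> \<Phi> f" by (rule nn_integral_cmult) measurable
    finally show ?thesis .
  qed
  have dom: "\<exists>w. integrable (nu \<beta>) w \<and> (\<forall>z\<in>ball 0 1. norm (f z) * h z \<le> w z)" if f: "f \<in> ?A" for f
  proof -
    obtain b where b: "b \<ge> 0" "modular \<alpha> \<Phi> f = ennreal b"
      using bergman_orliczD(2)[OF f] by (cases "\<integral>\<^sup>+z. ennreal (\<Phi> (norm (f z))) \<partial>nu \<alpha>") auto
    obtain K where K: "K > 0" "\<And>f z. holomorphic_ball f \<Longrightarrow>
       modular \<alpha> \<Phi> (f :: complex ^ 'n \<Rightarrow> complex) \<le> ennreal b \<Longrightarrow> z \<in> ball 0 1 \<Longrightarrow>
       norm (f z) * \<rho> (xd z powr N) \<le> K * \<Phi> (norm (f z))"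
      by (rule norm_mult_rho_le[OF al b(1), where 'n = 'n, folded N_def]) (rule that)
    let ?w = "\<lambda>z. K * \<Phi> (norm (f z)) * xd z powr - real k"
    have "integrable (nu \<beta>) ?w"
    proof (rule integrableI_nonneg)
      have "(\<lambda>z. \<Phi> (norm (f z))) \<in> borel_measurable (nu \<beta>)"
        using growth_measurable[OF gfPhi m\<beta>[OF f], of 1] by simp
      note [measurable] = this measurable_xd_powr_nu
      show "?w \<in> borel_measurable (nu \<beta>)" by measurable
      show "AE z in nu \<beta>. 0 \<le> ?w z" using K(1) growth_nonneg[OF gfPhi] by (intro AE_I2) simp
      show "(\<integral>\<^sup>+z. ennreal (?w z) \<partial>nu \<beta>) < \<infinity>"
        using weight[OF bergman_orliczD(1)[OF f], of K] K(1) b by (simp add: ennreal_mult_less_top)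
    qed
    moreover have "norm (f z) * h z \<le> ?w z" if z: "z \<in> ball 0 1" for z
      using mult_right_mono[OF K(2)[OF bergman_orliczD(1)[OF f] _ z], of "xd z powr - real k"] b by (simp add: h_def mult_ac)
    ultimately show ?thesis by blast
  qed
  have fD: "integrable (nu \<beta>) (\<lambda>z. f z * cnj (D z))" if f: "f \<in> ?A" for f
  proof -
    obtain w where w: "integrable (nu \<beta>) w" "\<forall>z\<in>ball 0 1. norm (f z) * h z \<le> w z" using dom[OF f] by blast
    show ?thesis
    proof (rule Bochner_Integration.integrable_bound[OF integrable_mult_right[OF w(1), of C]])
      note [measurable] = m\<beta>[OF f]
      show "(\<lambda>z. f z * cnj (D z)) \<in> borel_measurable (nu \<beta>)" by measurable
      show "AE z in nu \<beta>. norm (f z * cnj (D z)) \<le> norm (C * w z)"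
      proof (rule AE_I2)
        fix z :: "complex ^ 'n" assume "z \<in> space (nu \<beta>)"
        then have z: "z \<in> ball 0 1" by simp
        have "norm (f z * cnj (D z)) \<le> norm (f z) * (C * h z)" unfolding norm_mult complex_mod_cnj by (intro mult_left_mono D z) simp
        also have "... \<le> C * w z" using w(2) z C(1) by (simp add: mult.left_commute)
        finally show "norm (f z * cnj (D z)) \<le> norm (C * w z)" by simp
      qed
    qed
  qed
  \<comment> \<open>The constant 1 belongs to the space, so this is a case of
    \<open>fD\<close>.\<close>
  have Dint: "integrable (nu \<beta>) D"
  proof -
    have "integrable (nu \<beta>) (\<lambda>z. cnj (1 * cnj (D z)))" by (rule integrable_cnj[OF fD[OF one_in_bergman_orlicz[OF al]]])
    then show ?thesis by simp
  qed
  have fint: "integrable (nu \<beta>) f" if f: "f \<in> ?A" for f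
  proof -
    obtain w where w: "integrable (nu \<beta>) w" "\<forall>z\<in>ball 0 1. norm (f z) * h z \<le> w z" using dom[OF f] by blast
    have h0: "h 0 > 0" by (simp add: h_def xd_def rho_pos)
    show ?thesis
    proof (rule Bochner_Integration.integrable_bound[OF integrable_mult_right[OF w(1), of "c / h 0"] m\<beta>[OF f]], rule AE_I2)
      fix z :: "complex ^ 'n" assume "z \<in> space (nu \<beta>)"
      then have z: "z \<in> ball 0 1" by simp
      have "h 0 \<le> c * h z" using xd_le_1[of z] by (intro h_mono z) (simp add: xd_def)
      then have "norm (f z) * h 0 \<le> norm (f z) * (c * h z)" by (rule mult_left_mono) simp
      also have "... \<le> c * w z" using w(2) z c(1) by (simp add: mult.left_commute)
      finally have "norm (f z) \<le> c / h 0 * w z" using h0 by (simp add: field_simps)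
      then show "norm (f z) \<le> norm (c / h 0 * w z)" unfolding real_norm_def by (rule order.trans[OF _ abs_ge_self])
    qed
  qed
  have "bounded_functional \<alpha> \<Phi> \<Lambda>" unfolding bounded_functional_def
  proof (intro conjI ballI allI)
    fix f f' :: "complex ^ 'n \<Rightarrow> complex" assume "f \<in> ?A" "f' \<in> ?A"
    then show "\<Lambda> (\<lambda>z. f z + f' z) = \<Lambda> f + \<Lambda> f'"
      unfolding \<Lambda>_def distrib_right by (intro Bochner_Integration.integral_add fD)
  next
    fix f :: "complex ^ 'n \<Rightarrow> complex" and a
    show "\<Lambda> (\<lambda>z. a * f z) = a * \<Lambda> f" unfolding \<Lambda>_def by (simp only: mult.assoc integral_mult_right_zero)
  next
    obtain K where K: "K > 0" "\<And>f z. holomorphic_ball f \<Longrightarrow>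
       modular \<alpha> \<Phi> (f :: complex ^ 'n \<Rightarrow> complex) \<le> ennreal 1 \<Longrightarrow> z \<in> ball 0 1 \<Longrightarrow>
       norm (f z) * \<rho> (xd z powr N) \<le> K * \<Phi> (norm (f z))"
      by (rule norm_mult_rho_le[OF al zero_le_one, where 'n = 'n, folded N_def]) (rule that)
    let ?C = "C * (\<kappa> * K)"
    have C': "?C > 0" using C(1) \<kappa> K(1) by simp
    show "\<exists>C>0. \<forall>f\<in>?A. ennreal (norm (\<Lambda> f)) \<le> ennreal C * lux_norm \<alpha> \<Phi> f"
    proof (intro exI[of _ ?C] conjI C' ballI le_mult_lux_norm[OF C'])
      fix f :: "complex ^ 'n \<Rightarrow> complex" and l :: real
      assume f: "f \<in> ?A" and l: "l > 0" and adm: "(\<integral>\<^sup>+z. ennreal (\<Phi> (norm (f z) / l)) \<partial>nu \<alpha>) \<le> 1"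
      define F where "F z = of_real (1 / l) * f z" for z
      have hF: "holomorphic_ball F" unfolding F_def by (rule hol_ball_cmult[OF bergman_orliczD(1)[OF f]])
      have nF: "norm (F z) = norm (f z) / l" for z using l by (simp add: F_def norm_mult norm_divide)
      have admF: "modular \<alpha> \<Phi> F \<le> 1" using adm by (simp add: nF)
      have "ennreal (norm (\<Lambda> f)) \<le> (\<integral>\<^sup>+z. ennreal (norm (f z * cnj (D z))) \<partial>nu \<beta>)"
        unfolding \<Lambda>_def by (rule norm_integral_le_nn_integral)
      also have "... \<le> (\<integral>\<^sup>+z. ennreal (l * C * K * \<Phi> (norm (F z)) * xd z powr - real k) \<partial>nu \<beta>)"
      proof (intro nn_integral_mono ennreal_leI)
        fix z :: "complex ^ 'n" assume "z \<in> space (nu \<beta>)"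
        then have z: "z \<in> ball 0 1" by simp
        have "norm (f z * cnj (D z)) \<le> norm (f z) * (C * h z)" unfolding norm_mult complex_mod_cnj by (intro mult_left_mono D z) simp
        also have "... = (l * C * xd z powr - real k) * (norm (F z) * \<rho> (xd z powr N))" using l by (simp add: nF h_def)
        also have "... \<le> (l * C * xd z powr - real k) * (K * \<Phi> (norm (F z)))"
          using K(2)[OF hF _ z] admF l C(1) by (intro mult_left_mono) auto
        finally show "norm (f z * cnj (D z)) \<le> l * C * K * \<Phi> (norm (F z)) * xd z powr - real k" by (simp add: mult_ac)
      qed
      also have "... = ennreal (\<kappa> * (l * C * K)) * modular \<alpha> \<Phi> F" using l C(1) K(1) by (intro weight[OF hF]) simp
      also have "... \<le> ennreal (\<kappa> * (l * C * K)) * 1" by (intro mult_left_mono admF) simp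
      also have "... = ennreal (?C * l)" by (simp add: mult_ac)
      finally show "ennreal (norm (\<Lambda> f)) \<le> ennreal (?C * l)" .
    qed
  qed
  moreover have "represents \<alpha> \<Phi> g \<Lambda>" unfolding represents_def
  proof
    fix f assume f: "f \<in> ?A"
    have hf: "holomorphic_ball f" by (rule bergman_orliczD(1)[OF f])
    obtain w where w: "integrable (nu \<beta>) w" "\<forall>z\<in>ball 0 1. norm (f z) * h z \<le> w z" using dom[OF f] by blast
    have eq: "(\<integral>z. f (r *\<^sub>R z) * cnj (g z) \<partial>nu \<alpha>) = (\<integral>z. f z * cnj (D (r *\<^sub>R z)) \<partial>nu \<beta>)" if r: "0 < r" "r < 1" for r
    proof -
      obtain M where M: "\<And>z. z \<in> ball 0 1 \<Longrightarrow> norm (f (r *\<^sub>R z)) \<le> M"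
        by (rule bounded_hol_dilate[OF hf, of r]) (use r in auto)
      have hfr: "holomorphic_ball (\<lambda>z. f (r *\<^sub>R z))" using r by (intro hol_ball_dilate hf) auto
      have "(\<integral>z. f (r *\<^sub>R z) * cnj (g z) \<partial>nu \<alpha>) = cnj (\<integral>z. g z * cnj (f (r *\<^sub>R z)) \<partial>nu \<alpha>)"
        unfolding Bochner_Integration.integral_cnj[symmetric] by (simp add: mult.commute)
      also have "... = cnj (\<integral>z. D z * cnj (f (r *\<^sub>R z)) \<partial>nu \<beta>)" unfolding D_def N_def \<beta>_def
        by (subst bergman_parts[OF al \<epsilon> hol_ball_measurable[OF hol] fin hfr M]) auto
      also have "... = (\<integral>z. f (r *\<^sub>R z) * cnj (D z) \<partial>nu \<beta>)"
        unfolding Bochner_Integration.integral_cnj[symmetric] by (simp add: mult.commute)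
      also have "... = (\<integral>z. f z * cnj (D (r *\<^sub>R z)) \<partial>nu \<beta>)"
        using r by (intro dilation_adjoint[OF \<beta> fint[OF f] hf Dint hD]) auto
      finally show ?thesis .
    qed
    show "((\<lambda>r. \<integral>z. f (r *\<^sub>R z) * cnj (g z) \<partial>nu \<alpha>) \<longlongrightarrow> \<Lambda> f) (at_left 1)"
    proof (rule tendsto_at_left_sequentially[of 0])
      fix S :: "nat \<Rightarrow> real" assume S: "\<And>n. S n < 1" "\<And>n. 0 < S n" "S \<longlonglongrightarrow> 1"
      have "(\<lambda>n. \<integral>z. f z * cnj (D (S n *\<^sub>R z)) \<partial>nu \<beta>) \<longlonglongrightarrow> (\<integral>z. f z * cnj (D z) \<partial>nu \<beta>)"
      proof (rule integral_dominated_convergence[where w = "\<lambda>z. C * c * w z"])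
        note [measurable] = m\<beta>[OF f]
        show "(\<lambda>z. f z * cnj (D z)) \<in> borel_measurable (nu \<beta>)" by measurable
        show "(\<lambda>z. f z * cnj (D (S n *\<^sub>R z))) \<in> borel_measurable (nu \<beta>)" for n
        proof -
          have "(\<lambda>z. D (S n *\<^sub>R z)) \<in> borel_measurable (nu \<beta>)"
            using S(1,2)[of n] by (intro hol_ball_measurable hol_ball_dilate hD) auto
          note [measurable] = this
          show ?thesis by measurable
        qed
        show "integrable (nu \<beta>) (\<lambda>z. C * c * w z)" by (intro integrable_mult_right w)
        show "AE z in nu \<beta>. (\<lambda>n. f z * cnj (D (S n *\<^sub>R z))) \<longlonglongrightarrow> f z * cnj (D z)"
        proof (rule AE_I2)
          fix z :: "complex ^ 'n" assume "z \<in> space (nu \<beta>)"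
          then have z: "z \<in> ball 0 1" by simp
          have "(\<lambda>n. S n *\<^sub>R z) \<longlonglongrightarrow> 1 *\<^sub>R z" by (intro tendsto_intros S)
          moreover have "isCont D (1 *\<^sub>R z)" using hol_ball_imp_continuous_on[OF hD] z by (simp add: continuous_on_eq_continuous_at)
          ultimately have "(\<lambda>n. D (S n *\<^sub>R z)) \<longlonglongrightarrow> D (1 *\<^sub>R z)" by (rule isCont_tendsto_compose[rotated])
          then show "(\<lambda>n. f z * cnj (D (S n *\<^sub>R z))) \<longlonglongrightarrow> f z * cnj (D z)" by (auto intro!: tendsto_intros)
        qed
        show "AE z in nu \<beta>. norm (f z * cnj (D (S n *\<^sub>R z))) \<le> C * c * w z" for n
        proof (rule AE_I2)
          fix z :: "complex ^ 'n" assume "z \<in> space (nu \<beta>)"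
          then have z: "z \<in> ball 0 1" by simp
          have Sz: "S n *\<^sub>R z \<in> ball 0 1" using S(1,2)[of n] by (intro dilate_in_ball z) auto
          have "norm (S n *\<^sub>R z) \<le> norm z" using S(1,2)[of n] by (simp add: mult_left_le_one_le)
          then have x: "xd z \<le> xd (S n *\<^sub>R z)" unfolding xd_def by (simp add: power_mono del: norm_scaleR)
          have "norm (f z * cnj (D (S n *\<^sub>R z))) \<le> norm (f z) * (C * (c * h z))" unfolding norm_mult complex_mod_cnj
            by (intro mult_left_mono order.trans[OF D[OF Sz]] h_mono z x) (use C(1) in auto)
          also have "... = C * c * (norm (f z) * h z)" by (simp only: mult_ac)
          also have "... \<le> C * c * w z" using w(2) z C(1) c(1) by (intro mult_left_mono) auto
          finally show "norm (f z * cnj (D (S n *\<^sub>R z))) \<le> C * c * w z" .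
        qed
      qed
      then show "(\<lambda>n. \<integral>z. f (S n *\<^sub>R z) * cnj (g z) \<partial>nu \<alpha>) \<longlonglongrightarrow> \<Lambda> f" using eq S(1,2) by (simp add: \<Lambda>_def)
    qed simp
  qed
  ultimately show ?thesis by blast
qed

end


section \<open>Functionals are determined by their values on kernels\<close>

lemma bk_dilate: "bk s (r *\<^sub>R z) w = bk s z (r *\<^sub>R w)"
  by (simp add: bk_def cinner_scaleR_left cinner_scaleR_right)

text \<open>For r < 1 the base 1 - cinner z (r w) has real part at least 1 - r, so the kernel is
  continuous on a compact product of closed balls.\<close>

lemma bk_dilate_uniformly_continuous:
  fixes s r \<epsilon> :: real
  assumes r: "0 \<le> r" "r < 1" and \<epsilon>: "\<epsilon> > 0"
  obtains \<delta> where "\<delta> > 0" "\<And>z \<xi> \<zeta> :: complex ^ 'n. z \<in> cball 0 1 \<Longrightarrow> \<xi> \<in> cball 0 1 \<Longrightarrow> \<zeta> \<in> cball 0 1 \<Longrightarrow> dist \<xi> \<zeta> < \<delta> \<Longrightarrow>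
    norm (bk s z (r *\<^sub>R \<xi>) - bk s z (r *\<^sub>R \<zeta>)) < \<epsilon>"
proof -
  let ?S = "cball 0 1 \<times> cball 0 1 :: ((complex ^ 'n) \<times> (complex ^ 'n)) set"
  have re: "Re (1 - cinner z (r *\<^sub>R w)) > 0" if "z \<in> cball 0 1" "w \<in> cball 0 1" for z w :: "complex ^ 'n"
  proof -
    have "norm z * (r * norm w) \<le> 1 * (r * 1)" using that r by (intro mult_mono mult_left_mono) auto
    then have "norm (cinner z (r *\<^sub>R w)) \<le> r" using norm_cinner_le[of z "r *\<^sub>R w"] r by simp
    then show ?thesis using complex_Re_le_cmod[of "cinner z (r *\<^sub>R w)"] r by simp
  qed
  have "continuous_on ?S (\<lambda>(z, w). bk s z (r *\<^sub>R w))" unfolding bk_def split_beta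
  proof (rule continuous_on_powr_complex)
    show "?S \<subseteq> {p. Re (1 - cinner (fst p) (r *\<^sub>R snd p)) \<ge> 0 \<or> Im (1 - cinner (fst p) (r *\<^sub>R snd p)) \<noteq> 0}"
      using re by (auto simp: less_imp_le)
    show "continuous_on ?S (\<lambda>p. 1 - cinner (fst p) (r *\<^sub>R snd p))" unfolding cinner_def by (intro continuous_intros)
    show "0 < Re (complex_of_real (- s))" if "p \<in> ?S" "1 - cinner (fst p) (r *\<^sub>R snd p) = 0" for p
      using re[of "fst p" "snd p"] that by auto
  qed simp
  then have "uniformly_continuous_on ?S (\<lambda>(z, w). bk s z (r *\<^sub>R w))"
    by (intro compact_uniformly_continuous compact_Times compact_cball)
  then obtain \<delta> where \<delta>: "\<delta> > 0" "\<And>p p'. p \<in> ?S \<Longrightarrow> p' \<in> ?S \<Longrightarrow> dist p' p < \<delta> \<Longrightarrow>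
      dist ((\<lambda>(z, w). bk s z (r *\<^sub>R w)) p') ((\<lambda>(z, w). bk s z (r *\<^sub>R w)) p) < \<epsilon>"
    using \<epsilon> unfolding uniformly_continuous_on_def by metis
  show ?thesis
  proof (rule that[OF \<delta>(1)])
    fix z \<xi> \<zeta> :: "complex ^ 'n" assume z: "z \<in> cball 0 1" "\<xi> \<in> cball 0 1" "\<zeta> \<in> cball 0 1" "dist \<xi> \<zeta> < \<delta>"
    show "norm (bk s z (r *\<^sub>R \<xi>) - bk s z (r *\<^sub>R \<zeta>)) < \<epsilon>"
      using \<delta>(2)[of "(z, \<zeta>)" "(z, \<xi>)"] z by (simp add: dist_norm norm_Pair)
  qed
qed

context bounded_hol_functional
begin

lemma bound_nonneg: "B \<ge> 0"
proof -
  have "norm (L (\<lambda>z. 0)) \<le> B * 1" by (rule bound) auto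
  then show ?thesis using norm_ge_zero[of "L (\<lambda>z. 0)"] by linarith
qed

lemma L_cong:
  assumes f: "holomorphic_ball f" "bounded (f ` ball 0 1)" and g: "holomorphic_ball g" "bounded (g ` ball 0 1)"
    and eq: "\<And>z. z \<in> ball 0 1 \<Longrightarrow> f z = g z"
  shows "L f = L g"
proof -
  have g': "holomorphic_ball (\<lambda>z. (-1) * g z)" "bounded ((\<lambda>z. (-1) * g z) ` ball 0 1)"
    using hol_ball_cmult[OF g(1), of "-1"] g(2) by (auto simp: bounded_iff)
  have "norm (L (\<lambda>z. f z + (-1) * g z)) \<le> B * 0" using eq by (intro bound hol_ball_add f g') simp
  then have "L (\<lambda>z. f z + (-1) * g z) = 0" by simp
  then show ?thesis using add[OF f g'] cmult[OF g, of "-1"] by simp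
qed

text \<open>A dilation \<open>f(r\<cdot>)\<close> is the integral of kernels \<open>bk N (\<cdot>) (r \<xi>)\<close>, which depend uniformly
  continuously on \<open>\<xi>\<close>, so it is approximated by finite combinations of kernels.\<close>

lemma vanishes_on_dilations:
  assumes al: "\<alpha> > -1" and f: "holomorphic_ball f" "integrable (nu \<alpha>) f" and r: "0 \<le> r" "r < 1"
    and zero: "\<And>w. w \<in> ball 0 1 \<Longrightarrow> L (\<lambda>z. bk (real CARD('n) + 1 + \<alpha>) z w) = 0"
  shows "L (\<lambda>z. f (r *\<^sub>R z)) = 0"
proof -
  let ?J = "\<integral>\<xi>. norm (f \<xi>) \<partial>nu \<alpha>"
  define N where "N = real CARD('n) + 1 + \<alpha>"
  have N: "N > 0" unfolding N_def by (rule dim_exponent_pos[OF al])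
  define fA where "fA A \<xi> = indicator A \<xi> * f \<xi>" for A and \<xi> :: "complex ^ 'n"
  \<comment> \<open>The part of the dilate contributed by \<xi> in A. For A the whole space it is
    the dilate of f, by the reproducing formula.\<close>
  define H where "H A z = bk_transform \<alpha> N (fA A) (r *\<^sub>R z)" for A and z :: "complex ^ 'n"
  have fA: "integrable (nu \<alpha>) (fA A)" if "A \<in> sets borel" for A
  proof -
    have "(\<lambda>\<xi>::complex^'n. indicator A \<xi> :: complex) \<in> borel_measurable (nu \<alpha>)"
      by (rule measurable_borel_nu[OF borel_measurable_indicator[OF that]])
    then have "integrable (nu \<alpha>) (\<lambda>\<xi>. f \<xi> * indicator A \<xi>)"
      by (intro integrable_mult_bounded[OF f(2), where B = 1]) (auto simp: indicator_def)
    then show ?thesis by (simp add: fA_def[abs_def] mult.commute)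
  qed
  have mr: "(\<lambda>\<xi>. bk N (r *\<^sub>R z) \<xi>) \<in> borel_measurable (nu \<alpha>)" if "z \<in> ball 0 1" for z :: "complex ^ 'n"
    using r dilate_in_ball[OF that, of r] by (intro measurable_bk) auto
  have br: "norm (bk N (r *\<^sub>R z) \<xi>) \<le> (1 - r) powr - N" if z: "z \<in> ball 0 1" and \<xi>: "\<xi> \<in> ball 0 1" for z \<xi> :: "complex ^ 'n"
  proof -
    have "norm (bk N (r *\<^sub>R z) \<xi>) \<le> (1 - norm (r *\<^sub>R z)) powr - N"
      using r dilate_in_ball[OF z, of r] N \<xi> by (intro norm_bk_le) auto
    also have "... \<le> (1 - r) powr - N" using r z N by (intro powr_mono2') (auto simp: mult_left_le)
    finally show ?thesis .
  qed
  have intH: "integrable (nu \<alpha>) (\<lambda>\<xi>. fA A \<xi> * bk N (r *\<^sub>R z) \<xi>)" if "A \<in> sets borel" "z \<in> ball 0 1" for A z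
    using br[OF that(2)] by (intro integrable_mult_bounded[OF fA[OF that(1)] mr[OF that(2)], where B = "(1 - r) powr - N"]) auto
  have hH: "holomorphic_ball (H A)" if "A \<in> sets borel" for A
    unfolding H_def using r N by (intro hol_ball_dilate[of "bk_transform \<alpha> N (fA A)"] hol_ball_bk_transform[OF al fA[OF that]]) auto
  have bH: "bounded (H A ` ball 0 1)" if A: "A \<in> sets borel" for A
  proof -
    obtain M where "\<And>z. z \<in> ball 0 1 \<Longrightarrow> norm (H A z) \<le> M"
      unfolding H_def using r N by (rule_tac bounded_hol_dilate[OF hol_ball_bk_transform[OF al fA[OF A], of N], of r]) auto
    then show ?thesis unfolding bounded_iff by blast
  qed
  have small: "norm (L (\<lambda>z. f (r *\<^sub>R z))) \<le> B * (\<epsilon> * ?J)" if \<epsilon>: "\<epsilon> > 0" for \<epsilon>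
  proof -
    obtain \<delta> where \<delta>: "\<delta> > 0" "\<And>z \<xi> \<zeta> :: complex ^ 'n. z \<in> cball 0 1 \<Longrightarrow> \<xi> \<in> cball 0 1 \<Longrightarrow> \<zeta> \<in> cball 0 1 \<Longrightarrow> dist \<xi> \<zeta> < \<delta> \<Longrightarrow>
        norm (bk N z (r *\<^sub>R \<xi>) - bk N z (r *\<^sub>R \<zeta>)) < \<epsilon>"
      by (rule bk_dilate_uniformly_continuous[OF r \<epsilon>, where 'n = 'n]) (rule that)
    \<comment> \<open>On a ball of radius \<delta> all kernels are within \<epsilon> of the one
      centred at x, on which L vanishes. Subtracting that kernel times the integral of
      \<open>fA A\<close> leaves a function of sup norm at most \<epsilon> times the mass of f on
      A.\<close>
    have local: "norm (L (H A)) \<le> B * (\<epsilon> * (\<integral>\<xi>. norm (fA A \<xi>) \<partial>nu \<alpha>))" if A: "A \<in> sets borel" "A \<subseteq> ball x \<delta>" and x: "x \<in> cball 0 1" for A and x :: "complex ^ 'n"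
    proof -
      define a where "a = (\<integral>\<xi>. fA A \<xi> \<partial>nu \<alpha>)"
      let ?k = "\<lambda>z. bk N z (r *\<^sub>R x)"
      have rx: "r *\<^sub>R x \<in> ball 0 1"
      proof -
        have "r * norm x \<le> r * 1" using x r by (intro mult_left_mono) auto
        then show ?thesis using r by simp
      qed
      have k: "holomorphic_ball ?k" "bounded (?k ` ball 0 1)" using hol_bk[OF rx] bounded_bk[OF rx] N by auto
      have ak: "holomorphic_ball (\<lambda>z. (- a) * ?k z)" "bounded ((\<lambda>z. (- a) * ?k z) ` ball 0 1)"
        by (rule hol_ball_cmult[OF k(1)]) (rule bounded_mult_images[OF _ k(2)], simp add: image_constant_conv)
      have "L (\<lambda>z. H A z + (- a) * ?k z) = L (H A) + (- a) * L ?k"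
        using add[OF hH[OF A(1)] bH[OF A(1)] ak] cmult[OF k, of "- a"] by simp
      also have "... = L (H A)" using zero[OF rx] by (simp add: N_def)
      finally have "L (H A) = L (\<lambda>z. H A z + (- a) * ?k z)" by simp
      also have "norm ... \<le> B * (\<epsilon> * (\<integral>\<xi>. norm (fA A \<xi>) \<partial>nu \<alpha>))"
      proof (rule bound)
        show "holomorphic_ball (\<lambda>z. H A z + (- a) * ?k z)" by (intro hol_ball_add hH A ak)
        fix z :: "complex ^ 'n" assume z: "z \<in> ball 0 1"
        have "H A z + (- a) * ?k z = (\<integral>\<xi>. fA A \<xi> * bk N (r *\<^sub>R z) \<xi> \<partial>nu \<alpha>) - (\<integral>\<xi>. fA A \<xi> * ?k z \<partial>nu \<alpha>)"
          by (simp add: H_def bk_transform_def a_def)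
        also have "... = (\<integral>\<xi>. fA A \<xi> * bk N (r *\<^sub>R z) \<xi> - fA A \<xi> * ?k z \<partial>nu \<alpha>)"
          by (intro Bochner_Integration.integral_diff[symmetric] intH A z integrable_mult_left fA)
        also have "norm ... \<le> (\<integral>\<xi>. \<epsilon> * norm (fA A \<xi>) \<partial>nu \<alpha>)"
        proof (rule Bochner_Integration.integral_norm_bound_integral)
          show "integrable (nu \<alpha>) (\<lambda>\<xi>. fA A \<xi> * bk N (r *\<^sub>R z) \<xi> - fA A \<xi> * ?k z)"
            by (intro Bochner_Integration.integrable_diff intH A z integrable_mult_left fA)
          show "integrable (nu \<alpha>) (\<lambda>\<xi>. \<epsilon> * norm (fA A \<xi>))" by (intro integrable_mult_right integrable_norm fA A)
          fix \<xi> :: "complex ^ 'n" assume "\<xi> \<in> space (nu \<alpha>)"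
          then have \<xi>: "\<xi> \<in> ball 0 1" by simp
          show "norm (fA A \<xi> * bk N (r *\<^sub>R z) \<xi> - fA A \<xi> * ?k z) \<le> \<epsilon> * norm (fA A \<xi>)"
          proof (cases "\<xi> \<in> A")
            case True
            then have "dist \<xi> x < \<delta>" using A(2) by (auto simp: dist_commute)
            then have "norm (bk N z (r *\<^sub>R \<xi>) - ?k z) \<le> \<epsilon>" using \<delta>(2)[of z \<xi> x] z \<xi> x by simp
            then have "norm (fA A \<xi>) * norm (bk N z (r *\<^sub>R \<xi>) - ?k z) \<le> norm (fA A \<xi>) * \<epsilon>" by (rule mult_left_mono) simp
            then show ?thesis unfolding bk_dilate by (simp add: right_diff_distrib[symmetric] norm_mult mult.commute)
          qed (simp add: fA_def)
        qed
        finally show "norm (H A z + (- a) * ?k z) \<le> \<epsilon> * (\<integral>\<xi>. norm (fA A \<xi>) \<partial>nu \<alpha>)" by simp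
      qed
      finally show ?thesis .
    qed
    \<comment> \<open>Removing one ball at a time makes the pieces disjoint, so that their masses
      add up to that of A.\<close>
    have cover: "norm (L (H A)) \<le> B * (\<epsilon> * (\<integral>\<xi>. norm (fA A \<xi>) \<partial>nu \<alpha>))"
      if "finite K" "K \<subseteq> cball 0 1" "A \<in> sets borel" "A \<subseteq> (\<Union>x\<in>K. ball x \<delta>)" for A K
      using that
    proof (induction K arbitrary: A rule: finite_induct)
      case empty
      then show ?case by (intro local[of _ 0]) auto
    next
      case (insert x K)
      define A1 where "A1 = A \<inter> ball x \<delta>"
      define A2 where "A2 = A - ball x \<delta>"
      have A: "A1 \<in> sets borel" "A2 \<in> sets borel" using insert.prems(2) by (auto simp: A1_def A2_def)
      have dec: "fA A \<xi> = fA A1 \<xi> + fA A2 \<xi>" "norm (fA A \<xi>) = norm (fA A1 \<xi>) + norm (fA A2 \<xi>)" for \<xi>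
        by (auto simp: fA_def A1_def A2_def indicator_def)
      have "L (H A) = L (\<lambda>z. H A1 z + H A2 z)"
      proof (rule L_cong)
        show "bounded ((\<lambda>z. H A1 z + H A2 z) ` ball 0 1)" by (rule bounded_plus_comp[OF bH[OF A(1)] bH[OF A(2)]])
        show "H A z = H A1 z + H A2 z" if z: "z \<in> ball 0 1" for z
          unfolding H_def bk_transform_def dec distrib_right by (intro Bochner_Integration.integral_add intH A z)
      qed (intro hol_ball_add hH bH A insert.prems)+
      also have "... = L (H A1) + L (H A2)" by (intro add hH bH A)
      also have "norm ... \<le> B * (\<epsilon> * (\<integral>\<xi>. norm (fA A1 \<xi>) \<partial>nu \<alpha>)) + B * (\<epsilon> * (\<integral>\<xi>. norm (fA A2 \<xi>) \<partial>nu \<alpha>))"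
      proof (rule order.trans[OF norm_triangle_ineq add_mono])
        show "norm (L (H A1)) \<le> B * (\<epsilon> * (\<integral>\<xi>. norm (fA A1 \<xi>) \<partial>nu \<alpha>))"
          using insert.prems(1) by (intro local[of _ x] A) (auto simp: A1_def)
        show "norm (L (H A2)) \<le> B * (\<epsilon> * (\<integral>\<xi>. norm (fA A2 \<xi>) \<partial>nu \<alpha>))"
          using insert.prems by (intro insert.IH A) (auto simp: A2_def)
      qed
      also have "... = B * (\<epsilon> * (\<integral>\<xi>. norm (fA A \<xi>) \<partial>nu \<alpha>))"
        unfolding dec(2) by (subst Bochner_Integration.integral_add) (auto intro!: integrable_norm fA A simp: algebra_simps)
      finally show ?case .
    qed
    obtain K :: "(complex ^ 'n) set" where K: "finite K" "K \<subseteq> cball 0 1" "cball 0 1 \<subseteq> (\<Union>x\<in>K. ball x \<delta>)"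
    proof -
      have "seq_compact (cball (0 :: complex ^ 'n) 1)" by (rule compact_imp_seq_compact[OF compact_cball])
      from seq_compact_imp_totally_bounded[OF this, rule_format, OF \<delta>(1)] show ?thesis by (elim exE conjE) (rule that; assumption)
    qed
    have "L (H UNIV) = L (H (ball 0 1))"
    proof (rule L_cong)
      show "H UNIV z = H (ball 0 1) z" for z
        unfolding H_def bk_transform_def by (rule Bochner_Integration.integral_cong) (auto simp: fA_def)
    qed (intro hH bH; simp)+
    then have "norm (L (H UNIV)) = norm (L (H (ball 0 1)))" by (rule arg_cong)
    also have "... \<le> B * (\<epsilon> * (\<integral>\<xi>. norm (fA (ball 0 1) \<xi>) \<partial>nu \<alpha>))"
      by (rule cover[OF K(1,2)]) (simp, rule order.trans[OF ball_subset_cball K(3)])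
    also have "(\<integral>\<xi>. norm (fA (ball 0 1) \<xi>) \<partial>nu \<alpha>) = ?J"
      by (rule Bochner_Integration.integral_cong) (auto simp: fA_def)
    also have "L (H UNIV) = L (\<lambda>z. f (r *\<^sub>R z))"
    proof (rule L_cong)
      show "holomorphic_ball (\<lambda>z. f (r *\<^sub>R z))" using r by (intro hol_ball_dilate f) auto
      obtain M where "\<And>z. z \<in> ball 0 1 \<Longrightarrow> norm (f (r *\<^sub>R z)) \<le> M" by (rule bounded_hol_dilate[OF f(1) r]) (rule that)
      then show "bounded ((\<lambda>z. f (r *\<^sub>R z)) ` ball 0 1)" unfolding bounded_iff by blast
      show "H UNIV z = f (r *\<^sub>R z)" if z: "z \<in> ball 0 1" for z
        using bergman_reproducing[OF al f(2,1) dilate_in_ball[OF z, of r]] r by (simp add: H_def bk_transform_def fA_def N_def)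
    qed (intro hH bH, simp)+
    finally show ?thesis .
  qed
  have "norm (L (\<lambda>z. f (r *\<^sub>R z))) \<le> 0 + e" if e: "e > 0" for e
  proof -
    define b where "b = B * ?J + 1"
    have "B * ?J \<ge> 0" using bound_nonneg by (intro mult_nonneg_nonneg) auto
    then have b: "b > 0" "B * ?J \<le> b" by (auto simp: b_def)
    have "norm (L (\<lambda>z. f (r *\<^sub>R z))) \<le> B * (e / b * ?J)" using e b by (intro small) simp
    also have "... = (e / b) * (B * ?J)" by (simp only: mult_ac)
    also have "... \<le> (e / b) * b" using e b by (intro mult_left_mono b) simp
    also have "... = e" using b by simp
    finally show ?thesis by simp
  qed
  then have "norm (L (\<lambda>z. f (r *\<^sub>R z))) \<le> 0" by (rule field_le_epsilon)
  then show ?thesis by simp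
qed

end


text \<open>For the kernel at w the pairing at ratio r is the conjugate of g(r w), by the
  reproducing formula, and this tends to the value at w. Hence \<Lambda> determines g on the ball,
  which is the uniqueness of the representing function.\<close>

lemma represents_kernel:
  fixes g :: "complex ^ 'n \<Rightarrow> complex"
  assumes al: "\<alpha> > -1" and gf: "growth_function \<Phi>" and rep: "represents \<alpha> \<Phi> g \<Lambda>"
    and g: "holomorphic_ball g" "integrable (nu \<alpha>) g" and w: "w \<in> ball 0 1"
  shows "\<Lambda> (\<lambda>z. bk (real CARD('n) + 1 + \<alpha>) z w) = cnj (g w)"
proof -
  define N where "N = real CARD('n) + 1 + \<alpha>"
  have N: "N > 0" unfolding N_def by (rule dim_exponent_pos[OF al])
  have "(\<lambda>z. bk N z w) \<in> bergman_orlicz \<alpha> \<Phi>"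
    using w N by (intro bergman_orlicz_bounded[OF al gf, where M = "(1 - norm w) powr - N"] hol_ball_bk norm_bk_le') auto
  from bspec[OF rep[unfolded represents_def] this] have 1: "((\<lambda>r. \<integral>z. bk N (r *\<^sub>R z) w * cnj (g z) \<partial>nu \<alpha>) \<longlongrightarrow> \<Lambda> (\<lambda>z. bk N z w)) (at_left 1)"
    .
  have eq: "(\<integral>z. bk N (r *\<^sub>R z) w * cnj (g z) \<partial>nu \<alpha>) = cnj (g (r *\<^sub>R w))" if r: "r \<in> {0<..<1}" for r
  proof -
    have rw: "r *\<^sub>R w \<in> ball 0 1" using r by (intro dilate_in_ball w) auto
    have "(\<integral>z. bk N (r *\<^sub>R z) w * cnj (g z) \<partial>nu \<alpha>) = (\<integral>z. cnj (g z * bk N (r *\<^sub>R w) z) \<partial>nu \<alpha>)"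
    proof (rule Bochner_Integration.integral_cong)
      fix z :: "complex ^ 'n" assume "z \<in> space (nu \<alpha>)"
      then have "norm (r *\<^sub>R w) * norm z < 1" using rw by (intro norm_mult_ball_less) auto
      then have "cnj (bk N (r *\<^sub>R w) z) = bk N (r *\<^sub>R z) w" unfolding bk_dilate[of N r z w] by (rule cnj_bk)
      then show "bk N (r *\<^sub>R z) w * cnj (g z) = cnj (g z * bk N (r *\<^sub>R w) z)" by (simp add: mult.commute)
    qed simp
    also have "... = cnj (\<integral>z. g z * bk N (r *\<^sub>R w) z \<partial>nu \<alpha>)" by (rule Bochner_Integration.integral_cnj)
    also have "... = cnj (g (r *\<^sub>R w))" unfolding N_def by (simp add: bergman_reproducing[OF al g(2,1) rw])
    finally show ?thesis .
  qed
  have "isCont g (1 *\<^sub>R w)" using hol_ball_imp_continuous_on[OF g(1)] w by (simp add: continuous_on_eq_continuous_at)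
  then have "((\<lambda>r. cnj (g (r *\<^sub>R w))) \<longlongrightarrow> cnj (g (1 *\<^sub>R w))) (at_left 1)"
    by (intro tendsto_cnj isCont_tendsto_compose[of _ g] tendsto_intros)
  moreover have "eventually (\<lambda>r. r \<in> {0<..<1::real}) (at_left 1)" by (rule eventually_at_left_real) simp
  then have "eventually (\<lambda>r. cnj (g (r *\<^sub>R w)) = (\<integral>z. bk N (r *\<^sub>R z) w * cnj (g z) \<partial>nu \<alpha>)) (at_left 1)"
    by eventually_elim (simp add: eq)
  ultimately have "((\<lambda>r. \<integral>z. bk N (r *\<^sub>R z) w * cnj (g z) \<partial>nu \<alpha>) \<longlongrightarrow> cnj (g w)) (at_left 1)"
    by (simp add: tendsto_cong)
  with 1 show ?thesis unfolding N_def by (intro tendsto_unique[OF trivial_limit_at_left_real])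
qed

lemma bounded_functional_add:
  "bounded_functional \<alpha> \<Phi> \<Lambda> \<Longrightarrow> f \<in> bergman_orlicz \<alpha> \<Phi> \<Longrightarrow> g \<in> bergman_orlicz \<alpha> \<Phi> \<Longrightarrow> \<Lambda> (\<lambda>z. f z + g z) = \<Lambda> f + \<Lambda> g"
  unfolding bounded_functional_def by blast

lemma bounded_functionalD:
  fixes \<Lambda> :: "(complex ^ 'n \<Rightarrow> complex) \<Rightarrow> complex"
  assumes "bounded_functional \<alpha> \<Phi> \<Lambda>"
  obtains C where "C > 0" "\<And>f c. f \<in> bergman_orlicz \<alpha> \<Phi> \<Longrightarrow> c > 0 \<Longrightarrow> (\<integral>\<^sup>+z. ennreal (\<Phi> (norm (f z) / c)) \<partial>nu \<alpha>) \<le> 1 \<Longrightarrow> norm (\<Lambda> f) \<le> C * c"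
proof -
  obtain C where C: "C > 0" "\<And>f. f \<in> bergman_orlicz \<alpha> \<Phi> \<Longrightarrow> ennreal (norm (\<Lambda> f)) \<le> ennreal C * lux_norm \<alpha> \<Phi> f"
    using assms unfolding bounded_functional_def by blast
  show ?thesis
  proof (rule that[OF C(1)])
    fix f :: "complex ^ 'n \<Rightarrow> complex" and c :: real
    assume f: "f \<in> bergman_orlicz \<alpha> \<Phi>" and c: "c > 0" "(\<integral>\<^sup>+z. ennreal (\<Phi> (norm (f z) / c)) \<partial>nu \<alpha>) \<le> 1"
    have "ennreal (norm (\<Lambda> f)) \<le> ennreal C * ennreal c"
      by (rule order.trans[OF C(2)[OF f] mult_left_mono[OF lux_norm_le[OF c]]]) simp
    then show "norm (\<Lambda> f) \<le> C * c" using C(1) c(1) by (simp flip: ennreal_mult)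
  qed
qed

lemma bounded_functional_diff:
  fixes \<Lambda> \<Lambda>' :: "(complex ^ 'n \<Rightarrow> complex) \<Rightarrow> complex"
  assumes 1: "bounded_functional \<alpha> \<Phi> \<Lambda>" and 2: "bounded_functional \<alpha> \<Phi> \<Lambda>'"
  shows "bounded_functional \<alpha> \<Phi> (\<lambda>f. \<Lambda> f - \<Lambda>' f)"
  unfolding bounded_functional_def
proof (intro conjI ballI allI)
  obtain C where C: "C > 0" "\<And>f. f \<in> bergman_orlicz \<alpha> \<Phi> \<Longrightarrow> ennreal (norm (\<Lambda> f)) \<le> ennreal C * lux_norm \<alpha> \<Phi> f"
    using 1 unfolding bounded_functional_def by blast
  obtain C' where C': "C' > 0" "\<And>f. f \<in> bergman_orlicz \<alpha> \<Phi> \<Longrightarrow> ennreal (norm (\<Lambda>' f)) \<le> ennreal C' * lux_norm \<alpha> \<Phi> f"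
    using 2 unfolding bounded_functional_def by blast
  show "\<exists>C>0. \<forall>f\<in>bergman_orlicz \<alpha> \<Phi>. ennreal (norm (\<Lambda> f - \<Lambda>' f)) \<le> ennreal C * lux_norm \<alpha> \<Phi> f"
  proof (intro exI[of _ "C + C'"] conjI ballI)
    fix f :: "complex ^ 'n \<Rightarrow> complex" assume f: "f \<in> bergman_orlicz \<alpha> \<Phi>"
    have "ennreal (norm (\<Lambda> f - \<Lambda>' f)) \<le> ennreal (norm (\<Lambda> f) + norm (\<Lambda>' f))" by (intro ennreal_leI norm_triangle_ineq4)
    also have "... \<le> ennreal C * lux_norm \<alpha> \<Phi> f + ennreal C' * lux_norm \<alpha> \<Phi> f" using C(2)[OF f] C'(2)[OF f] by (simp add: add_mono)
    also have "... = ennreal (C + C') * lux_norm \<alpha> \<Phi> f" using C(1) C'(1) by (simp add: distrib_right)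
    finally show "ennreal (norm (\<Lambda> f - \<Lambda>' f)) \<le> ennreal (C + C') * lux_norm \<alpha> \<Phi> f" .
  qed (use C(1) C'(1) in simp)
qed (use 1 2 in \<open>auto simp: bounded_functional_def algebra_simps\<close>)

context hankel_growth
begin

text \<open>A function bounded by M > 0 is admissible at the level M / \<Psi> 1, since \<Phi>(\<Psi>
  1) = 1 and the measure has mass 1; this turns the bound of \<Lambda> into a sup norm
  bound.\<close>

lemma bounded_functional_hol:
  fixes \<Lambda> :: "(complex ^ 'n \<Rightarrow> complex) \<Rightarrow> complex"
  assumes al: "\<alpha> > -1" and \<Lambda>: "bounded_functional \<alpha> \<Phi> \<Lambda>"
  obtains B where "bounded_hol_functional \<Lambda> B"
proof -
  let ?A = "bergman_orlicz \<alpha> \<Phi> :: (complex ^ 'n \<Rightarrow> complex) set"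
  obtain C where C: "C > 0" "\<And>f c. f \<in> ?A \<Longrightarrow> c > 0 \<Longrightarrow> (\<integral>\<^sup>+z. ennreal (\<Phi> (norm (f z) / c)) \<partial>nu \<alpha>) \<le> 1 \<Longrightarrow> norm (\<Lambda> f) \<le> C * c"
    by (rule bounded_functionalD[OF \<Lambda>]) (rule that)
  have mem: "f \<in> ?A" if f: "holomorphic_ball f" "bounded (f ` ball 0 1)" for f :: "complex ^ 'n \<Rightarrow> complex"
  proof -
    obtain M where "\<forall>y\<in>f ` ball 0 1. norm y \<le> M" using f(2) unfolding bounded_iff by blast
    then show ?thesis by (intro bergman_orlicz_bounded[OF al gfPhi f(1), of M]) blast
  qed
  have \<Psi>: "\<Psi> 1 > 0" "\<Phi> (\<Psi> 1) = 1" using growth_inverse_pos[OF gfPhi, of 1] growth_inverse_eq[OF gfPhi, of 1] by auto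
  define B where "B = C / \<Psi> 1"
  have B: "B > 0" using C(1) \<Psi>(1) by (simp add: B_def)
  have pos: "norm (\<Lambda> f) \<le> B * M" if f: "holomorphic_ball f" and M: "M > 0" "\<And>z. z \<in> ball 0 1 \<Longrightarrow> norm (f z) \<le> M" for f :: "complex ^ 'n \<Rightarrow> complex" and M
  proof -
    have "norm (\<Lambda> f) \<le> C * (M / \<Psi> 1)"
    proof (rule C(2))
      show "f \<in> ?A" by (rule bergman_orlicz_bounded[OF al gfPhi f M(2)])
      show "M / \<Psi> 1 > 0" using M(1) \<Psi>(1) by simp
      have "(\<integral>\<^sup>+z. ennreal (\<Phi> (norm (f z) / (M / \<Psi> 1))) \<partial>nu \<alpha>) \<le> (\<integral>\<^sup>+(z::complex^'n). 1 \<partial>nu \<alpha>)"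
      proof (rule nn_integral_mono)
        fix z :: "complex ^ 'n" assume "z \<in> space (nu \<alpha>)"
        then have "norm (f z) / (M / \<Psi> 1) \<le> \<Psi> 1" using M(2)[of z] M(1) \<Psi>(1) by (simp add: field_simps)
        then have "\<Phi> (norm (f z) / (M / \<Psi> 1)) \<le> \<Phi> (\<Psi> 1)" using M(1) \<Psi>(1) by (intro growth_mono[OF gfPhi]) auto
        then show "ennreal (\<Phi> (norm (f z) / (M / \<Psi> 1))) \<le> 1" using ennreal_leI[of _ 1] \<Psi>(2) by simp
      qed
      also have "... = 1" using emeasure_nu_space[OF al, where 'n = 'n] by simp
      finally show "(\<integral>\<^sup>+z. ennreal (\<Phi> (norm (f z) / (M / \<Psi> 1))) \<partial>nu \<alpha>) \<le> 1" .
    qed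
    then show ?thesis by (simp add: B_def)
  qed
  show ?thesis
  proof (rule that[of B], unfold_locales)
    fix f g :: "complex ^ 'n \<Rightarrow> complex"
    assume "holomorphic_ball f" "bounded (f ` ball 0 1)" "holomorphic_ball g" "bounded (g ` ball 0 1)"
    then have "f \<in> ?A" "g \<in> ?A" by (auto intro!: mem)
    then show "\<Lambda> (\<lambda>z. f z + g z) = \<Lambda> f + \<Lambda> g" using \<Lambda> unfolding bounded_functional_def by blast
  next
    fix f :: "complex ^ 'n \<Rightarrow> complex" and c
    assume "holomorphic_ball f" "bounded (f ` ball 0 1)"
    then have "f \<in> ?A" by (rule mem)
    then show "\<Lambda> (\<lambda>z. c * f z) = c * \<Lambda> f" using \<Lambda> unfolding bounded_functional_def by blast
  next
    fix f :: "complex ^ 'n \<Rightarrow> complex" and M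
    assume f: "holomorphic_ball f" and M: "\<And>z. z \<in> ball 0 1 \<Longrightarrow> norm (f z) \<le> M"
    have M0: "M \<ge> 0" using order.trans[OF norm_ge_zero M[of 0]] by simp
    show "norm (\<Lambda> f) \<le> B * M"
    proof (rule field_le_epsilon)
      fix e :: real assume e: "e > 0"
      \<comment> \<open>\<open>pos\<close> asks for a positive bound while M may be 0; the surplus e
        / B costs e.\<close>
      have "norm (\<Lambda> f) \<le> B * (M + e / B)" using M M0 e B by (intro pos[OF f]) (auto intro: add_nonneg_pos add_increasing2)
      then show "norm (\<Lambda> f) \<le> B * M + e" using B by (simp add: distrib_left)
    qed
  qed
qed

text \<open>L vanishes on dilates, so L f = L (f - f(r .)). Smallness of the modular becomes
  smallness of the norm by applying density to f / c instead of f, with c = e / C.\<close>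

lemma bounded_functional_zero:
  fixes L :: "(complex ^ 'n \<Rightarrow> complex) \<Rightarrow> complex"
  assumes al: "\<alpha> > -1" and L: "bounded_functional \<alpha> \<Phi> L"
    and zero: "\<And>w. w \<in> ball 0 1 \<Longrightarrow> L (\<lambda>z. bk (real CARD('n) + 1 + \<alpha>) z w) = 0"
    and f: "f \<in> bergman_orlicz \<alpha> \<Phi>"
  shows "L f = 0"
proof -
  obtain C where C: "C > 0" "\<And>f c. f \<in> bergman_orlicz \<alpha> \<Phi> \<Longrightarrow> c > 0 \<Longrightarrow> (\<integral>\<^sup>+z. ennreal (\<Phi> (norm (f z) / c)) \<partial>nu \<alpha>) \<le> 1 \<Longrightarrow> norm (L f) \<le> C * c"
    by (rule bounded_functionalD[OF L]) (rule that)
  obtain B where B: "bounded_hol_functional L B" by (rule bounded_functional_hol[OF al L])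
  interpret bounded_hol_functional L B by (rule B)
  have hf: "holomorphic_ball f" by (rule bergman_orliczD(1)[OF f])
  have "norm (L f) \<le> 0 + e" if e: "e > 0" for e
  proof -
    define c where "c = e / C"
    have c: "c > 0" using e C(1) by (simp add: c_def)
    define F where "F z = of_real (1 / c) * f z" for z
    have "F \<in> bergman_orlicz \<alpha> \<Phi>" unfolding F_def by (rule bergman_orlicz_cmult[OF qcPhi f])
    then obtain r where r: "0 < r" "r < 1" "(\<integral>\<^sup>+z. ennreal (\<Phi> (norm (F z - F (r *\<^sub>R z)))) \<partial>nu \<alpha>) \<le> ennreal 1"
      using dilations_dense[OF al qcPhi _ zero_less_one] by blast
    \<comment> \<open>Dilating twice by the square root: f(s .) is bounded, hence integrable as
      \<open>vanishes_on_dilations\<close> requires, and its dilate by s is f(r .). The function f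
      itself need not be integrable.\<close>
    define s where "s = sqrt r"
    have s: "0 \<le> s" "s < 1" "s * s = r" using r by (auto simp: s_def)
    let ?fs = "\<lambda>z. f (s *\<^sub>R z)" and ?fr = "\<lambda>z. f (r *\<^sub>R z)"
    have hs: "holomorphic_ball ?fs" and hr: "holomorphic_ball ?fr" using s r by (auto intro: hol_ball_dilate hf)
    obtain Ms where Ms: "\<And>z. z \<in> ball 0 1 \<Longrightarrow> norm (?fs z) \<le> Ms" by (rule bounded_hol_dilate[OF hf s(1,2)]) (rule that)
    obtain Mr where Mr: "\<And>z. z \<in> ball 0 1 \<Longrightarrow> norm (?fr z) \<le> Mr" by (rule bounded_hol_dilate[OF hf less_imp_le[OF r(1)] r(2)]) (rule that)
    have fr: "?fr \<in> bergman_orlicz \<alpha> \<Phi>" by (rule bergman_orlicz_bounded[OF al gfPhi hr Mr])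
    have int: "integrable (nu \<alpha>) ?fs" by (rule integrable_nu_bounded[OF al hol_ball_measurable[OF hs] Ms])
    have L0: "L ?fr = 0" using vanishes_on_dilations[OF al hs int s(1,2) zero] s(3) by simp
    define h where "h z = f z + (-1) * f (r *\<^sub>R z)" for z
    have h: "h \<in> bergman_orlicz \<alpha> \<Phi>" unfolding h_def by (intro bergman_orlicz_add[OF qcPhi] bergman_orlicz_cmult[OF qcPhi] f fr)
    have "L (\<lambda>z. ?fr z + h z) = L ?fr + L h" by (rule bounded_functional_add[OF L fr h])
    moreover have "(\<lambda>z. ?fr z + h z) = f" by (simp add: h_def)
    ultimately have "L f = L h" using L0 by simp
    also have "norm (L h) \<le> C * c"
    proof (rule C(2)[OF h c])
      have "norm (h z) / c = norm (F z - F (r *\<^sub>R z))" for z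
      proof -
        have "F z - F (r *\<^sub>R z) = of_real (1 / c) * h z" by (simp add: F_def h_def algebra_simps)
        then show ?thesis using c by (simp add: norm_mult norm_divide)
      qed
      then show "(\<integral>\<^sup>+z. ennreal (\<Phi> (norm (h z) / c)) \<partial>nu \<alpha>) \<le> 1" using r(3) by simp
    qed
    finally show ?thesis using C(1) by (simp add: c_def)
  qed
  then have "norm (L f) \<le> 0" by (rule field_le_epsilon)
  then show ?thesis by simp
qed

text \<open>The candidate g = \<open>E N\<close> is forced by the values of \<Lambda> on kernels.
  Testing on higher kernels puts it into the space; the functional it induces then agrees with
  \<Lambda> on the kernels bk N, hence everywhere.\<close>

theorem functional_in_Gamma:
  fixes \<Lambda> :: "(complex ^ 'n \<Rightarrow> complex) \<Rightarrow> complex"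
  assumes al: "\<alpha> > -1" and \<Lambda>: "bounded_functional \<alpha> \<Phi> \<Lambda>"
  shows "\<exists>g\<in>Gamma_space \<alpha> \<rho>. represents \<alpha> \<Phi> g \<Lambda> \<and>
    (\<forall>h\<in>Gamma_space \<alpha> \<rho>. represents \<alpha> \<Phi> h \<Lambda> \<longrightarrow> (\<forall>z\<in>ball 0 1. h z = g z))"
proof -
  define N where "N = real CARD('n) + 1 + \<alpha>"
  have N: "N > 0" unfolding N_def by (rule dim_exponent_pos[OF al])
  obtain B where B: "bounded_hol_functional \<Lambda> B" by (rule bounded_functional_hol[OF al \<Lambda>])
  interpret bounded_hol_functional \<Lambda> B by (rule B)
  obtain C where C: "C > 0" "\<And>f c. f \<in> bergman_orlicz \<alpha> \<Phi> \<Longrightarrow> c > 0 \<Longrightarrow> (\<integral>\<^sup>+z. ennreal (\<Phi> (norm (f z) / c)) \<partial>nu \<alpha>) \<le> 1 \<Longrightarrow> norm (\<Lambda> f) \<le> C * c"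
    by (rule bounded_functionalD[OF \<Lambda>]) (rule that)
  define p' where "p' = p / (1 + p)"
  have p': "p' > 0" "p' \<le> p" using p by (auto simp: p'_def divide_le_eq)
  \<comment> \<open>p' is the lower type of \<Phi>. Because p' <= p, this m meets both the condition
    of \<open>kernel_admissible\<close> and m > N / p.\<close>
  obtain m :: nat where m0: "real m \<ge> 2 * N / p'" using real_arch_simple by blast
  have m: "(N + real m) * p' \<ge> 2 * N"
  proof -
    have "2 * N \<le> real m * p'" using m0 p' by (simp add: divide_le_eq)
    also have "... \<le> (N + real m) * p'" using N p' by (intro mult_right_mono) auto
    finally show ?thesis .
  qed
  have mN: "real m > (1 / p) * N"
  proof -
    have "(1 / p) * N < 2 * N / p" using N p by (simp add: divide_strict_right_mono)
    also have "... \<le> 2 * N / p'" using N p' by (intro divide_left_mono) auto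
    finally show ?thesis using m0 by simp
  qed
  obtain K where K: "K > 0" "\<And>(w :: complex ^ 'n) s. w \<in> ball 0 1 \<Longrightarrow> 0 \<le> s \<Longrightarrow> s \<le> N + real m \<Longrightarrow>
    (\<integral>\<^sup>+z. ennreal (\<Phi> (norm (bk s z w) / (K * (xd w powr - (N + real m) / \<Psi> (xd w powr - N))))) \<partial>nu \<alpha>) \<le> 1"
    by (rule kernel_admissible[OF al qcPhi[folded p'_def], where 'n = 'n, of "N + real m", folded N_def, OF m]) (rule that)
  define g where "g = E N"
  have gG: "g \<in> Gamma_space \<alpha> \<rho>"
  proof (rule Gamma_spaceI[OF al B])
    show "g w = E (real CARD('n) + 1 + \<alpha>) w" for w by (simp add: g_def N_def)
    show "real m > (1 / p) * (real CARD('n) + 1 + \<alpha>)" using mN by (simp add: N_def)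
    fix j :: nat and w :: "complex ^ 'n" assume j: "j \<le> m" and w: "w \<in> ball 0 1"
    have x: "xd w > 0" by (rule xd_posI[OF w])
    let ?c = "K * (xd w powr - (N + real m) / \<Psi> (xd w powr - N))"
    have \<Psi>: "\<Psi> (xd w powr - N) > 0" using x by (intro growth_inverse_pos[OF gfPhi]) simp
    have s: "0 \<le> N + real j" "N + real j \<le> N + real m" using N j by auto
    have "norm (E (N + real j) w) = norm (\<Lambda> (\<lambda>z. bk (N + real j) z w))" by (simp add: E_def)
    also have "... \<le> C * ?c"
    proof (rule C(2)[OF _ _ K(2)[OF w s]])
      show "(\<lambda>z. bk (N + real j) z w) \<in> bergman_orlicz \<alpha> \<Phi>"
        using w s by (intro bergman_orlicz_bounded[OF al gfPhi, where M = "(1 - norm w) powr - (N + real j)"] hol_ball_bk norm_bk_le') auto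
      show "?c > 0" using K(1) x \<Psi> by simp
    qed
    also have "?c = K * (xd w powr - real m * \<rho> (xd w powr N))"
    proof -
      have "xd w powr - (N + real m) = xd w powr - real m * xd w powr - N" by (simp add: algebra_simps flip: powr_add)
      then show ?thesis unfolding rho_xd(2)[OF x] by simp
    qed
    finally show "norm (E (real CARD('n) + 1 + \<alpha> + real j) w) \<le> C * K * (xd w powr - real m * \<rho> (xd w powr (real CARD('n) + 1 + \<alpha>)))"
      by (simp add: N_def mult.assoc)
  qed
  have G: "holomorphic_ball h" "integrable (nu \<alpha>) h" if "h \<in> Gamma_space \<alpha> \<rho>" for h :: "complex ^ 'n \<Rightarrow> complex"
    by (rule Gamma_spaceD[OF al that], assumption)+
  have kernel: "L (\<lambda>z. bk N z w) = cnj (h w)" if "h \<in> Gamma_space \<alpha> \<rho>" "represents \<alpha> \<Phi> h L" "w \<in> ball 0 1"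
    for h :: "complex ^ 'n \<Rightarrow> complex" and L w
    unfolding N_def by (rule represents_kernel[OF al gfPhi that(2) G[OF that(1)] that(3)])
  obtain \<Lambda>' where \<Lambda>': "bounded_functional \<alpha> \<Phi> \<Lambda>'" "represents \<alpha> \<Phi> g \<Lambda>'"
    using Gamma_functional[OF al gG] by blast
  have "\<Lambda> f - \<Lambda>' f = 0" if "f \<in> bergman_orlicz \<alpha> \<Phi>" for f
  proof (rule bounded_functional_zero[OF al bounded_functional_diff[OF \<Lambda> \<Lambda>'(1)] _ that])
    show "\<Lambda> (\<lambda>z. bk (real CARD('n) + 1 + \<alpha>) z w) - \<Lambda>' (\<lambda>z. bk (real CARD('n) + 1 + \<alpha>) z w) = 0" if "w \<in> ball 0 1" for w
      using kernel[OF gG \<Lambda>'(2) that] by (simp add: g_def E_def N_def)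
  qed
  then have "represents \<alpha> \<Phi> g \<Lambda>" using \<Lambda>'(2) unfolding represents_def by simp
  moreover have "h z = g z" if "h \<in> Gamma_space \<alpha> \<rho>" "represents \<alpha> \<Phi> h \<Lambda>" "z \<in> ball 0 1" for h z
    using kernel[OF that] by (simp add: g_def E_def)
  ultimately show ?thesis using gG by blast
qed

end

theorem theorem4p9:
  fixes \<alpha> p q :: real
    and \<Phi>\<^sub>1 \<Phi>\<^sub>2 \<Phi> \<rho> :: "real \<Rightarrow> real"
    and b :: "complex ^ 'n \<Rightarrow> complex"
  assumes "\<alpha> > -1" and "0 < p" and "p \<le> 1" and "q \<ge> 1"
    and "\<Phi>\<^sub>1 \<in> class_L p" and "\<Phi>\<^sub>2 \<in> class_U q"
    and "Dini_condition \<Phi>\<^sub>2"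
    and "\<And>t. t > 0 \<Longrightarrow> \<rho> t = rho_of \<Phi>\<^sub>1 t / rho_of \<Phi>\<^sub>2 t"
    and "growth_function \<Phi>" and "\<And>t. t > 0 \<Longrightarrow> \<rho> t = rho_of \<Phi> t"
    and "b \<in> bergman_orlicz \<alpha> (\<lambda>t. t\<^sup>2)"
  shows "(hankel_extends_bounded \<alpha> b \<Phi>\<^sub>1 \<Phi>\<^sub>2 \<longleftrightarrow> b \<in> Gamma_space \<alpha> \<rho>) \<and>
    is_dual_space \<alpha> \<Phi> (Gamma_space \<alpha> \<rho> :: (complex ^ 'n \<Rightarrow> complex) set)"
proof -
  interpret hankel_growth p q \<Phi>\<^sub>1 \<Phi>\<^sub>2 \<Phi> \<rho> by unfold_locales (fact assms)+
  show ?thesis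
  proof (intro conjI iffI)
    assume "hankel_extends_bounded \<alpha> b \<Phi>\<^sub>1 \<Phi>\<^sub>2"
    then show "b \<in> Gamma_space \<alpha> \<rho>"
      by (rule hankel_bounded_imp_Gamma[OF \<open>\<alpha> > -1\<close> bergman_A2_integrable[OF \<open>\<alpha> > -1\<close> assms(11)]])
  next
    assume "b \<in> Gamma_space \<alpha> \<rho>"
    then show "hankel_extends_bounded \<alpha> b \<Phi>\<^sub>1 \<Phi>\<^sub>2"
      using \<open>q \<ge> 1\<close> by (intro Gamma_imp_hankel_bounded[OF \<open>\<alpha> > -1\<close> _ \<open>Dini_condition \<Phi>\<^sub>2\<close>]) auto
  next
    show "is_dual_space \<alpha> \<Phi> (Gamma_space \<alpha> \<rho> :: (complex ^ 'n \<Rightarrow> complex) set)"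
      unfolding is_dual_space_def using Gamma_functional[OF \<open>\<alpha> > -1\<close>] functional_in_Gamma[OF \<open>\<alpha> > -1\<close>] by blast
  qed
qed


end
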